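(* Let $U_1,U_2,\dots$ be positive i.i.d. random variables with distribution $F$ and mean $m=\int_{(0,\infty)}x\,F(\mathrm{d}x)$, let $N$ be an independent Poisson process of rate $\lambda>0$, let $u_0\ge0$, and set $X(t)=u_0+\sum_{n=1}^{N_t}U_n-t$ and $Y(t)=X(t)-\inf_{s\le t}\{X(s),0\}$, $t\ge0$ (so $Y(0)=u_0$). Write $\xi(t)=X(t)-u_0$ and assume that the law of $\xi(1)$ is non-lattice (which holds if $F$ is non-lattice). Suppose that one of the following two cases holds: (Cramér case) there exists $\gamma\in(0,\infty)$ with $E[e^{\gamma \xi(1)}]=1$, $E[|\xi(1)|]<\infty$ and $E[|\xi(1)|e^{\gamma \xi(1)}]<\infty$; in this case let $r^*$ be the largest real root $s$ of $$\lambda\int_{(0,\infty)}e^{sy}F(\mathrm{d}y)-\lambda-s=0;$$ (positive drift case) $E[|\xi(1)|]<\infty$ and $E[\xi(1)]\in(0,\infty)$; in this case let $r^*$ be the smallest real root $s$ of the same equation. For $x>0$ let $\tau(x)=\inf\{t\ge0:Y(t)\in(x,\infty)\}$, $z(x)=x-Y(\tau(x)-)$ and $Z(x)=Y(\tau(x))-x$. Then, as $x\uparrow\infty$, $(z(x),Z(x))$ converges weakly to a random vector $(z(\infty),Z(\infty))$ whose law is given by $$P[(z(\infty),Z(\infty))\in\mathrm{d}u\otimes\mathrm{d}v]=\frac{\lambda}{\lambda m-1}\big(1-e^{r^*u}\big)\,F(\mathrm{d}v+u)\,\mathrm{d}u,\qquad u,v>0.$$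
   Context: This is the classical M/G/1 queue: $Y(t)$ is the workload at time $t$, $u_0$ the initial workload, and $\tau(x)$ the first time of overflow of a buffer of size $x$. "Non-lattice" means not supported on $h\mathbb{Z}$ for any $h>0$. The notation $F(\mathrm{d}v+u)$ denotes, for fixed $u$, the measure $A\mapsto F(A+u)$ on $(0,\infty)$. Roots of the characteristic equation are sought among real $s$ for which the integral is finite. *)

theory Defs
  imports "HOL-Probability.Probability"
begin

definition poisson_process :: "'a measure \<Rightarrow> real \<Rightarrow> (real \<Rightarrow> 'a \<Rightarrow> nat) \<Rightarrow> bool" where
  "poisson_process M rate N \<longleftrightarrow>
     (\<forall>t\<ge>0. N t \<in> M \<rightarrow>\<^sub>M count_space UNIV) \<and>
     (\<forall>\<omega>\<in>space M. N 0 \<omega> = 0) \<and>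
     (\<forall>\<omega>\<in>space M. mono_on {0..} (\<lambda>t. N t \<omega>)) \<and>
     (\<forall>\<omega>\<in>space M. \<forall>t\<ge>0. ((\<lambda>s. N s \<omega>) \<longlongrightarrow> N t \<omega>) (at_right t)) \<and>
     (\<forall>(ts :: nat \<Rightarrow> real) n. 0 \<le> ts 0 \<and> mono ts \<longrightarrow>
        prob_space.indep_vars M (\<lambda>_. count_space UNIV)
          (\<lambda>i \<omega>. N (ts (Suc i)) \<omega> - N (ts i) \<omega>) {..<n}) \<and>
     (\<forall>s t. 0 \<le> s \<and> s < t \<longrightarrow>
        distr M (count_space UNIV) (\<lambda>\<omega>. N t \<omega> - N s \<omega>) =
          measure_pmf (poisson_pmf (rate * (t - s))))"

definition netput :: "real \<Rightarrow> (nat \<Rightarrow> 'a \<Rightarrow> real) \<Rightarrow> (real \<Rightarrow> 'a \<Rightarrow> nat) \<Rightarrow> real \<Rightarrow> 'a \<Rightarrow> real" where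
  "netput u0 U N t \<omega> = u0 + (\<Sum>n=1..N t \<omega>. U n \<omega>) - t"

definition workload :: "(real \<Rightarrow> 'a \<Rightarrow> real) \<Rightarrow> real \<Rightarrow> 'a \<Rightarrow> real" where
  "workload X t \<omega> = X t \<omega> - Inf ({X s \<omega> | s. 0 \<le> s \<and> s \<le> t} \<union> {0})"

definition overflow_time :: "(real \<Rightarrow> 'a \<Rightarrow> real) \<Rightarrow> real \<Rightarrow> 'a \<Rightarrow> ereal" where
  "overflow_time Y x \<omega> = Inf {ereal t | t. 0 \<le> t \<and> Y t \<omega> \<in> {x<..}}"

(* On {overflow time = \<infinity>}, a null event in both cases of the theorem, real_of_ereal returns 0
   and the values below carry no meaning.  Likewise the left limit is meaningless if the
   overflow time is 0, which requires x < Y 0. *)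

definition undershoot :: "(real \<Rightarrow> 'a \<Rightarrow> real) \<Rightarrow> real \<Rightarrow> 'a \<Rightarrow> real" where
  "undershoot Y x \<omega> =
     (let T = real_of_ereal (overflow_time Y x \<omega>)
      in x - Lim (at T within {0..<T}) (\<lambda>t. Y t \<omega>))"

definition overshoot :: "(real \<Rightarrow> 'a \<Rightarrow> real) \<Rightarrow> real \<Rightarrow> 'a \<Rightarrow> real" where
  "overshoot Y x \<omega> = Y (real_of_ereal (overflow_time Y x \<omega>)) \<omega> - x"

definition non_lattice :: "real measure \<Rightarrow> bool" where
  "non_lattice \<mu> \<longleftrightarrow> (\<forall>h>0. \<not> (AE y in \<mu>. y \<in> range (\<lambda>k :: int. h * of_int k)))"

definition char_root :: "real \<Rightarrow> real measure \<Rightarrow> real \<Rightarrow> bool" where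
  "char_root rate F s \<longleftrightarrow>
     set_integrable F {0<..} (\<lambda>y. exp (s * y)) \<and>
     rate * (LINT y:{0<..}|F. exp (s * y)) - rate - s = 0"

definition cramer_case :: "'a measure \<Rightarrow> ('a \<Rightarrow> real) \<Rightarrow> bool" where
  "cramer_case M \<xi>1 \<longleftrightarrow>
     (\<exists>\<gamma>>0. integrable M (\<lambda>\<omega>. exp (\<gamma> * \<xi>1 \<omega>)) \<and> (LINT \<omega>|M. exp (\<gamma> * \<xi>1 \<omega>)) = 1 \<and>
            integrable M (\<lambda>\<omega>. \<bar>\<xi>1 \<omega>\<bar>) \<and>
            integrable M (\<lambda>\<omega>. \<bar>\<xi>1 \<omega>\<bar> * exp (\<gamma> * \<xi>1 \<omega>)))"

definition positive_drift_case :: "'a measure \<Rightarrow> ('a \<Rightarrow> real) \<Rightarrow> bool" where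
  "positive_drift_case M \<xi>1 \<longleftrightarrow> integrable M (\<lambda>\<omega>. \<bar>\<xi>1 \<omega>\<bar>) \<and> 0 < (LINT \<omega>|M. \<xi>1 \<omega>)"

(* HOL-Probability's weak_conv_m covers only sequences of measures on the real line. *)
definition weak_conv_at_top ::
    "(real \<Rightarrow> 'b::topological_space measure) \<Rightarrow> 'b measure \<Rightarrow> bool" where
  "weak_conv_at_top \<mu> L \<longleftrightarrow>
     (\<forall>f :: 'b \<Rightarrow> real. continuous_on UNIV f \<and> bounded (range f) \<longrightarrow>
        ((\<lambda>x. LINT p|\<mu> x. f p) \<longlongrightarrow> (LINT p|L. f p)) at_top)"

end

theory Submission
  imports Defs
begin

text \<open>
  At its jump times the workload is the Markov chain \<open>Q (n + 1) = max (Q n - E) 0 + U\<close> with an exponential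
  \<open>E\<close> and an independent job size \<open>U\<close>, and overflow happens at the first \<open>n\<close> with \<open>Q (n + 1) > x\<close>.
  An expected payoff collected until overflow therefore solves a one-step integral equation, whose
  solution is explicit in terms of the scale function \<open>W\<close> of the dual spectrally negative process
  and its derivative \<open>u\<close>: the jumps before overflow start from levels near \<open>x - q\<close> with intensity
  \<open>W (x - u0) u (x - q) / u x - W (x - u0 - q)\<close>. The scale function is built from a renewal series,
  and a renewal density theorem gives asymptotics precise enough to let \<open>x\<close> tend to infinity
  under the integral; the limit of the intensity is \<open>(1 - exp (r q)) / (\<lambda> m - 1)\<close>.
  The ladder heights have densities, so lattice effects do not arise.
\<close>

subsection \<open>Convolutions and the renewal equation\<close>

text \<open>The obstacle is that \<open>u\<close> stands in a denominator and is evaluated at single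
  points, so a renewal theorem for intervals is too weak: a renewal density has to converge
  pointwise. The regularity that makes this possible is one-sided. The density \<open>g\<close> is
  an exponentially discounted tail; it may drop at any speed, but over a distance \<open>s\<close>
  it grows at most by a factor \<open>exp (\<kappa> * s)\<close>. This passes to the renewal density
  and takes the place of continuity. The free constant in the solution of the one-step equation is
  fixed by reflection at level 0: the expected payoff has to be flat there, which is where the
  denominator \<open>u x\<close> comes from. The total mass of the limit law is never computed; the
  constant test function supplies it. The Poisson process is given through its increments, so the
  exponential gaps and the Markov property of the chain have to be derived from the joint law of the
  arrival times.\<close>

definition conv :: "(real \<Rightarrow> ennreal) \<Rightarrow> (real \<Rightarrow> ennreal) \<Rightarrow> real \<Rightarrow> ennreal" where
  "conv f g x = (\<integral>\<^sup>+y. f (x - y) * g y \<partial>lborel)"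

definition mconv :: "real measure \<Rightarrow> (real \<Rightarrow> ennreal) \<Rightarrow> real \<Rightarrow> ennreal" where
  "mconv F f x = (\<integral>\<^sup>+z. f (x - z) \<partial>F)"

lemma measurable_conv[measurable]:
  assumes [measurable]: "f \<in> borel_measurable borel" "g \<in> borel_measurable borel"
  shows "conv f g \<in> borel_measurable borel"
  unfolding conv_def[abs_def] by measurable

lemma conv_commute:
  assumes [measurable]: "f \<in> borel_measurable borel" "g \<in> borel_measurable borel"
  shows "conv f g x = conv g f x"
  unfolding conv_def
  by (subst nn_integral_real_affine[where c="-1" and t=x]) (auto simp: mult.commute)

lemma conv_assoc:
  assumes [measurable]: "f \<in> borel_measurable borel" "g \<in> borel_measurable borel" "h \<in> borel_measurable borel"
  shows "conv (conv f g) h x = conv f (conv g h) x"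
proof -
  have "conv f (conv g h) x = (\<integral>\<^sup>+y. (\<integral>\<^sup>+z. f (x - y) * (g (y - z) * h z) \<partial>lborel) \<partial>lborel)"
    unfolding conv_def by (intro nn_integral_cong nn_integral_cmult[symmetric]) measurable
  also have "\<dots> = (\<integral>\<^sup>+z. (\<integral>\<^sup>+y. f (x - y) * (g (y - z) * h z) \<partial>lborel) \<partial>lborel)"
    by (intro lborel_pair.Fubini') measurable
  also have "\<dots> = (\<integral>\<^sup>+z. (\<integral>\<^sup>+y. f (x - z - y) * g y * h z \<partial>lborel) \<partial>lborel)"
  proof (rule nn_integral_cong)
    fix z :: real
    show "(\<integral>\<^sup>+y. f (x - y) * (g (y - z) * h z) \<partial>lborel) = (\<integral>\<^sup>+y. f (x - z - y) * g y * h z \<partial>lborel)"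
      by (subst nn_integral_real_affine[where c="1" and t=z]) (auto simp: mult.assoc diff_diff_eq)
  qed
  also have "\<dots> = conv (conv f g) h x"
    unfolding conv_def by (intro nn_integral_cong nn_integral_multc) measurable
  finally show ?thesis ..
qed

lemma conv_add_right:
  assumes [measurable]: "f \<in> borel_measurable borel" "g \<in> borel_measurable borel" "h \<in> borel_measurable borel"
  shows "conv f (\<lambda>y. g y + h y) x = conv f g x + conv f h x"
  unfolding conv_def by (subst nn_integral_add[symmetric]) (auto simp: distrib_left)

lemma conv_add_left:
  assumes [measurable]: "f \<in> borel_measurable borel" "g \<in> borel_measurable borel" "h \<in> borel_measurable borel"
  shows "conv (\<lambda>y. f y + g y) h x = conv f h x + conv g h x"
  unfolding conv_def by (subst nn_integral_add[symmetric]) (auto simp: distrib_right)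

lemma conv_cmult_left:
  assumes [measurable]: "f \<in> borel_measurable borel" "g \<in> borel_measurable borel"
  shows "conv (\<lambda>y. c * f y) g x = c * conv f g x"
  unfolding conv_def by (subst nn_integral_cmult[symmetric]) (auto simp: mult.assoc)

lemma conv_cmult_right:
  assumes [measurable]: "f \<in> borel_measurable borel" "g \<in> borel_measurable borel"
  shows "conv f (\<lambda>y. c * g y) x = c * conv f g x"
  unfolding conv_def by (subst nn_integral_cmult[symmetric]) (auto simp: ac_simps)

lemma conv_mono:
  assumes "\<And>y. f y \<le> f' y" "\<And>y. g y \<le> g' y"
  shows "conv f g x \<le> conv f' g' x"
  unfolding conv_def by (intro nn_integral_mono mult_mono assms) auto

lemma conv_cong:
  assumes "\<And>y. f y = f' y" "\<And>y. g y = g' y"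
  shows "conv f g x = conv f' g' x"
  unfolding conv_def using assms by simp

lemma nn_integral_conv:
  assumes [measurable]: "f \<in> borel_measurable borel" "g \<in> borel_measurable borel"
  shows "(\<integral>\<^sup>+x. conv f g x \<partial>lborel) = (\<integral>\<^sup>+x. f x \<partial>lborel) * (\<integral>\<^sup>+x. g x \<partial>lborel)"
proof -
  have "(\<integral>\<^sup>+x. conv f g x \<partial>lborel) = (\<integral>\<^sup>+y. (\<integral>\<^sup>+x. f (x - y) * g y \<partial>lborel) \<partial>lborel)"
    unfolding conv_def by (intro lborel_pair.Fubini') measurable
  also have "\<dots> = (\<integral>\<^sup>+y. (\<integral>\<^sup>+x. f x \<partial>lborel) * g y \<partial>lborel)"
  proof (intro nn_integral_cong)
    fix y
    have "(\<integral>\<^sup>+x. f (x - y) * g y \<partial>lborel) = (\<integral>\<^sup>+x. f (x - y) \<partial>lborel) * g y"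
      by (intro nn_integral_multc) measurable
    also have "(\<integral>\<^sup>+x. f (x - y) \<partial>lborel) = (\<integral>\<^sup>+x. f x \<partial>lborel)"
      by (subst nn_integral_real_affine[where c="1" and t=y]) auto
    finally show "(\<integral>\<^sup>+x. f (x - y) * g y \<partial>lborel) = (\<integral>\<^sup>+x. f x \<partial>lborel) * g y" .
  qed
  also have "\<dots> = (\<integral>\<^sup>+x. f x \<partial>lborel) * (\<integral>\<^sup>+x. g x \<partial>lborel)"
    by (intro nn_integral_cmult) measurable
  finally show ?thesis .
qed

lemma measurable_mconv[measurable]:
  assumes "sigma_finite_measure F" and [measurable_cong]: "sets F = sets borel"
    and [measurable]: "f \<in> borel_measurable borel"
  shows "mconv F f \<in> borel_measurable borel"
proof -
  interpret sigma_finite_measure F by fact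
  show ?thesis unfolding mconv_def[abs_def] by measurable
qed

text \<open>With this the jump law acts on \<open>E\<close> alone inside
  \<open>W = E + E * v\<close>, so that the balance for \<open>E\<close> carries over to
  \<open>W\<close>; the same is done later with \<open>W\<close> and a payoff.\<close>

lemma mconv_conv:
  assumes "sigma_finite_measure F" and [measurable_cong]: "sets F = sets borel"
    and [measurable]: "f \<in> borel_measurable borel" "g \<in> borel_measurable borel"
  shows "mconv F (conv f g) x = conv (mconv F f) g x"
proof -
  interpret F: sigma_finite_measure F by fact
  interpret pair_sigma_finite F lborel ..
  have "mconv F (conv f g) x = (\<integral>\<^sup>+y. (\<integral>\<^sup>+z. f (x - y - z) * g y \<partial>F) \<partial>lborel)"
    unfolding conv_def mconv_def
    by (subst Fubini'[symmetric]) (auto intro!: nn_integral_cong simp: algebra_simps)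
  also have "\<dots> = conv (mconv F f) g x"
    unfolding conv_def mconv_def by (intro nn_integral_cong nn_integral_multc) measurable
  finally show ?thesis .
qed

text \<open>Picard iteration from 0. The iterates increase, so monotone convergence passes the
  equation to their supremum. The bound is the exact solution for \<open>g = B\<close> on the half
  line: one iteration maps \<open>B * exp (B * x)\<close> to itself, so no iterate exceeds
  it.\<close>

lemma renewal_equation_solvable:
  fixes g :: "real \<Rightarrow> ennreal" and B :: real
  assumes g[measurable]: "g \<in> borel_measurable borel"
    and B: "0 \<le> B" "\<And>x. g x \<le> ennreal B * indicator {0..} x"
  obtains v where "v \<in> borel_measurable borel" "\<And>x. v x = g x + conv g v x"
    "\<And>x. v x \<le> ennreal (B * exp (B * x)) * indicator {0..} x"
proof -
  define \<Psi> where "\<Psi> v x = g x + conv g v x" for v x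
  define w where "w n = (\<Psi> ^^ n) (\<lambda>_. 0)" for n
  have w0: "w 0 = (\<lambda>_. 0)" and wS: "\<And>n. w (Suc n) = \<Psi> (w n)" by (auto simp: w_def)
  have wm[measurable]: "w n \<in> borel_measurable borel" for n
  proof (induction n)
    case 0 show ?case by (simp add: w0)
  next
    case (Suc n)
    note [measurable] = Suc
    show ?case unfolding wS \<Psi>_def[abs_def] by measurable
  qed
  have mono: "w n x \<le> w (Suc n) x" for n x
  proof (induction n arbitrary: x)
    case 0 show ?case by (simp add: w0)
  next
    case (Suc n)
    show ?case using Suc unfolding wS[of n] wS[of "Suc n"] \<Psi>_def by (intro add_left_mono conv_mono) auto
  qed
  have inc: "incseq (\<lambda>n. w n x)" for x by (intro incseq_SucI mono)
  have bound: "w n x \<le> ennreal (B * exp (B * x)) * indicator {0..} x" for n x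
  proof (induction n arbitrary: x)
    case 0 show ?case by (simp add: w0)
  next
    case (Suc n)
    have "conv g (w n) x \<le> conv (\<lambda>x. ennreal B * indicator {0..} x) (\<lambda>x. ennreal (B * exp (B * x)) * indicator {0..} x) x"
      by (intro conv_mono B Suc)
    also have "\<dots> = ennreal B * (\<integral>\<^sup>+y. ennreal (B * exp (B * y)) * indicator {0..x} y \<partial>lborel)"
      unfolding conv_def by (subst nn_integral_cmult[symmetric]) (auto intro!: nn_integral_cong split: split_indicator simp: mult.assoc)
    also have "(\<integral>\<^sup>+y. ennreal (B * exp (B * y)) * indicator {0..x} y \<partial>lborel) = ennreal (exp (B * x) - 1) * indicator {0..} x"
    proof (cases "0 \<le> x")
      case True
      have "(\<integral>\<^sup>+y. ennreal (B * exp (B * y)) * indicator {0..x} y \<partial>lborel) = exp (B * x) - exp (B * 0)"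
        by (intro nn_integral_FTC_Icc) (use True B in \<open>auto intro!: derivative_eq_intros\<close>)
      with True show ?thesis by simp
    qed auto
    finally have *: "conv g (w n) x \<le> ennreal B * (ennreal (exp (B * x) - 1) * indicator {0..} x)" .
    show ?case
    proof (cases "0 \<le> x")
      case True
      have "w (Suc n) x \<le> ennreal B + ennreal B * ennreal (exp (B * x) - 1)"
        unfolding wS \<Psi>_def using B(2)[of x] * True by (intro add_mono) auto
      also have "\<dots> = ennreal (B + B * (exp (B * x) - 1))"
        using True B(1) by (simp add: ennreal_mult ennreal_plus)
      also have "B + B * (exp (B * x) - 1) = B * exp (B * x)" by (simp add: algebra_simps)
      finally show ?thesis using True by simp
    next
      case False
      then show ?thesis unfolding wS \<Psi>_def using B(2)[of x] * by auto
    qed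
  qed
  define v where "v x = (SUP n. w n x)" for x
  have [measurable]: "v \<in> borel_measurable borel" unfolding v_def[abs_def] by measurable
  have "v x = g x + conv g v x" for x
  proof -
    have "conv g v x = (\<integral>\<^sup>+y. (SUP n. g (x - y) * w n y) \<partial>lborel)"
      unfolding conv_def v_def by (simp add: SUP_mult_left_ennreal)
    also have "\<dots> = (SUP n. conv g (w n) x)"
      unfolding conv_def
      by (intro nn_integral_monotone_convergence_SUP) (auto simp: incseq_def le_fun_def intro!: mult_left_mono incseqD[OF inc])
    finally have "g x + conv g v x = (SUP n. g x + conv g (w n) x)"
      by (simp add: ennreal_SUP_add_right)
    also have "\<dots> = (SUP n. w (Suc n) x)" by (simp add: wS \<Psi>_def)
    also have "\<dots> = v x" unfolding v_def by (rule SUP_eq) (auto intro: mono exI[of _ "Suc _"])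
    finally show ?thesis ..
  qed
  moreover have "v x \<le> ennreal (B * exp (B * x)) * indicator {0..} x" for x
    unfolding v_def by (intro SUP_least bound)
  ultimately show ?thesis by (intro that[of v]) auto
qed


subsection \<open>A renewal density theorem\<close>

lemma filterlim_minus_const_at_top: "filterlim (\<lambda>x. f x - z) at_top F" if "filterlim f at_top F" for f :: "_ \<Rightarrow> real"
  using filterlim_tendsto_add_at_top[OF tendsto_const[of "-z"] that] by (simp add: add.commute)

text \<open>\<open>g_growth\<close> says that \<open>exp (- \<kappa> * x) * g x\<close> decreases on
  the half line. It admits downward jumps of \<open>g\<close>, which occur when the job law has
  atoms, and is still strong enough for a pointwise limit. The renewal density \<open>v\<close> is
  any given solution; its local integrability permits cancellation in
  \<open>ennreal\<close>.\<close>

locale renewal_density =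
  fixes g v :: "real \<Rightarrow> real" and \<kappa> :: real
  assumes g_meas[measurable]: "g \<in> borel_measurable borel"
    and v_meas[measurable]: "v \<in> borel_measurable borel"
    and g_nonneg: "\<And>x. 0 \<le> g x" and g_neg: "\<And>x. x < 0 \<Longrightarrow> g x = 0"
    and v_nonneg: "\<And>x. 0 \<le> v x" and v_neg: "\<And>x. x < 0 \<Longrightarrow> v x = 0"
    and \<kappa>_nonneg: "0 \<le> \<kappa>"
    and g_growth: "\<And>x s. 0 \<le> x \<Longrightarrow> 0 \<le> s \<Longrightarrow> g (x + s) \<le> exp (\<kappa> * s) * g x"
    and g_prob: "(\<integral>\<^sup>+x. g x \<partial>lborel) = 1"
    and g_mean: "integrable lborel (\<lambda>x. x * g x)"
    and renewal: "\<And>x. ennreal (v x) = ennreal (g x) + conv (\<lambda>x. ennreal (g x)) (\<lambda>x. ennreal (v x)) x"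
    and v_locally_integrable: "\<And>t. (\<integral>\<^sup>+x. ennreal (v x) * indicator {..t} x \<partial>lborel) < \<infinity>"
begin

abbreviation "G \<equiv> (\<lambda>x. ennreal (g x))"
abbreviation "V \<equiv> (\<lambda>x. ennreal (v x))"
abbreviation "H \<equiv> (indicator {0..} :: real \<Rightarrow> ennreal)"

definition tail :: "real \<Rightarrow> real" where
  "tail t = (\<integral>y. g y * indicator {t<..} y \<partial>lborel)"

lemma g_integrable: "integrable lborel g"
  using g_prob g_nonneg by (intro integrableI_nonneg) auto

lemma tail_integrable: "integrable lborel (\<lambda>y. g y * indicator {t<..} y)"
  by (rule integrable_real_mult_indicator) (auto intro: g_integrable)

lemma ennreal_tail: "ennreal (tail t) = (\<integral>\<^sup>+y. G y * indicator {t<..} y \<partial>lborel)"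
  unfolding tail_def
  by (subst nn_integral_eq_integral[symmetric])
     (auto intro!: tail_integrable nn_integral_cong simp: g_nonneg ennreal_mult' split: split_indicator)

lemma tail_nonneg: "0 \<le> tail t"
  unfolding tail_def by (intro integral_nonneg_AE) (auto simp: g_nonneg)

lemma measurable_tail[measurable]: "tail \<in> borel_measurable borel"
proof -
  have "tail = (\<lambda>t. \<integral>y. (if t < y then g y else 0) \<partial>lborel)"
    by (auto simp: tail_def fun_eq_iff intro!: Bochner_Integration.integral_cong split: split_indicator)
  then show ?thesis by simp
qed

lemma tail_tendsto_0: "(tail \<longlongrightarrow> 0) at_top"
proof -
  have "((\<lambda>t. \<integral>y. g y * indicator {t<..} y \<partial>lborel) \<longlongrightarrow> (\<integral>y. 0 \<partial>(lborel :: real measure))) at_top"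
  proof (rule integral_dominated_convergence_at_top[where w=g])
    show "AE x in lborel. ((\<lambda>t. g x * indicator {t<..} x) \<longlongrightarrow> 0) at_top"
    proof (intro AE_I2 tendsto_eventually)
      fix x :: real
      show "\<forall>\<^sub>F t in at_top. g x * indicator {t<..} x = 0"
        using eventually_ge_at_top[of x] by eventually_elim (auto split: split_indicator)
    qed
    show "\<forall>\<^sub>F t in at_top. AE x in lborel. norm (g x * indicator {t<..} x) \<le> g x"
      by (intro always_eventually allI AE_I2) (auto simp: g_nonneg split: split_indicator)
  qed (auto intro: g_integrable)
  then show ?thesis by (simp add: tail_def[abs_def])
qed

lemma nn_integral_tail:
  "(\<integral>\<^sup>+t. ennreal (tail t) * H t \<partial>lborel) = ennreal (\<integral>x. x * g x \<partial>lborel)"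
proof -
  have "(\<integral>\<^sup>+t. ennreal (tail t) * H t \<partial>lborel) = (\<integral>\<^sup>+t. (\<integral>\<^sup>+y. G y * indicator {t<..} y * H t \<partial>lborel) \<partial>lborel)"
    unfolding ennreal_tail by (intro nn_integral_cong nn_integral_multc[symmetric]) measurable
  also have "\<dots> = (\<integral>\<^sup>+y. (\<integral>\<^sup>+t. G y * indicator {0..<y} t \<partial>lborel) \<partial>lborel)"
  proof -
    have "(\<integral>\<^sup>+t. (\<integral>\<^sup>+y. G y * indicator {t<..} y * H t \<partial>lborel) \<partial>lborel)
        = (\<integral>\<^sup>+t. (\<integral>\<^sup>+y. (if 0 \<le> t \<and> t < y then G y else 0) \<partial>lborel) \<partial>lborel)"
      by (intro nn_integral_cong) (auto split: split_indicator)
    also have "\<dots> = (\<integral>\<^sup>+y. (\<integral>\<^sup>+t. (if 0 \<le> t \<and> t < y then G y else 0) \<partial>lborel) \<partial>lborel)"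
      by (intro lborel_pair.Fubini') measurable
    finally show ?thesis by (auto intro!: nn_integral_cong split: split_indicator simp: if_distrib cong: if_cong)
  qed
  also have "\<dots> = (\<integral>\<^sup>+y. ennreal (y * g y) \<partial>lborel)"
  proof (intro nn_integral_cong)
    fix y
    show "(\<integral>\<^sup>+t. G y * indicator {0..<y} t \<partial>lborel) = ennreal (y * g y)"
      by (cases "0 \<le> y") (auto simp: nn_integral_cmult ennreal_mult'' g_nonneg g_neg mult.commute)
  qed
  also have "\<dots> = ennreal (\<integral>x. x * g x \<partial>lborel)"
  proof (rule nn_integral_eq_integral[OF g_mean], intro AE_I2)
    show "0 \<le> x * g x" for x by (cases "x < 0") (auto simp: g_neg g_nonneg)
  qed
  finally show ?thesis .
qed

text \<open>Since \<open>g\<close> has mass one, \<open>H = ?T + H * G\<close> as convolutions,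
  \<open>?T\<close> being the tail on the half line. Convolving this with \<open>V\<close>, and the
  renewal equation with \<open>H\<close>, gives two expressions for \<open>V * H\<close> that share
  the term \<open>H * G * V\<close>. That term is finite by local integrability, and cancelling it
  leaves \<open>V * ?T = H * G\<close>.\<close>

lemma age_identity_ennreal:
  assumes "0 \<le> t"
  shows "ennreal (tail t) + conv V (\<lambda>t. ennreal (tail t) * H t) t = 1"
proof -
  let ?T = "\<lambda>t. ennreal (tail t) * H t"
  have H: "H s = ?T s + conv H G s" for s
  proof -
    have c: "conv H G s = (\<integral>\<^sup>+y. G y * indicator {..s} y \<partial>lborel)"
      unfolding conv_def by (auto intro!: nn_integral_cong split: split_indicator)
    show ?thesis
    proof (cases "0 \<le> s")
      case True
      have "ennreal (tail s) + conv H G s = (\<integral>\<^sup>+y. G y \<partial>lborel)"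
        unfolding c ennreal_tail
        by (subst nn_integral_add[symmetric]) (auto intro!: nn_integral_cong split: split_indicator)
      then show ?thesis using True g_prob by simp
    next
      case False
      have "conv H G s = (\<integral>\<^sup>+(y::real). 0 \<partial>lborel)"
        unfolding c by (intro nn_integral_cong) (use False in \<open>auto simp: g_neg split: split_indicator\<close>)
      then show ?thesis using False by simp
    qed
  qed
  have "conv V H t = conv V (\<lambda>s. ?T s + conv H G s) t" by (intro conv_cong refl H)
  also have "\<dots> = conv V ?T t + conv V (conv H G) t" by (intro conv_add_right) measurable
  also have "conv V (conv H G) t = conv (conv V H) G t" by (intro conv_assoc[symmetric]) measurable
  also have "\<dots> = conv (conv H V) G t" by (intro conv_cong refl conv_commute) measurable
  also have "\<dots> = conv H (conv V G) t" by (intro conv_assoc) measurable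
  also have "\<dots> = conv H (conv G V) t" by (intro conv_cong refl conv_commute) measurable
  finally have 1: "conv V H t = conv V ?T t + conv H (conv G V) t" .
  have "conv V H t = conv H V t" by (intro conv_commute) measurable
  also have "\<dots> = conv H (\<lambda>s. G s + conv G V s) t" by (intro conv_cong refl renewal)
  also have "\<dots> = conv H G t + conv H (conv G V) t" by (intro conv_add_right) measurable
  finally have 2: "conv V H t = conv H G t + conv H (conv G V) t" .
  have "conv H (conv G V) t \<le> conv H V t"
  proof (rule conv_mono)
    show "conv G V y \<le> V y" for y using renewal[of y] by (metis add.commute le_iff_add)
  qed simp
  also have "\<dots> = (\<integral>\<^sup>+x. V x * indicator {..t} x \<partial>lborel)"
    unfolding conv_def by (auto intro!: nn_integral_cong split: split_indicator)
  also have "\<dots> < \<infinity>" by (rule v_locally_integrable)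
  finally have fin: "conv H (conv G V) t \<noteq> \<infinity>" by simp
  from 1 2 have "conv H (conv G V) t + conv V ?T t = conv H (conv G V) t + conv H G t"
    by (metis add.commute)
  with fin have "conv V ?T t = conv H G t" by (metis ennreal_add_left_cancel infinity_ennreal_def)
  then show ?thesis using H[of t] assms by simp
qed

text \<open>The growth condition read backwards: one positive value \<open>g z\<close> bounds
  \<open>g\<close> from below on all of \<open>[0, z]\<close>.\<close>

lemma g_pos_near_0:
  obtains z g0 where "0 < z" "0 < g0" "\<And>y. 0 \<le> y \<Longrightarrow> y \<le> z \<Longrightarrow> g0 \<le> g y"
proof -
  have "\<exists>z>0. 0 < g z"
  proof (rule ccontr)
    assume "\<not> ?thesis"
    then have "g z = 0" if "z \<noteq> 0" for z using that g_neg[of z] g_nonneg[of z] by (cases "0 < z") (auto simp: less_le)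
    then have "(\<integral>\<^sup>+x. g x \<partial>lborel) = (\<integral>\<^sup>+x. 0 \<partial>(lborel :: real measure))"
      by (intro nn_integral_cong_AE eventually_mono[OF AE_lborel_singleton[of 0]]) auto
    then show False using g_prob by simp
  qed
  then obtain z where z: "0 < z" "0 < g z" by auto
  show ?thesis
  proof (rule that[of z "exp (- \<kappa> * z) * g z"])
    fix y assume y: "0 \<le> y" "y \<le> z"
    have "g z \<le> exp (\<kappa> * (z - y)) * g y" using g_growth[of y "z - y"] y by simp
    also have "\<dots> \<le> exp (\<kappa> * z) * g y"
      using y \<kappa>_nonneg by (intro mult_right_mono g_nonneg) (auto intro: mult_left_mono)
    finally show "exp (- \<kappa> * z) * g z \<le> g y" by (simp add: exp_minus field_simps)
  qed (use z in auto)
qed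

text \<open>The age identity bounds the mass that \<open>V\<close> gives to any window of length
  \<open>a\<close>, because \<open>tail\<close> is at least \<open>g0 * a\<close> on
  \<open>[0, a]\<close>. To pass from windows to points, \<open>g\<close> is dominated by a bump
  near 0 plus a multiple of its own window averages; convolved with \<open>V\<close> this leaves
  only window masses of \<open>V\<close>.\<close>

lemma v_bounded:
  obtains B where "0 < B" "\<And>x. g x \<le> B" "\<And>x. v x \<le> B"
proof -
  obtain z g0 where z: "0 < z" "0 < g0" "\<And>y. 0 \<le> y \<Longrightarrow> y \<le> z \<Longrightarrow> g0 \<le> g y"
    using g_pos_near_0 by metis
  define a where "a = z / 2"
  have a: "0 < a" using z by (simp add: a_def)
  have az: "a \<le> z" using z by (simp add: a_def)
  define I where "I = (indicator {0..a} :: real \<Rightarrow> ennreal)"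
  have [measurable]: "I \<in> borel_measurable borel" by (auto simp: I_def)
  have tail_lower: "g0 * a \<le> tail s" if "0 \<le> s" "s \<le> a" for s
  proof -
    have "g0 * a = (\<integral>y. g0 * indicator {a<..z} y \<partial>lborel)" using z by (simp add: a_def)
    also have "\<dots> \<le> tail s" unfolding tail_def
      by (intro integral_mono tail_integrable integrable_real_indicator integrable_mult_right) (use that a z az in \<open>auto simp: g_nonneg split: split_indicator\<close>)
    finally show ?thesis .
  qed
  define C where "C = 1 / (g0 * a)"
  have C: "0 < C" using z a by (simp add: C_def)
  have IV: "conv I V t \<le> ennreal C" for t
  proof (cases "0 \<le> t")
    case True
    have "ennreal (g0 * a) * conv I V t = ennreal (g0 * a) * conv V I t"
      by (subst conv_commute) auto
    also have "\<dots> = conv V (\<lambda>s. ennreal (g0 * a) * I s) t"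
      by (intro conv_cmult_right[symmetric]) auto
    also have "\<dots> \<le> conv V (\<lambda>s. ennreal (tail s) * H s) t"
      by (intro conv_mono order_refl) (auto simp: I_def intro!: ennreal_leI tail_lower split: split_indicator)
    also have "\<dots> \<le> 1" using age_identity_ennreal[OF True] by (metis add.commute le_iff_add)
    finally have "ennreal C * (ennreal (g0 * a) * conv I V t) \<le> ennreal C * 1" by (rule mult_left_mono) auto
    moreover have "ennreal C * ennreal (g0 * a) = 1"
      using z a C by (subst ennreal_mult[symmetric]) (auto simp: C_def)
    ultimately show ?thesis by (simp add: mult.assoc[symmetric])
  next
    case False
    have "conv I V t = (\<integral>\<^sup>+(y::real). 0 \<partial>lborel)" unfolding conv_def
      by (intro nn_integral_cong) (use False in \<open>auto simp: I_def v_neg split: split_indicator\<close>)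
    then show ?thesis by simp
  qed
  \<comment> \<open>\<open>K\<close> bounds \<open>g\<close> on \<open>[0, a]\<close>. For
    \<open>y > a\<close> the growth condition compares \<open>g y\<close> with every value on
    \<open>[y - a, y]\<close>, and averaging over that window gives the factor
    \<open>exp (\<kappa> * a) / a\<close>.\<close>
  define K where "K = exp (\<kappa> * a) * g 0"
  define K' where "K' = exp (\<kappa> * a) / a"
  have K: "0 \<le> K" "0 \<le> K'" using a g_nonneg by (auto simp: K_def K'_def)
  have Gb: "G y \<le> ennreal K * I y + ennreal K' * conv I G y" for y
  proof -
    consider "y < 0" | "0 \<le> y" "y \<le> a" | "a < y" by linarith
    then show ?thesis
    proof cases
      case 1 then show ?thesis by (simp add: g_neg)
    next
      case 2
      have "g y \<le> exp (\<kappa> * y) * g 0" using g_growth[of 0 y] 2 by simp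
      also have "\<dots> \<le> K" unfolding K_def using 2 \<kappa>_nonneg
        by (intro mult_right_mono g_nonneg) (auto intro: mult_left_mono)
      finally have "G y \<le> ennreal K * I y" using 2 by (auto simp: I_def intro: ennreal_leI)
      then show ?thesis by (rule order_trans) simp
    next
      case 3
      have "ennreal (exp (- \<kappa> * a) * g y) * ennreal a = (\<integral>\<^sup>+w. ennreal (exp (- \<kappa> * a) * g y) * indicator {y - a..y} w \<partial>lborel)"
        using a by (simp add: nn_integral_cmult)
      also have "\<dots> \<le> conv I G y" unfolding conv_def
      proof (intro nn_integral_mono)
        fix w
        show "ennreal (exp (- \<kappa> * a) * g y) * indicator {y - a..y} w \<le> I (y - w) * G w"
        proof (cases "w \<in> {y - a..y}")
          case True
          have "g y \<le> exp (\<kappa> * (y - w)) * g w" using g_growth[of w "y - w"] True 3 by simp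
          also have "\<dots> \<le> exp (\<kappa> * a) * g w"
            using True \<kappa>_nonneg by (intro mult_right_mono g_nonneg) (auto intro: mult_left_mono)
          finally have "exp (- \<kappa> * a) * g y \<le> g w" by (simp add: exp_minus field_simps)
          then show ?thesis using True by (auto simp: I_def intro: ennreal_leI)
        qed auto
      qed
      finally have "ennreal K' * (ennreal (exp (- \<kappa> * a) * g y) * ennreal a) \<le> ennreal K' * conv I G y"
        by (rule mult_left_mono) auto
      moreover have "K' * ((exp (- \<kappa> * a) * g y) * a) = g y"
        using a by (simp add: K'_def exp_minus)
      moreover have "ennreal K' * (ennreal (exp (- \<kappa> * a) * g y) * ennreal a) = ennreal (K' * ((exp (- \<kappa> * a) * g y) * a))"
        using a K g_nonneg by (subst ennreal_mult, simp, simp, subst ennreal_mult) auto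
      ultimately have "G y \<le> ennreal K' * conv I G y" by metis
      then show ?thesis by (rule order_trans) simp
    qed
  qed
  have IG: "conv I G y \<le> 1" for y
  proof -
    have "conv I G y \<le> (\<integral>\<^sup>+w. G w \<partial>lborel)" unfolding conv_def
      by (intro nn_integral_mono) (auto simp: I_def split: split_indicator)
    then show ?thesis using g_prob by simp
  qed
  have g_le: "g y \<le> K + K'" for y
  proof -
    have "G y \<le> ennreal K * 1 + ennreal K' * 1"
      by (rule order_trans[OF Gb]) (intro add_mono mult_left_mono IG, auto simp: I_def split: split_indicator)
    then show ?thesis using K by (simp add: ennreal_plus[symmetric] del: ennreal_plus)
  qed
  have v_le: "v y \<le> (K + K') + (K * C + K' * C)" for y
  proof -
    have "conv G V y \<le> conv (\<lambda>y. ennreal K * I y + ennreal K' * conv I G y) V y"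
      by (intro conv_mono Gb order_refl)
    also have "\<dots> = conv (\<lambda>y. ennreal K * I y) V y + conv (\<lambda>y. ennreal K' * conv I G y) V y"
      by (intro conv_add_left) measurable
    also have "conv (\<lambda>y. ennreal K * I y) V y = ennreal K * conv I V y" by (intro conv_cmult_left) measurable
    also have "conv (\<lambda>y. ennreal K' * conv I G y) V y = ennreal K' * conv (conv I G) V y"
      by (intro conv_cmult_left) measurable
    also have "conv (conv I G) V y = conv (conv G I) V y" by (intro conv_cong conv_commute refl) measurable
    also have "\<dots> = conv G (conv I V) y" by (intro conv_assoc) measurable
    also have "ennreal K * conv I V y + ennreal K' * conv G (conv I V) y
        \<le> ennreal K * ennreal C + ennreal K' * conv G (\<lambda>_. ennreal C) y"
      by (intro add_mono mult_left_mono IV conv_mono order_refl) auto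
    also have "conv G (\<lambda>_. ennreal C) y = ennreal C"
    proof -
      have "conv G (\<lambda>_. ennreal C) y = conv (\<lambda>_. ennreal C) G y" by (intro conv_commute) measurable
      also have "\<dots> = ennreal C * (\<integral>\<^sup>+y. G y \<partial>lborel)" unfolding conv_def by (intro nn_integral_cmult) measurable
      finally show ?thesis using g_prob by simp
    qed
    finally have *: "conv G V y \<le> ennreal K * ennreal C + ennreal K' * ennreal C" .
    have "V y \<le> ennreal (K + K') + (ennreal K * ennreal C + ennreal K' * ennreal C)"
      by (subst renewal) (intro add_mono * ennreal_leI g_le)
    also have "\<dots> = ennreal ((K + K') + (K * C + K' * C))" using K C by (simp add: ennreal_mult ennreal_plus)
    finally show ?thesis using K C by (subst (asm) ennreal_le_iff) auto
  qed
  show ?thesis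
  proof (rule that[of "(K + K') + (K * C + K' * C)"])
    have p: "0 < K'" "0 \<le> K * C" "0 \<le> K' * C" using K C a by (auto simp: K'_def)
    show "0 < K + K' + (K * C + K' * C)" using p K(1) by linarith
    show "g x \<le> K + K' + (K * C + K' * C)" for x
      using g_le[of x] p by linarith
  qed (rule v_le)
qed


lemma integrable_conv_v:
  assumes [measurable]: "q \<in> borel_measurable borel" and "integrable lborel q"
  shows "integrable lborel (\<lambda>y. v (t - y) * q y)"
proof -
  obtain B where B: "0 < B" "\<And>x. v x \<le> B" by (metis v_bounded)
  show ?thesis
  proof (rule Bochner_Integration.integrable_bound)
    show "integrable lborel (\<lambda>y. B * q y)" using assms by simp
    show "AE y in lborel. norm (v (t - y) * q y) \<le> norm (B * q y)"
      using B v_nonneg by (auto simp: abs_mult intro!: mult_mono)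
  qed measurable
qed

lemma conv_v_integral:
  assumes [measurable]: "q \<in> borel_measurable borel" and "integrable lborel q" and "\<And>y. 0 \<le> q y"
  shows "conv V (\<lambda>y. ennreal (q y)) t = ennreal (\<integral>y. v (t - y) * q y \<partial>lborel)"
  unfolding conv_def
  by (subst nn_integral_eq_integral[symmetric])
     (auto intro!: nn_integral_cong integrable_conv_v simp: assms v_nonneg ennreal_mult)

lemma renewal_integral: "v t = g t + (\<integral>y. v (t - y) * g y \<partial>lborel)"
proof -
  have "V t = G t + conv V G t" by (subst renewal) (simp add: conv_commute[of G V])
  also have "\<dots> = ennreal (g t + (\<integral>y. v (t - y) * g y \<partial>lborel))"
    by (subst conv_v_integral)
       (auto simp: g_integrable g_nonneg v_nonneg intro!: ennreal_plus[symmetric] integral_nonneg_AE)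
  finally show ?thesis
    by (subst (asm) ennreal_inj) (auto simp: g_nonneg v_nonneg intro!: add_nonneg_nonneg integral_nonneg_AE)
qed

definition \<mu> :: real where "\<mu> = (\<integral>x. x * g x \<partial>lborel)"

definition tail0 :: "real \<Rightarrow> real" where "tail0 t = tail t * indicator {0..} t"

lemma measurable_tail0[measurable]: "tail0 \<in> borel_measurable borel"
  unfolding tail0_def[abs_def] by measurable

lemma tail0_nonneg: "0 \<le> tail0 t" by (simp add: tail0_def tail_nonneg)

lemma \<mu>_nonneg: "0 \<le> \<mu>"
  unfolding \<mu>_def
proof (intro integral_nonneg_AE AE_I2)
  show "0 \<le> x * g x" for x by (cases "x < 0") (auto simp: g_neg g_nonneg)
qed

lemma ennreal_tail0: "ennreal (tail0 t) = ennreal (tail t) * H t"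
  by (auto simp: tail0_def split: split_indicator)

lemma has_bochner_integral_tail0: "has_bochner_integral lborel tail0 \<mu>"
  using nn_integral_tail
  by (intro has_bochner_integral_nn_integral) (auto simp: \<mu>_nonneg ennreal_tail0 \<mu>_def[symmetric] tail0_nonneg)

lemma tail0_integrable: "integrable lborel tail0" and integral_tail0: "integral\<^sup>L lborel tail0 = \<mu>"
  using has_bochner_integral_tail0 by (auto simp: has_bochner_integral_iff)

text \<open>In renewal terms: the law of the age of the process at time \<open>t\<close> has total mass one.\<close>

lemma age_identity:
  assumes "0 \<le> t"
  shows "tail t + (\<integral>y. v (t - y) * tail0 y \<partial>lborel) = 1"
proof -
  have "ennreal (tail t + (\<integral>y. v (t - y) * tail0 y \<partial>lborel)) = ennreal (tail t) + conv V (\<lambda>y. ennreal (tail0 y)) t"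
    by (subst conv_v_integral)
       (auto simp: tail0_integrable tail0_nonneg tail_nonneg v_nonneg intro!: ennreal_plus integral_nonneg_AE)
  also have "\<dots> = 1" unfolding ennreal_tail0 by (rule age_identity_ennreal[OF assms])
  finally show ?thesis by (simp add: ennreal_eq_1)
qed

text \<open>Shift the variable in the renewal integral at \<open>t + s\<close> by \<open>s\<close>.
  Where the shifted argument is nonnegative, the growth condition compares with the integral at
  \<open>t\<close> up to the factor \<open>exp (\<kappa> * s)\<close>; the remaining piece has
  length \<open>s\<close> and a bounded integrand. Only upward moves of \<open>v\<close> are
  controlled, so later arguments look from a low value to the times after it.\<close>

lemma v_slowly_increasing:
  obtains \<omega> where "\<And>t s. 0 \<le> t \<Longrightarrow> 0 \<le> s \<Longrightarrow> v (t + s) \<le> v t + \<omega> s"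
    "\<And>s s'. 0 \<le> s \<Longrightarrow> s \<le> s' \<Longrightarrow> \<omega> s \<le> \<omega> s'" "(\<omega> \<longlongrightarrow> 0) (at_right 0)"
proof -
  obtain B where B: "0 < B" "\<And>x. g x \<le> B" "\<And>x. v x \<le> B" using v_bounded by metis
  define \<omega> where "\<omega> s = (exp (\<kappa> * s) - 1) * B + B * B * exp (\<kappa> * s) * s" for s
  have "v (t + s) \<le> v t + \<omega> s" if ts: "0 \<le> t" "0 \<le> s" for t s
  proof -
    let ?e = "exp (\<kappa> * s)"
    have e1: "1 \<le> ?e" using \<kappa>_nonneg ts by simp
    have "conv G V (t + s) = (\<integral>\<^sup>+y. V (t + s - y) * G y \<partial>lborel)"
      by (subst conv_commute) (auto simp: conv_def)
    also have "\<dots> = (\<integral>\<^sup>+y. V (t - y) * G (y + s) \<partial>lborel)"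
      by (subst nn_integral_real_affine[where c=1 and t=s]) (auto simp: algebra_simps)
    also have "\<dots> \<le> (\<integral>\<^sup>+y. ennreal ?e * (V (t - y) * G y) + ennreal (B * B * ?e) * indicator {-s..0} y \<partial>lborel)"
    proof (intro nn_integral_mono)
      fix y
      consider "y < -s" | "-s \<le> y" "y < 0" | "0 \<le> y" by linarith
      then show "V (t - y) * G (y + s) \<le> ennreal ?e * (V (t - y) * G y) + ennreal (B * B * ?e) * indicator {-s..0} y"
      proof cases
        case 1 then show ?thesis by (simp add: g_neg)
      next
        case 2
        have "v (t - y) * g (y + s) \<le> B * B" using B by (intro mult_mono v_nonneg g_nonneg) auto
        also have "\<dots> \<le> B * B * ?e" using e1 B by simp
        finally have "V (t - y) * G (y + s) \<le> ennreal (B * B * ?e)"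
          by (simp add: ennreal_mult[symmetric] g_nonneg v_nonneg ennreal_leI)
        then show ?thesis using 2 by (simp add: add_increasing)
      next
        case 3
        have "v (t - y) * g (y + s) \<le> v (t - y) * (?e * g y)"
          using g_growth[of y s] 3 ts by (intro mult_left_mono v_nonneg) auto
        also have "\<dots> = ?e * (v (t - y) * g y)" by simp
        finally have "V (t - y) * G (y + s) \<le> ennreal (?e * (v (t - y) * g y))"
          by (simp add: ennreal_mult[symmetric] g_nonneg v_nonneg ennreal_leI)
        also have "\<dots> = ennreal ?e * (V (t - y) * G y)" by (simp add: ennreal_mult g_nonneg v_nonneg)
        finally show ?thesis by (simp add: add_increasing2)
      qed
    qed
    also have "\<dots> = ennreal ?e * conv V G t + ennreal (B * B * ?e) * ennreal s"
      using ts by (subst nn_integral_add) (auto simp: nn_integral_cmult conv_def)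
    also have "conv V G t = conv G V t" by (intro conv_commute) auto
    finally have 1: "conv G V (t + s) \<le> ennreal ?e * conv G V t + ennreal (B * B * ?e * s)"
      using B ts by (simp add: ennreal_mult)
    have "G (t + s) \<le> ennreal ?e * G t"
      using g_growth[OF ts] by (simp add: ennreal_mult[symmetric] g_nonneg ennreal_leI)
    with 1 have "V (t + s) \<le> ennreal ?e * G t + (ennreal ?e * conv G V t + ennreal (B * B * ?e * s))"
      by (subst renewal) (intro add_mono)
    also have "\<dots> = ennreal ?e * V t + ennreal (B * B * ?e * s)"
      by (subst renewal[of t]) (simp add: distrib_left add.assoc)
    also have "\<dots> = ennreal (?e * v t + B * B * ?e * s)"
      using ts B v_nonneg by (simp add: ennreal_mult)
    finally have "v (t + s) \<le> ?e * v t + B * B * ?e * s"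
      using ts B v_nonneg by (subst (asm) ennreal_le_iff) auto
    moreover have "(?e - 1) * v t \<le> (?e - 1) * B" using e1 B by (intro mult_left_mono) auto
    ultimately show ?thesis by (simp add: \<omega>_def algebra_simps)
  qed
  moreover have "\<omega> s \<le> \<omega> s'" if "0 \<le> s" "s \<le> s'" for s s'
    unfolding \<omega>_def using that B \<kappa>_nonneg
    by (intro add_mono mult_mono mult_nonneg_nonneg diff_right_mono) (auto intro: mult_left_mono)
  moreover have "(\<omega> \<longlongrightarrow> (exp (\<kappa> * 0) - 1) * B + B * B * exp (\<kappa> * 0) * 0) (at_right 0)"
    unfolding \<omega>_def by (intro tendsto_intros)
  ultimately show ?thesis by (intro that[of \<omega>]) auto
qed

text \<open>The limit superior of \<open>v\<close> at infinity, kept real valued as the infimum of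
  the eventual upper bounds.\<close>

definition \<beta> :: real where "\<beta> = Inf {b. \<forall>\<^sub>F t in at_top. v t \<le> b}"

lemma
  shows \<beta>_upper: "0 < \<epsilon> \<Longrightarrow> \<forall>\<^sub>F t in at_top. v t \<le> \<beta> + \<epsilon>"
    and \<beta>_lower: "0 < \<epsilon> \<Longrightarrow> \<exists>t\<ge>T. \<beta> - \<epsilon> < v t"
    and \<beta>_nonneg: "0 \<le> \<beta>"
proof -
  let ?S = "{b. \<forall>\<^sub>F t in at_top. v t \<le> b}"
  obtain B where B: "0 < B" "\<And>x. v x \<le> B" by (metis v_bounded)
  have ne: "B \<in> ?S" using B by auto
  have lb: "0 \<le> b" if "b \<in> ?S" for b
  proof -
    from that have "\<exists>t. v t \<le> b" using eventually_happens[of "\<lambda>t. v t \<le> b" at_top] by auto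
    then show ?thesis using v_nonneg order_trans by blast
  qed
  have bdd: "bdd_below ?S" by (rule bdd_belowI[of _ 0]) (rule lb)
  show "0 \<le> \<beta>" unfolding \<beta>_def using ne lb by (intro cInf_greatest) auto
  show "\<forall>\<^sub>F t in at_top. v t \<le> \<beta> + \<epsilon>" if "0 < \<epsilon>"
  proof -
    have "Inf ?S < \<beta> + \<epsilon>" using that by (simp add: \<beta>_def)
    then obtain b where "b \<in> ?S" "b < \<beta> + \<epsilon>" using cInf_lessD[of ?S "\<beta> + \<epsilon>"] ne by auto
    then show ?thesis by (auto elim: eventually_mono)
  qed
  show "\<exists>t\<ge>T. \<beta> - \<epsilon> < v t" if "0 < \<epsilon>"
  proof (rule ccontr)
    assume "\<not> ?thesis"
    then have "\<beta> - \<epsilon> \<in> ?S" by (auto simp: eventually_at_top_linorder not_less)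
    then have "\<beta> \<le> \<beta> - \<epsilon>" unfolding \<beta>_def using bdd by (intro cInf_lower)
    then show False using that by simp
  qed
qed

text \<open>Averages of \<open>v\<close> against \<open>q\<close> are asymptotically at most
  \<open>\<beta>\<close> times the mass of \<open>q\<close>, and a window on which \<open>v\<close>
  lies \<open>\<eta>\<close> lower costs \<open>\<eta>\<close> times the weight of that window. The
  threshold for \<open>t\<close> is uniform in window and depth, hence the quantifiers under
  \<open>eventually\<close>. It is used with \<open>g\<close> and with the tail as weight.\<close>

lemma weighted_average_drop:
  assumes [measurable]: "q \<in> borel_measurable borel" and q: "integrable lborel q" "\<And>y. 0 \<le> q y"
    and \<epsilon>: "0 < \<epsilon>"
  shows "\<forall>\<^sub>F t in at_top. \<forall>c d \<eta> q0. c \<le> d \<longrightarrow> 0 \<le> \<eta> \<longrightarrow> (\<forall>y\<in>{c..d}. q0 \<le> q y \<and> v (t - y) \<le> \<beta> - \<eta>) \<longrightarrow>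
     (\<integral>y. v (t - y) * q y \<partial>lborel) \<le> \<beta> * (\<integral>y. q y \<partial>lborel) + \<epsilon> - \<eta> * q0 * (d - c)"
proof -
  obtain B where B: "0 < B" "\<And>x. v x \<le> B" by (metis v_bounded)
  let ?I = "\<integral>y. q y \<partial>lborel"
  have I: "0 \<le> ?I" using q by (intro integral_nonneg_AE) auto
  \<comment> \<open>Half of \<epsilon> pays for replacing \<beta> by
    \<open>\<beta> + \<epsilon>'\<close> where \<open>t - y\<close> is late. The other half pays for
    \<open>y > t - T\<close>, where only \<open>v \<le> B\<close> is known but the weight of
    \<open>q\<close> vanishes as \<open>t\<close> grows.\<close>
  define \<epsilon>' where "\<epsilon>' = \<epsilon> / (2 * (1 + ?I))"
  have \<epsilon>': "0 < \<epsilon>'" using \<epsilon> I by (simp add: \<epsilon>'_def)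
  have \<epsilon>'I: "\<epsilon>' * ?I \<le> \<epsilon> / 2" using \<epsilon> I by (simp add: \<epsilon>'_def field_simps)
  obtain T where T: "\<And>t. T \<le> t \<Longrightarrow> v t \<le> \<beta> + \<epsilon>'"
    using \<beta>_upper[OF \<epsilon>'] by (auto simp: eventually_at_top_linorder)
  have "((\<lambda>t. \<integral>y. q y * indicator {t - T<..} y \<partial>lborel) \<longlongrightarrow> (\<integral>y. 0 \<partial>(lborel :: real measure))) at_top"
  proof (rule integral_dominated_convergence_at_top[where w=q])
    show "AE x in lborel. ((\<lambda>t. q x * indicator {t - T<..} x) \<longlongrightarrow> 0) at_top"
    proof (intro AE_I2 tendsto_eventually)
      fix x :: real
      show "\<forall>\<^sub>F t in at_top. q x * indicator {t - T<..} x = 0"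
        using eventually_ge_at_top[of "x + T"] by eventually_elim (auto split: split_indicator)
    qed
    show "\<forall>\<^sub>F t in at_top. AE x in lborel. norm (q x * indicator {t - T<..} x) \<le> q x"
      by (intro always_eventually allI AE_I2) (auto simp: q split: split_indicator)
  qed (auto intro: q)
  then have "\<forall>\<^sub>F t in at_top. (\<integral>y. q y * indicator {t - T<..} y \<partial>lborel) < \<epsilon> / (2 * B)"
    using \<epsilon> B by (intro order_tendstoD(2)) auto
  then show ?thesis
  proof eventually_elim
    case (elim t)
    show ?case
    proof (intro allI impI)
      fix c d \<eta> q0 :: real
      assume cd: "c \<le> d" "0 \<le> \<eta>" and h: "\<forall>y\<in>{c..d}. q0 \<le> q y \<and> v (t - y) \<le> \<beta> - \<eta>"
      have int: "integrable lborel (\<lambda>y. q y * indicator {t - T<..} y)"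
        by (rule integrable_real_mult_indicator) (auto intro: q)
      have "(\<integral>y. v (t - y) * q y \<partial>lborel)
        \<le> (\<integral>y. (\<beta> + \<epsilon>') * q y + B * (q y * indicator {t - T<..} y) - \<eta> * q0 * indicator {c..d} y \<partial>lborel)"
      proof (rule integral_mono)
        show "v (t - y) * q y \<le> (\<beta> + \<epsilon>') * q y + B * (q y * indicator {t - T<..} y) - \<eta> * q0 * indicator {c..d} y" for y
        proof (cases "y \<in> {c..d}")
          case True
          have "v (t - y) * q y \<le> (\<beta> - \<eta>) * q y" using h True q by (intro mult_right_mono) auto
          also have "\<dots> \<le> \<beta> * q y - \<eta> * q0" using h True cd mult_left_mono[of q0 "q y" \<eta>] by (simp add: algebra_simps)
          also have "\<dots> \<le> (\<beta> + \<epsilon>') * q y + B * (q y * indicator {t - T<..} y) - \<eta> * q0"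
            using \<epsilon>' q(2)[of y] B by (simp add: algebra_simps)
          finally show ?thesis using True by simp
        next
          case False
          have "v (t - y) * q y \<le> (\<beta> + \<epsilon>') * q y + B * (q y * indicator {t - T<..} y)"
          proof (cases "t - T < y")
            case True
            then show ?thesis using B(2)[of "t - y"] q(2)[of y] \<beta>_nonneg \<epsilon>'
              by (simp add: add_increasing mult_right_mono)
          next
            case False
            then show ?thesis using T[of "t - y"] q(2)[of y] by (simp add: mult_right_mono)
          qed
          then show ?thesis using False by simp
        qed
      qed (use cd int q in \<open>auto intro!: integrable_conv_v integrable_real_indicator\<close>)
      also have "\<dots> = (\<beta> + \<epsilon>') * ?I + B * (\<integral>y. q y * indicator {t - T<..} y \<partial>lborel) - \<eta> * q0 * (d - c)"
        using cd int q by simp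
      also have "\<dots> \<le> \<beta> * ?I + \<epsilon> - \<eta> * q0 * (d - c)"
        using \<epsilon>'I elim B by (simp add: field_simps)
      finally show "(\<integral>y. v (t - y) * q y \<partial>lborel) \<le> \<beta> * ?I + \<epsilon> - \<eta> * q0 * (d - c)" .
    qed
  qed
qed

text \<open>An integrable function need not vanish at infinity, but here \<open>g t\<close> is at
  most \<open>exp \<kappa>\<close> times the mass of \<open>g\<close> on the unit interval before
  \<open>t\<close>.\<close>

lemma g_tendsto_0: "(g \<longlongrightarrow> 0) at_top"
proof (rule tendsto_sandwich[where f="\<lambda>_. 0" and h="\<lambda>t. exp \<kappa> * tail (t - 1)"])
  show "\<forall>\<^sub>F t in at_top. g t \<le> exp \<kappa> * tail (t - 1)"
    using eventually_gt_at_top[of 1]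
  proof eventually_elim
    case (elim t)
    have "exp (- \<kappa>) * g t = (\<integral>y. exp (- \<kappa>) * g t * indicator {t - 1<..t} y \<partial>lborel)" by simp
    also have "\<dots> \<le> tail (t - 1)" unfolding tail_def
    proof (intro integral_mono tail_integrable)
      show "integrable lborel (\<lambda>y. exp (- \<kappa>) * g t * indicator {t - 1<..t} y)"
        by (intro integrable_mult_right integrable_real_indicator) auto
      show "exp (- \<kappa>) * g t * indicator {t - 1<..t} y \<le> g y * indicator {t - 1<..} y" for y
      proof (cases "y \<in> {t - 1<..t}")
        case True
        have "g t \<le> exp (\<kappa> * (t - y)) * g y" using g_growth[of y "t - y"] True elim by simp
        also have "\<dots> \<le> exp \<kappa> * g y" using True \<kappa>_nonneg
          by (intro mult_right_mono g_nonneg) (auto intro: mult_left_le)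
        finally show ?thesis using True by (simp add: exp_minus field_simps)
      qed (auto simp: g_nonneg split: split_indicator)
    qed
    finally show ?case by (simp add: exp_minus field_simps)
  qed
  from filterlim_compose[OF tail_tendsto_0 filterlim_minus_const_at_top[OF filterlim_ident]]
  show "((\<lambda>t. exp \<kappa> * tail (t - 1)) \<longlongrightarrow> 0) at_top"
    by (auto intro: tendsto_mult_right_zero)
qed (auto simp: g_nonneg)

text \<open>If \<open>v\<close> is close to its upper limit at a late time \<open>t\<close>, then, because \<open>v t\<close> is essentially an
  average of earlier values, so it is at almost every earlier time; slow increase turns
  almost every into every.\<close>

lemma upper_limit_propagates:
  obtains z where "0 < z" "\<And>s y. filterlim s at_top sequentially \<Longrightarrow> (\<lambda>n. v (s n)) \<longlonglongrightarrow> \<beta> \<Longrightarrow> 0 < y \<Longrightarrow> y \<le> z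
    \<Longrightarrow> (\<lambda>n. v (s n - y)) \<longlonglongrightarrow> \<beta>"
proof -
  obtain z g0 where z: "0 < z" "0 < g0" "\<And>y. 0 \<le> y \<Longrightarrow> y \<le> z \<Longrightarrow> g0 \<le> g y"
    using g_pos_near_0 by metis
  obtain \<omega> where \<omega>: "\<And>t s. 0 \<le> t \<Longrightarrow> 0 \<le> s \<Longrightarrow> v (t + s) \<le> v t + \<omega> s"
    "\<And>s s'. 0 \<le> s \<Longrightarrow> s \<le> s' \<Longrightarrow> \<omega> s \<le> \<omega> s'" "(\<omega> \<longlongrightarrow> 0) (at_right 0)"
    using v_slowly_increasing by metis
  show ?thesis
  proof (rule that[OF z(1)])
    fix s :: "nat \<Rightarrow> real" and y
    assume s: "filterlim s at_top sequentially" "(\<lambda>n. v (s n)) \<longlonglongrightarrow> \<beta>" and y: "0 < y" "y \<le> z"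
    have s': "filterlim (\<lambda>n. s n - y) at_top sequentially"
      by (rule filterlim_minus_const_at_top[OF s(1)])
    show "(\<lambda>n. v (s n - y)) \<longlonglongrightarrow> \<beta>"
    proof (rule order_tendstoI)
      fix b assume "\<beta> < b"
      then have "\<forall>\<^sub>F t in at_top. v t \<le> \<beta> + (b - \<beta>) / 2" by (intro \<beta>_upper) auto
      then have "\<forall>\<^sub>F n in sequentially. v (s n - y) \<le> \<beta> + (b - \<beta>) / 2"
        using s' by (rule eventually_compose_filterlim)
      then show "\<forall>\<^sub>F n in sequentially. v (s n - y) < b"
        by eventually_elim (use \<open>\<beta> < b\<close> in \<open>simp add: field_simps\<close>)
    next
      fix b assume "b < \<beta>"
      define \<eta> where "\<eta> = (\<beta> - b) / 3"
      have \<eta>: "0 < \<eta>" using \<open>b < \<beta>\<close> by (simp add: \<eta>_def)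
      have "\<forall>\<^sub>F s in at_right 0. \<omega> s < \<eta>" using \<omega>(3) \<eta> by (rule order_tendstoD)
      then obtain s1 where s1: "0 < s1" "\<And>s. 0 < s \<Longrightarrow> s < s1 \<Longrightarrow> \<omega> s < \<eta>"
        by (auto simp: eventually_at_right_field)
      define s0 where "s0 = min y (s1 / 2)"
      have s0: "0 < s0" "s0 \<le> y" "\<omega> s0 \<le> \<eta>"
        using s1 y less_imp_le[OF s1(2)[of s0]] by (auto simp: s0_def)
      \<comment> \<open>The drop caused by the window is
        \<open>\<eta> * g0 * s0 = 3 * \<epsilon>\<close>. One \<epsilon> is lost to the averaging
        error and one to the term \<open>g t\<close>; the third would keep \<open>v (s n)\<close>
        away from \<beta>.\<close>
      define \<epsilon> where "\<epsilon> = \<eta> * g0 * s0 / 3"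
      have \<epsilon>: "0 < \<epsilon>" using \<eta> z s0 by (simp add: \<epsilon>_def)
      have "\<forall>\<^sub>F t in at_top. g t < \<epsilon>" using g_tendsto_0 \<epsilon> by (rule order_tendstoD)
      moreover note weighted_average_drop[OF g_meas g_integrable g_nonneg \<epsilon>]
      moreover have "\<forall>\<^sub>F t in at_top. y \<le> t" by (rule eventually_ge_at_top)
      ultimately have "\<forall>\<^sub>F t in at_top. v (t - y) < \<beta> - 2 * \<eta> \<longrightarrow> v t < \<beta> - \<epsilon>"
      proof eventually_elim
        case (elim t)
        show ?case
        proof
          assume low: "v (t - y) < \<beta> - 2 * \<eta>"
          have "g0 \<le> g y' \<and> v (t - y') \<le> \<beta> - \<eta>" if "y' \<in> {y - s0..y}" for y'
          proof
            show "g0 \<le> g y'" using that s0 y by (intro z) auto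
            have "v (t - y') \<le> v (t - y) + \<omega> (y - y')" using \<omega>(1)[of "t - y" "y - y'"] that elim by simp
            also have "\<omega> (y - y') \<le> \<omega> s0" using that by (intro \<omega>) auto
            finally show "v (t - y') \<le> \<beta> - \<eta>" using low s0 by simp
          qed
          then have "(\<integral>y. v (t - y) * g y \<partial>lborel) \<le> \<beta> * (\<integral>y. g y \<partial>lborel) + \<epsilon> - \<eta> * g0 * (y - (y - s0))"
            by (intro elim(2)[rule_format]) (use s0 \<eta> in auto)
          also have "(\<integral>y. g y \<partial>lborel) = 1"
            using nn_integral_eq_integral[OF g_integrable] g_nonneg g_prob by (simp add: ennreal_eq_1)
          finally have "v t < \<beta> + 2 * \<epsilon> - \<eta> * g0 * s0"
            using renewal_integral[of t] elim by simp
          also have "\<eta> * g0 * s0 = 3 * \<epsilon>" by (simp add: \<epsilon>_def)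
          finally show "v t < \<beta> - \<epsilon>" by simp
        qed
      qed
      then have "\<forall>\<^sub>F n in sequentially. v (s n - y) < \<beta> - 2 * \<eta> \<longrightarrow> v (s n) < \<beta> - \<epsilon>"
        using s(1) by (rule eventually_compose_filterlim)
      moreover have "\<forall>\<^sub>F n in sequentially. \<beta> - \<epsilon> < v (s n)" using s(2) \<epsilon> by (intro order_tendstoD) auto
      ultimately have "\<forall>\<^sub>F n in sequentially. \<beta> - 2 * \<eta> \<le> v (s n - y)"
        by eventually_elim auto
      then show "\<forall>\<^sub>F n in sequentially. b < v (s n - y)"
        by eventually_elim (use \<open>b < \<beta>\<close> in \<open>simp add: \<eta>_def field_simps\<close>)
    qed
  qed
qed

text \<open>Choose times along which \<open>v\<close> approaches its limit superior. Any
  \<open>y\<close> is a multiple of a step shorter than \<open>z\<close>, so iterating the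
  propagation gives the limit \<beta> at distance \<open>y\<close> before these times as well, and
  dominated convergence turns the age identity into \<open>\<beta> * \<mu> = 1\<close>.\<close>

lemma \<beta>_times_\<mu>: "\<beta> * \<mu> = 1"
proof -
  obtain B where B: "0 < B" "\<And>x. v x \<le> B" by (metis v_bounded)
  obtain z where z: "0 < z" "\<And>s y. filterlim s at_top sequentially \<Longrightarrow> (\<lambda>n. v (s n)) \<longlonglongrightarrow> \<beta> \<Longrightarrow> 0 < y \<Longrightarrow> y \<le> z
    \<Longrightarrow> (\<lambda>n. v (s n - y)) \<longlonglongrightarrow> \<beta>" using upper_limit_propagates by blast
  have "\<exists>t\<ge>real n. \<beta> - 1 / real (Suc n) < v t" for n by (rule \<beta>_lower) auto
  then obtain s where s: "\<And>n. real n \<le> s n" "\<And>n. \<beta> - 1 / real (Suc n) < v (s n)" by metis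
  have lim: "filterlim s at_top sequentially"
    using filterlim_real_sequentially by (rule filterlim_at_top_mono) (auto simp: s)
  have shift: "filterlim (\<lambda>n. s n - y) at_top sequentially" for y
    by (rule filterlim_minus_const_at_top[OF lim])
  have base: "(\<lambda>n. v (s n)) \<longlonglongrightarrow> \<beta>"
  proof (rule order_tendstoI)
    fix b assume "\<beta> < b"
    then have "\<forall>\<^sub>F t in at_top. v t \<le> \<beta> + (b - \<beta>) / 2" by (intro \<beta>_upper) auto
    then have "\<forall>\<^sub>F n in sequentially. v (s n) \<le> \<beta> + (b - \<beta>) / 2"
      using lim by (rule eventually_compose_filterlim)
    then show "\<forall>\<^sub>F n in sequentially. v (s n) < b"
      by eventually_elim (use \<open>\<beta> < b\<close> in \<open>simp add: field_simps\<close>)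
  next
    fix b assume "b < \<beta>"
    have "(\<lambda>n. \<beta> - 1 / real (Suc n)) \<longlonglongrightarrow> \<beta> - 0"
      using LIMSEQ_inverse_real_of_nat by (intro tendsto_diff tendsto_const) (simp add: inverse_eq_divide)
    then have "\<forall>\<^sub>F n in sequentially. b < \<beta> - 1 / real (Suc n)" using \<open>b < \<beta>\<close> by (intro order_tendstoD) auto
    then show "\<forall>\<^sub>F n in sequentially. b < v (s n)" by eventually_elim (use s(2) less_trans in blast)
  qed
  have earlier: "(\<lambda>n. v (s n - y)) \<longlonglongrightarrow> \<beta>" if y: "0 \<le> y" for y
  proof -
    obtain k :: nat where k: "y / z < real k" using reals_Archimedean2 by blast
    have "y < real k * z" using k z by (simp add: field_simps)
    have k0: "0 < k" using k y z by (cases k) (auto simp: field_simps not_less)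
    have "y \<noteq> 0 \<Longrightarrow> (\<lambda>n. v (s n - real j * (y / k))) \<longlonglongrightarrow> \<beta>" for j
    proof (induction j)
      case 0 then show ?case using base by simp
    next
      case (Suc j)
      have "(\<lambda>n. v ((s n - real j * (y / k)) - y / k)) \<longlonglongrightarrow> \<beta>"
        using \<open>y < real k * z\<close> y Suc k0 by (intro z shift Suc.IH) (auto simp: field_simps)
      then show ?case by (simp add: algebra_simps add_divide_distrib)
    qed
    from this[of k] show ?thesis using k0 base by (cases "y = 0") auto
  qed
  have "(\<lambda>n. \<integral>y. v (s n - y) * tail0 y \<partial>lborel) \<longlonglongrightarrow> (\<integral>y. \<beta> * tail0 y \<partial>lborel)"
  proof (rule integral_dominated_convergence[where w="\<lambda>y. B * tail0 y"])
    show "AE y in lborel. (\<lambda>n. v (s n - y) * tail0 y) \<longlonglongrightarrow> \<beta> * tail0 y"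
    proof (intro AE_I2)
      fix y :: real
      show "(\<lambda>n. v (s n - y) * tail0 y) \<longlonglongrightarrow> \<beta> * tail0 y"
        by (cases "0 \<le> y") (auto intro!: tendsto_mult_right earlier simp: tail0_def)
    qed
    show "AE y in lborel. norm (v (s n - y) * tail0 y) \<le> B * tail0 y" for n
      using B v_nonneg tail0_nonneg by (auto simp: abs_mult intro!: mult_right_mono)
  qed (auto intro: tail0_integrable)
  then have "(\<lambda>n. tail (s n) + (\<integral>y. v (s n - y) * tail0 y \<partial>lborel)) \<longlonglongrightarrow> 0 + (\<integral>y. \<beta> * tail0 y \<partial>lborel)"
    by (intro tendsto_add filterlim_compose[OF tail_tendsto_0 lim])
  moreover have "tail (s n) + (\<integral>y. v (s n - y) * tail0 y \<partial>lborel) = 1" for n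
    using s(1)[of n] by (intro age_identity) (meson of_nat_0_le_iff order_trans)
  ultimately have "(\<lambda>n::nat. 1) \<longlonglongrightarrow> \<beta> * \<mu>" by (simp add: integral_tail0 tail0_integrable)
  then show ?thesis by (simp add: LIMSEQ_const_iff)
qed

text \<open>The limit superior is identified, so only dips are to be excluded. By slow increase, a
  value well below \<beta> at \<open>t - s0\<close> keeps \<open>v\<close> low on all of
  \<open>[t - s0, t]\<close>, exactly where the weight \<open>tail0\<close> is bounded below; the
  age identity at a late \<open>t\<close> would then total less than one.\<close>

theorem renewal_density_limit: "(v \<longlongrightarrow> 1 / \<mu>) at_top"
proof -
  have \<mu>: "0 < \<mu>" using \<beta>_times_\<mu> \<mu>_nonneg by (cases "\<mu> = 0") auto
  have \<beta>: "\<beta> = 1 / \<mu>" using \<beta>_times_\<mu> \<mu> by (simp add: field_simps)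
  obtain z g0 where z: "0 < z" "0 < g0" "\<And>y. 0 \<le> y \<Longrightarrow> y \<le> z \<Longrightarrow> g0 \<le> g y"
    using g_pos_near_0 by metis
  obtain \<omega> where \<omega>: "\<And>t s. 0 \<le> t \<Longrightarrow> 0 \<le> s \<Longrightarrow> v (t + s) \<le> v t + \<omega> s"
    "\<And>s s'. 0 \<le> s \<Longrightarrow> s \<le> s' \<Longrightarrow> \<omega> s \<le> \<omega> s'" "(\<omega> \<longlongrightarrow> 0) (at_right 0)"
    using v_slowly_increasing by metis
  show ?thesis
  proof (rule order_tendstoI)
    fix b assume "1 / \<mu> < b"
    then have "\<forall>\<^sub>F t in at_top. v t \<le> \<beta> + (b - \<beta>) / 2" by (intro \<beta>_upper) (simp add: \<beta>)
    then show "\<forall>\<^sub>F t in at_top. v t < b"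
      by eventually_elim (use \<open>1 / \<mu> < b\<close> \<beta> in \<open>simp add: field_simps\<close>)
  next
    fix b assume b: "b < 1 / \<mu>"
    define \<eta> where "\<eta> = (\<beta> - b) / 2"
    have \<eta>: "0 < \<eta>" using b by (simp add: \<eta>_def \<beta>)
    have "\<forall>\<^sub>F s in at_right 0. \<omega> s < \<eta>" using \<omega>(3) \<eta> by (rule order_tendstoD)
    then obtain s1 where s1: "0 < s1" "\<And>s. 0 < s \<Longrightarrow> s < s1 \<Longrightarrow> \<omega> s < \<eta>"
      by (auto simp: eventually_at_right_field)
    define s0 where "s0 = min (z / 2) (s1 / 2)"
    have s0: "0 < s0" "s0 \<le> z / 2" "\<omega> s0 \<le> \<eta>"
      using s1 z less_imp_le[OF s1(2)[of s0]] by (auto simp: s0_def)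
    define q0 where "q0 = g0 * (z / 2)"
    have q0: "0 < q0" using z by (simp add: q0_def)
    have tail_lower: "q0 \<le> tail0 s" if "0 \<le> s" "s \<le> s0" for s
    proof -
      have "q0 = (\<integral>y. g0 * indicator {z/2<..z} y \<partial>lborel)" using z by (simp add: q0_def)
      also have "\<dots> \<le> tail s" unfolding tail_def
        by (intro integral_mono tail_integrable integrable_mult_right integrable_real_indicator)
          (use that s0 z in \<open>auto simp: g_nonneg split: split_indicator\<close>)
      finally show ?thesis using that by (simp add: tail0_def)
    qed
    define \<epsilon> where "\<epsilon> = \<eta> * q0 * s0 / 3"
    have \<epsilon>: "0 < \<epsilon>" using \<eta> q0 s0 by (simp add: \<epsilon>_def)
    have "\<forall>\<^sub>F t in at_top. tail t < \<epsilon>" using tail_tendsto_0 \<epsilon> by (rule order_tendstoD)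
    then have "\<forall>\<^sub>F t in at_top. \<beta> - 2 * \<eta> < v (t - s0)"
      using weighted_average_drop[OF measurable_tail0 tail0_integrable tail0_nonneg \<epsilon>]
        eventually_ge_at_top[of s0]
    proof eventually_elim
      case (elim t)
      show ?case
      proof (rule ccontr)
        assume "\<not> ?thesis"
        then have low: "v (t - s0) \<le> \<beta> - 2 * \<eta>" by simp
        have "q0 \<le> tail0 y \<and> v (t - y) \<le> \<beta> - \<eta>" if "y \<in> {0..s0}" for y
        proof
          show "q0 \<le> tail0 y" using that by (intro tail_lower) auto
          have "v (t - y) \<le> v (t - s0) + \<omega> (s0 - y)" using \<omega>(1)[of "t - s0" "s0 - y"] that elim by simp
          also have "\<omega> (s0 - y) \<le> \<omega> s0" using that by (intro \<omega>) auto
          finally show "v (t - y) \<le> \<beta> - \<eta>" using low s0 by simp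
        qed
        then have "(\<integral>y. v (t - y) * tail0 y \<partial>lborel) \<le> \<beta> * (\<integral>y. tail0 y \<partial>lborel) + \<epsilon> - \<eta> * q0 * (s0 - 0)"
          by (intro elim(2)[rule_format]) (use s0 \<eta> in auto)
        also have "\<eta> * q0 * (s0 - 0) = 3 * \<epsilon>" by (simp add: \<epsilon>_def)
        finally have "1 \<le> tail t + 1 - 2 * \<epsilon>"
          using age_identity[of t] elim s0 \<beta>_times_\<mu> by (simp add: integral_tail0)
        then show False using elim \<epsilon> by simp
      qed
    qed
    then obtain T where T: "\<And>t. T \<le> t \<Longrightarrow> \<beta> - 2 * \<eta> < v (t - s0)" by (auto simp: eventually_at_top_linorder)
    show "\<forall>\<^sub>F t in at_top. b < v t"
      using eventually_ge_at_top[of "T - s0"]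
    proof eventually_elim
      case (elim t)
      then show ?case using T[of "t + s0"] by (simp add: \<eta>_def field_simps)
    qed
  qed
qed

end


subsection \<open>The scale function\<close>

abbreviation exponential :: "real \<Rightarrow> real measure" where
  "exponential l \<equiv> density lborel (exponential_density l)"

text \<open>Fubini, and the fact that the exponential tail at \<open>e'\<close> is its density
  divided by \<open>l\<close>. In \<open>payoff_one_step\<close> this makes the payoff accumulated
  along the way cancel, in the mean, against a term at the end point.\<close>

lemma integral_exponential_partial:
  fixes p :: "real \<Rightarrow> real"
  assumes l: "0 < l" and [measurable]: "p \<in> borel_measurable borel" and p: "integrable lborel p"
    and p_neg: "\<And>e. e < 0 \<Longrightarrow> p e = 0"
  shows "integrable (exponential l) (\<lambda>e. \<integral>e'. p e' * indicator {..e} e' \<partial>lborel)"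
    and "(\<integral>e. (\<integral>e'. p e' * indicator {..e} e' \<partial>lborel) \<partial>exponential l) = (\<integral>e. p e \<partial>exponential l) / l"
proof -
  interpret X: prob_space "exponential l" by (rule prob_space_exponential_density[OF l])
  interpret XL: pair_sigma_finite "exponential l" lborel ..
  let ?f = "\<lambda>e e'. p e' * indicator {..e} e'"
  have m: "(\<lambda>(e, e'). ?f e e') \<in> borel_measurable (exponential l \<Otimes>\<^sub>M lborel)"
  proof -
    have "(\<lambda>(e, e'). ?f e e') = (\<lambda>(e, e'). if e' \<le> e then p e' else 0)"
      by (auto simp: fun_eq_iff split: split_indicator)
    also have "\<dots> \<in> borel_measurable (exponential l \<Otimes>\<^sub>M lborel)" by measurable
    finally show ?thesis .
  qed
  have i1: "integrable lborel (?f e)" for e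
    by (rule integrable_real_mult_indicator) (auto intro: p)
  have int: "integrable (exponential l \<Otimes>\<^sub>M lborel) (\<lambda>(e, e'). ?f e e')"
  proof (rule XL.Fubini_integrable[OF m])
    have nm: "(\<lambda>e. \<integral>e'. norm (?f e e') \<partial>lborel) \<in> borel_measurable (exponential l)"
    proof -
      have "(\<lambda>e. \<integral>e'. norm (?f e e') \<partial>lborel) = (\<lambda>e. \<integral>e'. (if e' \<le> e then \<bar>p e'\<bar> else 0) \<partial>lborel)"
        by (intro ext Bochner_Integration.integral_cong) (auto split: split_indicator)
      also have "\<dots> \<in> borel_measurable (exponential l)" by measurable
      finally show ?thesis .
    qed
    show "integrable (exponential l) (\<lambda>e. \<integral>e'. norm (case (e, e') of (e, e') \<Rightarrow> ?f e e') \<partial>lborel)"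
    proof (rule X.integrable_const_bound[where B="\<integral>e'. \<bar>p e'\<bar> \<partial>lborel"])
      show "AE e in exponential l. norm (\<integral>e'. norm (case (e, e') of (e, e') \<Rightarrow> ?f e e') \<partial>lborel) \<le> (\<integral>e'. \<bar>p e'\<bar> \<partial>lborel)"
      proof (intro AE_I2)
        fix e
        have "(\<integral>e'. norm (?f e e') \<partial>lborel) \<le> (\<integral>e'. \<bar>p e'\<bar> \<partial>lborel)"
          by (intro integral_mono integrable_norm i1 integrable_abs p) (auto split: split_indicator)
        then show "norm (\<integral>e'. norm (case (e, e') of (e, e') \<Rightarrow> ?f e e') \<partial>lborel) \<le> (\<integral>e'. \<bar>p e'\<bar> \<partial>lborel)"
          by (subst real_norm_def, subst abs_of_nonneg) (auto intro: integral_nonneg_AE)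
      qed
    qed (use nm in \<open>simp only: prod.case\<close>)
  qed (auto intro: i1)
  from XL.integrable_fst[OF int] show "integrable (exponential l) (\<lambda>e. \<integral>e'. ?f e e' \<partial>lborel)" by simp
  have "(\<integral>e. (\<integral>e'. ?f e e' \<partial>lborel) \<partial>exponential l) = (\<integral>e'. (\<integral>e. ?f e e' \<partial>exponential l) \<partial>lborel)"
    using XL.Fubini_integral[OF int] by simp
  also have "\<dots> = (\<integral>e'. p e' * (exponential_density l e' / l) \<partial>lborel)"
  proof (rule Bochner_Integration.integral_cong[OF refl])
    fix e'
    have "(\<integral>e. ?f e e' \<partial>exponential l) = p e' * X.prob {e'..}"
    proof -
      have "(\<integral>e. ?f e e' \<partial>exponential l) = (\<integral>e. p e' * indicator {e'..} e \<partial>exponential l)"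
        by (intro Bochner_Integration.integral_cong) (auto split: split_indicator)
      then show ?thesis by simp
    qed
    also have "\<dots> = p e' * (exponential_density l e' / l)"
    proof (cases "0 \<le> e'")
      case True
      have "emeasure (exponential l) {e'..} = (\<integral>\<^sup>+x. ennreal (l * exp (- x * l)) * indicator {e'..} x \<partial>lborel)"
        by (subst emeasure_density) (use True l in \<open>auto intro!: nn_integral_cong simp: exponential_density_def split: split_indicator\<close>)
      also have "\<dots> = ennreal (0 - (- exp (- e' * l)))"
      proof (rule nn_integral_FTC_atLeast)
        show "((\<lambda>x. - exp (- x * l)) \<longlongrightarrow> 0) at_top" using l by real_asymp
      qed (use l in \<open>auto intro!: derivative_eq_intros\<close>)
      finally have "X.prob {e'..} = exp (- e' * l)" by (simp add: measure_def)
      then show ?thesis using True l by (simp add: exponential_density_def)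
    qed (auto simp: p_neg)
    finally show "(\<integral>e. ?f e e' \<partial>exponential l) = p e' * (exponential_density l e' / l)" .
  qed
  also have "\<dots> = (\<integral>e. p e \<partial>exponential l) / l"
    using l by (subst integral_density) (auto simp: exponential_density_def mult.commute AE_I2)
  finally show "(\<integral>e. (\<integral>e'. ?f e e' \<partial>lborel) \<partial>exponential l) = (\<integral>e. p e \<partial>exponential l) / l" .
qed

text \<open>\<open>\<rho>\<close> is a nonnegative root of \<open>\<psi> s = s - \<lambda> + \<lambda> (LINT y|F. exp (- s y))\<close>, the Laplace exponent of the
  spectrally negative process dual to the netput; \<open>W\<close> is its scale function and \<open>u\<close> the derivative of \<open>W\<close>.
  Factoring \<open>\<psi> s = (s - \<rho>) (1 - \<integral> exp (- s x) g x dx)\<close> turns \<open>1 / \<psi>\<close> into the renewal series \<open>v\<close>.\<close>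

locale scale_function =
  fixes F :: "real measure" and l \<rho> :: real
  assumes F_prob: "prob_space F" and F_sets[measurable_cong, simp]: "sets F = sets borel"
    and F_pos: "AE y in F. 0 < y" and l_pos: "0 < l" and \<rho>_nonneg: "0 \<le> \<rho>"
    and \<rho>_root: "ennreal l * (\<integral>\<^sup>+y. ennreal (exp (- \<rho> * y)) \<partial>F) + ennreal \<rho> = ennreal l"
begin

sublocale F: prob_space F by (rule F_prob)

abbreviation "H \<equiv> (indicator {0..} :: real \<Rightarrow> ennreal)"

text \<open>The jump tail discounted at rate \<rho>. For \<open>\<rho> = 0\<close> it is
  \<open>l\<close> times the tail of \<open>F\<close>, of total mass \<open>l\<close> times the
  mean; for a positive root with finite mean it is a probability density.\<close>

definition g :: "real \<Rightarrow> ennreal" where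
  "g x = ennreal l * (\<integral>\<^sup>+y. ennreal (exp (\<rho> * (x - y))) * indicator {x<..} y \<partial>F) * H x"

text \<open>Has Laplace transform \<open>1 / (s - \<rho>)\<close>, the first factor of
  \<open>1 / \<psi>\<close>.\<close>

definition E :: "real \<Rightarrow> ennreal" where "E x = ennreal (exp (\<rho> * x)) * H x"

lemma measurable_g[measurable]: "g \<in> borel_measurable borel"
proof -
  have "g = (\<lambda>x. ennreal l * (\<integral>\<^sup>+y. (if x < y then ennreal (exp (\<rho> * (x - y))) else 0) \<partial>F) * H x)"
    unfolding g_def by (auto intro!: ext arg_cong2[where f="(*)"] nn_integral_cong split: split_indicator)
  also have "\<dots> \<in> borel_measurable borel" by measurable
  finally show ?thesis .
qed

lemma measurable_E[measurable]: "E \<in> borel_measurable borel"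
  unfolding E_def[abs_def] by measurable

lemma g_le: "g x \<le> ennreal l * H x"
proof -
  have "(\<integral>\<^sup>+y. ennreal (exp (\<rho> * (x - y))) * indicator {x<..} y \<partial>F) \<le> (\<integral>\<^sup>+y. 1 \<partial>F)"
  proof (intro nn_integral_mono)
    show "ennreal (exp (\<rho> * (x - y))) * indicator {x<..} y \<le> 1" for y
      using mult_nonneg_nonpos[of \<rho> "x - y"] \<rho>_nonneg by (auto split: split_indicator simp: ennreal_le_1)
  qed
  then have "(\<integral>\<^sup>+y. ennreal (exp (\<rho> * (x - y))) * indicator {x<..} y \<partial>F) \<le> 1" by (simp add: F.emeasure_space_1)
  then have "ennreal l * (\<integral>\<^sup>+y. ennreal (exp (\<rho> * (x - y))) * indicator {x<..} y \<partial>F) * H x \<le> ennreal l * 1 * H x"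
    by (intro mult_right_mono mult_left_mono) auto
  then show ?thesis unfolding g_def by simp
qed

definition v :: "real \<Rightarrow> ennreal" where
  "v = (SOME v. v \<in> borel_measurable borel \<and> (\<forall>x. v x = g x + conv g v x) \<and> (\<forall>x. v x \<le> ennreal (l * exp (l * x)) * H x))"

lemma measurable_v[measurable]: "v \<in> borel_measurable borel"
  and v_renewal: "v x = g x + conv g v x"
  and v_le: "v x \<le> ennreal (l * exp (l * x)) * H x"
proof -
  obtain w where "w \<in> borel_measurable borel" "\<And>x. w x = g x + conv g w x" "\<And>x. w x \<le> ennreal (l * exp (l * x)) * H x"
    using renewal_equation_solvable[OF measurable_g less_imp_le[OF l_pos] g_le] by blast
  then have "\<exists>v. v \<in> borel_measurable borel \<and> (\<forall>x. v x = g x + conv g v x) \<and> (\<forall>x. v x \<le> ennreal (l * exp (l * x)) * H x)"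
    by blast
  from someI_ex[OF this, folded v_def]
  show "v \<in> borel_measurable borel" "v x = g x + conv g v x" "v x \<le> ennreal (l * exp (l * x)) * H x" by auto
qed

text \<open>The measure with unit mass at 0 and density \<open>v\<close> has transform
  \<open>1 / (1 - g)\<close> in terms of the transform of \<open>g\<close>, so \<open>W\<close> has
  transform \<open>1 / \<psi>\<close>. As \<open>E\<close> has slope \<open>\<rho> E\<close> and
  jumps by 1 at 0, differentiating \<open>E + E * v\<close> gives \<open>\<rho> W + v\<close>, the
  definition of \<open>u\<close>.\<close>

definition W :: "real \<Rightarrow> ennreal" where "W x = E x + conv E v x"
definition u :: "real \<Rightarrow> ennreal" where "u x = ennreal \<rho> * W x + v x"

lemma measurable_W[measurable]: "W \<in> borel_measurable borel"
  and measurable_u[measurable]: "u \<in> borel_measurable borel"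
  unfolding W_def[abs_def] u_def[abs_def] by measurable

lemma measurable_mconv_F[measurable]: "f \<in> borel_measurable borel \<Longrightarrow> mconv F f \<in> borel_measurable borel"
  by (intro measurable_mconv F.sigma_finite_measure_axioms) auto

lemma mconv_F_conv:
  "f \<in> borel_measurable borel \<Longrightarrow> h \<in> borel_measurable borel \<Longrightarrow> mconv F (conv f h) x = conv (mconv F f) h x"
  by (intro mconv_conv F.sigma_finite_measure_axioms) auto

text \<open>The factorization of \<psi> before taking transforms: jumps \<open>y \<le> x\<close>
  contribute the convolution with \<open>E\<close>, jumps \<open>y > x\<close> contribute
  \<open>g\<close>, and together they give the complete integral in
  \<open>\<rho>_root\<close>.\<close>

lemma E_balance: "ennreal l * mconv F E x + g x + ennreal \<rho> * E x = ennreal l * E x"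
proof (cases "0 \<le> x")
  case True
  have "mconv F E x + (\<integral>\<^sup>+y. ennreal (exp (\<rho> * (x - y))) * indicator {x<..} y \<partial>F) = (\<integral>\<^sup>+y. ennreal (exp (\<rho> * (x - y))) \<partial>F)"
    unfolding mconv_def E_def
    by (subst nn_integral_add[symmetric]) (auto intro!: nn_integral_cong split: split_indicator)
  also have "\<dots> = (\<integral>\<^sup>+y. ennreal (exp (\<rho> * x)) * ennreal (exp (- \<rho> * y)) \<partial>F)"
    by (intro nn_integral_cong) (auto simp: ennreal_mult[symmetric] exp_add[symmetric] algebra_simps)
  also have "\<dots> = ennreal (exp (\<rho> * x)) * (\<integral>\<^sup>+y. ennreal (exp (- \<rho> * y)) \<partial>F)"
    by (intro nn_integral_cmult) measurable
  finally have *: "mconv F E x + (\<integral>\<^sup>+y. ennreal (exp (\<rho> * (x - y))) * indicator {x<..} y \<partial>F)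
      = ennreal (exp (\<rho> * x)) * (\<integral>\<^sup>+y. ennreal (exp (- \<rho> * y)) \<partial>F)" .
  have "ennreal l * mconv F E x + g x + ennreal \<rho> * E x
      = ennreal l * (mconv F E x + (\<integral>\<^sup>+y. ennreal (exp (\<rho> * (x - y))) * indicator {x<..} y \<partial>F)) + ennreal \<rho> * E x"
    using True by (simp add: g_def distrib_left)
  also have "\<dots> = ennreal (exp (\<rho> * x)) * (ennreal l * (\<integral>\<^sup>+y. ennreal (exp (- \<rho> * y)) \<partial>F) + ennreal \<rho>)"
    unfolding * using True by (simp add: E_def distrib_left ac_simps)
  also have "\<dots> = ennreal l * E x" unfolding \<rho>_root using True by (simp add: E_def mult.commute)
  finally show ?thesis .
next
  case False
  have "mconv F E x = (\<integral>\<^sup>+y. 0 \<partial>F)" unfolding mconv_def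
    by (intro nn_integral_cong_AE eventually_mono[OF F_pos]) (use False in \<open>auto simp: E_def\<close>)
  then show ?thesis using False by (simp add: g_def E_def)
qed

text \<open>In transforms this is \<open>\<psi> W = 1\<close>, that is,
  \<open>W' = l W - l (F * W)\<close>. The subtracted terms stand on the other side because the
  values are in \<open>ennreal\<close>. It follows from \<open>E_balance\<close> by convolving with
  \<open>v\<close> and adding the renewal equation.\<close>

lemma W_balance: "ennreal l * mconv F W x + u x = ennreal l * W x"
proof -
  let ?D = "\<lambda>x. ennreal l * mconv F E x + g x + ennreal \<rho> * E x"
  have "mconv F W x = mconv F E x + conv (mconv F E) v x"
    unfolding mconv_F_conv[OF measurable_E measurable_v, symmetric]
    unfolding mconv_def W_def[abs_def] by (intro nn_integral_add) auto
  then have "ennreal l * mconv F W x + u x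
    = (ennreal l * mconv F E x + g x + ennreal \<rho> * E x) +
      (ennreal l * conv (mconv F E) v x + conv g v x + ennreal \<rho> * conv E v x)"
    unfolding u_def W_def by (subst v_renewal) (simp add: distrib_left ac_simps)
  also have "ennreal l * conv (mconv F E) v x + conv g v x + ennreal \<rho> * conv E v x = conv ?D v x"
    by (simp add: conv_add_left conv_cmult_left)
  also have "\<dots> = conv (\<lambda>x. ennreal l * E x) v x" by (intro conv_cong E_balance refl)
  also have "\<dots> = ennreal l * conv E v x" by (intro conv_cmult_left) auto
  finally show ?thesis unfolding E_balance W_def by (simp add: distrib_left)
qed

lemma E_eq: "E x = H x + ennreal \<rho> * conv H E x"
proof (cases "0 \<le> x")
  case True
  have "ennreal \<rho> * conv H E x = (\<integral>\<^sup>+y. ennreal (\<rho> * exp (\<rho> * y)) * indicator {0..x} y \<partial>lborel)"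
    unfolding conv_def using \<rho>_nonneg
    by (subst nn_integral_cmult[symmetric]) (auto intro!: nn_integral_cong simp: E_def ennreal_mult split: split_indicator)
  also have "\<dots> = exp (\<rho> * x) - exp (\<rho> * 0)"
    by (intro nn_integral_FTC_Icc) (use True \<rho>_nonneg in \<open>auto intro!: derivative_eq_intros\<close>)
  finally have "ennreal 1 + ennreal \<rho> * conv H E x = ennreal 1 + ennreal (exp (\<rho> * x) - 1)" by simp
  also have "\<dots> = ennreal (exp (\<rho> * x))" using True \<rho>_nonneg by (subst ennreal_plus[symmetric]) auto
  finally show ?thesis using True by (simp add: E_def)
next
  case False
  have "conv H E x = (\<integral>\<^sup>+(y::real). 0 \<partial>lborel)" unfolding conv_def
    by (intro nn_integral_cong) (use False in \<open>auto simp: E_def split: split_indicator\<close>)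
  then show ?thesis using False by (simp add: E_def)
qed

text \<open>The integrated form of \<open>W' = u\<close> and \<open>W 0 = 1\<close>, obtained from
  the integral equation of \<open>E\<close>, so that \<open>W\<close> itself is never
  differentiated.\<close>

lemma W_eq: "W x = H x + conv H u x"
proof -
  have "conv H u x = ennreal \<rho> * (conv H E x + conv (conv H E) v x) + conv H v x"
    by (simp add: u_def[abs_def] W_def[abs_def] conv_add_right conv_cmult_right conv_assoc)
  also have "\<dots> = ennreal \<rho> * conv H E x + conv (\<lambda>x. H x + ennreal \<rho> * conv H E x) v x"
    by (simp add: conv_add_left conv_cmult_left distrib_left ac_simps)
  also have "conv (\<lambda>x. H x + ennreal \<rho> * conv H E x) v x = conv E v x" by (intro conv_cong E_eq[symmetric] refl)
  finally show ?thesis unfolding W_def by (subst E_eq) (simp add: add.assoc)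
qed

lemma W_neg: "x < 0 \<Longrightarrow> W x = 0"
proof -
  assume x: "x < 0"
  have "conv H u x = conv u H x" by (intro conv_commute) auto
  have v0: "v y = 0" if "y < 0" for y using v_le[of y] that by simp
  have "conv E v x = (\<integral>\<^sup>+(y::real). 0 \<partial>lborel)" unfolding conv_def
  proof (intro nn_integral_cong)
    show "E (x - y) * v y = 0" for y using x v0[of y] by (cases "y < 0") (auto simp: E_def)
  qed
  then show ?thesis using x by (simp add: W_def E_def)
qed

lemma v_neg: "x < 0 \<Longrightarrow> v x = 0" using v_le[of x] by simp

lemma u_neg: "x < 0 \<Longrightarrow> u x = 0" by (simp add: u_def W_neg v_neg)

lemma conv_H_mono: "x \<le> y \<Longrightarrow> conv H f x \<le> conv H f y"
  unfolding conv_def by (intro nn_integral_mono) (auto split: split_indicator)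

lemma W_mono: "x \<le> y \<Longrightarrow> W x \<le> W y"
  unfolding W_eq by (intro add_mono conv_H_mono) (auto split: split_indicator)

lemma W_finite: "W x < \<infinity>"
proof (cases "0 \<le> x")
  case True
  have "conv E v x \<le> (\<integral>\<^sup>+y. ennreal (exp (\<rho> * x) * (l * exp (l * x))) * indicator {0..x} y \<partial>lborel)"
    unfolding conv_def
  proof (intro nn_integral_mono)
    fix y
    show "E (x - y) * v y \<le> ennreal (exp (\<rho> * x) * (l * exp (l * x))) * indicator {0..x} y"
    proof (cases "y \<in> {0..x}")
      case True
      have "v y \<le> ennreal (l * exp (l * y))" using v_le[of y] True by simp
      also have "\<dots> \<le> ennreal (l * exp (l * x))" using True l_pos by (intro ennreal_leI) auto
      finally have "E (x - y) * v y \<le> ennreal (exp (\<rho> * x)) * ennreal (l * exp (l * x))"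
        using True \<rho>_nonneg by (intro mult_mono) (auto simp: E_def intro!: ennreal_leI mult_left_mono)
      then show ?thesis using True l_pos by (simp add: ennreal_mult)
    next
      case False
      then have "E (x - y) = 0 \<or> v y = 0" using v_le[of y] by (auto simp: E_def)
      then show ?thesis using False by auto
    qed
  qed
  also have "\<dots> < \<infinity>" using True by (simp add: nn_integral_cmult ennreal_mult_less_top)
  finally show ?thesis by (simp add: W_def E_def ennreal_mult_less_top split: split_indicator)
qed (simp add: W_neg)

lemma v_finite: "v x < \<infinity>"
  using v_le[of x] by (rule order.strict_trans1) (simp split: split_indicator)

lemma u_finite: "u x < \<infinity>"
  by (simp add: u_def ennreal_mult_less_top W_finite[simplified] v_finite[simplified])

definition Wr :: "real \<Rightarrow> real" where "Wr x = enn2real (W x)"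
definition ur :: "real \<Rightarrow> real" where "ur x = enn2real (u x)"
definition vr :: "real \<Rightarrow> real" where "vr x = enn2real (v x)"

lemma measurable_r[measurable]: "Wr \<in> borel_measurable borel" "ur \<in> borel_measurable borel" "vr \<in> borel_measurable borel"
  unfolding Wr_def[abs_def] ur_def[abs_def] vr_def[abs_def] by measurable

lemma r_nonneg: "0 \<le> Wr x" "0 \<le> ur x" "0 \<le> vr x" by (auto simp: Wr_def ur_def vr_def)

lemma ennreal_r: "ennreal (Wr x) = W x" "ennreal (ur x) = u x" "ennreal (vr x) = v x"
  using W_finite[of x] u_finite[of x] v_finite[of x] by (auto simp: Wr_def ur_def vr_def)

lemma r_neg: "x < 0 \<Longrightarrow> Wr x = 0" "x < 0 \<Longrightarrow> ur x = 0" "x < 0 \<Longrightarrow> vr x = 0"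
  by (auto simp: Wr_def ur_def vr_def W_neg u_neg v_neg)

lemma Wr_mono: "x \<le> y \<Longrightarrow> Wr x \<le> Wr y"
  unfolding Wr_def using W_finite[of y] by (intro enn2real_mono W_mono) auto

lemma ur_eq: "ur x = \<rho> * Wr x + vr x"
proof -
  have "ennreal (ur x) = ennreal (\<rho> * Wr x + vr x)"
    using \<rho>_nonneg r_nonneg by (simp add: ennreal_r ennreal_mult u_def)
  then show ?thesis using \<rho>_nonneg r_nonneg by (subst (asm) ennreal_inj) auto
qed

lemma ur_le: "x \<le> t \<Longrightarrow> ur x \<le> \<rho> * Wr t + l * exp (l * t)"
proof -
  assume x: "x \<le> t"
  have "ennreal (vr x) \<le> ennreal (l * exp (l * x))" unfolding ennreal_r
    by (rule order_trans[OF v_le]) (auto split: split_indicator)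
  then have "vr x \<le> l * exp (l * x)" using l_pos by (subst (asm) ennreal_le_iff) auto
  also have "\<dots> \<le> l * exp (l * t)" using x l_pos by simp
  finally show ?thesis unfolding ur_eq using x \<rho>_nonneg by (intro add_mono mult_left_mono Wr_mono) auto
qed


section \<open>Expected payoffs until overflow\<close>

lemma integral_H:
  assumes "integrable lborel (\<lambda>y. f y * indicator {..s} y)" "\<And>y::real. 0 \<le> f y"
  shows "conv H (\<lambda>y. ennreal (f y)) s = ennreal (\<integral>y. f y * indicator {..s} y \<partial>lborel)"
  unfolding conv_def
  by (subst nn_integral_eq_integral[symmetric])
     (use assms in \<open>auto intro!: nn_integral_cong split: split_indicator\<close>)

lemma locally_bounded_integrable:
  fixes f :: "real \<Rightarrow> real"
  assumes [measurable]: "f \<in> borel_measurable borel" and f: "\<And>x. x < 0 \<Longrightarrow> f x = 0" "\<And>x. x \<le> t \<Longrightarrow> \<bar>f x\<bar> \<le> B"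
  shows "integrable lborel (\<lambda>y. f y * indicator {..t} y)"
proof (rule Bochner_Integration.integrable_bound)
  have fin: "emeasure lborel {0..t} < \<infinity>" by (cases "0 \<le> t") auto
  show "integrable lborel (\<lambda>q. B * indicator {0..t} q)"
    using fin by (intro integrable_mult_right integrable_real_indicator) auto
  show "AE q in lborel. norm (f q * indicator {..t} q) \<le> norm (B * indicator {0..t} q)"
  proof (intro AE_I2)
    show "norm (f q * indicator {..t} q) \<le> norm (B * indicator {0..t} q)" for q
      using f(1)[of q] f(2)[of q] by (auto split: split_indicator simp: not_le)
  qed
qed measurable

lemma ur_locally_integrable: "integrable lborel (\<lambda>y. ur y * indicator {..t} y)"
  by (rule locally_bounded_integrable[where B="\<rho> * Wr t + l * exp (l * t)"]) (auto simp: r_neg r_nonneg ur_le)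

lemma Wr_integral: "0 \<le> s \<Longrightarrow> Wr s = 1 + (\<integral>y. ur y * indicator {..s} y \<partial>lborel)"
proof -
  assume s: "0 \<le> s"
  have n: "0 \<le> (\<integral>y. ur y * indicator {..s} y \<partial>lborel)" using r_nonneg by (intro integral_nonneg_AE) auto
  have "ennreal (Wr s) = ennreal 1 + conv H (\<lambda>y. ennreal (ur y)) s" using W_eq[of s] s by (simp add: ennreal_r)
  also have "\<dots> = ennreal (1 + (\<integral>y. ur y * indicator {..s} y \<partial>lborel))"
    using n by (subst integral_H) (auto intro: ur_locally_integrable simp: r_nonneg)
  finally show ?thesis using n r_nonneg by (subst (asm) ennreal_inj) auto
qed

text \<open>The expected payoff, started from workload \<open>y\<close>, when a jump from level \<open>x - q\<close> pays \<open>p q\<close>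
  up to and including the overflow of \<open>x\<close>.\<close>

definition payoff :: "(real \<Rightarrow> real) \<Rightarrow> real \<Rightarrow> real \<Rightarrow> real" where
  "payoff p x y = l * (p x + (\<integral>q. ur (x - q) * p q \<partial>lborel)) / ur x * Wr (x - y)
      - l * (\<integral>q. Wr (x - y - q) * p q \<partial>lborel)"

context
  fixes p :: "real \<Rightarrow> real" and K :: real
  assumes p_meas[measurable]: "p \<in> borel_measurable borel"
    and p_nonneg: "\<And>q. 0 \<le> p q" and p_le: "\<And>q. p q \<le> K" and p_neg: "\<And>q. q < 0 \<Longrightarrow> p q = 0"
begin

lemma K_nonneg: "0 \<le> K" using p_nonneg[of 0] p_le[of 0] by simp

abbreviation (input) "P \<equiv> (\<lambda>q. ennreal (p q))"

lemma convolution_bounded: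
  fixes f :: "real \<Rightarrow> real"
  assumes [measurable]: "f \<in> borel_measurable borel" and f: "\<And>x. 0 \<le> f x" "\<And>x. x < 0 \<Longrightarrow> f x = 0"
    and "\<And>x. x \<le> t \<Longrightarrow> f x \<le> B" "s \<le> t"
  shows "integrable lborel (\<lambda>q. f (s - q) * p q)"
    and "ennreal (\<integral>q. f (s - q) * p q \<partial>lborel) = conv (\<lambda>x. ennreal (f x)) P s"
    and "0 \<le> (\<integral>q. f (s - q) * p q \<partial>lborel)" "(\<integral>q. f (s - q) * p q \<partial>lborel) \<le> B * K * \<bar>t\<bar>"
proof -
  have B: "0 \<le> B" using f(1)[of t] assms(4)[of t] by simp
  have bd: "f (s - q) * p q \<le> B * K * indicator {0..t} q" for q
  proof (cases "q \<in> {0..t}")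
    case True
    then have "f (s - q) * p q \<le> B * K" using assms p_le p_nonneg B by (intro mult_mono) auto
    then show ?thesis using True by simp
  next
    case False
    then have "f (s - q) = 0 \<or> p q = 0" using f p_neg assms by (auto simp: not_le)
    then show ?thesis using False by auto
  qed
  have fin: "emeasure lborel {0..t} < \<infinity>" by (cases "0 \<le> t") auto
  show i: "integrable lborel (\<lambda>q. f (s - q) * p q)"
  proof (rule Bochner_Integration.integrable_bound)
    show "integrable lborel (\<lambda>q. B * K * indicator {0..t} q)"
      using fin by (intro integrable_mult_right integrable_real_indicator) auto
    show "AE q in lborel. norm (f (s - q) * p q) \<le> norm (B * K * indicator {0..t} q)"
      using bd f p_nonneg by (intro AE_I2) (metis abs_ge_self abs_of_nonneg mult_nonneg_nonneg order_trans real_norm_def)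
  qed measurable
  show "ennreal (\<integral>q. f (s - q) * p q \<partial>lborel) = conv (\<lambda>x. ennreal (f x)) P s"
    unfolding conv_def using i f p_nonneg
    by (subst nn_integral_eq_integral[symmetric]) (auto intro!: nn_integral_cong simp: ennreal_mult)
  show "0 \<le> (\<integral>q. f (s - q) * p q \<partial>lborel)" using f p_nonneg by (intro integral_nonneg_AE) auto
  have "(\<integral>q. f (s - q) * p q \<partial>lborel) \<le> (\<integral>q. B * K * indicator {0..t} q \<partial>lborel)"
    using fin bd i by (intro integral_mono integrable_mult_right integrable_real_indicator) auto
  also have "\<dots> \<le> B * K * \<bar>t\<bar>" using B K_nonneg by (cases "0 \<le> t") (auto intro: mult_nonneg_nonpos)
  finally show "(\<integral>q. f (s - q) * p q \<partial>lborel) \<le> B * K * \<bar>t\<bar>" .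
qed

text \<open>\<open>Ap\<close> is the convolution \<open>W * p\<close> and \<open>up\<close> is
  \<open>u * p\<close>. By associativity they inherit from \<open>W\<close> and \<open>u\<close>
  both the balance under the jump law and the integrated form of the derivative.\<close>

definition Ap :: "real \<Rightarrow> real" where "Ap s = (\<integral>q. Wr (s - q) * p q \<partial>lborel)"
definition up :: "real \<Rightarrow> real" where "up s = (\<integral>q. ur (s - q) * p q \<partial>lborel)"

lemma Ap_up_measurable[measurable]: "Ap \<in> borel_measurable borel" "up \<in> borel_measurable borel"
  unfolding Ap_def[abs_def] up_def[abs_def] by measurable

lemmas Ap_facts = convolution_bounded[of Wr, OF measurable_r(1) r_nonneg(1) r_neg(1) Wr_mono, folded Ap_def]
lemmas up_facts = convolution_bounded[of ur, OF measurable_r(2) r_nonneg(2) r_neg(2) ur_le, folded up_def]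

lemma ennreal_Ap: "ennreal (Ap s) = conv W P s"
  using Ap_facts(2)[of s s s] by (simp add: ennreal_r)

lemma ennreal_up: "ennreal (up s) = conv u P s"
  using up_facts(2)[of s s s] by (simp add: ennreal_r)

lemma Ap_nonneg: "0 \<le> Ap s" and up_nonneg: "0 \<le> up s"
  using Ap_facts(3)[of s s s] up_facts(3)[of s s s] by auto

lemma Ap_neg: "s < 0 \<Longrightarrow> Ap s = 0" and up_neg: "s < 0 \<Longrightarrow> up s = 0"
proof -
  assume s: "s < 0"
  have "(\<lambda>q. Wr (s - q) * p q) = (\<lambda>_. 0)" "(\<lambda>q. ur (s - q) * p q) = (\<lambda>_. 0)"
    using s p_neg r_neg(1,2) by (auto simp: fun_eq_iff) (metis diff_less_0_iff_less not_less order.strict_trans1)+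
  then show "Ap s = 0" "up s = 0" by (auto simp: Ap_def up_def)
qed

lemma Ap_balance: "ennreal l * mconv F (conv W P) s + conv u P s = ennreal l * conv W P s"
proof -
  have "ennreal l * mconv F (conv W P) s + conv u P s = conv (\<lambda>s. ennreal l * mconv F W s + u s) P s"
    by (simp add: mconv_F_conv conv_add_left conv_cmult_left)
  also have "\<dots> = conv (\<lambda>s. ennreal l * W s) P s" by (intro conv_cong W_balance refl)
  finally show ?thesis by (simp add: conv_cmult_left)
qed

lemma Ap_eq: "conv W P s = conv H P s + conv H (conv u P) s"
proof -
  have "conv W P s = conv (\<lambda>s. H s + conv H u s) P s" by (intro conv_cong W_eq refl)
  then show ?thesis by (simp add: conv_add_left conv_assoc)
qed

text \<open>Carries a balance from \<open>ennreal\<close> to real integrals; integrability is part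
  of the gain, as the balance bounds \<open>l\<close> times the integral by the finite right-hand
  side.\<close>

lemma integral_F_of_balance:
  fixes f h :: "real \<Rightarrow> real"
  assumes [measurable]: "f \<in> borel_measurable borel" and f: "\<And>x. 0 \<le> f x" and h: "\<And>x. 0 \<le> h x"
    and bal: "ennreal l * mconv F (\<lambda>s. ennreal (f s)) s + ennreal (h s) = ennreal l * ennreal (f s)"
  shows "integrable F (\<lambda>z. f (s - z))" and "(\<integral>z. f (s - z) \<partial>F) = f s - h s / l"
proof -
  have le: "ennreal l * mconv F (\<lambda>s. ennreal (f s)) s \<le> ennreal l * ennreal (f s)" unfolding bal[symmetric] by simp
  then have fin: "(\<integral>\<^sup>+z. ennreal (f (s - z)) \<partial>F) < \<infinity>"
    using l_pos by (auto simp: mconv_def ennreal_mult[symmetric] f less_top[symmetric] ennreal_mult_eq_top_iff top_unique)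
  show i: "integrable F (\<lambda>z. f (s - z))"
    using fin f by (intro integrableI_nonneg) auto
  have e: "mconv F (\<lambda>s. ennreal (f s)) s = ennreal (\<integral>z. f (s - z) \<partial>F)"
    unfolding mconv_def using i f by (intro nn_integral_eq_integral) auto
  have nn: "0 \<le> (\<integral>z. f (s - z) \<partial>F)" using f by (intro integral_nonneg_AE) auto
  have "ennreal (l * (\<integral>z. f (s - z) \<partial>F) + h s) = ennreal (l * f s)"
    using bal l_pos nn f h unfolding e by (simp add: ennreal_mult)
  then have "l * (\<integral>z. f (s - z) \<partial>F) + h s = l * f s"
    using l_pos nn f h by (subst (asm) ennreal_inj) auto
  then show "(\<integral>z. f (s - z) \<partial>F) = f s - h s / l" using l_pos by (simp add: field_simps)
qed

lemma F_integral_Wr: "integrable F (\<lambda>z. Wr (s - z))" "(\<integral>z. Wr (s - z) \<partial>F) = Wr s - ur s / l"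
  using integral_F_of_balance[of Wr ur s] W_balance[of s] r_nonneg by (simp_all add: ennreal_r)

lemma F_integral_Ap: "integrable F (\<lambda>z. Ap (s - z))" "(\<integral>z. Ap (s - z) \<partial>F) = Ap s - up s / l"
  using integral_F_of_balance[of Ap up s] Ap_balance[of s] Ap_nonneg up_nonneg
  by (simp_all add: ennreal_Ap ennreal_up)

lemma p_locally_integrable: "integrable lborel (\<lambda>y. p y * indicator {..t} y)"
  using p_le p_nonneg p_neg by (intro locally_bounded_integrable[where B=K]) auto

lemma up_locally_integrable: "integrable lborel (\<lambda>y. up y * indicator {..t} y)"
  by (rule locally_bounded_integrable[where B="(\<rho> * Wr t + l * exp (l * t)) * K * \<bar>t\<bar>"])
    (auto simp: up_neg up_nonneg up_facts)

lemma Ap_integral: "Ap s = (\<integral>y. p y * indicator {..s} y \<partial>lborel) + (\<integral>y. up y * indicator {..s} y \<partial>lborel)"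
proof -
  have n: "0 \<le> (\<integral>y. up y * indicator {..s} y \<partial>lborel)" "0 \<le> (\<integral>y. p y * indicator {..s} y \<partial>lborel)"
    using up_nonneg p_nonneg by (auto intro!: integral_nonneg_AE)
  have "ennreal (Ap s) = conv H P s + conv H (\<lambda>s. ennreal (up s)) s"
    by (simp add: ennreal_Ap ennreal_up Ap_eq)
  also have "\<dots> = ennreal ((\<integral>y. p y * indicator {..s} y \<partial>lborel) + (\<integral>y. up y * indicator {..s} y \<partial>lborel))"
    using n by (subst (1 2) integral_H) (auto intro: up_locally_integrable p_locally_integrable simp: p_nonneg up_nonneg)
  finally show ?thesis using n Ap_nonneg by (subst (asm) ennreal_inj) auto
qed

lemma payoff_eq: "payoff p x y = l * (p x + up x) / ur x * Wr (x - y) - l * Ap (x - y)"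
  unfolding payoff_def up_def Ap_def ..

lemma measurable_payoff: "payoff p x \<in> borel_measurable borel"
  unfolding payoff_eq[abs_def] by measurable

lemma payoff_above: "x < y \<Longrightarrow> payoff p x y = 0"
  by (simp add: payoff_eq r_neg Ap_neg)

lemma payoff_bounded:
  assumes "0 < ur x"
  obtains B where "\<And>y. 0 \<le> y \<Longrightarrow> \<bar>payoff p x y\<bar> \<le> B"
proof (rule that)
  let ?C = "l * (p x + up x) / ur x"
  have C: "0 \<le> ?C" using l_pos p_nonneg up_nonneg assms by simp
  fix y :: real assume "0 \<le> y"
  then have "Ap (x - y) \<le> Wr x * K * \<bar>x\<bar>" by (intro Ap_facts) auto
  then have 1: "l * Ap (x - y) \<le> l * (Wr x * K * \<bar>x\<bar>)" using l_pos by simp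
  have 2: "?C * Wr (x - y) \<le> ?C * Wr x" using C \<open>0 \<le> y\<close> by (intro mult_left_mono Wr_mono) auto
  have 3: "0 \<le> l * Ap (x - y)" "0 \<le> ?C * Wr (x - y)"
    using l_pos Ap_nonneg mult_nonneg_nonneg[OF C r_nonneg(1)] by auto
  from 1 2 3 show "\<bar>payoff p x y\<bar> \<le> ?C * Wr x + l * (Wr x * K * \<bar>x\<bar>)" unfolding payoff_eq by linarith
qed

text \<open>As a function of \<open>x - y\<close> the payoff is a constant plus the integral of
  \<open>k\<close>, because \<open>W\<close> and \<open>W * p\<close> are integrals of their
  derivatives. The balances under \<open>F\<close> show that paying and jumping from level
  \<open>w\<close> returns the payoff at \<open>w\<close> minus \<open>k (x - w) / l\<close>.
  Draining from \<open>y\<close> to \<open>w\<close> adds an integral of \<open>k\<close>, and the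
  exponential average of that integral is the average of \<open>k (x - w) / l\<close>.\<close>

lemma payoff_one_step:
  assumes ux: "0 < ur x" and y: "0 \<le> y" "y \<le> x"
  shows "payoff p x y = (\<integral>e. p (x - max (y - e) 0) + (\<integral>z. payoff p x (max (y - e) 0 + z) \<partial>F) \<partial>exponential l)"
proof -
  \<comment> \<open>The jump balance holds for every multiple \<open>C\<close> of \<open>W\<close>.
    This \<open>C\<close> makes \<open>k x = 0\<close>, that is, the payoff has zero slope at the
    reflecting level 0.\<close>
  define C where "C = l * (p x + up x) / ur x"
  define k where "k s = C * ur s - l * p s - l * up s" for s
  have [measurable]: "k \<in> borel_measurable borel" unfolding k_def[abs_def] by measurable
  have kx: "k x = 0" using ux by (simp add: k_def C_def field_simps)
  have k_int: "integrable lborel (\<lambda>s. k s * indicator {..t} s)" for t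
  proof -
    have "integrable lborel (\<lambda>s. C * (ur s * indicator {..t} s) - l * (p s * indicator {..t} s) - l * (up s * indicator {..t} s))"
      by (intro Bochner_Integration.integrable_diff integrable_mult_right ur_locally_integrable p_locally_integrable up_locally_integrable)
    then show ?thesis by (simp add: k_def algebra_simps)
  qed
  have pay: "payoff p x y = C + (\<integral>s. k s * indicator {..x - y} s \<partial>lborel)" if "y \<le> x" for y
  proof -
    have "(\<integral>s. k s * indicator {..x - y} s \<partial>lborel) = (\<integral>s. C * (ur s * indicator {..x - y} s) - l * (p s * indicator {..x - y} s) - l * (up s * indicator {..x - y} s) \<partial>lborel)"
      by (simp add: k_def algebra_simps)
    also have "\<dots> = C * (\<integral>s. ur s * indicator {..x - y} s \<partial>lborel) - l * (\<integral>s. p s * indicator {..x - y} s \<partial>lborel)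
        - l * (\<integral>s. up s * indicator {..x - y} s \<partial>lborel)"
      by (simp add: ur_locally_integrable p_locally_integrable up_locally_integrable)
    also have "\<dots> = C * (Wr (x - y) - 1) - l * Ap (x - y)"
      using that by (simp add: Wr_integral Ap_integral algebra_simps)
    finally show ?thesis unfolding payoff_eq C_def[symmetric] by (simp add: algebra_simps)
  qed
  have J: "p (x - w) + (\<integral>z. payoff p x (w + z) \<partial>F) = payoff p x w - k (x - w) / l" for w
  proof -
    have "(\<integral>z. payoff p x (w + z) \<partial>F) = (\<integral>z. C * Wr (x - w - z) - l * Ap (x - w - z) \<partial>F)"
      by (simp add: payoff_eq C_def diff_diff_eq)
    also have "\<dots> = C * (Wr (x - w) - ur (x - w) / l) - l * (Ap (x - w) - up (x - w) / l)"
      by (simp add: F_integral_Wr F_integral_Ap)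
    finally have int: "(\<integral>z. payoff p x (w + z) \<partial>F) = C * (Wr (x - w) - ur (x - w) / l) - l * (Ap (x - w) - up (x - w) / l)" .
    show ?thesis unfolding int unfolding payoff_eq C_def[symmetric] k_def
      using l_pos by (simp add: field_simps)
  qed
  \<comment> \<open>\<open>k\<close> read along the draining path as a function of elapsed time, cut
    off when the queue is empty.\<close>
  define r where "r e = k (x - y + e) * indicator {0..y} e" for e
  have [measurable]: "r \<in> borel_measurable borel" unfolding r_def[abs_def] by measurable
  have r_int: "integrable lborel r"
  proof -
    have "integrable lborel (\<lambda>s. k s * indicator {..x} s * indicator {x-y..} s)"
      by (rule integrable_real_mult_indicator) (auto intro: k_int)
    then have "integrable lborel (\<lambda>e. k (x - y + 1 * e) * indicator {..x} (x - y + 1 * e) * indicator {x-y..} (x - y + 1 * e))"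
      by (rule lborel_integrable_real_affine) simp
    moreover have "(\<lambda>e. k (x - y + 1 * e) * indicator {..x} (x - y + 1 * e) * indicator {x-y..} (x - y + 1 * e)) = r"
      by (auto simp: r_def split: split_indicator)
    ultimately show ?thesis by simp
  qed
  have step: "p (x - max (y - e) 0) + (\<integral>z. payoff p x (max (y - e) 0 + z) \<partial>F)
     = payoff p x y + (\<integral>e'. r e' * indicator {..e} e' \<partial>lborel) - r e / l" if e: "0 \<le> e" for e
  proof -
    let ?w = "max (y - e) 0"
    have "payoff p x ?w - payoff p x y = (\<integral>s. k s * indicator {..x - ?w} s \<partial>lborel) - (\<integral>s. k s * indicator {..x - y} s \<partial>lborel)"
      using y e by (simp add: pay)
    also have "\<dots> = (\<integral>s. k s * indicator {..x - ?w} s - k s * indicator {..x - y} s \<partial>lborel)"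
      by (intro Bochner_Integration.integral_diff[symmetric] k_int)
    also have "\<dots> = (\<integral>s. k s * indicator {x - y<..x - ?w} s \<partial>lborel)"
      using y e by (intro Bochner_Integration.integral_cong) (auto split: split_indicator)
    also have "\<dots> = (\<integral>s. k (x - y + s) * indicator {x - y<..x - ?w} (x - y + s) \<partial>lborel)"
      using lborel_integral_real_affine[where c=1 and t="x - y" and f="\<lambda>s. k s * indicator {x - y<..x - ?w} s"] by simp
    also have "\<dots> = (\<integral>e'. r e' * indicator {..e} e' \<partial>lborel)"
      using y e by (intro integral_cong_AE) (auto intro!: eventually_mono[OF AE_lborel_singleton[of 0]] simp: r_def split: split_indicator)
    finally have "payoff p x ?w = payoff p x y + (\<integral>e'. r e' * indicator {..e} e' \<partial>lborel)" by simp
    \<comment> \<open>After the queue has emptied the level stays 0, and \<open>k x = 0\<close>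
      agrees with the cut-off in \<open>r\<close>. Here the choice of \<open>C\<close>
      enters.\<close>
    moreover have "k (x - ?w) = r e"
    proof (cases "e < y")
      case True
      then have "x - ?w = x - y + e" by simp
      then have "k (x - ?w) = k (x - y + e)" by (simp only:)
      then show ?thesis using True e by (simp only: r_def) simp
    next
      case False
      then show ?thesis using y e kx by (auto simp: r_def split: split_indicator)
    qed
    ultimately show ?thesis unfolding J by simp
  qed
  have r0: "r e = 0" if "e < 0" for e using that by (simp add: r_def)
  interpret X: prob_space "exponential l" by (rule prob_space_exponential_density[OF l_pos])
  have r_exp: "integrable (exponential l) r"
  proof -
    have "integrable lborel (\<lambda>e. exponential_density l e * r e)"
      by (rule Bochner_Integration.integrable_bound[where f="\<lambda>e. l * r e"])
         (use r_int l_pos in \<open>auto simp: exponential_density_def abs_mult r0 intro!: AE_I2 mult_left_le_one_le\<close>)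
    then show ?thesis using l_pos by (subst integrable_density) (auto simp: exponential_density_nonneg)
  qed
  have "(\<integral>e. p (x - max (y - e) 0) + (\<integral>z. payoff p x (max (y - e) 0 + z) \<partial>F) \<partial>exponential l)
    = (\<integral>e. payoff p x y + (\<integral>e'. r e' * indicator {..e} e' \<partial>lborel) - r e / l \<partial>exponential l)"
  proof (rule integral_cong_AE)
    show "AE e in exponential l. p (x - max (y - e) 0) + (\<integral>z. payoff p x (max (y - e) 0 + z) \<partial>F)
       = payoff p x y + (\<integral>e'. r e' * indicator {..e} e' \<partial>lborel) - r e / l"
      by (subst AE_density) (auto intro!: AE_I2 step simp: exponential_density_def split: if_splits)
    show "(\<lambda>e. p (x - max (y - e) 0) + (\<integral>z. payoff p x (max (y - e) 0 + z) \<partial>F)) \<in> borel_measurable (exponential l)"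
      using measurable_payoff by measurable
    show "(\<lambda>e. payoff p x y + (\<integral>e'. r e' * indicator {..e} e' \<partial>lborel) - r e / l) \<in> borel_measurable (exponential l)"
      using integral_exponential_partial(1)[OF l_pos _ r_int r0] r_exp
      by (intro borel_measurable_diff borel_measurable_add borel_measurable_divide) auto
  qed
  also have "\<dots> = payoff p x y"
    using integral_exponential_partial[OF l_pos _ r_int r0] r_exp X.prob_space by simp
  finally show ?thesis ..
qed

end

end


subsection \<open>Asymptotics of the scale function\<close>

context scale_function
begin

definition gr :: "real \<Rightarrow> real" where "gr x = enn2real (g x)"

lemma measurable_gr[measurable]: "gr \<in> borel_measurable borel"
  unfolding gr_def[abs_def] by measurable

lemma ennreal_gr: "ennreal (gr x) = g x"
proof -
  have "ennreal l * H x < \<infinity>" by (simp split: split_indicator)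
  with g_le[of x] have "g x < \<infinity>" by (rule order.strict_trans1)
  then show ?thesis by (simp add: gr_def)
qed

lemma gr_nonneg: "0 \<le> gr x" by (simp add: gr_def)

lemma gr_neg: "x < 0 \<Longrightarrow> gr x = 0" by (simp add: gr_def g_def)

text \<open>Tonelli. Mass and mean of \<open>g\<close>, tilted or not, become integrals over
  \<open>F\<close> of elementary integrals in \<open>x\<close>.\<close>

lemma nn_integral_g_mult:
  assumes [measurable]: "\<phi> \<in> borel_measurable borel"
  shows "(\<integral>\<^sup>+x. \<phi> x * g x \<partial>lborel) = ennreal l * (\<integral>\<^sup>+y. (\<integral>\<^sup>+x. \<phi> x * ennreal (exp (\<rho> * (x - y))) * indicator {0..<y} x \<partial>lborel) \<partial>F)"
proof -
  interpret FL: pair_sigma_finite F lborel ..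
  have "(\<integral>\<^sup>+x. \<phi> x * g x \<partial>lborel) = (\<integral>\<^sup>+x. ennreal l * (\<integral>\<^sup>+y. (if 0 \<le> x \<and> x < y then \<phi> x * ennreal (exp (\<rho> * (x - y))) else 0) \<partial>F) \<partial>lborel)"
  proof (rule nn_integral_cong)
    fix x :: real
    have "(\<integral>\<^sup>+y. (if 0 \<le> x \<and> x < y then \<phi> x * ennreal (exp (\<rho> * (x - y))) else 0) \<partial>F)
      = (\<integral>\<^sup>+y. \<phi> x * H x * (ennreal (exp (\<rho> * (x - y))) * indicator {x<..} y) \<partial>F)"
      by (intro nn_integral_cong) (auto split: split_indicator)
    also have "\<dots> = \<phi> x * H x * (\<integral>\<^sup>+y. ennreal (exp (\<rho> * (x - y))) * indicator {x<..} y \<partial>F)"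
      by (intro nn_integral_cmult) measurable
    finally show "\<phi> x * g x = ennreal l * (\<integral>\<^sup>+y. (if 0 \<le> x \<and> x < y then \<phi> x * ennreal (exp (\<rho> * (x - y))) else 0) \<partial>F)"
      by (simp add: g_def ac_simps)
  qed
  also have "\<dots> = ennreal l * (\<integral>\<^sup>+x. (\<integral>\<^sup>+y. (if 0 \<le> x \<and> x < y then \<phi> x * ennreal (exp (\<rho> * (x - y))) else 0) \<partial>F) \<partial>lborel)"
    by (intro nn_integral_cmult) measurable
  also have "(\<integral>\<^sup>+x. (\<integral>\<^sup>+y. (if 0 \<le> x \<and> x < y then \<phi> x * ennreal (exp (\<rho> * (x - y))) else 0) \<partial>F) \<partial>lborel)
      = (\<integral>\<^sup>+y. (\<integral>\<^sup>+x. (if 0 \<le> x \<and> x < y then \<phi> x * ennreal (exp (\<rho> * (x - y))) else 0) \<partial>lborel) \<partial>F)"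
    by (intro FL.Fubini') measurable
  also have "\<dots> = (\<integral>\<^sup>+y. (\<integral>\<^sup>+x. \<phi> x * ennreal (exp (\<rho> * (x - y))) * indicator {0..<y} x \<partial>lborel) \<partial>F)"
    by (intro nn_integral_cong) (auto split: split_indicator)
  finally show ?thesis .
qed

text \<open>Multiplication by \<open>exp (\<theta> * x)\<close> commutes with convolution, so the
  renewal equation survives, and it only adds \<theta> to the growth rate. The positive drift case
  takes \<open>\<theta> = 0\<close>; in the Cramer case \<open>g\<close> has mass below one and
  \<open>\<theta> = \<gamma>\<close> restores mass one.\<close>

lemma exponentially_tilted_renewal:
  assumes \<theta>: "0 \<le> \<theta>"
    and prob: "(\<integral>\<^sup>+x. ennreal (exp (\<theta> * x)) * g x \<partial>lborel) = 1"
    and mean: "(\<integral>\<^sup>+x. ennreal (x * exp (\<theta> * x)) * g x \<partial>lborel) < \<infinity>"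
  shows "renewal_density (\<lambda>x. exp (\<theta> * x) * gr x) (\<lambda>x. exp (\<theta> * x) * vr x) (\<rho> + \<theta>)"
proof
  show "(\<lambda>x. exp (\<theta> * x) * gr x) \<in> borel_measurable borel" "(\<lambda>x. exp (\<theta> * x) * vr x) \<in> borel_measurable borel"
    by measurable
  show "0 \<le> exp (\<theta> * x) * gr x" "0 \<le> exp (\<theta> * x) * vr x" for x by (auto simp: gr_nonneg r_nonneg)
  show "x < 0 \<Longrightarrow> exp (\<theta> * x) * gr x = 0" "x < 0 \<Longrightarrow> exp (\<theta> * x) * vr x = 0" for x by (auto simp: gr_neg r_neg)
  show "0 \<le> \<rho> + \<theta>" using \<theta> \<rho>_nonneg by simp
  show "exp (\<theta> * (x + s)) * gr (x + s) \<le> exp ((\<rho> + \<theta>) * s) * (exp (\<theta> * x) * gr x)" if "0 \<le> x" "0 \<le> s" for x s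
  proof -
    have "g (x + s) \<le> ennreal l * (\<integral>\<^sup>+y. ennreal (exp (\<rho> * s)) * (ennreal (exp (\<rho> * (x - y))) * indicator {x<..} y) \<partial>F)"
      unfolding g_def using that
      by (simp, intro mult_left_mono nn_integral_mono)
         (auto simp: ennreal_mult[symmetric] exp_add[symmetric] algebra_simps split: split_indicator)
    also have "\<dots> = ennreal (exp (\<rho> * s)) * g x"
      unfolding g_def using that by (subst nn_integral_cmult) (auto simp: ac_simps)
    finally have "gr (x + s) \<le> exp (\<rho> * s) * gr x"
      by (simp add: ennreal_gr[symmetric] ennreal_mult[symmetric] gr_nonneg)
    then have "exp (\<theta> * (x + s)) * gr (x + s) \<le> exp (\<theta> * (x + s)) * (exp (\<rho> * s) * gr x)" by simp
    also have "\<dots> = exp ((\<rho> + \<theta>) * s) * (exp (\<theta> * x) * gr x)" by (simp add: algebra_simps exp_add)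
    finally show ?thesis .
  qed
  show "(\<integral>\<^sup>+x. ennreal (exp (\<theta> * x) * gr x) \<partial>lborel) = 1"
    using prob by (simp add: ennreal_mult gr_nonneg ennreal_gr)
  show "integrable lborel (\<lambda>x. x * (exp (\<theta> * x) * gr x))"
  proof (rule integrableI_nonneg)
    show "AE x in lborel. 0 \<le> x * (exp (\<theta> * x) * gr x)"
    proof (intro AE_I2)
      show "0 \<le> x * (exp (\<theta> * x) * gr x)" for x by (cases "x < 0") (auto simp: gr_neg gr_nonneg)
    qed
    have "(\<integral>\<^sup>+x. ennreal (x * (exp (\<theta> * x) * gr x)) \<partial>lborel) = (\<integral>\<^sup>+x. ennreal (x * exp (\<theta> * x)) * g x \<partial>lborel)"
    proof (rule nn_integral_cong)
      show "ennreal (x * (exp (\<theta> * x) * gr x)) = ennreal (x * exp (\<theta> * x)) * g x" for x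
      proof (cases "x < 0")
        case False
        then have "ennreal (x * exp (\<theta> * x) * gr x) = ennreal (x * exp (\<theta> * x)) * ennreal (gr x)"
          by (intro ennreal_mult) (auto simp: gr_nonneg)
        then show ?thesis by (simp add: ennreal_gr mult.assoc)
      qed (auto simp: gr_neg g_def)
    qed
    then show "(\<integral>\<^sup>+x. ennreal (x * (exp (\<theta> * x) * gr x)) \<partial>lborel) < \<infinity>" using mean by simp
  qed measurable
  show "ennreal (exp (\<theta> * x) * vr x) = ennreal (exp (\<theta> * x) * gr x) +
         conv (\<lambda>x. ennreal (exp (\<theta> * x) * gr x)) (\<lambda>x. ennreal (exp (\<theta> * x) * vr x)) x" for x
  proof -
    have "conv (\<lambda>x. ennreal (exp (\<theta> * x) * gr x)) (\<lambda>x. ennreal (exp (\<theta> * x) * vr x)) x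
      = (\<integral>\<^sup>+y. ennreal (exp (\<theta> * x)) * (g (x - y) * v y) \<partial>lborel)"
      unfolding conv_def
    proof (rule nn_integral_cong)
      fix y
      have "exp (\<theta> * (x - y)) * gr (x - y) * (exp (\<theta> * y) * vr y) = exp (\<theta> * x) * (gr (x - y) * vr y)"
        by (simp add: algebra_simps exp_diff)
      then show "ennreal (exp (\<theta> * (x - y)) * gr (x - y)) * ennreal (exp (\<theta> * y) * vr y) = ennreal (exp (\<theta> * x)) * (g (x - y) * v y)"
        by (simp add: ennreal_gr[symmetric] ennreal_r[symmetric] ennreal_mult[symmetric] gr_nonneg r_nonneg)
    qed
    also have "\<dots> = ennreal (exp (\<theta> * x)) * conv g v x" unfolding conv_def by (intro nn_integral_cmult) measurable
    finally have c: "conv (\<lambda>x. ennreal (exp (\<theta> * x) * gr x)) (\<lambda>x. ennreal (exp (\<theta> * x) * vr x)) x = ennreal (exp (\<theta> * x)) * conv g v x" .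
    have "ennreal (exp (\<theta> * x) * vr x) = ennreal (exp (\<theta> * x)) * v x" by (simp add: ennreal_mult r_nonneg ennreal_r)
    also have "\<dots> = ennreal (exp (\<theta> * x)) * g x + ennreal (exp (\<theta> * x)) * conv g v x"
      by (subst v_renewal) (simp add: distrib_left)
    finally show ?thesis unfolding c by (simp add: ennreal_mult gr_nonneg ennreal_gr)
  qed
  show "(\<integral>\<^sup>+x. ennreal (exp (\<theta> * x) * vr x) * indicator {..t} x \<partial>lborel) < \<infinity>" for t
  proof -
    have "(\<integral>\<^sup>+x. ennreal (exp (\<theta> * x) * vr x) * indicator {..t} x \<partial>lborel) \<le> (\<integral>\<^sup>+x. ennreal (exp (\<theta> * t) * (l * exp (l * t))) * indicator {0..t} x \<partial>lborel)"
    proof (rule nn_integral_mono)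
      fix x
      show "ennreal (exp (\<theta> * x) * vr x) * indicator {..t} x \<le> ennreal (exp (\<theta> * t) * (l * exp (l * t))) * indicator {0..t} x"
      proof (cases "x \<in> {0..t}")
        case True
        have "ennreal (vr x) \<le> ennreal (l * exp (l * x))" unfolding ennreal_r using v_le[of x] True by simp
        then have "vr x \<le> l * exp (l * x)" using l_pos by (subst (asm) ennreal_le_iff) auto
        also have "\<dots> \<le> l * exp (l * t)" using True l_pos by simp
        finally have "exp (\<theta> * x) * vr x \<le> exp (\<theta> * t) * (l * exp (l * t))"
          using True \<theta> r_nonneg by (intro mult_mono) (auto intro: mult_left_mono)
        then show ?thesis using True by (simp add: ennreal_leI)
      qed (auto simp: r_neg split: split_indicator)
    qed
    also have "\<dots> < \<infinity>" by (cases "0 \<le> t") (auto simp: nn_integral_cmult ennreal_mult_less_top)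
    finally show ?thesis .
  qed
qed

text \<open>The bracket is the intensity, up to the factor \<open>l\<close>, of jumps starting at
  distance \<open>q\<close> below \<open>x\<close>, so both cases reduce to its pointwise limit and
  a dominating function. The term with \<open>p x\<close> belongs to jumps out of the empty queue,
  where \<open>q = x\<close>; it lies outside the integral and has to vanish by itself.\<close>

lemma payoff_tendsto:
  fixes p b e :: "real \<Rightarrow> real"
  assumes [measurable]: "p \<in> borel_measurable borel" and p: "\<And>q. 0 \<le> p q" "\<And>q. p q \<le> K" "\<And>q. q < 0 \<Longrightarrow> p q = 0"
    and y: "0 \<le> y"
    and pos: "\<forall>\<^sub>F x in at_top. 0 < ur x"
    and lim: "\<And>q. 0 \<le> q \<Longrightarrow> ((\<lambda>x. Wr (x - y) * ur (x - q) / ur x - Wr (x - y - q)) \<longlongrightarrow> b q) at_top"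
    and dom: "\<forall>\<^sub>F x in at_top. \<forall>q. 0 \<le> q \<longrightarrow> q \<le> x \<longrightarrow> \<bar>Wr (x - y) * ur (x - q) / ur x - Wr (x - y - q)\<bar> \<le> D * e q"
    and e: "\<And>q. 0 \<le> e q" "0 \<le> D" "integrable lborel (\<lambda>q. e q * p q)"
    and [measurable]: "b \<in> borel_measurable borel"
    and zero: "((\<lambda>x. p x * Wr (x - y) / ur x) \<longlongrightarrow> 0) at_top"
  shows "((\<lambda>x. payoff p x y) \<longlongrightarrow> l * (\<integral>q. b q * p q \<partial>lborel)) at_top"
proof -
  note cu = convolution_bounded(1)[of p K ur, OF assms(1) p measurable_r(2) r_nonneg(2) r_neg(2) ur_le order_refl]
  note cW = convolution_bounded(1)[of p K Wr, OF assms(1) p measurable_r(1) r_nonneg(1) r_neg(1) Wr_mono order_refl]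
  let ?B = "\<lambda>x q. Wr (x - y) * ur (x - q) / ur x - Wr (x - y - q)"
  have eq: "payoff p x y = l * (p x * Wr (x - y) / ur x) + l * (\<integral>q. ?B x q * p q \<partial>lborel)" for x
  proof -
    have "(\<integral>q. ?B x q * p q \<partial>lborel) = (\<integral>q. (Wr (x - y) / ur x) * (ur (x - q) * p q) - Wr (x - y - q) * p q \<partial>lborel)"
      by (simp add: algebra_simps)
    also have "\<dots> = (Wr (x - y) / ur x) * (\<integral>q. ur (x - q) * p q \<partial>lborel) - (\<integral>q. Wr (x - y - q) * p q \<partial>lborel)"
      by (simp add: cu cW)
    finally have I: "(\<integral>q. ?B x q * p q \<partial>lborel) = (Wr (x - y) / ur x) * (\<integral>q. ur (x - q) * p q \<partial>lborel) - (\<integral>q. Wr (x - y - q) * p q \<partial>lborel)" .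
    show ?thesis unfolding payoff_def I by (simp add: algebra_simps add_divide_distrib)
  qed
  have "((\<lambda>x. \<integral>q. ?B x q * p q \<partial>lborel) \<longlongrightarrow> (\<integral>q. b q * p q \<partial>lborel)) at_top"
  proof (rule integral_dominated_convergence_at_top[where w="\<lambda>q. D * (e q * p q)"])
    show "AE q in lborel. ((\<lambda>x. ?B x q * p q) \<longlongrightarrow> b q * p q) at_top"
    proof (intro AE_I2)
      show "((\<lambda>x. ?B x q * p q) \<longlongrightarrow> b q * p q) at_top" for q
        by (cases "0 \<le> q") (auto intro!: tendsto_mult_right lim simp: p)
    qed
    show "\<forall>\<^sub>F x in at_top. AE q in lborel. norm (?B x q * p q) \<le> D * (e q * p q)"
      using dom
    proof eventually_elim
      case (elim x)
      show ?case
      proof (intro AE_I2)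
        fix q
        consider "q < 0" | "x < q" | "0 \<le> q" "q \<le> x" by linarith
        then show "norm (?B x q * p q) \<le> D * (e q * p q)"
        proof cases
          case 1 then show ?thesis by (simp add: p)
        next
          case 2 then show ?thesis using y e p by (simp add: r_neg)
        next
          case 3
          then have "\<bar>?B x q\<bar> * p q \<le> D * e q * p q" using elim p by (intro mult_right_mono) auto
          then show ?thesis by (simp add: abs_mult p mult.assoc)
        qed
      qed
    qed
  qed (use e in auto)
  then have "((\<lambda>x. l * (p x * Wr (x - y) / ur x) + l * (\<integral>q. ?B x q * p q \<partial>lborel)) \<longlongrightarrow> l * 0 + l * (\<integral>q. b q * p q \<partial>lborel)) at_top"
    by (intro tendsto_intros zero)
  then show ?thesis by (simp add: eq)
qed

lemma nn_integral_F_tail: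
  assumes [measurable]: "\<phi> \<in> borel_measurable borel"
  shows "(\<integral>\<^sup>+q. \<phi> q * emeasure F {q<..} * H q \<partial>lborel) = (\<integral>\<^sup>+z. (\<integral>\<^sup>+q. \<phi> q * indicator {0..<z} q \<partial>lborel) \<partial>F)"
proof -
  interpret FL: pair_sigma_finite F lborel ..
  have "(\<integral>\<^sup>+q. \<phi> q * emeasure F {q<..} * H q \<partial>lborel) = (\<integral>\<^sup>+q. (\<integral>\<^sup>+z. (if 0 \<le> q \<and> q < z then \<phi> q else 0) \<partial>F) \<partial>lborel)"
  proof (rule nn_integral_cong)
    fix q :: real
    have "(\<integral>\<^sup>+z. (if 0 \<le> q \<and> q < z then \<phi> q else 0) \<partial>F) = (\<integral>\<^sup>+z. \<phi> q * H q * indicator {q<..} z \<partial>F)"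
      by (intro nn_integral_cong) (auto split: split_indicator)
    also have "\<dots> = \<phi> q * H q * emeasure F {q<..}" by (intro nn_integral_cmult_indicator) auto
    finally show "\<phi> q * emeasure F {q<..} * H q = (\<integral>\<^sup>+z. (if 0 \<le> q \<and> q < z then \<phi> q else 0) \<partial>F)" by (simp add: ac_simps)
  qed
  also have "\<dots> = (\<integral>\<^sup>+z. (\<integral>\<^sup>+q. (if 0 \<le> q \<and> q < z then \<phi> q else 0) \<partial>lborel) \<partial>F)"
    by (intro FL.Fubini') measurable
  also have "\<dots> = (\<integral>\<^sup>+z. (\<integral>\<^sup>+q. \<phi> q * indicator {0..<z} q \<partial>lborel) \<partial>F)"
    by (intro nn_integral_cong) (auto split: split_indicator)
  finally show ?thesis .
qed

text \<open>A payoff collected only when the jump exceeds \<open>q\<close> is dominated by the tail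
  of \<open>F\<close>, which turns integrability against \<phi> into a moment condition on
  \<open>F\<close>.\<close>

lemma F_tail_integrable:
  fixes p :: "real \<Rightarrow> real"
  assumes [measurable]: "p \<in> borel_measurable borel" "\<phi> \<in> borel_measurable borel"
    and p: "\<And>q. 0 \<le> p q" "\<And>q. p q \<le> K * measure F {q<..}" "\<And>q. q < 0 \<Longrightarrow> p q = 0"
    and \<phi>: "\<And>q. 0 \<le> \<phi> q" "(\<integral>\<^sup>+z. (\<integral>\<^sup>+q. ennreal (\<phi> q) * indicator {0..<z} q \<partial>lborel) \<partial>F) < \<infinity>"
  shows "integrable lborel (\<lambda>q. \<phi> q * p q)"
proof (rule integrableI_nonneg)
  have le: "ennreal (\<phi> q * p q) \<le> ennreal K * (ennreal (\<phi> q) * emeasure F {q<..} * H q)" for q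
  proof (cases "q < 0")
    case False
    have "ennreal (p q) \<le> ennreal (K * measure F {q<..})" using p by (intro ennreal_leI)
    also have "\<dots> = ennreal K * emeasure F {q<..}"
      by (simp add: ennreal_mult'' F.emeasure_eq_measure)
    finally have "ennreal (\<phi> q) * ennreal (p q) \<le> ennreal (\<phi> q) * (ennreal K * emeasure F {q<..})" by (rule mult_left_mono) auto
    then show ?thesis using False p \<phi> by (simp add: ennreal_mult ac_simps)
  qed (simp add: p)
  have "(\<integral>\<^sup>+q. ennreal (\<phi> q * p q) \<partial>lborel) \<le> (\<integral>\<^sup>+q. ennreal K * (ennreal (\<phi> q) * emeasure F {q<..} * H q) \<partial>lborel)"
    by (intro nn_integral_mono le)
  also have "\<dots> = ennreal K * (\<integral>\<^sup>+q. ennreal (\<phi> q) * emeasure F {q<..} * H q \<partial>lborel)"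
  proof (rule nn_integral_cmult)
    have "(\<lambda>q. emeasure F {q<..}) \<in> borel_measurable borel"
    proof -
      have "(\<lambda>q. \<integral>\<^sup>+z. (if q < z then 1 else 0) \<partial>F) \<in> borel_measurable borel" by measurable
      also have "(\<lambda>q. \<integral>\<^sup>+z. (if q < z then 1 else 0) \<partial>F) = (\<lambda>q. emeasure F {q<..})"
      proof
        fix q :: real
        have "(\<integral>\<^sup>+z. (if q < z then 1 else 0) \<partial>F) = (\<integral>\<^sup>+z. indicator {q<..} z \<partial>F)"
          by (intro nn_integral_cong) (auto split: split_indicator)
        then show "(\<integral>\<^sup>+z. (if q < z then 1 else 0) \<partial>F) = emeasure F {q<..}" by simp
      qed
      finally show ?thesis .
    qed
    note [measurable] = this
    show "(\<lambda>q. ennreal (\<phi> q) * emeasure F {q<..} * H q) \<in> borel_measurable lborel" by measurable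
  qed
  also have "\<dots> < \<infinity>" using \<phi> by (subst nn_integral_F_tail) (auto simp: ennreal_mult_less_top)
  finally show "(\<integral>\<^sup>+q. ennreal (\<phi> q * p q) \<partial>lborel) < \<infinity>" .
qed (use p \<phi> in auto)


lemma F_nonneg: "AE y in F. 0 \<le> y"
  using F_pos by eventually_elim simp

lemma measure_tail_tendsto_0: "((\<lambda>q. measure F {q<..}) \<longlongrightarrow> 0) at_top"
proof -
  have "((\<lambda>q. \<integral>z. indicator {q<..} z \<partial>F) \<longlongrightarrow> (\<integral>z. (0 :: real) \<partial>F)) at_top"
  proof (rule integral_dominated_convergence_at_top[where w="\<lambda>_. 1::real"])
    show "AE z in F. ((\<lambda>q. indicator {q<..} z :: real) \<longlongrightarrow> 0) at_top"
    proof (intro AE_I2 tendsto_eventually)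
      show "\<forall>\<^sub>F q in at_top. (indicator {q<..} z :: real) = 0" for z :: real
        using eventually_ge_at_top[of z] by eventually_elim auto
    qed
    show "\<forall>\<^sub>F q in at_top. AE z in F. norm (indicator {q<..} z :: real) \<le> 1"
      by (intro always_eventually allI AE_I2) (auto split: split_indicator)
  qed auto
  then show ?thesis by simp
qed

lemma tail_bound_constant:
  assumes p: "\<And>q. 0 \<le> p q" "\<And>q. p q \<le> K * measure F {q<..}"
  shows "0 \<le> K" and "p q \<le> K"
proof -
  \<comment> \<open>At \<open>q = -1\<close> the tail is the whole mass, so the bound on
    \<open>p\<close> there forces \<open>K\<close> to be nonnegative.\<close>
  have "measure F {-1<..} = 1" by (subst F.prob_eq_1) (use F_pos in \<open>auto elim: eventually_mono\<close>)
  then show K: "0 \<le> K" using p(1)[of "-1"] p(2)[of "-1"] by simp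
  show "p q \<le> K"
    using p(2)[of q] K mult_left_mono[of "measure F {q<..}" 1 K] by (simp add: F.prob_le_1)
qed

lemma has_bochner_integral_exp_decay:
  fixes \<kappa> :: real
  assumes "0 < \<kappa>"
  shows "has_bochner_integral lborel (\<lambda>t. exp (- \<kappa> * t) * indicator {0..} t) (1 / \<kappa>)"
proof (rule has_bochner_integral_nn_integral)
  have "(\<integral>\<^sup>+t. ennreal (exp (- \<kappa> * t) * indicator {0..} t) \<partial>lborel) = (\<integral>\<^sup>+t. ennreal (exp (- \<kappa> * t)) * indicator {0..} t \<partial>lborel)"
    by (intro nn_integral_cong) (auto split: split_indicator)
  also have "\<dots> = ennreal (0 - (- exp (- \<kappa> * 0) / \<kappa>))"
  proof (rule nn_integral_FTC_atLeast)
    show "((\<lambda>t. - exp (- \<kappa> * t) / \<kappa>) \<longlongrightarrow> 0) at_top" using assms by real_asymp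
  qed (use assms in \<open>auto intro!: derivative_eq_intros\<close>)
  finally show "(\<integral>\<^sup>+t. ennreal (exp (- \<kappa> * t) * indicator {0..} t) \<partial>lborel) = ennreal (1 / \<kappa>)" by simp
qed (use assms in auto)

text \<open>Here \<open>W x = c exp (\<rho> x) - D x\<close> with \<open>D x \<rightarrow> 1 / (l m - 1)\<close>. The exponentially growing parts cancel
  in \<open>payoff\<close>, so that the second-order term \<open>D\<close> determines the limit.\<close>

theorem payoff_limit_positive_drift:
  fixes p :: "real \<Rightarrow> real"
  assumes \<rho>: "0 < \<rho>" and F_mean: "integrable F (\<lambda>y. y)" and drift: "1 < l * (\<integral>y. y \<partial>F)"
    and [measurable]: "p \<in> borel_measurable borel"
    and p: "\<And>q. 0 \<le> p q" "\<And>q. p q \<le> K * measure F {q<..}" "\<And>q. q < 0 \<Longrightarrow> p q = 0"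
    and y: "0 \<le> y"
  shows "\<forall>\<^sub>F x in at_top. 0 < ur x"
    and "((\<lambda>x. payoff p x y) \<longlongrightarrow> l / (l * (\<integral>y. y \<partial>F) - 1) * (\<integral>q. (1 - exp (- \<rho> * q)) * p q \<partial>lborel)) at_top"
proof -
  define m where "m = (\<integral>y. y \<partial>F)"
  have root: "l * (\<integral>y. exp (- \<rho> * y) \<partial>F) + \<rho> = l" and Fexp: "integrable F (\<lambda>y. exp (- \<rho> * y))"
  proof -
    show i: "integrable F (\<lambda>y. exp (- \<rho> * y))"
      by (rule F.integrable_const_bound[where B=1]) (use F_nonneg \<rho> in \<open>auto elim: eventually_mono\<close>)
    have n: "0 \<le> (\<integral>y. exp (- \<rho> * y) \<partial>F)" by simp
    have "ennreal (l * (\<integral>y. exp (- \<rho> * y) \<partial>F) + \<rho>) = ennreal l"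
      using \<rho>_root l_pos n \<rho> nn_integral_eq_integral[OF i] by (simp add: ennreal_mult)
    then show "l * (\<integral>y. exp (- \<rho> * y) \<partial>F) + \<rho> = l"
      using l_pos n \<rho> by (subst (asm) ennreal_inj) (auto intro: add_nonneg_nonneg)
  qed
  have inner0: "(\<integral>\<^sup>+x. ennreal (exp (\<rho> * (x - y))) * indicator {0..<y} x \<partial>lborel) = ennreal ((1 - exp (- \<rho> * y)) / \<rho>)" if "0 < y" for y
  proof -
    have "(\<integral>\<^sup>+x. ennreal (exp (\<rho> * (x - y))) * indicator {0..<y} x \<partial>lborel) = (\<integral>\<^sup>+x. ennreal (exp (\<rho> * (x - y))) * indicator {0..y} x \<partial>lborel)"
      by (intro nn_integral_cong_AE eventually_mono[OF AE_lborel_singleton[of y]]) (auto split: split_indicator)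
    also have "\<dots> = exp (\<rho> * (y - y)) / \<rho> - exp (\<rho> * (0 - y)) / \<rho>"
      by (intro nn_integral_FTC_Icc) (use that \<rho> in \<open>auto intro!: derivative_eq_intros\<close>)
    finally show ?thesis by (simp add: diff_divide_distrib)
  qed
  have inner1: "(\<integral>\<^sup>+x. ennreal x * ennreal (exp (\<rho> * (x - y))) * indicator {0..<y} x \<partial>lborel) = ennreal (y / \<rho> - (1 - exp (- \<rho> * y)) / \<rho>^2)" if "0 < y" for y
  proof -
    let ?f = "\<lambda>x. exp (\<rho> * (x - y)) * (x / \<rho> - 1 / \<rho>^2)"
    have "(\<integral>\<^sup>+x. ennreal x * ennreal (exp (\<rho> * (x - y))) * indicator {0..<y} x \<partial>lborel) = (\<integral>\<^sup>+x. ennreal (x * exp (\<rho> * (x - y))) * indicator {0..y} x \<partial>lborel)"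
      by (intro nn_integral_cong_AE eventually_mono[OF AE_lborel_singleton[of y]]) (auto simp: ennreal_mult'' split: split_indicator)
    also have "\<dots> = ?f y - ?f 0"
      by (intro nn_integral_FTC_Icc)
         (use that \<rho> in \<open>auto intro!: derivative_eq_intros simp: field_simps power2_eq_square\<close>)
    finally show ?thesis by (simp add: algebra_simps diff_divide_distrib)
  qed
  \<comment> \<open>The root equation is exactly what gives \<open>g\<close> mass one. The drift
    enters through the mean of \<open>g\<close>, which is \<open>(l * m - 1) / \<rho>\<close>. The
    vacuous factor \<open>exp (0 * x)\<close> matches the tilted form of the renewal lemma.\<close>
  have mass: "(\<integral>\<^sup>+x. ennreal (exp (0 * x)) * g x \<partial>lborel) = 1"
  proof -
    have "(\<integral>\<^sup>+x. ennreal (exp (0 * x)) * g x \<partial>lborel) = ennreal l * (\<integral>\<^sup>+y. (\<integral>\<^sup>+x. ennreal (exp (\<rho> * (x - y))) * indicator {0..<y} x \<partial>lborel) \<partial>F)"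
      by (subst nn_integral_g_mult) auto
    also have "(\<integral>\<^sup>+y. (\<integral>\<^sup>+x. ennreal (exp (\<rho> * (x - y))) * indicator {0..<y} x \<partial>lborel) \<partial>F) = (\<integral>\<^sup>+y. ennreal ((1 - exp (- \<rho> * y)) / \<rho>) \<partial>F)"
      by (intro nn_integral_cong_AE eventually_mono[OF F_pos] inner0)
    also have "\<dots> = ennreal (\<integral>y. (1 - exp (- \<rho> * y)) / \<rho> \<partial>F)"
      using Fexp \<rho> by (intro nn_integral_eq_integral) (auto intro!: eventually_mono[OF F_pos] divide_nonneg_pos)
    also have "(\<integral>y. (1 - exp (- \<rho> * y)) / \<rho> \<partial>F) = 1 / l"
      using Fexp root l_pos \<rho> by (simp add: F.prob_space[simplified] field_simps)
    finally show ?thesis using l_pos by (simp add: ennreal_mult[symmetric])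
  qed
  have mean: "(\<integral>\<^sup>+x. ennreal (x * exp (0 * x)) * g x \<partial>lborel) = ennreal ((l * m - 1) / \<rho>)"
  proof -
    have "(\<integral>\<^sup>+x. ennreal (x * exp (0 * x)) * g x \<partial>lborel) = ennreal l * (\<integral>\<^sup>+y. (\<integral>\<^sup>+x. ennreal x * ennreal (exp (\<rho> * (x - y))) * indicator {0..<y} x \<partial>lborel) \<partial>F)"
      by (subst nn_integral_g_mult) auto
    also have "(\<integral>\<^sup>+y. (\<integral>\<^sup>+x. ennreal x * ennreal (exp (\<rho> * (x - y))) * indicator {0..<y} x \<partial>lborel) \<partial>F) = (\<integral>\<^sup>+y. ennreal (y / \<rho> - (1 - exp (- \<rho> * y)) / \<rho>^2) \<partial>F)"
      by (intro nn_integral_cong_AE eventually_mono[OF F_pos]) (rule inner1)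
    also have "\<dots> = ennreal (\<integral>y. y / \<rho> - (1 - exp (- \<rho> * y)) / \<rho>^2 \<partial>F)"
    proof (intro nn_integral_eq_integral)
      show "AE y in F. 0 \<le> y / \<rho> - (1 - exp (- \<rho> * y)) / \<rho>^2"
      proof (intro eventually_mono[OF F_pos])
        fix y :: real
        have "1 + (- \<rho> * y) \<le> exp (- \<rho> * y)" by (rule exp_ge_add_one_self)
        then show "0 \<le> y / \<rho> - (1 - exp (- \<rho> * y)) / \<rho>^2" using \<rho> by (simp add: field_simps power2_eq_square)
      qed
    qed (use Fexp F_mean in auto)
    also have "(\<integral>y. y / \<rho> - (1 - exp (- \<rho> * y)) / \<rho>^2 \<partial>F) = m / \<rho> - (1 - (l - \<rho>) / l) / \<rho>^2"
    proof -
      have "(\<integral>y. exp (- \<rho> * y) \<partial>F) = (l - \<rho>) / l" using root l_pos by (simp add: field_simps)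
      then show ?thesis using Fexp F_mean by (simp add: F.prob_space[simplified] m_def)
    qed
    also have "\<dots> = (l * m - 1) / \<rho> / l" using l_pos \<rho> by (simp add: field_simps power2_eq_square)
    finally show ?thesis using l_pos drift \<rho> by (simp add: ennreal_mult[symmetric] m_def)
  qed
  have mu_pos: "0 < (l * m - 1) / \<rho>" using drift \<rho> by (simp add: m_def)
  interpret R: renewal_density "\<lambda>x. exp (0 * x) * gr x" "\<lambda>x. exp (0 * x) * vr x" "\<rho> + 0"
    by (rule exponentially_tilted_renewal) (use mass mean in auto)
  have "R.\<mu> = (l * m - 1) / \<rho>"
  proof -
    have "ennreal R.\<mu> = (\<integral>\<^sup>+x. ennreal (x * gr x) \<partial>lborel)"
      unfolding R.\<mu>_def by (subst nn_integral_eq_integral)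
        (use R.g_mean in \<open>auto intro!: AE_I2 simp: gr_nonneg gr_neg zero_le_mult_iff not_le\<close>)
    also have "\<dots> = (\<integral>\<^sup>+x. ennreal (x * exp (0 * x)) * g x \<partial>lborel)"
      by (intro nn_integral_cong) (simp add: ennreal_gr[symmetric] ennreal_mult'' gr_nonneg)
    finally show ?thesis using mean mu_pos R.\<mu>_nonneg by (simp add: less_imp_le)
  qed
  then have v_lim: "(vr \<longlongrightarrow> \<rho> / (l * m - 1)) at_top" using R.renewal_density_limit by simp
  obtain Bv where "0 < Bv" "\<And>x. exp (0 * x) * vr x \<le> Bv" using R.v_bounded by metis
  then have Bv: "0 < Bv" "\<And>x. vr x \<le> Bv" by auto


  define k where "k = 1 / (l * m - 1)"
  have k: "0 < k" using drift by (simp add: k_def m_def)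
  have "has_bochner_integral lborel (\<lambda>t. exp (- \<rho> * t) * indicator {0..} t) (1 / \<rho>)"
    by (rule has_bochner_integral_exp_decay[OF \<rho>])
  then have exp_int: "integrable lborel (\<lambda>t. exp (- \<rho> * t) * indicator {0..} t)"
    and exp_integral: "(\<integral>t. exp (- \<rho> * t) * indicator {0..} t \<partial>lborel) = 1 / \<rho>"
    by (auto simp: has_bochner_integral_iff)
  have Dint: "integrable lborel (\<lambda>t. exp (- \<rho> * t) * vr (x + t) * indicator {0..} t)" for x
  proof (rule Bochner_Integration.integrable_bound)
    show "integrable lborel (\<lambda>t. Bv * (exp (- \<rho> * t) * indicator {0..} t))" using exp_int by simp
    show "AE t in lborel. norm (exp (- \<rho> * t) * vr (x + t) * indicator {0..} t) \<le> norm (Bv * (exp (- \<rho> * t) * indicator {0..} t))"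
      using Bv r_nonneg by (intro AE_I2) (auto split: split_indicator simp: abs_mult)
  qed measurable
  \<comment> \<open>The part of the integral of \<open>exp (- \<rho> * y) * vr y\<close> beyond
    \<open>x\<close>, rescaled by \<open>exp (\<rho> * x)\<close>. Completing the convolution
    \<open>E * v\<close> to the full half line yields the constant \<open>c\<close> and leaves
    \<open>D\<close> as remainder. The limit is \<open>k\<close> because \<open>v\<close> tends to
    \<open>\<rho> * k\<close>.\<close>
  define D where "D x = (\<integral>t. exp (- \<rho> * t) * vr (x + t) * indicator {0..} t \<partial>lborel)" for x
  have D_nonneg: "0 \<le> D x" for x unfolding D_def using r_nonneg by (intro integral_nonneg_AE) auto
  have D_le: "D x \<le> Bv / \<rho>" for x
  proof -
    have "D x \<le> (\<integral>t. Bv * (exp (- \<rho> * t) * indicator {0..} t) \<partial>lborel)" unfolding D_def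
      using Bv by (intro integral_mono Dint integrable_mult_right exp_int) (auto split: split_indicator)
    then show ?thesis by (simp only: integral_mult_right_zero exp_integral) simp
  qed
  have D_lim: "(D \<longlongrightarrow> k) at_top"
  proof -
    have "((\<lambda>x. \<integral>t. exp (- \<rho> * t) * vr (x + t) * indicator {0..} t \<partial>lborel) \<longlongrightarrow>
       (\<integral>t. (\<rho> / (l * m - 1)) * (exp (- \<rho> * t) * indicator {0..} t) \<partial>lborel)) at_top"
    proof (rule integral_dominated_convergence_at_top[where w="\<lambda>t. Bv * (exp (- \<rho> * t) * indicator {0..} t)"])
      show "AE t in lborel. ((\<lambda>x. exp (- \<rho> * t) * vr (x + t) * indicator {0..} t) \<longlongrightarrow> \<rho> / (l * m - 1) * (exp (- \<rho> * t) * indicator {0..} t)) at_top"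
      proof (intro AE_I2)
        fix t :: real
        have "filterlim (\<lambda>x. x + t) at_top at_top"
          using filterlim_tendsto_add_at_top[OF tendsto_const[of t] filterlim_ident] by (simp add: add.commute)
        then have "((\<lambda>x. exp (- \<rho> * t) * vr (x + t) * indicator {0..} t) \<longlongrightarrow> exp (- \<rho> * t) * (\<rho> / (l * m - 1)) * indicator {0..} t) at_top"
          by (intro tendsto_intros filterlim_compose[OF v_lim])
        then show "((\<lambda>x. exp (- \<rho> * t) * vr (x + t) * indicator {0..} t) \<longlongrightarrow> \<rho> / (l * m - 1) * (exp (- \<rho> * t) * indicator {0..} t)) at_top"
          by (simp add: ac_simps)
      qed
      show "\<forall>\<^sub>F x in at_top. AE t in lborel. norm (exp (- \<rho> * t) * vr (x + t) * indicator {0..} t) \<le> Bv * (exp (- \<rho> * t) * indicator {0..} t)"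
        using Bv r_nonneg by (intro always_eventually allI AE_I2) (auto split: split_indicator simp: abs_mult)
    qed (use exp_int in auto)
    also have "(\<integral>t. (\<rho> / (l * m - 1)) * (exp (- \<rho> * t) * indicator {0..} t) \<partial>lborel) = k"
      by (simp only: integral_mult_right_zero exp_integral) (use \<rho> in \<open>simp add: k_def\<close>)
    finally show ?thesis by (simp add: D_def[abs_def])
  qed
  have vI: "integrable lborel (\<lambda>y. exp (- \<rho> * y) * vr y)"
  proof -
    have "(\<lambda>y. exp (- \<rho> * y) * vr y) = (\<lambda>t. exp (- \<rho> * t) * vr (0 + t) * indicator {0..} t)"
      by (auto simp: fun_eq_iff r_neg split: split_indicator)
    then show ?thesis using Dint[of 0] by simp
  qed
  have vI_ind: "integrable lborel (\<lambda>y. exp (- \<rho> * y) * vr y * indicator A y)" if "A \<in> sets borel" for A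
    by (rule integrable_real_mult_indicator) (use that vI in auto)
  define c where "c = 1 + (\<integral>y. exp (- \<rho> * y) * vr y \<partial>lborel)"
  have W_dec: "Wr x = c * exp (\<rho> * x) - D x" if "0 \<le> x" for x
  proof -
    have n: "0 \<le> (\<integral>y. exp (- \<rho> * y) * vr y * indicator {..x} y \<partial>lborel)" using r_nonneg by (intro integral_nonneg_AE) auto
    have "conv E v x = (\<integral>\<^sup>+y. ennreal (exp (\<rho> * x)) * ennreal (exp (- \<rho> * y) * vr y * indicator {..x} y) \<partial>lborel)"
      unfolding conv_def
    proof (rule nn_integral_cong)
      fix y
      have "exp (\<rho> * (x - y)) = exp (\<rho> * x) * exp (- \<rho> * y)" by (simp add: exp_add[symmetric] algebra_simps)
      then show "E (x - y) * v y = ennreal (exp (\<rho> * x)) * ennreal (exp (- \<rho> * y) * vr y * indicator {..x} y)"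
        by (auto simp: E_def ennreal_r[symmetric] ennreal_mult r_nonneg mult.assoc split: split_indicator)
    qed
    also have "\<dots> = ennreal (exp (\<rho> * x)) * ennreal (\<integral>y. exp (- \<rho> * y) * vr y * indicator {..x} y \<partial>lborel)"
      by (subst nn_integral_cmult, measurable, subst nn_integral_eq_integral) (use vI_ind[of "{..x}"] in \<open>auto simp: r_nonneg\<close>)
    finally have "ennreal (Wr x) = ennreal (exp (\<rho> * x)) + ennreal (exp (\<rho> * x)) * ennreal (\<integral>y. exp (- \<rho> * y) * vr y * indicator {..x} y \<partial>lborel)"
      using that by (simp add: ennreal_r W_def E_def)
    also have "\<dots> = ennreal (exp (\<rho> * x) + exp (\<rho> * x) * (\<integral>y. exp (- \<rho> * y) * vr y * indicator {..x} y \<partial>lborel))"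
      using n by (simp add: ennreal_mult)
    finally have 1: "Wr x = exp (\<rho> * x) + exp (\<rho> * x) * (\<integral>y. exp (- \<rho> * y) * vr y * indicator {..x} y \<partial>lborel)"
      using n r_nonneg by (subst (asm) ennreal_inj) auto
    have "(\<integral>y. exp (- \<rho> * y) * vr y \<partial>lborel) = (\<integral>y. exp (- \<rho> * y) * vr y * indicator {..x} y + exp (- \<rho> * y) * vr y * indicator {x..} y \<partial>lborel)"
      by (intro integral_cong_AE eventually_mono[OF AE_lborel_singleton[of x]]) (auto split: split_indicator)
    also have "\<dots> = (\<integral>y. exp (- \<rho> * y) * vr y * indicator {..x} y \<partial>lborel) + (\<integral>y. exp (- \<rho> * y) * vr y * indicator {x..} y \<partial>lborel)"
      by (rule Bochner_Integration.integral_add; rule vI_ind; simp)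
    also have "(\<integral>y. exp (- \<rho> * y) * vr y * indicator {x..} y \<partial>lborel) = (\<integral>t. exp (- \<rho> * (x + t)) * vr (x + t) * indicator {x..} (x + t) \<partial>lborel)"
      using lborel_integral_real_affine[where c=1 and t=x and f="\<lambda>y. exp (- \<rho> * y) * vr y * indicator {x..} y"] by simp
    also have "\<dots> = (\<integral>t. exp (- \<rho> * x) * (exp (- \<rho> * t) * vr (x + t) * indicator {0..} t) \<partial>lborel)"
      by (intro Bochner_Integration.integral_cong) (auto simp: exp_add[symmetric] algebra_simps split: split_indicator)
    also have "\<dots> = exp (- \<rho> * x) * D x" unfolding D_def by (rule integral_mult_right_zero)
    finally have "c = 1 + (\<integral>y. exp (- \<rho> * y) * vr y * indicator {..x} y \<partial>lborel) + exp (- \<rho> * x) * D x" by (simp add: c_def)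
    then show ?thesis unfolding 1 by (simp add: algebra_simps exp_minus)
  qed
  \<comment> \<open>The error of \<open>u\<close> relative to
    \<open>\<rho> * c * exp (\<rho> * x)\<close>. The limits of \<open>v\<close> and
    \<open>\<rho> * D\<close> agree, so it vanishes; as it is only ever multiplied by
    \<open>W / u\<close>, at most \<open>1 / \<rho>\<close>, no rate is required.\<close>
  define \<epsilon> where "\<epsilon> x = vr x - \<rho> * D x" for x
  have \<epsilon>_lim: "(\<epsilon> \<longlongrightarrow> 0) at_top"
  proof -
    have "(\<epsilon> \<longlongrightarrow> \<rho> / (l * m - 1) - \<rho> * k) at_top" unfolding \<epsilon>_def[abs_def] by (intro tendsto_intros v_lim D_lim)
    then show ?thesis by (simp add: k_def)
  qed
  have \<epsilon>_le: "\<bar>\<epsilon> x\<bar> \<le> Bv" for x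
  proof -
    have "\<rho> * D x \<le> \<rho> * (Bv / \<rho>)" using \<rho> D_le by (intro mult_left_mono) auto
    then have "\<rho> * D x \<le> Bv" using \<rho> by simp
    moreover have "0 \<le> \<rho> * D x" using \<rho> D_nonneg by simp
    ultimately show ?thesis using Bv(2)[of x] r_nonneg(3)[of x] unfolding \<epsilon>_def by linarith
  qed
  have u_dec: "ur x = \<rho> * c * exp (\<rho> * x) + \<epsilon> x" if "0 \<le> x" for x
    unfolding ur_eq \<epsilon>_def W_dec[OF that] by (simp add: algebra_simps)
  have W1: "1 \<le> Wr x" if "0 \<le> x" for x
  proof -
    have "ennreal 1 \<le> ennreal (Wr x)" unfolding ennreal_r by (subst W_eq) (use that in simp)
    then show ?thesis using r_nonneg by (subst (asm) ennreal_le_iff) auto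
  qed
  have u_pos: "0 < ur x" if "0 \<le> x" for x
    unfolding ur_eq using \<rho> W1[OF that] r_nonneg by (intro add_pos_nonneg) auto
  show pos: "\<forall>\<^sub>F x in at_top. 0 < ur x"
    using eventually_ge_at_top[of 0] by eventually_elim (rule u_pos)
  have R: "0 \<le> Wr (x - y) / ur x \<and> Wr (x - y) / ur x \<le> 1 / \<rho>" if "0 \<le> x" for x
  proof -
    have "\<rho> * Wr (x - y) \<le> ur x" unfolding ur_eq using \<rho> y r_nonneg Wr_mono[of "x - y" x]
      by (intro add_increasing2) auto
    then show ?thesis using u_pos[OF that] \<rho> r_nonneg by (simp add: field_simps)
  qed
  \<comment> \<open>Shifting by \<open>q\<close> multiplies the exponential parts of
    \<open>W\<close> and \<open>u\<close> by the same factor \<open>exp (- \<rho> * q)\<close>; they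
    cancel exactly and only \<epsilon> and \<open>D\<close> remain.\<close>
  have B_eq: "Wr (x - y) * ur (x - q) / ur x - Wr (x - y - q)
      = Wr (x - y) / ur x * (\<epsilon> (x - q) - exp (- \<rho> * q) * \<epsilon> x) + (D (x - y - q) - exp (- \<rho> * q) * D (x - y))"
    if q: "0 \<le> q" "q \<le> x - y" for x q
  proof -
    have e: "exp (\<rho> * (z - q)) = exp (- \<rho> * q) * exp (\<rho> * z)" for z by (simp add: exp_add[symmetric] algebra_simps)
    have 1: "ur (x - q) = exp (- \<rho> * q) * ur x + (\<epsilon> (x - q) - exp (- \<rho> * q) * \<epsilon> x)"
    proof -
      have a: "ur (x - q) = \<rho> * c * exp (\<rho> * (x - q)) + \<epsilon> (x - q)" "ur x = \<rho> * c * exp (\<rho> * x) + \<epsilon> x"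
        by (rule u_dec, use q y in simp)+
      show ?thesis unfolding a(1) unfolding a(2) e by (simp add: algebra_simps)
    qed
    have 2: "Wr (x - y - q) = exp (- \<rho> * q) * Wr (x - y) + exp (- \<rho> * q) * D (x - y) - D (x - y - q)"
    proof -
      have a: "Wr (x - y - q) = c * exp (\<rho> * (x - y - q)) - D (x - y - q)" "Wr (x - y) = c * exp (\<rho> * (x - y)) - D (x - y)"
        by (rule W_dec, use q y in simp)+
      show ?thesis unfolding a(1) unfolding a(2) e by (simp add: algebra_simps)
    qed
    show ?thesis unfolding 1 2 using u_pos[of x] q y by (simp add: field_simps)
  qed
  have "((\<lambda>x. payoff p x y) \<longlongrightarrow> l * (\<integral>q. (k - exp (- \<rho> * q) * k) * p q \<partial>lborel)) at_top"
  \<comment> \<open>The dominating constant has three parts: two values of \<epsilon> times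
    \<open>W / u\<close>, two values of \<open>D\<close>, and the range
    \<open>x - y < q \<le> x\<close>. There \<open>W (x - y - q)\<close> vanishes and
    \<open>u (x - q)\<close> is taken at a point below \<open>y\<close>.\<close>
  proof (rule payoff_tendsto[where K=K and e="\<lambda>_. 1" and D="1 / \<rho> * (2 * Bv) + 2 * (Bv / \<rho>) + (1 / \<rho>) * (\<rho> * Wr y + l * exp (l * y))"])
    have K: "0 \<le> K" and p_le: "p q \<le> K" for q using tail_bound_constant[OF p(1,2)] by auto
    show "p q \<le> K" for q by (rule p_le)
    show "\<forall>\<^sub>F x in at_top. 0 < ur x" by (rule pos)
    show "((\<lambda>x. Wr (x - y) * ur (x - q) / ur x - Wr (x - y - q)) \<longlongrightarrow> k - exp (- \<rho> * q) * k) at_top" if q: "0 \<le> q" for q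
    proof -
      have sh: "filterlim (\<lambda>x. x - z) at_top at_top" for z :: real
        by (rule filterlim_minus_const_at_top[OF filterlim_ident])
      have sh2: "filterlim (\<lambda>x. x - y - q) at_top at_top" using sh[of "y + q"] by (simp add: diff_diff_eq)
      have "((\<lambda>x. Wr (x - y) / ur x * (\<epsilon> (x - q) - exp (- \<rho> * q) * \<epsilon> x)) \<longlongrightarrow> 0) at_top"
      proof (rule Lim_null_comparison)
        show "\<forall>\<^sub>F x in at_top. norm (Wr (x - y) / ur x * (\<epsilon> (x - q) - exp (- \<rho> * q) * \<epsilon> x)) \<le> 1 / \<rho> * \<bar>\<epsilon> (x - q) - exp (- \<rho> * q) * \<epsilon> x\<bar>"
          using eventually_ge_at_top[of 0]
        proof eventually_elim
          case (elim x)
          then show ?case using R[OF elim] unfolding real_norm_def abs_mult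
            by (intro mult_right_mono) auto
        qed
        have "((\<lambda>x. 1 / \<rho> * \<bar>\<epsilon> (x - q) - exp (- \<rho> * q) * \<epsilon> x\<bar>) \<longlongrightarrow> 1 / \<rho> * \<bar>0 - exp (- \<rho> * q) * 0\<bar>) at_top"
          by (intro tendsto_intros \<epsilon>_lim filterlim_compose[OF \<epsilon>_lim sh])
        then show "((\<lambda>x. 1 / \<rho> * \<bar>\<epsilon> (x - q) - exp (- \<rho> * q) * \<epsilon> x\<bar>) \<longlongrightarrow> 0) at_top" by simp
      qed
      then have "((\<lambda>x. Wr (x - y) / ur x * (\<epsilon> (x - q) - exp (- \<rho> * q) * \<epsilon> x) + (D (x - y - q) - exp (- \<rho> * q) * D (x - y))) \<longlongrightarrow> 0 + (k - exp (- \<rho> * q) * k)) at_top"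
        by (intro tendsto_intros filterlim_compose[OF D_lim sh] filterlim_compose[OF D_lim sh2])
      then have lim: "((\<lambda>x. Wr (x - y) / ur x * (\<epsilon> (x - q) - exp (- \<rho> * q) * \<epsilon> x) + (D (x - y - q) - exp (- \<rho> * q) * D (x - y))) \<longlongrightarrow> k - exp (- \<rho> * q) * k) at_top"
        by simp
      show ?thesis
      proof (rule Lim_transform_eventually[OF lim])
        show "\<forall>\<^sub>F x in at_top. Wr (x - y) / ur x * (\<epsilon> (x - q) - exp (- \<rho> * q) * \<epsilon> x) + (D (x - y - q) - exp (- \<rho> * q) * D (x - y))
          = Wr (x - y) * ur (x - q) / ur x - Wr (x - y - q)"
          using eventually_ge_at_top[of "q + y"] by eventually_elim (subst B_eq, use q in auto)
      qed
    qed
    show "\<forall>\<^sub>F x in at_top. \<forall>q. 0 \<le> q \<longrightarrow> q \<le> x \<longrightarrow> \<bar>Wr (x - y) * ur (x - q) / ur x - Wr (x - y - q)\<bar>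
       \<le> (1 / \<rho> * (2 * Bv) + 2 * (Bv / \<rho>) + (1 / \<rho>) * (\<rho> * Wr y + l * exp (l * y))) * 1"
      using eventually_ge_at_top[of 0]
    proof eventually_elim
      case (elim x)
      note R = R[OF elim]
      have nn: "0 \<le> (1 / \<rho>) * (\<rho> * Wr y + l * exp (l * y))" "0 \<le> 1 / \<rho> * (2 * Bv) + 2 * (Bv / \<rho>)"
        using \<rho> l_pos Bv r_nonneg by (auto intro!: add_nonneg_nonneg mult_nonneg_nonneg)
      show ?case
      proof (intro allI impI)
        fix q assume q: "0 \<le> q" "q \<le> x"
        show "\<bar>Wr (x - y) * ur (x - q) / ur x - Wr (x - y - q)\<bar>
       \<le> (1 / \<rho> * (2 * Bv) + 2 * (Bv / \<rho>) + (1 / \<rho>) * (\<rho> * Wr y + l * exp (l * y))) * 1"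
        proof (cases "q \<le> x - y")
          case True
          have eq1: "exp (- \<rho> * q) \<le> 1" using \<rho> q by simp
          have 1: "\<bar>exp (- \<rho> * q) * \<epsilon> x\<bar> \<le> 1 * Bv" unfolding abs_mult
            using eq1 \<epsilon>_le by (intro mult_mono) auto
          have 2: "\<bar>exp (- \<rho> * q) * D (x - y)\<bar> \<le> 1 * (Bv / \<rho>)" unfolding abs_mult
            using eq1 D_le D_nonneg by (intro mult_mono) auto
          have "\<bar>Wr (x - y) / ur x * (\<epsilon> (x - q) - exp (- \<rho> * q) * \<epsilon> x)\<bar> \<le> 1 / \<rho> * (2 * Bv)"
            unfolding abs_mult using R 1 \<epsilon>_le[of "x - q"] \<rho> by (intro mult_mono) auto
          moreover have "\<bar>D (x - y - q) - exp (- \<rho> * q) * D (x - y)\<bar> \<le> 2 * (Bv / \<rho>)"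
            using 2 D_le[of "x - y - q"] D_nonneg[of "x - y - q"] by linarith
          moreover have "\<bar>A\<bar> \<le> a \<Longrightarrow> \<bar>B\<bar> \<le> b \<Longrightarrow> 0 \<le> c \<Longrightarrow> \<bar>A + B\<bar> \<le> (a + b + c) * 1" for A B a b c :: real
            by (rule order_trans[OF abs_triangle_ineq]) simp
          ultimately show ?thesis unfolding B_eq[OF q(1) True] using nn(1) by blast
        next
          case False
          then have "Wr (x - y - q) = 0" by (intro r_neg) auto
          moreover have "Wr (x - y) / ur x * ur (x - q) \<le> (1 / \<rho>) * (\<rho> * Wr y + l * exp (l * y))"
            using R False r_nonneg \<rho> by (intro mult_mono ur_le) auto
          moreover have "0 \<le> Wr (x - y) / ur x * ur (x - q)" using R r_nonneg by (intro mult_nonneg_nonneg) auto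
          ultimately show ?thesis using nn by simp
        qed
      qed
    qed
    show "0 \<le> 1 / \<rho> * (2 * Bv) + 2 * (Bv / \<rho>) + (1 / \<rho>) * (\<rho> * Wr y + l * exp (l * y))"
      using \<rho> l_pos Bv r_nonneg by (auto intro!: add_nonneg_nonneg mult_nonneg_nonneg)
    show "integrable lborel (\<lambda>q. 1 * p q)"
    proof (rule F_tail_integrable[OF _ _ p])
      have "(\<integral>\<^sup>+z. (\<integral>\<^sup>+q. ennreal 1 * indicator {0..<z} q \<partial>lborel) \<partial>F) = (\<integral>\<^sup>+z. ennreal z \<partial>F)"
        by (intro nn_integral_cong_AE eventually_mono[OF F_pos]) simp
      also have "\<dots> = ennreal m" unfolding m_def using F_nonneg by (intro nn_integral_eq_integral F_mean) auto
      finally show "(\<integral>\<^sup>+z. (\<integral>\<^sup>+q. ennreal 1 * indicator {0..<z} q \<partial>lborel) \<partial>F) < \<infinity>" by simp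
    qed auto
    show "((\<lambda>x. p x * Wr (x - y) / ur x) \<longlongrightarrow> 0) at_top"
    proof (rule Lim_null_comparison)
      show "\<forall>\<^sub>F x in at_top. norm (p x * Wr (x - y) / ur x) \<le> K * measure F {x<..} * (1 / \<rho>)"
        using eventually_ge_at_top[of 0]
      proof eventually_elim
        case (elim x)
        have "p x * (Wr (x - y) / ur x) \<le> K * measure F {x<..} * (1 / \<rho>)"
          using R[OF elim] p(1)[of x] p(2)[of x] by (intro mult_mono) auto
        moreover have "0 \<le> p x * (Wr (x - y) / ur x)" using R[OF elim] p by (intro mult_nonneg_nonneg) auto
        ultimately show ?case by simp
      qed
      have "((\<lambda>x. K * measure F {x<..} * (1 / \<rho>)) \<longlongrightarrow> K * 0 * (1 / \<rho>)) at_top"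
        by (intro tendsto_intros measure_tail_tendsto_0)
      then show "((\<lambda>x. K * measure F {x<..} * (1 / \<rho>)) \<longlongrightarrow> 0) at_top" by simp
    qed
  qed (use p y in auto)
  also have "(\<integral>q. (k - exp (- \<rho> * q) * k) * p q \<partial>lborel) = (\<integral>q. k * ((1 - exp (- \<rho> * q)) * p q) \<partial>lborel)"
    by (simp add: algebra_simps)
  also have "l * \<dots> = l / (l * m - 1) * (\<integral>q. (1 - exp (- \<rho> * q)) * p q \<partial>lborel)" by (simp add: k_def)
  finally show "((\<lambda>x. payoff p x y) \<longlongrightarrow> l / (l * (\<integral>y. y \<partial>F) - 1) * (\<integral>q. (1 - exp (- \<rho> * q)) * p q \<partial>lborel)) at_top"
    by (simp add: m_def)
qed


text \<open>Here \<open>W\<close> converges to \<open>c = 1 / (1 - l m)\<close>, whereas \<open>u\<close> decays like \<open>exp (- \<gamma> x)\<close>, so that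
  \<open>u (x - q) / u x \<rightarrow> exp (\<gamma> q)\<close>.\<close>

theorem payoff_limit_cramer:
  fixes p :: "real \<Rightarrow> real"
  assumes \<rho>: "\<rho> = 0" and \<gamma>: "0 < \<gamma>" and F_exp: "integrable F (\<lambda>y. exp (\<gamma> * y))"
    and root: "l * ((\<integral>y. exp (\<gamma> * y) \<partial>F) - 1) = \<gamma>"
    and F_exp_mean: "integrable F (\<lambda>y. y * exp (\<gamma> * y))" and F_mean: "integrable F (\<lambda>y. y)"
    and drift: "l * (\<integral>y. y \<partial>F) < 1"
    and [measurable]: "p \<in> borel_measurable borel"
    and p: "\<And>q. 0 \<le> p q" "\<And>q. p q \<le> K * measure F {q<..}" "\<And>q. q < 0 \<Longrightarrow> p q = 0"
    and y: "0 \<le> y"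
  shows "\<forall>\<^sub>F x in at_top. 0 < ur x"
    and "((\<lambda>x. payoff p x y) \<longlongrightarrow> l / (l * (\<integral>y. y \<partial>F) - 1) * (\<integral>q. (1 - exp (\<gamma> * q)) * p q \<partial>lborel)) at_top"
proof -
  define m where "m = (\<integral>y. y \<partial>F)"
  define k where "k = 1 / (l * m - 1)"
  have inner0: "(\<integral>\<^sup>+x. ennreal (exp (\<gamma> * x)) * indicator {0..<z} x \<partial>lborel) = ennreal ((exp (\<gamma> * z) - 1) / \<gamma>)" if "0 < z" for z
  proof -
    have "(\<integral>\<^sup>+x. ennreal (exp (\<gamma> * x)) * indicator {0..<z} x \<partial>lborel) = (\<integral>\<^sup>+x. ennreal (exp (\<gamma> * x)) * indicator {0..z} x \<partial>lborel)"
      by (intro nn_integral_cong_AE eventually_mono[OF AE_lborel_singleton[of z]]) (auto split: split_indicator)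
    also have "\<dots> = exp (\<gamma> * z) / \<gamma> - exp (\<gamma> * 0) / \<gamma>"
      by (intro nn_integral_FTC_Icc) (use that \<gamma> in \<open>auto intro!: derivative_eq_intros\<close>)
    finally show ?thesis by (simp add: diff_divide_distrib)
  qed
  \<comment> \<open>The equation for \<gamma> in integrated form. It gives the tilted density mass
    one, and it is also the moment that makes \<open>exp (\<gamma> * q)\<close> integrable against a
    payoff.\<close>
  have tail_mass: "(\<integral>\<^sup>+z. (\<integral>\<^sup>+x. ennreal (exp (\<gamma> * x)) * indicator {0..<z} x \<partial>lborel) \<partial>F) = ennreal (1 / l)"
  proof -
    have "(\<integral>\<^sup>+z. (\<integral>\<^sup>+x. ennreal (exp (\<gamma> * x)) * indicator {0..<z} x \<partial>lborel) \<partial>F) = (\<integral>\<^sup>+z. ennreal ((exp (\<gamma> * z) - 1) / \<gamma>) \<partial>F)"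
      by (intro nn_integral_cong_AE eventually_mono[OF F_pos] inner0)
    also have "\<dots> = ennreal (\<integral>z. (exp (\<gamma> * z) - 1) / \<gamma> \<partial>F)"
      using F_exp \<gamma> by (intro nn_integral_eq_integral) (auto intro!: eventually_mono[OF F_pos] divide_nonneg_pos)
    also have "(\<integral>z. (exp (\<gamma> * z) - 1) / \<gamma> \<partial>F) = ((\<integral>y. exp (\<gamma> * y) \<partial>F) - 1) / \<gamma>"
      using F_exp by (simp add: F.prob_space[simplified])
    also have "\<dots> = 1 / l" using l_pos \<gamma> root by (simp add: field_simps)
    finally show ?thesis .
  qed
  have mass: "(\<integral>\<^sup>+x. ennreal (exp (\<gamma> * x)) * g x \<partial>lborel) = 1"
    by (subst nn_integral_g_mult) (use l_pos in \<open>simp_all add: \<rho> tail_mass ennreal_mult[symmetric]\<close>)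
  have mean: "(\<integral>\<^sup>+x. ennreal (x * exp (\<gamma> * x)) * g x \<partial>lborel) < \<infinity>"
  proof -
    have eq: "(\<integral>\<^sup>+x. ennreal (x * exp (\<gamma> * x)) * g x \<partial>lborel) = ennreal l * (\<integral>\<^sup>+z. (\<integral>\<^sup>+x. ennreal (x * exp (\<gamma> * x)) * indicator {0..<z} x \<partial>lborel) \<partial>F)"
      by (subst nn_integral_g_mult) (simp_all add: \<rho>)
    have "(\<integral>\<^sup>+z. (\<integral>\<^sup>+x. ennreal (x * exp (\<gamma> * x)) * indicator {0..<z} x \<partial>lborel) \<partial>F) \<le> (\<integral>\<^sup>+z. ennreal (z * exp (\<gamma> * z) / \<gamma>) \<partial>F)"
    proof (intro nn_integral_mono_AE eventually_mono[OF F_pos])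
      fix z :: real assume z: "0 < z"
      have "(\<integral>\<^sup>+x. ennreal (x * exp (\<gamma> * x)) * indicator {0..<z} x \<partial>lborel) \<le> (\<integral>\<^sup>+x. ennreal z * (ennreal (exp (\<gamma> * x)) * indicator {0..<z} x) \<partial>lborel)"
        using z by (intro nn_integral_mono) (auto simp: ennreal_mult[symmetric] intro!: ennreal_leI split: split_indicator)
      also have "\<dots> = ennreal z * ennreal ((exp (\<gamma> * z) - 1) / \<gamma>)"
        by (subst nn_integral_cmult) (use inner0[OF z] in auto)
      also have "\<dots> \<le> ennreal (z * exp (\<gamma> * z) / \<gamma>)"
        using z \<gamma> by (simp add: ennreal_mult[symmetric] divide_simps)
      finally show "(\<integral>\<^sup>+x. ennreal (x * exp (\<gamma> * x)) * indicator {0..<z} x \<partial>lborel) \<le> ennreal (z * exp (\<gamma> * z) / \<gamma>)" .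
    qed
    also have "(\<integral>\<^sup>+z. ennreal (z * exp (\<gamma> * z) / \<gamma>) \<partial>F) = ennreal (\<integral>z. z * exp (\<gamma> * z) / \<gamma> \<partial>F)"
      using F_exp_mean \<gamma> by (intro nn_integral_eq_integral) (auto intro!: eventually_mono[OF F_pos])
    also have "\<dots> < \<infinity>" by simp
    finally show ?thesis unfolding eq by (simp add: ennreal_mult_less_top)
  qed
  interpret R: renewal_density "\<lambda>x. exp (\<gamma> * x) * gr x" "\<lambda>x. exp (\<gamma> * x) * vr x" "\<rho> + \<gamma>"
    by (rule exponentially_tilted_renewal) (use mass mean \<gamma> in auto)
  \<comment> \<open>The tilted renewal density. Only positivity of its limit matters: the value
    \<open>L\<close> cancels in \<open>u (x - q) / u x\<close>.\<close>
  define \<nu> where "\<nu> x = exp (\<gamma> * x) * vr x" for x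
  define L where "L = 1 / R.\<mu>"
  have L: "0 < L" using R.\<beta>_times_\<mu> R.\<mu>_nonneg by (cases "R.\<mu> = 0") (auto simp: L_def)
  have \<nu>_lim: "(\<nu> \<longlongrightarrow> L) at_top" using R.renewal_density_limit by (simp add: \<nu>_def[abs_def] L_def)
  obtain Bv where "0 < Bv" "\<And>x. exp (\<gamma> * x) * vr x \<le> Bv" using R.v_bounded by metis
  then have Bv: "0 < Bv" "\<And>x. \<nu> x \<le> Bv" by (auto simp: \<nu>_def)
  have \<nu>_nonneg: "0 \<le> \<nu> x" for x by (simp add: \<nu>_def r_nonneg)
  have u\<nu>: "ur x = exp (- \<gamma> * x) * \<nu> x" for x
  proof -
    have "ur x = vr x" by (subst ur_eq) (use \<rho> in simp)
    then show ?thesis by (simp add: \<nu>_def exp_minus)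
  qed

  have exp_int: "integrable lborel (\<lambda>t. exp (- \<gamma> * t) * indicator {0..} t)"
    using has_bochner_integral_exp_decay[OF \<gamma>] by (simp add: has_bochner_integral_iff)
  have u_int: "integrable lborel ur"
  proof (rule Bochner_Integration.integrable_bound)
    show "integrable lborel (\<lambda>t. Bv * (exp (- \<gamma> * t) * indicator {0..} t))" using exp_int by simp
    show "AE t in lborel. norm (ur t) \<le> norm (Bv * (exp (- \<gamma> * t) * indicator {0..} t))"
    proof (intro AE_I2)
      show "norm (ur t) \<le> norm (Bv * (exp (- \<gamma> * t) * indicator {0..} t))" for t
      proof (cases "t < 0")
        case False
        then show ?thesis using Bv \<nu>_nonneg by (simp add: abs_mult u\<nu> mult.commute)
      qed (simp add: r_neg)
    qed
  qed measurable
  have g_total: "(\<integral>\<^sup>+x. g x \<partial>lborel) = ennreal (l * m)"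
  proof -
    have "(\<integral>\<^sup>+x. 1 * g x \<partial>lborel) = ennreal l * (\<integral>\<^sup>+z. (\<integral>\<^sup>+x. indicator {0..<z} x \<partial>lborel) \<partial>F)"
      by (subst nn_integral_g_mult) (simp_all add: \<rho>)
    also have "(\<integral>\<^sup>+z. (\<integral>\<^sup>+x. indicator {0..<z} x \<partial>(lborel :: real measure)) \<partial>F) = (\<integral>\<^sup>+z. ennreal z \<partial>F)"
      by (intro nn_integral_cong_AE eventually_mono[OF F_pos]) simp
    also have "\<dots> = ennreal m" unfolding m_def using F_nonneg by (intro nn_integral_eq_integral F_mean) auto
    finally show ?thesis using l_pos by (simp add: ennreal_mult')
  qed
  have m_nonneg: "0 \<le> m" unfolding m_def using F_nonneg by (intro integral_nonneg_AE) auto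
  define c where "c = 1 + (\<integral>x. ur x \<partial>lborel)"
  \<comment> \<open>\<open>c\<close> is the limit of \<open>W\<close>. Integrating the renewal
    equation over the line makes the mass \<open>c - 1\<close> of \<open>v\<close> a solution of
    \<open>c - 1 = l * m + l * m * (c - 1)\<close>, which is solvable because
    \<open>l * m < 1\<close>.\<close>
  have c: "c = - k"
  proof -
    have Iu: "(\<integral>\<^sup>+x. u x \<partial>lborel) = ennreal (c - 1)"
      unfolding c_def using nn_integral_eq_integral[OF u_int] r_nonneg by (simp add: ennreal_r)
    have uv: "u = v" by (rule ext, subst u_def) (use \<rho> in simp)
    have "(\<integral>\<^sup>+x. v x \<partial>lborel) = (\<integral>\<^sup>+x. g x + conv g v x \<partial>lborel)"
      by (intro nn_integral_cong v_renewal)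
    also have "\<dots> = (\<integral>\<^sup>+x. g x \<partial>lborel) + (\<integral>\<^sup>+x. g x \<partial>lborel) * (\<integral>\<^sup>+x. v x \<partial>lborel)"
      by (subst nn_integral_add) (auto simp: nn_integral_conv)
    finally have "ennreal (c - 1) = ennreal (l * m) + ennreal (l * m) * ennreal (c - 1)"
      unfolding g_total using Iu by (simp add: uv)
    moreover have n: "0 \<le> c - 1" unfolding c_def using r_nonneg by simp
    ultimately have "ennreal (c - 1) = ennreal (l * m + l * m * (c - 1))"
      using l_pos m_nonneg by (simp add: ennreal_mult)
    then have "c - 1 = l * m + l * m * (c - 1)" using n l_pos m_nonneg by (subst (asm) ennreal_inj) auto
    then show ?thesis using drift by (simp add: k_def m_def[symmetric] field_simps)
  qed
  have W_le: "Wr x \<le> c" for x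
  proof (cases "0 \<le> x")
    case True
    have "(\<integral>y. ur y * indicator {..x} y \<partial>lborel) \<le> (\<integral>y. ur y \<partial>lborel)"
      using r_nonneg by (intro integral_mono ur_locally_integrable u_int) (auto split: split_indicator)
    then show ?thesis using Wr_integral[OF True] by (simp add: c_def)
  next
    case False
    then show ?thesis using r_nonneg by (simp add: r_neg c_def add_nonneg_nonneg)
  qed
  have W_lim: "(Wr \<longlongrightarrow> c) at_top"
  proof -
    have "((\<lambda>x. \<integral>y. ur y * indicator {..x} y \<partial>lborel) \<longlongrightarrow> (\<integral>y. ur y \<partial>lborel)) at_top"
    proof (rule integral_dominated_convergence_at_top[where w=ur])
      show "AE z in lborel. ((\<lambda>x. ur z * indicator {..x} z) \<longlongrightarrow> ur z) at_top"
      proof (intro AE_I2 tendsto_eventually)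
        show "\<forall>\<^sub>F x in at_top. ur z * indicator {..x} z = ur z" for z :: real
          using eventually_ge_at_top[of z] by eventually_elim auto
      qed
      show "\<forall>\<^sub>F x in at_top. AE z in lborel. norm (ur z * indicator {..x} z) \<le> ur z"
        using r_nonneg by (intro always_eventually allI AE_I2) (auto split: split_indicator)
    qed (use u_int in auto)
    then have "((\<lambda>x. 1 + (\<integral>y. ur y * indicator {..x} y \<partial>lborel)) \<longlongrightarrow> c) at_top"
      unfolding c_def by (intro tendsto_intros)
    then show ?thesis
    proof (rule Lim_transform_eventually)
      show "\<forall>\<^sub>F x in at_top. 1 + (\<integral>y. ur y * indicator {..x} y \<partial>lborel) = Wr x"
        using eventually_ge_at_top[of 0] by eventually_elim (rule Wr_integral[symmetric])
    qed
  qed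
  have \<nu>_low: "\<forall>\<^sub>F x in at_top. L / 2 < \<nu> x" using \<nu>_lim L by (intro order_tendstoD) auto
  show pos: "\<forall>\<^sub>F x in at_top. 0 < ur x"
    using \<nu>_low by eventually_elim (use L in \<open>auto simp: u\<nu>\<close>)
  have c0: "0 \<le> c" using W_le[of 0] r_nonneg(1)[of 0] by linarith
  have sh: "filterlim (\<lambda>x. x - z) at_top at_top" for z :: real
    by (rule filterlim_minus_const_at_top[OF filterlim_ident])
  have ratio: "ur (x - q) / ur x = exp (\<gamma> * q) * (\<nu> (x - q) / \<nu> x)" for x q
    by (simp add: u\<nu> algebra_simps exp_diff exp_minus divide_simps)
  have "((\<lambda>x. payoff p x y) \<longlongrightarrow> l * (\<integral>q. (c * exp (\<gamma> * q) - c) * p q \<partial>lborel)) at_top"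
  proof (rule payoff_tendsto[where K=K and e="\<lambda>q. exp (\<gamma> * q)" and D="c * (Bv * (2 / L)) + c"])
    have K: "0 \<le> K" and p_le: "p q \<le> K" for q using tail_bound_constant[OF p(1,2)] by auto
    show "p q \<le> K" for q by (rule p_le)
    show "\<forall>\<^sub>F x in at_top. 0 < ur x" by (rule pos)
    show "((\<lambda>x. Wr (x - y) * ur (x - q) / ur x - Wr (x - y - q)) \<longlongrightarrow> c * exp (\<gamma> * q) - c) at_top" for q
    proof -
      have sh2: "filterlim (\<lambda>x. x - y - q) at_top at_top" using sh[of "y + q"] by (simp add: diff_diff_eq)
      have "((\<lambda>x. Wr (x - y) * (exp (\<gamma> * q) * (\<nu> (x - q) / \<nu> x)) - Wr (x - y - q)) \<longlongrightarrow> c * (exp (\<gamma> * q) * (L / L)) - c) at_top"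
        using L by (intro tendsto_intros \<nu>_lim filterlim_compose[OF W_lim sh] filterlim_compose[OF W_lim sh2] filterlim_compose[OF \<nu>_lim sh]) auto
      then show ?thesis unfolding ratio[symmetric] using L by simp
    qed
    show "\<forall>\<^sub>F x in at_top. \<forall>q. 0 \<le> q \<longrightarrow> q \<le> x \<longrightarrow> \<bar>Wr (x - y) * ur (x - q) / ur x - Wr (x - y - q)\<bar>
       \<le> (c * (Bv * (2 / L)) + c) * exp (\<gamma> * q)"
      using \<nu>_low
    proof eventually_elim
      case (elim x)
      show ?case
      proof (intro allI impI)
        fix q :: real assume q: "0 \<le> q" "q \<le> x"
        have "\<nu> (x - q) / \<nu> x \<le> Bv / (L / 2)"
          using elim L Bv \<nu>_nonneg by (intro frac_le) auto
        moreover have n: "0 \<le> \<nu> (x - q) / \<nu> x" using \<nu>_nonneg by simp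
        ultimately have "Wr (x - y) * (exp (\<gamma> * q) * (\<nu> (x - q) / \<nu> x)) \<le> c * (exp (\<gamma> * q) * (Bv * (2 / L)))"
          using W_le c0 by (intro mult_mono) (auto simp: \<nu>_nonneg)
        moreover have "0 \<le> Wr (x - y) * (exp (\<gamma> * q) * (\<nu> (x - q) / \<nu> x))"
          using n r_nonneg by (intro mult_nonneg_nonneg) auto
        moreover have "Wr (x - y - q) \<le> c * exp (\<gamma> * q)"
        proof -
          have "c * 1 \<le> c * exp (\<gamma> * q)" using c0 q \<gamma> by (intro mult_left_mono) auto
          then show ?thesis using W_le[of "x - y - q"] by simp
        qed
        moreover have "0 \<le> Wr (x - y - q)" by (rule r_nonneg)
        ultimately have "\<bar>Wr (x - y) * (exp (\<gamma> * q) * (\<nu> (x - q) / \<nu> x)) - Wr (x - y - q)\<bar> \<le> c * (exp (\<gamma> * q) * (Bv * (2 / L))) + c * exp (\<gamma> * q)"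
          by linarith
        then show "\<bar>Wr (x - y) * ur (x - q) / ur x - Wr (x - y - q)\<bar> \<le> (c * (Bv * (2 / L)) + c) * exp (\<gamma> * q)"
          unfolding times_divide_eq_right[symmetric] ratio by (simp add: algebra_simps)
      qed
    qed
    show "0 \<le> c * (Bv * (2 / L)) + c" using c0 Bv L by (intro add_nonneg_nonneg mult_nonneg_nonneg) auto
    show "integrable lborel (\<lambda>q. exp (\<gamma> * q) * p q)"
      by (rule F_tail_integrable[OF _ _ p]) (auto simp: tail_mass)
    \<comment> \<open>Now \<open>1 / u x\<close> grows like \<open>exp (\<gamma> * x)\<close>, so
      the plain tail bound is not enough. Since \<open>p x\<close> is bounded by the tail at
      \<open>x\<close>, the product is controlled by the integral of
      \<open>exp (\<gamma> * z)\<close> over \<open>z > x\<close>, the remainder of a convergent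
      integral.\<close>
    show "((\<lambda>x. p x * Wr (x - y) / ur x) \<longlongrightarrow> 0) at_top"
    proof -
      have tail: "((\<lambda>q. \<integral>z. exp (\<gamma> * z) * indicator {q<..} z \<partial>F) \<longlongrightarrow> (\<integral>z. (0 :: real) \<partial>F)) at_top"
      proof (rule integral_dominated_convergence_at_top[where w="\<lambda>z. exp (\<gamma> * z)"])
        show "AE z in F. ((\<lambda>q. exp (\<gamma> * z) * indicator {q<..} z) \<longlongrightarrow> 0) at_top"
        proof (intro AE_I2 tendsto_eventually)
          show "\<forall>\<^sub>F q in at_top. exp (\<gamma> * z) * indicator {q<..} z = 0" for z :: real
            using eventually_ge_at_top[of z] by eventually_elim auto
        qed
        show "\<forall>\<^sub>F q in at_top. AE z in F. norm (exp (\<gamma> * z) * indicator {q<..} z) \<le> exp (\<gamma> * z)"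
          by (intro always_eventually allI AE_I2) (auto split: split_indicator)
      qed (use F_exp in auto)
      show ?thesis
      proof (rule Lim_null_comparison)
        show "\<forall>\<^sub>F x in at_top. norm (p x * Wr (x - y) / ur x) \<le> K * c * (2 / L) * (\<integral>z. exp (\<gamma> * z) * indicator {x<..} z \<partial>F)"
          using \<nu>_low
        proof eventually_elim
          case (elim x)
          have \<nu>x: "0 < \<nu> x" using elim L by linarith
          have "exp (\<gamma> * x) * measure F {x<..} = (\<integral>z. exp (\<gamma> * x) * indicator {x<..} z \<partial>F)" by simp
          also have "\<dots> \<le> (\<integral>z. exp (\<gamma> * z) * indicator {x<..} z \<partial>F)"
            using \<gamma> F_exp by (intro integral_mono integrable_real_mult_indicator) (auto split: split_indicator)
          finally have t: "exp (\<gamma> * x) * measure F {x<..} \<le> (\<integral>z. exp (\<gamma> * z) * indicator {x<..} z \<partial>F)" .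
          have "p x * Wr (x - y) / ur x = exp (\<gamma> * x) * p x * (Wr (x - y) * (1 / \<nu> x))"
            by (simp add: u\<nu> exp_minus field_simps)
          also have "\<dots> \<le> exp (\<gamma> * x) * (K * measure F {x<..}) * (c * (2 / L))"
          proof (intro mult_mono mult_nonneg_nonneg)
            show "1 / \<nu> x \<le> 2 / L" using elim L \<nu>x by (simp add: field_simps)
          qed (use K c0 L p W_le r_nonneg \<nu>x in auto)
          also have "\<dots> = K * c * (2 / L) * (exp (\<gamma> * x) * measure F {x<..})" by simp
          also have "\<dots> \<le> K * c * (2 / L) * (\<integral>z. exp (\<gamma> * z) * indicator {x<..} z \<partial>F)"
            using K c0 L t by (intro mult_left_mono) auto
          finally show ?case using p r_nonneg by simp
        qed
        have "((\<lambda>x. K * c * (2 / L) * (\<integral>z. exp (\<gamma> * z) * indicator {x<..} z \<partial>F)) \<longlongrightarrow> K * c * (2 / L) * (\<integral>z. (0 :: real) \<partial>F)) at_top"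
          by (intro tendsto_intros tail)
        then show "((\<lambda>x. K * c * (2 / L) * (\<integral>z. exp (\<gamma> * z) * indicator {x<..} z \<partial>F)) \<longlongrightarrow> 0) at_top" by simp
      qed
    qed
  qed (use p y in auto)
  also have "(\<integral>q. (c * exp (\<gamma> * q) - c) * p q \<partial>lborel) = (\<integral>q. k * ((1 - exp (\<gamma> * q)) * p q) \<partial>lborel)"
    by (simp add: algebra_simps c)
  also have "l * \<dots> = l / (l * m - 1) * (\<integral>q. (1 - exp (\<gamma> * q)) * p q \<partial>lborel)" by (simp add: k_def)
  finally show "((\<lambda>x. payoff p x y) \<longlongrightarrow> l / (l * (\<integral>y. y \<partial>F) - 1) * (\<integral>q. (1 - exp (\<gamma> * q)) * p q \<partial>lborel)) at_top"
    by (simp add: m_def)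
qed

end


subsection \<open>Arrival times of a Poisson process\<close>

definition counting_path :: "(real \<Rightarrow> nat) \<Rightarrow> bool" where
  "counting_path c \<longleftrightarrow> c 0 = 0 \<and> mono_on {0..} c \<and> (\<forall>t\<ge>0. (c \<longlongrightarrow> c t) (at_right t))"

text \<open>The junk value \<open>-1\<close> marks arrivals that never happen.\<close>

definition arrival :: "(real \<Rightarrow> nat) \<Rightarrow> nat \<Rightarrow> real" where
  "arrival c n = (if \<exists>t\<ge>0. n \<le> c t then Inf {t. 0 \<le> t \<and> n \<le> c t} else -1)"

lemma counting_path_mono: "counting_path c \<Longrightarrow> 0 \<le> s \<Longrightarrow> s \<le> t \<Longrightarrow> c s \<le> c t"
  unfolding counting_path_def by (auto intro: mono_onD)

lemma counting_path_right_constant: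
  assumes "counting_path c" "0 \<le> t"
  obtains d where "t < d" "\<And>s. t \<le> s \<Longrightarrow> s < d \<Longrightarrow> c s = c t"
proof -
  have "(c \<longlongrightarrow> c t) (at_right t)" using assms by (auto simp: counting_path_def)
  then have "\<forall>\<^sub>F s in at_right t. c s = c t" by (simp add: tendsto_discrete)
  then obtain d where "t < d" "\<And>s. t < s \<Longrightarrow> s < d \<Longrightarrow> c s = c t"
    by (auto simp: eventually_at_right_field)
  then show ?thesis by (intro that[of d]) (auto simp: le_less)
qed

text \<open>The infimum is attained: right-continuity of an integer valued path keeps it constant
  just after the infimum, where times with count at least \<open>n\<close> are found. The condition
  \<open>0 \<le> arrival c n\<close> excludes the junk value.\<close>

lemma arrival_le_iff:
  assumes c: "counting_path c" and t: "0 \<le> t"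
  shows "n \<le> c t \<longleftrightarrow> 0 \<le> arrival c n \<and> arrival c n \<le> t"
proof -
  let ?S = "{t. 0 \<le> t \<and> n \<le> c t}"
  have bdd: "bdd_below ?S" by (rule bdd_belowI[of _ 0]) auto
  show ?thesis
  proof
    assume "n \<le> c t"
    with t have "t \<in> ?S" by simp
    then show "0 \<le> arrival c n \<and> arrival c n \<le> t"
      using bdd by (auto simp: arrival_def intro!: cInf_lower cInf_greatest)
  next
    assume a: "0 \<le> arrival c n \<and> arrival c n \<le> t"
    then have ne: "?S \<noteq> {}" by (auto simp: arrival_def split: if_splits)
    then have eq: "arrival c n = Inf ?S" by (auto simp: arrival_def)
    obtain d where d: "arrival c n < d" "\<And>s. arrival c n \<le> s \<Longrightarrow> s < d \<Longrightarrow> c s = c (arrival c n)"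
      using counting_path_right_constant[OF c] a by metis
    obtain s where s: "s \<in> ?S" "s < d" using cInf_lessD[OF ne] d(1) unfolding eq by auto
    have "arrival c n \<le> s" unfolding eq using s bdd by (intro cInf_lower)
    then have "c s = c (arrival c n)" using s(2) by (rule d(2))
    then have "n \<le> c (arrival c n)" using s(1) by simp
    also have "\<dots> \<le> c t" using a by (intro counting_path_mono[OF c]) auto
    finally show "n \<le> c t" .
  qed
qed

lemma arrival_0: "counting_path c \<Longrightarrow> arrival c 0 = 0"
  using arrival_le_iff[of c 0 0] by simp

lemma arrival_cases: "arrival c n = -1 \<or> 0 \<le> arrival c n"
proof (cases "\<exists>t\<ge>0. n \<le> c t")
  case True
  then have "0 \<le> Inf {t. 0 \<le> t \<and> n \<le> c t}" by (intro cInf_greatest) auto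
  then show ?thesis using True by (auto simp: arrival_def)
qed (auto simp: arrival_def)

lemma measurable_arrival:
  assumes N: "\<And>t. 0 \<le> t \<Longrightarrow> N t \<in> M \<rightarrow>\<^sub>M count_space UNIV"
    and c: "\<And>\<omega>. \<omega> \<in> space M \<Longrightarrow> counting_path (\<lambda>t. N t \<omega>)"
  shows "(\<lambda>\<omega>. arrival (\<lambda>t. N t \<omega>) n) \<in> borel_measurable M"
proof (rule borel_measurable_iff_le[THEN iffD2], intro allI)
  fix t :: real
  let ?A = "\<lambda>\<omega>. arrival (\<lambda>t. N t \<omega>) n"
  have ge[measurable]: "{\<omega> \<in> space M. n \<le> N t \<omega>} \<in> sets M" if "0 \<le> t" for t
  proof -
    have "{\<omega> \<in> space M. n \<le> N t \<omega>} = N t -` {n..} \<inter> space M" by auto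
    then show ?thesis using measurable_sets[OF N[OF that], of "{n..}"] by simp
  qed
  \<comment> \<open>By monotonicity an arrival that is missing at all integer times never happens,
    so the junk event is a countable combination.\<close>
  have never: "{\<omega> \<in> space M. ?A \<omega> = -1} = space M - (\<Union>k::nat. {\<omega> \<in> space M. n \<le> N (real k) \<omega>})"
  proof (intro set_eqI iffI)
    fix \<omega> assume "\<omega> \<in> {\<omega> \<in> space M. ?A \<omega> = -1}"
    then show "\<omega> \<in> space M - (\<Union>k::nat. {\<omega> \<in> space M. n \<le> N (real k) \<omega>})"
      using arrival_le_iff[OF c, of \<omega>] by auto
  next
    fix \<omega> assume w: "\<omega> \<in> space M - (\<Union>k::nat. {\<omega> \<in> space M. n \<le> N (real k) \<omega>})"
    have "\<not> 0 \<le> ?A \<omega>"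
    proof
      assume "0 \<le> ?A \<omega>"
      moreover obtain k :: nat where "?A \<omega> \<le> real k" using real_arch_simple by blast
      ultimately have "n \<le> N (real k) \<omega>" using arrival_le_iff[OF c, of \<omega> "real k" n] w by auto
      then show False using w by auto
    qed
    then show "\<omega> \<in> {\<omega> \<in> space M. ?A \<omega> = -1}" using w arrival_cases[of "\<lambda>t. N t \<omega>" n] by auto
  qed
  have never_sets: "{\<omega> \<in> space M. ?A \<omega> = -1} \<in> sets M" unfolding never using ge by auto
  consider "t < -1" | "-1 \<le> t" "t < 0" | "0 \<le> t" by linarith
  then show "{\<omega> \<in> space M. ?A \<omega> \<le> t} \<in> sets M"
  proof cases
    case 1
    have "\<not> ?A \<omega> \<le> t" for \<omega> using 1 arrival_cases[of "\<lambda>t. N t \<omega>" n] by linarith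
    then have eq: "{\<omega> \<in> space M. ?A \<omega> \<le> t} = {}" by blast
    show ?thesis unfolding eq by simp
  next
    case 2
    have "?A \<omega> \<le> t \<longleftrightarrow> ?A \<omega> = -1" for \<omega> using 2 arrival_cases[of "\<lambda>t. N t \<omega>" n] by linarith
    then have eq: "{\<omega> \<in> space M. ?A \<omega> \<le> t} = {\<omega> \<in> space M. ?A \<omega> = -1}" by blast
    show ?thesis unfolding eq by (rule never_sets)
  next
    case 3
    have "?A \<omega> \<le> t \<longleftrightarrow> ?A \<omega> = -1 \<or> n \<le> N t \<omega>" if "\<omega> \<in> space M" for \<omega>
      using 3 arrival_cases[of "\<lambda>t. N t \<omega>" n] unfolding arrival_le_iff[OF c[OF that] 3, of n] by linarith
    then have eq: "{\<omega> \<in> space M. ?A \<omega> \<le> t} = {\<omega> \<in> space M. ?A \<omega> = -1} \<union> {\<omega> \<in> space M. n \<le> N t \<omega>}" by blast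
    show ?thesis unfolding eq using never_sets ge[OF 3] by (rule sets.Un)
  qed
qed

section \<open>The joint density of the first arrival times\<close>

definition prev :: "(nat \<Rightarrow> real) \<Rightarrow> nat \<Rightarrow> real" where
  "prev t i = (if i = 0 then 0 else t (i - 1))"

definition arrival_cone :: "nat \<Rightarrow> (nat \<Rightarrow> real) set" where
  "arrival_cone n = {t. \<forall>i<n. prev t i < t i}"

text \<open>Vectors are indexed from 0, so \<open>t i\<close> is arrival number \<open>i + 1\<close>
  and the last of \<open>n\<close> arrivals is \<open>prev t n\<close>, which is correctly 0 for
  \<open>n = 0\<close>.\<close>

definition arrival_density :: "real \<Rightarrow> nat \<Rightarrow> (nat \<Rightarrow> real) \<Rightarrow> ennreal" where
  "arrival_density l n t = ennreal (l ^ n * exp (- l * prev t n)) * indicator (arrival_cone n) t"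

definition arrival_box :: "nat \<Rightarrow> (nat \<Rightarrow> real) \<Rightarrow> (nat \<Rightarrow> real) \<Rightarrow> (nat \<Rightarrow> real) set" where
  "arrival_box n a b = {t \<in> space (Pi\<^sub>M {..<n} (\<lambda>_. borel)). \<forall>i<n. a i < t i \<and> t i \<le> b i}"

text \<open>Consecutive intervals may touch but not overlap, which forces the coordinates to
  increase. Weak inequalities keep degenerate boxes in the family, so that it is closed under
  intersection.\<close>

definition ordered_box :: "nat \<Rightarrow> (nat \<Rightarrow> real) \<Rightarrow> (nat \<Rightarrow> real) \<Rightarrow> bool" where
  "ordered_box n a b \<longleftrightarrow> 0 \<le> a 0 \<and> (\<forall>i<n. a i \<le> b i) \<and> (\<forall>i. Suc i < n \<longrightarrow> b i \<le> a (Suc i))"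

abbreviation arrival_law :: "real \<Rightarrow> nat \<Rightarrow> (nat \<Rightarrow> real) measure" where
  "arrival_law l n \<equiv> density (Pi\<^sub>M {..<n} (\<lambda>_. lborel)) (arrival_density l n)"

lemma sets_PiM_lborel: "sets (Pi\<^sub>M I (\<lambda>_. lborel :: real measure)) = sets (Pi\<^sub>M I (\<lambda>_. borel))"
  by (intro sets_PiM_cong) auto

lemma space_PiM_lborel: "space (Pi\<^sub>M I (\<lambda>_. lborel :: real measure)) = space (Pi\<^sub>M I (\<lambda>_. borel))"
  by (simp add: space_PiM)

lemma measurable_coordinate: "i < n \<Longrightarrow> (\<lambda>t. t i) \<in> borel_measurable (Pi\<^sub>M {..<n} (\<lambda>_. borel :: real measure))"
  by (rule measurable_component_singleton) auto

lemma measurable_prev: "i \<le> n \<Longrightarrow> (\<lambda>t. prev t i) \<in> borel_measurable (Pi\<^sub>M {..<n} (\<lambda>_. borel :: real measure))"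
  unfolding prev_def by (cases i) (auto intro: measurable_coordinate)

lemma cone_sets: "{t \<in> space (Pi\<^sub>M {..<n} (\<lambda>_. borel)). t \<in> arrival_cone n} \<in> sets (Pi\<^sub>M {..<n} (\<lambda>_. borel))"
proof -
  have "{t \<in> space (Pi\<^sub>M {..<n} (\<lambda>_. borel)). \<forall>i\<in>{..<n}. prev t i < t i} \<in> sets (Pi\<^sub>M {..<n} (\<lambda>_. borel))"
    by (intro sets.sets_Collect_finite_All borel_measurable_less measurable_coordinate measurable_prev) auto
  then show ?thesis by (simp only: arrival_cone_def mem_Collect_eq lessThan_iff Ball_def)
qed

lemma measurable_arrival_density: "arrival_density l n \<in> borel_measurable (Pi\<^sub>M {..<n} (\<lambda>_. borel))"
proof -
  have "{t \<in> space (Pi\<^sub>M {..<n} (\<lambda>_. borel :: real measure)). t \<in> arrival_cone n} = arrival_cone n \<inter> space (Pi\<^sub>M {..<n} (\<lambda>_. borel))"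
    by blast
  then have "(indicator (arrival_cone n) :: _ \<Rightarrow> ennreal) \<in> borel_measurable (Pi\<^sub>M {..<n} (\<lambda>_. borel :: real measure))"
    using cone_sets[of n] by (simp add: borel_measurable_indicator_iff)
  moreover note measurable_prev[OF order_refl, of n]
  ultimately show ?thesis unfolding arrival_density_def by measurable
qed

lemma box_sets: "arrival_box n a b \<in> sets (Pi\<^sub>M {..<n} (\<lambda>_. borel))"
proof -
  have "{t \<in> space (Pi\<^sub>M {..<n} (\<lambda>_. borel)). \<forall>i\<in>{..<n}. a i < t i \<and> t i \<le> b i} \<in> sets (Pi\<^sub>M {..<n} (\<lambda>_. borel))"
    by (intro sets.sets_Collect_finite_All sets.sets_Collect_conj borel_measurable_less borel_measurable_le measurable_coordinate) auto
  then show ?thesis by (simp only: arrival_box_def mem_Collect_eq lessThan_iff Ball_def)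
qed

lemma box_cone: "ordered_box n a b \<Longrightarrow> arrival_box n a b \<subseteq> arrival_cone n"
proof
  fix t assume o: "ordered_box n a b" and t: "t \<in> arrival_box n a b"
  show "t \<in> arrival_cone n" unfolding arrival_cone_def prev_def
  proof (intro CollectI allI impI)
    fix i assume i: "i < n"
    show "(if i = 0 then 0 else t (i - 1)) < t i"
    proof (cases i)
      case 0
      then show ?thesis using t o i by (auto simp: arrival_box_def ordered_box_def intro: order.strict_trans1)
    next
      case (Suc j)
      then have "t j \<le> b j" "b j \<le> a i" "a i < t i" using t o i by (auto simp: arrival_box_def ordered_box_def)
      then show ?thesis using Suc by simp
    qed
  qed
qed

text \<open>Separate consecutive coordinates by rationals: the number chosen after
  \<open>t j\<close> serves as \<open>b j\<close> and as the next \<open>a\<close>. The optional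
  bound \<open>q\<close> yields the half spaces \<open>{w. w i < q}\<close>. The update
  \<open>a(n:=0)\<close> matters for \<open>n = 0\<close> only: a member of the empty product is
  undefined everywhere, while \<open>ordered_box\<close> asks for
  \<open>0 \<le> a 0\<close>.\<close>

lemma rational_box:
  assumes t: "t \<in> space (Pi\<^sub>M {..<n} (\<lambda>_. borel))" "t \<in> arrival_cone n" and q: "i < n \<Longrightarrow> t i < q"
  obtains a b where "a \<in> Pi\<^sub>E {..<n} (\<lambda>_. \<rat>)" "b \<in> Pi\<^sub>E {..<n} (\<lambda>_. \<rat>)" "ordered_box n (a(n:=0)) b" "t \<in> arrival_box n (a(n:=0)) b" "i < n \<Longrightarrow> b i < q"
proof -
  have "\<exists>r\<in>\<rat>. t j < r \<and> (Suc j < n \<longrightarrow> r < t (Suc j)) \<and> (j = i \<and> i < n \<longrightarrow> r < q)" if j: "j < n" for j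
  proof -
    define hi where "hi = min (if Suc j < n then t (Suc j) else t j + 1) (if j = i \<and> i < n then q else t j + 1)"
    have "t j < t (Suc j)" if "Suc j < n" using t(2) that by (auto simp: arrival_cone_def prev_def dest!: spec[of _ "Suc j"])
    then have "t j < hi" using q by (auto simp: hi_def)
    from Rats_dense_in_real[OF this] obtain r where "r \<in> \<rat>" "t j < r" "r < hi" by auto
    then show ?thesis by (auto simp: hi_def split: if_splits intro!: bexI[of _ r])
  qed
  then obtain r where r: "\<And>j. j < n \<Longrightarrow> r j \<in> \<rat> \<and> t j < r j \<and> (Suc j < n \<longrightarrow> r j < t (Suc j)) \<and> (j = i \<and> i < n \<longrightarrow> r j < q)"
    by metis
  define a where "a = (\<lambda>j\<in>{..<n}. if j = 0 then 0 else r (j - 1))"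
  define b where "b = restrict r {..<n}"
  have t0: "0 < t 0" if "0 < n" using t(2) that by (auto simp: arrival_cone_def prev_def dest!: spec[of _ 0])
  have at: "a j < t j \<and> t j \<le> b j" if "j < n" for j
    using r[of j] r[of "j - 1"] t0 that by (cases j) (auto simp: a_def b_def)
  show ?thesis
  proof (rule that[of a b])
    show "a \<in> Pi\<^sub>E {..<n} (\<lambda>_. \<rat>)" "b \<in> Pi\<^sub>E {..<n} (\<lambda>_. \<rat>)"
      using r by (auto simp: a_def b_def intro!: PiE_I)
    have "b j \<le> a (Suc j)" if "Suc j < n" for j using that by (simp add: a_def b_def)
    moreover have "a j \<le> b j" if "j < n" for j using at[OF that] by linarith
    ultimately show "ordered_box n (a(n:=0)) b" unfolding ordered_box_def by (auto simp: a_def)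
    show "t \<in> arrival_box n (a(n:=0)) b" using t at by (auto simp: arrival_box_def)
    show "i < n \<Longrightarrow> b i < q" using r[of i] by (simp add: b_def)
  qed
qed

text \<open>The four properties that the uniqueness theorem for measures asks of a generator, for
  the trace of the product sigma algebra on the cone.\<close>

lemma sigma_boxes:
  fixes n :: nat
  defines "\<Omega> \<equiv> {t \<in> space (Pi\<^sub>M {..<n} (\<lambda>_. borel :: real measure)). t \<in> arrival_cone n}"
    and "\<E> \<equiv> {arrival_box n a b | a b. ordered_box n a b}"
  shows "sets (restrict_space (Pi\<^sub>M {..<n} (\<lambda>_. borel :: real measure)) \<Omega>) = sigma_sets \<Omega> \<E>"
    and "\<E> \<subseteq> Pow \<Omega>"
    and "\<exists>\<A>. countable \<A> \<and> \<A> \<subseteq> \<E> \<and> \<Union>\<A> = \<Omega>"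
    and "Int_stable \<E>"
proof -
  let ?P = "Pi\<^sub>M {..<n} (\<lambda>_. borel :: real measure)"
  have \<Omega>: "\<Omega> \<in> sets ?P" unfolding \<Omega>_def by (rule cone_sets)
  have \<Omega>_sub: "\<Omega> \<subseteq> space ?P" by (auto simp: \<Omega>_def)
  show sub: "\<E> \<subseteq> Pow \<Omega>"
  proof
    fix X assume "X \<in> \<E>"
    then obtain a b where "X = arrival_box n a b" "ordered_box n a b" by (auto simp: \<E>_def)
    then show "X \<in> Pow \<Omega>" using box_cone[of n a b] by (auto simp: \<Omega>_def arrival_box_def)
  qed
  define R where "R = {(a, b). a \<in> Pi\<^sub>E {..<n} (\<lambda>_. \<rat>) \<and> b \<in> Pi\<^sub>E {..<n} (\<lambda>_. \<rat>) \<and> ordered_box n (a(n:=0)) b}"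
  have R: "countable R"
  proof (rule countable_subset)
    show "R \<subseteq> Pi\<^sub>E {..<n} (\<lambda>_. \<rat>) \<times> Pi\<^sub>E {..<n} (\<lambda>_. \<rat>)" by (auto simp: R_def)
    show "countable (Pi\<^sub>E {..<n} (\<lambda>_. \<rat> :: real set) \<times> Pi\<^sub>E {..<n} (\<lambda>_. \<rat> :: real set))"
      by (intro countable_SIGMA countable_PiE) (auto intro: countable_rat)
  qed
  show "\<exists>\<A>. countable \<A> \<and> \<A> \<subseteq> \<E> \<and> \<Union>\<A> = \<Omega>"
  proof (intro exI conjI)
    let ?A = "(\<lambda>(a, b). arrival_box n (a(n:=0)) b) ` R"
    show "countable ?A" using R by auto
    show AE: "?A \<subseteq> \<E>" by (auto simp: R_def \<E>_def)
    show "\<Union>?A = \<Omega>"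
    proof
      show "\<Union>?A \<subseteq> \<Omega>" using AE sub by blast
      show "\<Omega> \<subseteq> \<Union>?A"
      proof
        fix t assume "t \<in> \<Omega>"
        then have "t \<in> space ?P" "t \<in> arrival_cone n" by (auto simp: \<Omega>_def)
        then obtain a b where "a \<in> Pi\<^sub>E {..<n} (\<lambda>_. \<rat>)" "b \<in> Pi\<^sub>E {..<n} (\<lambda>_. \<rat>)" "ordered_box n (a(n:=0)) b" "t \<in> arrival_box n (a(n:=0)) b"
          by (rule rational_box[where i=n and q=0]) auto
        then show "t \<in> \<Union>?A" by (auto simp: R_def intro!: bexI[of _ "(a, b)"])
      qed
    qed
  qed
  \<comment> \<open>Once the coordinates are measurable for the sigma algebra of boxes, so is the
    identity into the product space, and every trace belongs to it. The set
    \<open>{w. w i < q}\<close> is the union of the rational boxes with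
    \<open>b i < q\<close>.\<close>
  have coord: "(\<lambda>t. t i) \<in> borel_measurable (sigma \<Omega> \<E>)" if i: "i < n" for i
  proof (rule borel_measurable_iff_less[THEN iffD2], intro allI)
    fix q :: real
    let ?A = "(\<lambda>(a, b). arrival_box n (a(n:=0)) b) ` {(a, b) \<in> R. b i < q}"
    have "{w \<in> space (sigma \<Omega> \<E>). w i < q} = \<Union>?A"
    proof
      show "{w \<in> space (sigma \<Omega> \<E>). w i < q} \<subseteq> \<Union>?A"
      proof
        fix t assume "t \<in> {w \<in> space (sigma \<Omega> \<E>). w i < q}"
        then have "t \<in> space ?P" "t \<in> arrival_cone n" "i < n \<Longrightarrow> t i < q" using sub by (auto simp: \<Omega>_def)
        then obtain a b where "a \<in> Pi\<^sub>E {..<n} (\<lambda>_. \<rat>)" "b \<in> Pi\<^sub>E {..<n} (\<lambda>_. \<rat>)" "ordered_box n (a(n:=0)) b"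
          "t \<in> arrival_box n (a(n:=0)) b" "i < n \<Longrightarrow> b i < q"
          by (rule rational_box[where i=i and q=q]) auto
        then show "t \<in> \<Union>?A" using i by (auto simp: R_def intro!: bexI[of _ "(a, b)"])
      qed
      show "\<Union>?A \<subseteq> {w \<in> space (sigma \<Omega> \<E>). w i < q}"
      proof
        fix t assume "t \<in> \<Union>?A"
        then obtain a b where ab: "(a, b) \<in> R" "b i < q" "t \<in> arrival_box n (a(n:=0)) b" by auto
        then have "arrival_box n (a(n:=0)) b \<in> \<E>" by (auto simp: R_def \<E>_def)
        then have "t \<in> \<Omega>" using sub ab by auto
        moreover have "t i < q" using ab i by (auto simp: arrival_box_def intro: order.strict_trans1)
        ultimately show "t \<in> {w \<in> space (sigma \<Omega> \<E>). w i < q}" using sub by simp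
      qed
    qed
    also have "\<dots> \<in> sets (sigma \<Omega> \<E>)"
    proof (rule sets.countable_Union)
      show "countable ?A" by (intro countable_image countable_subset[OF _ R]) auto
      have "?A \<subseteq> \<E>" by (auto simp: R_def \<E>_def)
      then show "?A \<subseteq> sets (sigma \<Omega> \<E>)" using sub by auto
    qed
    finally show "{w \<in> space (sigma \<Omega> \<E>). w i < q} \<in> sets (sigma \<Omega> \<E>)" .
  qed
  have id: "(\<lambda>t. t) \<in> sigma \<Omega> \<E> \<rightarrow>\<^sub>M ?P"
  proof (rule measurable_PiM_single')
    show "\<And>i. i \<in> {..<n} \<Longrightarrow> (\<lambda>t. t i) \<in> borel_measurable (sigma \<Omega> \<E>)" using coord by auto
    show "(\<lambda>t. t) \<in> space (sigma \<Omega> \<E>) \<rightarrow> (\<Pi>\<^sub>E i\<in>{..<n}. space borel)"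
      using \<Omega>_sub sub by (auto simp: space_PiM)
  qed
  show "sets (restrict_space ?P \<Omega>) = sigma_sets \<Omega> \<E>"
  proof
    show "sets (restrict_space ?P \<Omega>) \<subseteq> sigma_sets \<Omega> \<E>"
    proof
      fix X assume "X \<in> sets (restrict_space ?P \<Omega>)"
      then obtain A where A: "A \<in> sets ?P" "X = \<Omega> \<inter> A" by (auto simp: sets_restrict_space)
      have "(\<lambda>t. t) -` A \<inter> space (sigma \<Omega> \<E>) \<in> sets (sigma \<Omega> \<E>)" using id A(1) by (rule measurable_sets)
      then show "X \<in> sigma_sets \<Omega> \<E>" using A sub by (simp add: Int_commute)
    qed
    have "\<E> \<subseteq> sets (restrict_space ?P \<Omega>)"
    proof
      fix X assume X: "X \<in> \<E>"
      then have "X \<in> sets ?P" "X \<subseteq> \<Omega>" using sub by (auto simp: \<E>_def box_sets)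
      then show "X \<in> sets (restrict_space ?P \<Omega>)" by (auto simp: sets_restrict_space image_iff intro!: bexI[of _ X])
    qed
    then show "sigma_sets \<Omega> \<E> \<subseteq> sets (restrict_space ?P \<Omega>)"
      using sets.sigma_sets_subset[of \<E> "restrict_space ?P \<Omega>"] \<Omega>_sub by (simp add: space_restrict_space Int_absorb2)
  qed
  show "Int_stable \<E>"
  proof (rule Int_stableI)
    fix X Y assume "X \<in> \<E>" "Y \<in> \<E>"
    then obtain a b a' b' where X: "X = arrival_box n a b" "ordered_box n a b" and Y: "Y = arrival_box n a' b'" "ordered_box n a' b'"
      by (auto simp: \<E>_def)
    let ?a = "\<lambda>i. max (a i) (a' i)" and ?b = "\<lambda>i. min (b i) (b' i)"
    have eq: "X \<inter> Y = arrival_box n ?a ?b" unfolding X Y by (auto simp: arrival_box_def)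
    show "X \<inter> Y \<in> \<E>"
    proof (cases "\<forall>i<n. ?a i \<le> ?b i")
      case True
      have "ordered_box n ?a ?b" unfolding ordered_box_def
      proof (intro conjI allI impI)
        show "0 \<le> ?a 0" using X by (auto simp: ordered_box_def)
        show "i < n \<Longrightarrow> ?a i \<le> ?b i" for i using True by blast
        show "?b i \<le> ?a (Suc i)" if "Suc i < n" for i
        proof -
          have "b i \<le> a (Suc i)" using X(2) that by (auto simp: ordered_box_def)
          then show ?thesis by (auto simp: min_def max_def)
        qed
      qed
      then show ?thesis unfolding eq \<E>_def by blast
    next
      case False
      then obtain i where i: "i < n" "?b i < ?a i" by (auto simp: not_le)
      have "t \<notin> arrival_box n ?a ?b" for t
      proof
        assume "t \<in> arrival_box n ?a ?b"
        then have "?a i < t i" "t i \<le> ?b i" using i(1) by (auto simp: arrival_box_def simp del: max_less_iff_conj min.bounded_iff)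
        then show False using i(2) by linarith
      qed
      \<comment> \<open>An empty intersection has to be presented as an ordered box; the box with
        both ends 1 is ordered and empty since \<open>i < n\<close> exists.\<close>
      moreover have "t \<notin> arrival_box n (\<lambda>_. 1) (\<lambda>_. 1)" for t using i(1) by (auto simp: arrival_box_def intro!: exI[of _ i])
      ultimately have "arrival_box n ?a ?b = arrival_box n (\<lambda>_. 1) (\<lambda>_. 1)" by blast
      moreover have "ordered_box n (\<lambda>_. 1) (\<lambda>_. 1)" by (auto simp: ordered_box_def)
      ultimately show ?thesis unfolding eq \<E>_def by blast
    qed
  qed
qed


lemma cone_Suc: "t \<in> arrival_cone (Suc n) \<longleftrightarrow> t \<in> arrival_cone n \<and> prev t n < t n"
  by (auto simp: arrival_cone_def less_Suc_eq)

text \<open>The density of \<open>n + 1\<close> arrivals depends only on the last one, so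
  substituting \<open>prev x n + e\<close> for it splits off an exponential factor in
  \<open>e\<close>. This is where the gaps become exponential and independent of the past.\<close>

lemma nn_integral_arrival_law_Suc:
  assumes l: "0 < l" and \<Psi>[measurable]: "\<Psi> \<in> borel_measurable (Pi\<^sub>M {..<n} (\<lambda>_. borel) \<Otimes>\<^sub>M borel)"
  shows "(\<integral>\<^sup>+t. \<Psi> (restrict t {..<n}, t n - prev t n) \<partial>arrival_law l (Suc n))
       = (\<integral>\<^sup>+t. (\<integral>\<^sup>+e. \<Psi> (t, e) \<partial>density lborel (exponential_density l)) \<partial>arrival_law l n)"
proof -
  interpret L: product_sigma_finite "\<lambda>_::nat. lborel :: real measure" ..
  have lS: "{..<Suc n} = insert n {..<n}" by auto
  have m1: "(\<lambda>t. restrict t {..<n}) \<in> Pi\<^sub>M {..<Suc n} (\<lambda>_. borel) \<rightarrow>\<^sub>M Pi\<^sub>M {..<n} (\<lambda>_. borel :: real measure)"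
    by (rule measurable_restrict_subset) auto
  have m2: "(\<lambda>t. t n - prev t n) \<in> borel_measurable (Pi\<^sub>M {..<Suc n} (\<lambda>_. borel :: real measure))"
    by (intro borel_measurable_diff measurable_coordinate measurable_prev) auto
  have \<Psi>': "(\<lambda>t. \<Psi> (restrict t {..<n}, t n - prev t n)) \<in> borel_measurable (Pi\<^sub>M {..<Suc n} (\<lambda>_. borel))"
    using measurable_compose[OF measurable_Pair[OF m1 m2] \<Psi>] .
  have mS: "borel_measurable (Pi\<^sub>M I (\<lambda>_. lborel :: real measure)) = borel_measurable (Pi\<^sub>M I (\<lambda>_. borel))" for I :: "nat set"
    by (rule measurable_cong_sets) (auto simp: sets_PiM_lborel)
  have dm: "arrival_density l k \<in> borel_measurable (Pi\<^sub>M {..<k} (\<lambda>_. lborel))" for k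
    unfolding mS by (rule measurable_arrival_density)
  have \<Psi>e: "(\<lambda>t. (\<integral>\<^sup>+e. \<Psi> (t, e) \<partial>density lborel (exponential_density l))) \<in> borel_measurable (Pi\<^sub>M {..<n} (\<lambda>_. borel))"
  proof -
    have "(\<lambda>t. (\<integral>\<^sup>+e. ennreal (exponential_density l e) * \<Psi> (t, e) \<partial>lborel)) \<in> borel_measurable (Pi\<^sub>M {..<n} (\<lambda>_. borel))"
      by measurable
    also have "(\<lambda>t. (\<integral>\<^sup>+e. ennreal (exponential_density l e) * \<Psi> (t, e) \<partial>lborel)) x = (\<integral>\<^sup>+e. \<Psi> (x, e) \<partial>density lborel (exponential_density l))"
      if "x \<in> space (Pi\<^sub>M {..<n} (\<lambda>_. borel))" for x
      using that by (subst nn_integral_density) auto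
    then have "((\<lambda>t. (\<integral>\<^sup>+e. ennreal (exponential_density l e) * \<Psi> (t, e) \<partial>lborel)) \<in> borel_measurable (Pi\<^sub>M {..<n} (\<lambda>_. borel))) \<longleftrightarrow>
      ((\<lambda>t. (\<integral>\<^sup>+e. \<Psi> (t, e) \<partial>density lborel (exponential_density l))) \<in> borel_measurable (Pi\<^sub>M {..<n} (\<lambda>_. borel)))"
      by (intro measurable_cong)
    finally show ?thesis .
  qed
  have "(\<integral>\<^sup>+t. \<Psi> (restrict t {..<n}, t n - prev t n) \<partial>arrival_law l (Suc n))
    = (\<integral>\<^sup>+t. arrival_density l (Suc n) t * \<Psi> (restrict t {..<n}, t n - prev t n) \<partial>Pi\<^sub>M {..<Suc n} (\<lambda>_. lborel))"
    using \<Psi>' by (intro nn_integral_density dm) (simp only: mS)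
  also have "\<dots> = (\<integral>\<^sup>+x. (\<integral>\<^sup>+y. arrival_density l (Suc n) (x(n:=y)) * \<Psi> (restrict (x(n:=y)) {..<n}, (x(n:=y)) n - prev (x(n:=y)) n) \<partial>lborel) \<partial>Pi\<^sub>M {..<n} (\<lambda>_. lborel))"
    unfolding lS
  proof (rule L.product_nn_integral_insert)
    show "(\<lambda>t. arrival_density l (Suc n) t * \<Psi> (restrict t {..<n}, t n - prev t n)) \<in> borel_measurable (Pi\<^sub>M (insert n {..<n}) (\<lambda>_. lborel))"
      unfolding lS[symmetric] using \<Psi>' by (intro borel_measurable_times_ennreal dm) (simp only: mS)
  qed auto
  also have "\<dots> = (\<integral>\<^sup>+x. arrival_density l n x * (\<integral>\<^sup>+e. \<Psi> (x, e) \<partial>density lborel (exponential_density l)) \<partial>Pi\<^sub>M {..<n} (\<lambda>_. lborel))"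
  proof (rule nn_integral_cong)
    fix x assume x: "x \<in> space (Pi\<^sub>M {..<n} (\<lambda>_. lborel :: real measure))"
    then have xb: "x \<in> space (Pi\<^sub>M {..<n} (\<lambda>_. borel :: real measure))" by (simp add: space_PiM_lborel)
    have xr: "restrict (x(n:=y)) {..<n} = x" for y
      using xb by (auto simp: space_PiM PiE_def extensional_def fun_eq_iff restrict_def)
    have xp: "prev (x(n:=y)) i = prev x i" if "i \<le> n" for y i using that by (auto simp: prev_def)
    have xc: "x(n:=y) \<in> arrival_cone n \<longleftrightarrow> x \<in> arrival_cone n" for y by (auto simp: arrival_cone_def xp)
    have \<Psi>x: "(\<lambda>e. \<Psi> (x, e)) \<in> borel_measurable borel" using xb by measurable
    let ?p = "prev x n"
    have "(\<integral>\<^sup>+y. arrival_density l (Suc n) (x(n:=y)) * \<Psi> (restrict (x(n:=y)) {..<n}, (x(n:=y)) n - prev (x(n:=y)) n) \<partial>lborel)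
      = (\<integral>\<^sup>+y. indicator (arrival_cone n) x * ennreal (l ^ Suc n * exp (- l * y)) * indicator {?p<..} y * \<Psi> (x, y - ?p) \<partial>lborel)"
      by (intro nn_integral_cong) (auto simp: arrival_density_def cone_Suc xc xr xp prev_def[of _ "Suc n"] split: split_indicator)
    also have "\<dots> = (\<integral>\<^sup>+e. indicator (arrival_cone n) x * ennreal (l ^ Suc n * exp (- l * (?p + e))) * indicator {0<..} e * \<Psi> (x, e) \<partial>lborel)"
      using \<Psi>x by (subst nn_integral_real_affine[where c=1 and t="?p"]) (auto intro!: nn_integral_cong split: split_indicator)
    also have "\<dots> = (\<integral>\<^sup>+e. arrival_density l n x * (ennreal (exponential_density l e) * \<Psi> (x, e)) \<partial>lborel)"
    proof (intro nn_integral_cong_AE eventually_mono[OF AE_lborel_singleton[of 0]])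
      fix e :: real assume e: "e \<noteq> 0"
      have "l ^ Suc n * exp (- l * (?p + e)) = l ^ n * exp (- l * ?p) * (l * exp (- e * l))"
        by (simp add: distrib_left exp_add[symmetric] exp_diff exp_minus field_simps)
      then have "ennreal (l ^ Suc n * exp (- l * (?p + e))) = ennreal (l ^ n * exp (- l * ?p)) * ennreal (l * exp (- e * l))"
        using l by (simp only:) (subst ennreal_mult[symmetric]; simp)
      then show "indicator (arrival_cone n) x * ennreal (l ^ Suc n * exp (- l * (?p + e))) * indicator {0<..} e * \<Psi> (x, e)
        = arrival_density l n x * (ennreal (exponential_density l e) * \<Psi> (x, e))"
        using e by (auto simp: arrival_density_def exponential_density_def mult.assoc split: split_indicator)
    qed
    also have "\<dots> = arrival_density l n x * (\<integral>\<^sup>+e. ennreal (exponential_density l e) * \<Psi> (x, e) \<partial>lborel)"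
      using \<Psi>x by (intro nn_integral_cmult) auto
    also have "(\<integral>\<^sup>+e. ennreal (exponential_density l e) * \<Psi> (x, e) \<partial>lborel) = (\<integral>\<^sup>+e. \<Psi> (x, e) \<partial>density lborel (exponential_density l))"
      using \<Psi>x by (subst nn_integral_density) auto
    finally show "(\<integral>\<^sup>+y. arrival_density l (Suc n) (x(n:=y)) * \<Psi> (restrict (x(n:=y)) {..<n}, (x(n:=y)) n - prev (x(n:=y)) n) \<partial>lborel)
      = arrival_density l n x * (\<integral>\<^sup>+e. \<Psi> (x, e) \<partial>density lborel (exponential_density l))" .
  qed
  also have "\<dots> = (\<integral>\<^sup>+t. (\<integral>\<^sup>+e. \<Psi> (t, e) \<partial>density lborel (exponential_density l)) \<partial>arrival_law l n)"
    using \<Psi>e by (intro nn_integral_density[symmetric] dm) (simp only: mS)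
  finally show ?thesis .
qed

lemma emeasure_arrival_law_space:
  assumes l: "0 < l"
  shows "emeasure (arrival_law l n) (space (arrival_law l n)) = 1"
proof (induction n)
  case 0
  interpret L: product_sigma_finite "\<lambda>_::nat. lborel :: real measure" ..
  have "emeasure (arrival_law l 0) (space (arrival_law l 0)) = (\<integral>\<^sup>+t. 1 \<partial>arrival_law l 0)" by simp
  also have "\<dots> = (\<integral>\<^sup>+t. arrival_density l 0 t * 1 \<partial>Pi\<^sub>M {..<0} (\<lambda>_. lborel))"
    using measurable_arrival_density[of l 0]
    by (intro nn_integral_density) (auto cong: measurable_cong_sets simp: sets_PiM_lborel)
  also have "\<dots> = 1" by (simp add: PiM_empty arrival_density_def arrival_cone_def prev_def)
  finally show ?case .
next
  case (Suc n)
  interpret X: prob_space "density lborel (exponential_density l)" by (rule prob_space_exponential_density[OF l])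
  have "emeasure (arrival_law l (Suc n)) (space (arrival_law l (Suc n))) = (\<integral>\<^sup>+t. 1 \<partial>arrival_law l (Suc n))" by simp
  also have "\<dots> = (\<integral>\<^sup>+t. (\<integral>\<^sup>+e. 1 \<partial>density lborel (exponential_density l)) \<partial>arrival_law l n)"
    using nn_integral_arrival_law_Suc[OF l, of "\<lambda>_. 1" n] by simp
  also have "\<dots> = (\<integral>\<^sup>+t. 1 \<partial>arrival_law l n)"
    by (intro nn_integral_cong) (simp only: nn_integral_const X.emeasure_space_1, simp)
  also have "\<dots> = 1" using Suc.IH by simp
  finally show ?case .
qed

text \<open>On an ordered box the cone condition is automatic and the density involves only the last
  coordinate, so the integral is a product: lengths for the first \<open>k\<close> coordinates, an
  exponential integral for the last.\<close>

lemma emeasure_arrival_law_box: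
  assumes l: "0 < l" and o: "ordered_box (Suc k) a b"
  shows "emeasure (arrival_law l (Suc k)) (arrival_box (Suc k) a b)
    = ennreal ((\<Prod>i<k. l * (b i - a i)) * (exp (- l * a k) - exp (- l * b k)))"
proof -
  interpret L: product_sigma_finite "\<lambda>_::nat. lborel :: real measure" ..
  define f where "f i t = (if i < k then ennreal l else ennreal (l * exp (- l * t))) * indicator {a i<..b i} t" for i t
  have [measurable]: "f i \<in> borel_measurable borel" for i unfolding f_def[abs_def] by (cases "i < k") auto
  have ab: "a i \<le> b i" if "i \<le> k" for i using o that by (auto simp: ordered_box_def)
  have "emeasure (arrival_law l (Suc k)) (arrival_box (Suc k) a b)
    = (\<integral>\<^sup>+t. arrival_density l (Suc k) t * indicator (arrival_box (Suc k) a b) t \<partial>Pi\<^sub>M {..<Suc k} (\<lambda>_. lborel))"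
    using box_sets[of "Suc k" a b] measurable_arrival_density[of l "Suc k"]
    by (intro emeasure_density) (auto cong: measurable_cong_sets simp: sets_PiM_lborel)
  also have "\<dots> = (\<integral>\<^sup>+t. (\<Prod>i\<in>{..<Suc k}. f i (t i)) \<partial>Pi\<^sub>M {..<Suc k} (\<lambda>_. lborel))"
  proof (rule nn_integral_cong)
    fix t assume t: "t \<in> space (Pi\<^sub>M {..<Suc k} (\<lambda>_. lborel :: real measure))"
    show "arrival_density l (Suc k) t * indicator (arrival_box (Suc k) a b) t = (\<Prod>i\<in>{..<Suc k}. f i (t i))"
    proof (cases "t \<in> arrival_box (Suc k) a b")
      case True
      then have "(\<Prod>i\<in>{..<k}. f i (t i)) = (\<Prod>i\<in>{..<k}. ennreal l)"
        by (intro prod.cong) (auto simp: f_def arrival_box_def)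
      then have "(\<Prod>i\<in>{..<Suc k}. f i (t i)) = ennreal l ^ k * ennreal (l * exp (- l * t k))"
        using True by (simp add: f_def arrival_box_def)
      also have "\<dots> = ennreal (l ^ Suc k * exp (- l * t k))"
        using l by (simp add: ennreal_power ennreal_mult[symmetric] ac_simps)
      finally show ?thesis using True box_cone[OF o] by (auto simp: arrival_density_def prev_def)
    next
      case False
      then obtain i where "i < Suc k" "\<not> (a i < t i \<and> t i \<le> b i)"
        using t by (auto simp: arrival_box_def space_PiM_lborel)
      then have "\<exists>i\<in>{..<Suc k}. f i (t i) = 0" by (intro bexI[of _ i]) (auto simp: f_def)
      then have "(\<Prod>i\<in>{..<Suc k}. f i (t i)) = 0" by (intro prod_zero) auto
      then show ?thesis using False by simp
    qed
  qed
  also have "\<dots> = (\<Prod>i\<in>{..<Suc k}. integral\<^sup>N lborel (f i))"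
    by (intro L.product_nn_integral_prod) auto
  also have "\<dots> = (\<Prod>i<k. ennreal (l * (b i - a i))) * ennreal (exp (- l * a k) - exp (- l * b k))"
  proof -
    have "integral\<^sup>N lborel (f i) = ennreal (l * (b i - a i))" if "i < k" for i
      using that l ab[of i] by (simp add: f_def[abs_def] nn_integral_cmult ennreal_mult')
    moreover have "integral\<^sup>N lborel (f k) = ennreal (exp (- l * a k) - exp (- l * b k))"
    proof -
      have "integral\<^sup>N lborel (f k) = (\<integral>\<^sup>+t. ennreal (l * exp (- l * t)) * indicator {a k..b k} t \<partial>lborel)"
        by (intro nn_integral_cong_AE eventually_mono[OF AE_lborel_singleton[of "a k"]]) (auto simp: f_def split: split_indicator)
      also have "\<dots> = ennreal (- exp (- l * b k) - (- exp (- l * a k)))"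
        by (intro nn_integral_FTC_Icc) (use l ab[of k] in \<open>auto intro!: derivative_eq_intros\<close>)
      finally show ?thesis by simp
    qed
    ultimately show ?thesis by simp
  qed
  also have "\<dots> = ennreal ((\<Prod>i<k. l * (b i - a i)) * (exp (- l * a k) - exp (- l * b k)))"
    using l ab by (subst prod_ennreal) (auto simp: ennreal_mult'' intro!: prod_nonneg)
  finally show ?thesis .
qed

section \<open>Identification of the arrival times of a Poisson process\<close>

locale poisson_arrivals = prob_space M for M :: "'a measure" +
  fixes N :: "real \<Rightarrow> 'a \<Rightarrow> nat" and l :: real
  assumes poisson: "poisson_process M l N" and l_pos: "0 < l"
begin

definition T :: "nat \<Rightarrow> 'a \<Rightarrow> real" where "T n \<omega> = arrival (\<lambda>t. N t \<omega>) n"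

definition T_vec :: "nat \<Rightarrow> 'a \<Rightarrow> nat \<Rightarrow> real" where "T_vec n \<omega> = (\<lambda>i\<in>{..<n}. T (Suc i) \<omega>)"

lemma N_measurable: "0 \<le> t \<Longrightarrow> N t \<in> M \<rightarrow>\<^sub>M count_space UNIV"
  using poisson by (auto simp: poisson_process_def)

lemma N_path: "\<omega> \<in> space M \<Longrightarrow> counting_path (\<lambda>t. N t \<omega>)"
  using poisson by (auto simp: poisson_process_def counting_path_def)

lemma measurable_T[measurable]: "T n \<in> borel_measurable M"
  unfolding T_def[abs_def] by (intro measurable_arrival N_measurable N_path)

lemma measurable_T_vec[measurable]: "T_vec n \<in> M \<rightarrow>\<^sub>M Pi\<^sub>M {..<n} (\<lambda>_. borel)"
  unfolding T_vec_def[abs_def] by (intro measurable_restrict) auto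

lemma increment_prob:
  assumes "0 \<le> s" "s \<le> t"
  shows "prob {\<omega> \<in> space M. N t \<omega> - N s \<omega> = k} = (l * (t - s)) ^ k / fact k * exp (- (l * (t - s)))"
proof (cases "s < t")
  case True
  have [measurable]: "N t \<in> M \<rightarrow>\<^sub>M count_space UNIV" "N s \<in> M \<rightarrow>\<^sub>M count_space UNIV"
    using assms by (auto intro!: N_measurable)
  have "distr M (count_space UNIV) (\<lambda>\<omega>. N t \<omega> - N s \<omega>) = measure_pmf (poisson_pmf (l * (t - s)))"
    using poisson assms True by (auto simp: poisson_process_def)
  then have "measure (distr M (count_space UNIV) (\<lambda>\<omega>. N t \<omega> - N s \<omega>)) {k} = pmf (poisson_pmf (l * (t - s))) k"
    by (simp add: measure_pmf_single)
  moreover have "measure (distr M (count_space UNIV) (\<lambda>\<omega>. N t \<omega> - N s \<omega>)) {k} = prob {\<omega> \<in> space M. N t \<omega> - N s \<omega> = k}"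
    by (subst measure_distr) (auto intro!: arg_cong[where f=prob])
  ultimately show ?thesis using True l_pos by simp
next
  case False
  then have "s = t" using assms by simp
  then show ?thesis by (cases k) (auto simp: prob_space)
qed

text \<open>For an ordered box, the constraints on the arrival times are constraints on the increments of \<open>N\<close>
  over disjoint intervals. Such boxes are an intersection-stable generator on the cone of increasing
  sequences, which is how the law of the arrival times is identified.\<close>

lemma prob_arrival_box:
  assumes o: "ordered_box (Suc k) a b"
  shows "prob {\<omega> \<in> space M. T_vec (Suc k) \<omega> \<in> arrival_box (Suc k) a b}
    = (\<Prod>i<k. l * (b i - a i)) * (exp (- l * a k) - exp (- l * b k))"
proof -
  \<comment> \<open>Past index \<open>k\<close> both sequences stay at \<open>b k\<close>:
    \<open>poisson_process\<close> asks for a monotone infinite sequence of times.\<close>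
  define a' where "a' i = (if i \<le> k then a i else b k)" for i
  define b' where "b' i = (if i \<le> k then b i else b k)" for i
  have a'b': "a' i \<le> b' i" "b' i \<le> a' (Suc i)" "0 \<le> a' 0" for i
    using o by (auto simp: ordered_box_def a'_def b'_def less_Suc_eq_le dest: le_antisym not_less_eq_eq[THEN iffD1])
  \<comment> \<open>The times \<open>0, a 0, b 0, a 1, b 1, ...\<close>: odd positions hold left
    ends, positive even positions hold right ends.\<close>
  define ts where "ts j = (if j = 0 then 0 else if odd j then a' (j div 2) else b' (j div 2 - 1))" for j
  have ts0: "ts 0 = 0" and ts_odd: "ts (Suc (2 * i)) = a' i" and ts_even: "ts (Suc (Suc (2 * i))) = b' i" for i
    by (auto simp: ts_def)
  have ts_step: "ts j \<le> ts (Suc j)" for j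
  proof (cases "even j")
    case True
    then obtain i where i: "j = 2 * i" by auto
    show ?thesis
    proof (cases i)
      case 0 then show ?thesis using i a'b' ts_odd[of 0] ts0 by simp
    next
      case (Suc i') then show ?thesis using i a'b'(2)[of i'] ts_odd[of i] ts_even[of i'] by simp
    qed
  next
    case False
    then obtain i where i: "j = Suc (2 * i)" by (auto elim!: oddE)
    then show ?thesis using a'b'(1)[of i] by (simp add: ts_odd ts_even)
  qed
  have ts_mono: "mono ts" using ts_step by (auto simp: mono_iff_le_Suc)
  have ts_nonneg: "0 \<le> ts j" for j using monoD[OF ts_mono, of 0 j] ts0 by simp
  define \<Delta> where "\<Delta> j \<omega> = N (ts (Suc j)) \<omega> - N (ts j) \<omega>" for j \<omega>
  \<comment> \<open>Between windows there is no arrival, inside a window exactly one. The last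
    window asks only for at least one, because later arrivals are unconstrained and may fall into it
    too.\<close>
  define S where "S j = (if j = Suc (2 * k) then {1..} else if even j then {0} else {1::nat})" for j
  have ind: "indep_vars (\<lambda>_. count_space UNIV) \<Delta> {..<2 * k + 2}"
    using poisson ts_mono ts0 unfolding poisson_process_def \<Delta>_def[abs_def] by auto
  have Nmono: "N s \<omega> \<le> N t \<omega>" if "\<omega> \<in> space M" "0 \<le> s" "s \<le> t" for s t \<omega>
    using counting_path_mono[OF N_path] that by simp
  have event: "{\<omega> \<in> space M. T_vec (Suc k) \<omega> \<in> arrival_box (Suc k) a b} = (\<Inter>j\<in>{..<2 * k + 2}. \<Delta> j -` S j \<inter> space M)"
  proof (intro set_eqI iffI)
    fix \<omega> assume w: "\<omega> \<in> {\<omega> \<in> space M. T_vec (Suc k) \<omega> \<in> arrival_box (Suc k) a b}"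
    then have \<omega>: "\<omega> \<in> space M" and T: "\<And>i. i \<le> k \<Longrightarrow> a i < T (Suc i) \<omega> \<and> T (Suc i) \<omega> \<le> b i"
      by (auto simp: arrival_box_def T_vec_def)
    have lo: "N (a' i) \<omega> \<le> i" and hi: "Suc i \<le> N (b' i) \<omega>" if "i \<le> k" for i
    proof -
      have ge: "0 \<le> a' i" "0 \<le> b' i" using ts_nonneg[of "Suc (2 * i)"] ts_nonneg[of "Suc (Suc (2 * i))"] by (auto simp: ts_odd ts_even)
      have "\<not> Suc i \<le> N (a' i) \<omega>" using T[OF that] that arrival_le_iff[OF N_path[OF \<omega>] ge(1), of "Suc i"] by (auto simp: T_def a'_def)
      then show "N (a' i) \<omega> \<le> i" by simp
      show "Suc i \<le> N (b' i) \<omega>" using T[OF that] that ge arrival_le_iff[OF N_path[OF \<omega>] ge(2), of "Suc i"] by (auto simp: T_def a'_def b'_def)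
    qed
    have Nb: "N (b' i) \<omega> = Suc i" if "i < k" for i
    proof -
      have "N (b' i) \<omega> \<le> N (a' (Suc i)) \<omega>" using \<omega> a'b' ts_nonneg[of "Suc (Suc (2 * i))"] by (intro Nmono) (auto simp: ts_even)
      also have "\<dots> \<le> Suc i" using lo[of "Suc i"] that by simp
      finally show ?thesis using hi[of i] that by simp
    qed
    have Na: "N (a' i) \<omega> = i" if "i \<le> k" for i
    proof (cases i)
      case 0 then show ?thesis using lo[OF that] by simp
    next
      case (Suc i')
      have "N (b' i') \<omega> \<le> N (a' i) \<omega>" using \<omega> a'b' ts_nonneg[of "Suc (Suc (2 * i'))"] Suc by (intro Nmono) (auto simp: ts_even)
      then show ?thesis using lo[OF that] Nb[of i'] Suc that by simp
    qed
    have N0: "N 0 \<omega> = 0" using N_path[OF \<omega>] by (simp add: counting_path_def)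
    have "\<Delta> j \<omega> \<in> S j" if "j < 2 * k + 2" for j
    proof (cases "even j")
      case True
      then obtain i where i: "j = 2 * i" by auto
      then have "i \<le> k" using that by simp
      show ?thesis
      proof (cases i)
        case 0
        then show ?thesis using i Na[of 0] N0 ts_odd[of 0] by (simp add: \<Delta>_def S_def ts0)
      next
        case (Suc i')
        then have "ts j = b' i'" "ts (Suc j) = a' i" using i ts_even[of i'] ts_odd[of i] by simp_all
        then show ?thesis using i Suc \<open>i \<le> k\<close> Na[of i] Nb[of i'] by (simp add: \<Delta>_def S_def)
      qed
    next
      case False
      then obtain i where i: "j = Suc (2 * i)" by (auto elim!: oddE)
      then have "i \<le> k" using that by simp
      then show ?thesis using i Na[of i] Nb[of i] hi[of i]
        by (cases "i = k") (auto simp: \<Delta>_def S_def ts_odd ts_even)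
    qed
    then show "\<omega> \<in> (\<Inter>j\<in>{..<2 * k + 2}. \<Delta> j -` S j \<inter> space M)" using \<omega> by auto
  next
    fix \<omega> assume w: "\<omega> \<in> (\<Inter>j\<in>{..<2 * k + 2}. \<Delta> j -` S j \<inter> space M)"
    have \<Delta>': "\<omega> \<in> \<Delta> j -` S j \<inter> space M" if "j < 2 * k + 2" for j using w that by (rule_tac INT_D) auto
    have \<omega>: "\<omega> \<in> space M" using \<Delta>'[of 0] by simp
    have \<Delta>: "\<Delta> j \<omega> \<in> S j" if "j < 2 * k + 2" for j using \<Delta>'[OF that] by simp
    have Nts: "N (ts j) \<omega> \<le> N (ts (Suc j)) \<omega>" for j using \<omega> ts_nonneg ts_step by (intro Nmono)
    have N0: "N 0 \<omega> = 0" using N_path[OF \<omega>] by (simp add: counting_path_def)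
    have Na: "i \<le> k \<Longrightarrow> N (a' i) \<omega> = i" for i
    proof (induction i)
      case 0
      then show ?case using \<Delta>[of 0] N0 by (simp add: \<Delta>_def S_def ts0 ts_odd[of 0, simplified])
    next
      case (Suc i)
      have "\<Delta> (Suc (2 * i)) \<omega> = 1" using \<Delta>[of "Suc (2 * i)"] Suc by (simp add: S_def)
      then have b: "N (b' i) \<omega> = Suc i" using Suc Nts[of "Suc (2 * i)"] by (simp add: \<Delta>_def ts_odd ts_even)
      have "\<Delta> (Suc (Suc (2 * i))) \<omega> = 0" using \<Delta>[of "Suc (Suc (2 * i))"] Suc by (simp add: S_def)
      moreover have t: "ts (Suc (Suc (Suc (2 * i)))) = a' (Suc i)" using ts_odd[of "Suc i"] by simp
      ultimately have "N (a' (Suc i)) \<omega> - N (b' i) \<omega> = 0" "N (b' i) \<omega> \<le> N (a' (Suc i)) \<omega>"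
        using Nts[of "Suc (Suc (2 * i))"] unfolding \<Delta>_def t ts_even by auto
      then show ?case using b by linarith
    qed
    have Nb: "Suc i \<le> N (b' i) \<omega>" if "i \<le> k" for i
    proof -
      have "1 \<le> \<Delta> (Suc (2 * i)) \<omega>" using \<Delta>[of "Suc (2 * i)"] that by (auto simp: S_def split: if_splits)
      then show ?thesis using Na[OF that] by (simp add: \<Delta>_def ts_odd ts_even)
    qed
    have "a i < T (Suc i) \<omega> \<and> T (Suc i) \<omega> \<le> b i" if "i \<le> k" for i
    proof -
      have ge: "0 \<le> a' i" "0 \<le> b' i" using ts_nonneg[of "Suc (2 * i)"] ts_nonneg[of "Suc (Suc (2 * i))"] by (auto simp: ts_odd ts_even)
      have "0 \<le> T (Suc i) \<omega> \<and> T (Suc i) \<omega> \<le> b' i"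
        using arrival_le_iff[OF N_path[OF \<omega>] ge(2), of "Suc i"] Nb[OF that] by (simp add: T_def)
      moreover have "\<not> (0 \<le> T (Suc i) \<omega> \<and> T (Suc i) \<omega> \<le> a' i)"
        using arrival_le_iff[OF N_path[OF \<omega>] ge(1), of "Suc i"] Na[OF that] by (simp add: T_def)
      ultimately show ?thesis using that by (auto simp: a'_def b'_def)
    qed
    then show "\<omega> \<in> {\<omega> \<in> space M. T_vec (Suc k) \<omega> \<in> arrival_box (Suc k) a b}"
      using \<omega> by (auto simp: arrival_box_def T_vec_def space_PiM)
  qed
  define P where "P j = prob (\<Delta> j -` S j \<inter> space M)" for j
  have "prob (\<Inter>j\<in>{..<2 * k + 2}. \<Delta> j -` S j \<inter> space M) = (\<Prod>j\<in>{..<2 * k + 2}. P j)"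
    unfolding P_def by (rule indep_varsD[OF ind]) auto
  also have "\<dots> = (\<Prod>j<Suc (2 * k). P j) * P (Suc (2 * k))" by simp
  also have "P (Suc (2 * k)) = 1 - exp (- l * (b k - a k))"
  proof -
    have ab: "0 \<le> a' k" "a' k \<le> b' k" using ts_nonneg[of "Suc (2 * k)"] a'b' by (auto simp: ts_odd)
    have m: "{\<omega> \<in> space M. N (b' k) \<omega> - N (a' k) \<omega> = 0} \<in> events"
    proof -
      have [measurable]: "N (b' k) \<in> M \<rightarrow>\<^sub>M count_space UNIV" "N (a' k) \<in> M \<rightarrow>\<^sub>M count_space UNIV"
        using ab by (auto intro!: N_measurable)
      show ?thesis by measurable
    qed
    have "\<Delta> (Suc (2 * k)) -` S (Suc (2 * k)) \<inter> space M = space M - {\<omega> \<in> space M. N (b' k) \<omega> - N (a' k) \<omega> = 0}"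
      by (auto simp: \<Delta>_def S_def ts_odd ts_even)
    then show ?thesis unfolding P_def using m increment_prob[OF ab, of 0] by (simp add: prob_compl a'_def b'_def)
  qed
  also have "(\<Prod>j<Suc (2 * i). P j) = (\<Prod>i<i. l * (b i - a i)) * exp (- l * a i)" if "i \<le> k" for i
    using that
  proof (induction i)
    case 0
    have "\<Delta> 0 -` S 0 \<inter> space M = {\<omega> \<in> space M. N (a' 0) \<omega> - N 0 \<omega> = 0}"
      by (auto simp: \<Delta>_def S_def ts0 ts_odd[of 0, simplified])
    then show ?case using increment_prob[of 0 "a' 0" 0] a'b'(3) by (simp add: P_def a'_def)
  next
    case (Suc i)
    have ge: "0 \<le> a' i" "0 \<le> b' i" using ts_nonneg[of "Suc (2 * i)"] ts_nonneg[of "Suc (Suc (2 * i))"] by (auto simp: ts_odd ts_even)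
    have "\<Delta> (Suc (2 * i)) -` S (Suc (2 * i)) \<inter> space M = {\<omega> \<in> space M. N (b' i) \<omega> - N (a' i) \<omega> = 1}"
      using Suc.prems by (auto simp: \<Delta>_def S_def ts_odd ts_even)
    then have 1: "P (Suc (2 * i)) = l * (b i - a i) * exp (- (l * (b i - a i)))"
      using increment_prob[OF ge(1) a'b'(1), of 1] Suc.prems by (simp add: P_def a'_def b'_def)
    have "\<Delta> (Suc (Suc (2 * i))) -` S (Suc (Suc (2 * i))) \<inter> space M = {\<omega> \<in> space M. N (a' (Suc i)) \<omega> - N (b' i) \<omega> = 0}"
      using Suc.prems ts_odd[of "Suc i"] by (auto simp: \<Delta>_def S_def ts_even)
    then have 2: "P (Suc (Suc (2 * i))) = exp (- (l * (a (Suc i) - b i)))"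
      using increment_prob[OF ge(2) a'b'(2), of 0] Suc.prems by (simp add: P_def a'_def b'_def)
    have "(\<Prod>j<Suc (2 * Suc i). P j) = (\<Prod>j<Suc (2 * i). P j) * P (Suc (2 * i)) * P (Suc (Suc (2 * i)))"
      by simp
    also have "\<dots> = ((\<Prod>i<i. l * (b i - a i)) * (l * (b i - a i))) * (exp (- l * a i) * exp (- (l * (b i - a i))) * exp (- (l * (a (Suc i) - b i))))"
      using Suc.IH Suc.prems unfolding 1 2 by (simp del: prod.lessThan_Suc)
    also have "exp (- l * a i) * exp (- (l * (b i - a i))) * exp (- (l * (a (Suc i) - b i))) = exp (- l * a (Suc i))"
      by (simp add: exp_add[symmetric] algebra_simps)
    finally show ?case by simp
  qed
  then have "(\<Prod>j<Suc (2 * k). P j) * (1 - exp (- l * (b k - a k))) = (\<Prod>i<k. l * (b i - a i)) * (exp (- l * a k) * (1 - exp (- l * (b k - a k))))"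
    by simp
  also have "exp (- l * a k) * (1 - exp (- l * (b k - a k))) = exp (- l * a k) - exp (- l * b k)"
    by (simp add: right_diff_distrib exp_add[symmetric] algebra_simps)
  finally show ?thesis unfolding event .
qed

end


context poisson_arrivals
begin

lemma emeasure_T_vec_box:
  assumes "ordered_box n a b"
  shows "emeasure (distr M (Pi\<^sub>M {..<n} (\<lambda>_. borel)) (T_vec n)) (arrival_box n a b) = emeasure (arrival_law l n) (arrival_box n a b)"
proof (cases n)
  case 0
  have "arrival_box n a b = space (Pi\<^sub>M {..<n} (\<lambda>_. borel))" by (simp add: arrival_box_def 0)
  moreover have "emeasure (distr M (Pi\<^sub>M {..<n} (\<lambda>_. borel)) (T_vec n)) (space (Pi\<^sub>M {..<n} (\<lambda>_. borel))) = 1"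
  proof -
    have "T_vec n -` space (Pi\<^sub>M {..<n} (\<lambda>_. borel)) \<inter> space M = space M"
      using measurable_space[OF measurable_T_vec] by auto
    then show ?thesis by (simp add: emeasure_distr emeasure_space_1)
  qed
  ultimately show ?thesis using emeasure_arrival_law_space[OF l_pos, of n] by (simp add: space_PiM_lborel)
next
  case (Suc k)
  have "emeasure (distr M (Pi\<^sub>M {..<n} (\<lambda>_. borel)) (T_vec n)) (arrival_box n a b) = emeasure M (T_vec n -` arrival_box n a b \<inter> space M)"
    by (intro emeasure_distr box_sets measurable_T_vec)
  also have "T_vec n -` arrival_box n a b \<inter> space M = {\<omega> \<in> space M. T_vec (Suc k) \<omega> \<in> arrival_box (Suc k) a b}"
    using Suc by auto
  also have "emeasure M \<dots> = ennreal ((\<Prod>i<k. l * (b i - a i)) * (exp (- l * a k) - exp (- l * b k)))"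
    using prob_arrival_box[of k a b] assms Suc by (simp add: emeasure_eq_measure)
  finally show ?thesis using emeasure_arrival_law_box[OF l_pos, of k a b] assms Suc by simp
qed

text \<open>Boxes identify the two laws on the cone only. The explicit law has mass one and its
  density vanishes off the cone, hence the law of \<open>T_vec\<close> also gives the cone mass one;
  this yields equality everywhere and the strict order of the arrivals at once.\<close>

lemma distr_T_vec: "distr M (Pi\<^sub>M {..<n} (\<lambda>_. borel)) (T_vec n) = arrival_law l n"
  and AE_T_vec_cone: "AE \<omega> in M. T_vec n \<omega> \<in> arrival_cone n"
proof -
  let ?P = "Pi\<^sub>M {..<n} (\<lambda>_. borel :: real measure)"
  let ?D = "distr M ?P (T_vec n)"
  let ?L = "arrival_law l n"
  define \<Omega> where "\<Omega> = {t \<in> space ?P. t \<in> arrival_cone n}"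
  have \<Omega>: "\<Omega> \<in> sets ?P" unfolding \<Omega>_def by (rule cone_sets)
  have setsL: "sets ?L = sets ?P" by (simp add: sets_PiM_lborel)
  have spaceL: "space ?L = space ?P" by (simp add: space_PiM_lborel)
  interpret D: prob_space ?D by (rule prob_space_distr) simp
  have L1: "emeasure ?L (space ?P) = 1" using emeasure_arrival_law_space[OF l_pos, of n] by (simp only: spaceL)
  note sb = sigma_boxes[of n, folded \<Omega>_def]
  obtain \<A> where \<A>: "countable \<A>" "\<A> \<subseteq> {arrival_box n a b | a b. ordered_box n a b}" "\<Union>\<A> = \<Omega>" using sb(3) by blast
  have eq: "restrict_space ?D \<Omega> = restrict_space ?L \<Omega>"
  proof (rule measure_eqI_generator_eq_countable[OF sb(4) sb(2) _ _ _ \<A>(2,3,1)])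
    have sets_r: "sets (restrict_space ?D \<Omega>) = sets (restrict_space ?P \<Omega>)" "sets (restrict_space ?L \<Omega>) = sets (restrict_space ?P \<Omega>)"
      using setsL by (simp_all add: sets_restrict_space)
    show "sets (restrict_space ?D \<Omega>) = sigma_sets \<Omega> {arrival_box n a b |a b. ordered_box n a b}"
      "sets (restrict_space ?L \<Omega>) = sigma_sets \<Omega> {arrival_box n a b |a b. ordered_box n a b}"
      unfolding sets_r sb(1) by auto
    fix X assume X: "X \<in> {arrival_box n a b |a b. ordered_box n a b}"
    then have "X \<subseteq> \<Omega>" using sb(2) by auto
    then show "emeasure (restrict_space ?D \<Omega>) X = emeasure (restrict_space ?L \<Omega>) X"
      using X \<Omega> setsL spaceL
      by (subst (1 2) emeasure_restrict_space) (auto simp: emeasure_T_vec_box Int_absorb1 \<Omega>_def)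
  next
    fix X assume "X \<in> \<A>"
    then have "X \<subseteq> \<Omega>" using \<A> by auto
    then show "emeasure (restrict_space ?D \<Omega>) X \<noteq> \<infinity>"
      using \<Omega> by (subst emeasure_restrict_space) (auto simp: Int_absorb1 \<Omega>_def D.emeasure_finite[unfolded infinity_ennreal_def])
  qed
  have on_cone: "emeasure ?D X = emeasure ?L X" if "X \<in> sets ?P" "X \<subseteq> \<Omega>" for X
  proof -
    have "emeasure (restrict_space ?D \<Omega>) X = emeasure ?D X" "emeasure (restrict_space ?L \<Omega>) X = emeasure ?L X"
      using that \<Omega> setsL spaceL by (auto intro!: emeasure_restrict_space simp: Int_absorb1 \<Omega>_def)
    then show ?thesis using eq by simp
  qed
  have L_cone: "emeasure ?L X = emeasure ?L (X \<inter> \<Omega>)" if X: "X \<in> sets ?P" for X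
  proof -
    have dm: "arrival_density l n \<in> borel_measurable (Pi\<^sub>M {..<n} (\<lambda>_. lborel))"
      using measurable_arrival_density[of l n] by (auto cong: measurable_cong_sets simp: sets_PiM_lborel)
    have Xs: "X \<in> sets (Pi\<^sub>M {..<n} (\<lambda>_. lborel))" "X \<inter> \<Omega> \<in> sets (Pi\<^sub>M {..<n} (\<lambda>_. lborel))"
      using X \<Omega> by (auto simp: sets_PiM_lborel)
    show ?thesis
      unfolding emeasure_density[OF dm Xs(1)] emeasure_density[OF dm Xs(2)]
      by (intro nn_integral_cong) (auto simp: arrival_density_def \<Omega>_def space_PiM_lborel split: split_indicator)
  qed
  have D\<Omega>: "emeasure ?D \<Omega> = 1"
    using on_cone[OF \<Omega>] L_cone[of "space ?P"] L1 sets.sets_into_space[OF \<Omega>] by (simp add: Int_absorb1)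
  have AE_D: "AE t in ?D. t \<in> \<Omega>" using D\<Omega> \<Omega> D.prob_eq_1[of \<Omega>] by (simp add: D.emeasure_eq_measure)
  then have "AE \<omega> in M. T_vec n \<omega> \<in> \<Omega>" using \<Omega> by (subst (asm) AE_distr_iff) (auto simp: \<Omega>_def)
  then show "AE \<omega> in M. T_vec n \<omega> \<in> arrival_cone n" by eventually_elim (simp add: \<Omega>_def)
  show "?D = ?L"
  proof (rule measure_eqI)
    fix X assume "X \<in> sets ?D"
    then have X: "X \<in> sets ?P" by simp
    have "emeasure ?D X = emeasure ?D (X \<inter> \<Omega>)"
      using X \<Omega> AE_D by (intro emeasure_eq_AE) (auto elim: eventually_mono)
    also have "\<dots> = emeasure ?L (X \<inter> \<Omega>)" using X \<Omega> by (intro on_cone) auto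
    finally show "emeasure ?D X = emeasure ?L X" using L_cone[OF X] by simp
  qed (simp add: sets_PiM_lborel)
qed

lemma AE_T_increasing: "AE \<omega> in M. \<forall>n. T n \<omega> < T (Suc n) \<omega>"
proof (subst AE_all_countable, intro allI)
  fix n
  show "AE \<omega> in M. T n \<omega> < T (Suc n) \<omega>"
    using AE_T_vec_cone[of "Suc n"] AE_space
  proof eventually_elim
    case (elim \<omega>)
    then have "prev (T_vec (Suc n) \<omega>) n < T_vec (Suc n) \<omega> n" by (auto simp: arrival_cone_def)
    moreover have "prev (T_vec (Suc n) \<omega>) n = T n \<omega>"
      using arrival_0[OF N_path[OF elim(2)]] by (cases n) (auto simp: prev_def T_vec_def T_def)
    ultimately show ?case by (simp add: T_vec_def)
  qed
qed

end

section \<open>The queue: independence of job sizes, arrivals and the past\<close>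

locale mg1_queue = poisson_arrivals M N l for M :: "'a measure" and N l +
  fixes U :: "nat \<Rightarrow> 'a \<Rightarrow> real" and F :: "real measure" and u0 :: real
  assumes U_indep: "indep_vars (\<lambda>_. borel) U {1..}"
    and U_pos: "\<And>n. 1 \<le> n \<Longrightarrow> AE \<omega> in M. 0 < U n \<omega>"
    and U_distr: "\<And>n. 1 \<le> n \<Longrightarrow> distr M borel (U n) = F"
    and UN_indep: "indep_set
           (sets (vimage_algebra (space M) (\<lambda>\<omega>. \<lambda>n\<in>{1..}. U n \<omega>) (Pi\<^sub>M {1..} (\<lambda>_. borel))))
           (sets (vimage_algebra (space M) (\<lambda>\<omega>. \<lambda>t\<in>{0..}. N t \<omega>) (Pi\<^sub>M {0..} (\<lambda>_. count_space UNIV))))"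
    and u0_nonneg: "0 \<le> u0"
begin

lemma U_measurable: "1 \<le> n \<Longrightarrow> U n \<in> borel_measurable M"
  using U_indep by (auto simp: indep_vars_def)

lemma F_sets[simp, measurable_cong]: "sets F = sets borel"
  using U_distr[of 1] by auto

sublocale F: prob_space F
  using U_distr[of 1] U_measurable[of 1] by (metis le_refl prob_space_distr)

lemma F_pos: "AE y in F. 0 < y"
  using U_pos[of 1] U_measurable[of 1] U_distr[of 1] by (subst U_distr[of 1, symmetric]) (auto simp: AE_distr_iff)

definition U_vec :: "nat \<Rightarrow> 'a \<Rightarrow> nat \<Rightarrow> real" where "U_vec n \<omega> = (\<lambda>i\<in>{..<n}. U (Suc i) \<omega>)"

lemma measurable_U_vec[measurable]: "U_vec n \<in> M \<rightarrow>\<^sub>M Pi\<^sub>M {..<n} (\<lambda>_. borel)"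
  unfolding U_vec_def[abs_def] by (intro measurable_restrict U_measurable) auto

lemma distr_U_vec_Suc: "distr M (Pi\<^sub>M {..<Suc n} (\<lambda>_. borel)) (U_vec (Suc n)) = Pi\<^sub>M {..<Suc n} (\<lambda>_. F)"
proof -
  have i: "indep_vars (\<lambda>_. borel) (\<lambda>k. U (Suc k)) {..<Suc n}"
    unfolding indep_vars_def2
  proof (intro conjI ballI indep_setsI)
    show rv: "random_variable borel (U (Suc k))" for k by (intro U_measurable) auto
    show "{U (Suc k) -` A \<inter> space M |A. A \<in> sets borel} \<subseteq> events" for k
      using measurable_sets[OF rv] by auto
    fix A J assume J: "J \<noteq> {}" "J \<subseteq> {..<Suc n}" "finite J" "\<forall>j\<in>J. A j \<in> {U (Suc j) -` A \<inter> space M |A. A \<in> sets borel}"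
    have ind: "indep_sets (\<lambda>i. {U i -` A \<inter> space M |A. A \<in> sets borel}) {1..}"
      using U_indep by (auto simp: indep_vars_def2)
    have "prob (\<Inter>j\<in>Suc ` J. A (j - 1)) = (\<Prod>j\<in>Suc ` J. prob (A (j - 1)))"
      by (rule indep_setsD[OF ind]) (use J in auto)
    then show "prob (\<Inter>j\<in>J. A j) = (\<Prod>j\<in>J. prob (A j))" by (simp add: prod.reindex image_image)
  qed
  have "distr M (Pi\<^sub>M {..<Suc n} (\<lambda>_. borel)) (\<lambda>x. \<lambda>k\<in>{..<Suc n}. U (Suc k) x) = Pi\<^sub>M {..<Suc n} (\<lambda>k. distr M borel (U (Suc k)))"
    using i U_measurable by (subst (asm) indep_vars_iff_distr_eq_PiM') auto
  then show ?thesis by (simp add: U_vec_def[abs_def] U_distr)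
qed

abbreviation "N_algebra \<equiv> vimage_algebra (space M) (\<lambda>\<omega>. \<lambda>t\<in>{0..}. N t \<omega>) (Pi\<^sub>M {0..} (\<lambda>_. count_space UNIV))"

lemma measurable_N_algebra:
  assumes t: "0 \<le> t"
  shows "N t \<in> N_algebra \<rightarrow>\<^sub>M count_space UNIV"
proof -
  have m: "(\<lambda>\<omega>. \<lambda>t\<in>{0..}. N t \<omega>) \<in> N_algebra \<rightarrow>\<^sub>M Pi\<^sub>M {0..} (\<lambda>_. count_space UNIV)"
    by (rule measurable_vimage_algebra1) (auto simp: space_PiM)
  have "(\<lambda>\<omega>. (\<lambda>t\<in>{0..}. N t \<omega>) t) \<in> N_algebra \<rightarrow>\<^sub>M count_space UNIV"
    by (rule measurable_compose[OF m measurable_component_singleton]) (use t in auto)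
  then show ?thesis using t by simp
qed

text \<open>Stated for any variable that is measurable over the arrival process:
  \<open>T_vec\<close> is one instance, the count \<open>N 1\<close> is needed for the moments of
  the netput.\<close>

lemma indep_U_vec_N:
  assumes Z: "Z \<in> N_algebra \<rightarrow>\<^sub>M S" and [measurable]: "Z \<in> M \<rightarrow>\<^sub>M S"
  shows "distr M (Pi\<^sub>M {..<n} (\<lambda>_. borel) \<Otimes>\<^sub>M S) (\<lambda>\<omega>. (U_vec n \<omega>, Z \<omega>))
   = distr M (Pi\<^sub>M {..<n} (\<lambda>_. borel)) (U_vec n) \<Otimes>\<^sub>M distr M S Z"
proof -
  let ?MU = "vimage_algebra (space M) (\<lambda>\<omega>. \<lambda>n\<in>{1..}. U n \<omega>) (Pi\<^sub>M {1..} (\<lambda>_. borel))"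
  have U': "U i \<in> borel_measurable ?MU" if "1 \<le> i" for i
  proof -
    have m: "(\<lambda>\<omega>. \<lambda>n\<in>{1..}. U n \<omega>) \<in> ?MU \<rightarrow>\<^sub>M Pi\<^sub>M {1..} (\<lambda>_. borel)"
      by (rule measurable_vimage_algebra1) (auto simp: space_PiM)
    have "(\<lambda>\<omega>. (\<lambda>n\<in>{1..}. U n \<omega>) i) \<in> borel_measurable ?MU"
      by (rule measurable_compose[OF m measurable_component_singleton]) (use that in auto)
    then show ?thesis using that by simp
  qed
  have Uv: "U_vec n \<in> ?MU \<rightarrow>\<^sub>M Pi\<^sub>M {..<n} (\<lambda>_. borel)"
    unfolding U_vec_def[abs_def] by (intro measurable_restrict U') auto
  interpret DU: prob_space "distr M (Pi\<^sub>M {..<n} (\<lambda>_. borel)) (U_vec n)" by (rule prob_space_distr) simp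
  interpret DZ: prob_space "distr M S Z" by (rule prob_space_distr) simp
  show ?thesis
  proof (rule pair_measure_eqI[symmetric, OF DU.sigma_finite_measure_axioms DZ.sigma_finite_measure_axioms])
    show "sets (distr M (Pi\<^sub>M {..<n} (\<lambda>_. borel)) (U_vec n) \<Otimes>\<^sub>M distr M S Z)
      = sets (distr M (Pi\<^sub>M {..<n} (\<lambda>_. borel) \<Otimes>\<^sub>M S) (\<lambda>\<omega>. (U_vec n \<omega>, Z \<omega>)))"
      by (simp cong: sets_pair_measure_cong)
    fix A B assume "A \<in> sets (distr M (Pi\<^sub>M {..<n} (\<lambda>_. borel)) (U_vec n))" "B \<in> sets (distr M S Z)"
    then have [measurable]: "A \<in> sets (Pi\<^sub>M {..<n} (\<lambda>_. borel))" "B \<in> sets S" by auto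
    have "U_vec n -` A \<inter> space M \<in> sets ?MU" "Z -` B \<inter> space M \<in> sets N_algebra"
      using measurable_sets[OF Uv, of A] measurable_sets[OF Z, of B] by simp_all
    then have "prob ((U_vec n -` A \<inter> space M) \<inter> (Z -` B \<inter> space M)) = prob (U_vec n -` A \<inter> space M) * prob (Z -` B \<inter> space M)"
      by (rule indep_setD[OF UN_indep])
    moreover have "(\<lambda>\<omega>. (U_vec n \<omega>, Z \<omega>)) -` (A \<times> B) \<inter> space M = (U_vec n -` A \<inter> space M) \<inter> (Z -` B \<inter> space M)" by auto
    ultimately show "emeasure (distr M (Pi\<^sub>M {..<n} (\<lambda>_. borel)) (U_vec n)) A * emeasure (distr M S Z) B
      = emeasure (distr M (Pi\<^sub>M {..<n} (\<lambda>_. borel) \<Otimes>\<^sub>M S) (\<lambda>\<omega>. (U_vec n \<omega>, Z \<omega>))) (A \<times> B)"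
      by (simp add: emeasure_distr emeasure_eq_measure ennreal_mult[symmetric])
  qed
qed

lemma indep_U_vec_T_vec:
  "distr M (Pi\<^sub>M {..<n} (\<lambda>_. borel) \<Otimes>\<^sub>M Pi\<^sub>M {..<n} (\<lambda>_. borel)) (\<lambda>\<omega>. (U_vec n \<omega>, T_vec n \<omega>))
   = distr M (Pi\<^sub>M {..<n} (\<lambda>_. borel)) (U_vec n) \<Otimes>\<^sub>M distr M (Pi\<^sub>M {..<n} (\<lambda>_. borel)) (T_vec n)"
proof (rule indep_U_vec_N)
  show "T_vec n \<in> N_algebra \<rightarrow>\<^sub>M Pi\<^sub>M {..<n} (\<lambda>_. borel)"
    unfolding T_vec_def[abs_def] T_def
    by (intro measurable_restrict measurable_arrival measurable_N_algebra) (auto intro: N_path)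
qed simp

definition history :: "nat \<Rightarrow> 'a \<Rightarrow> (nat \<Rightarrow> real) \<times> (nat \<Rightarrow> real)" where
  "history n \<omega> = (T_vec n \<omega>, U_vec n \<omega>)"

abbreviation "history_space n \<equiv> Pi\<^sub>M {..<n} (\<lambda>_. borel :: real measure) \<Otimes>\<^sub>M Pi\<^sub>M {..<n} (\<lambda>_. borel :: real measure)"

lemma measurable_history[measurable]: "history n \<in> M \<rightarrow>\<^sub>M history_space n"
  unfolding history_def[abs_def] by measurable

abbreviation "Exp \<equiv> density lborel (exponential_density l)"

text \<open>The last coordinate is split off from both vectors: in the arrival law as an exponential
  gap, in the product of job laws as one factor \<open>F\<close>. Fubini then puts the new pair
  innermost.\<close>

lemma nn_integral_next_arrival_unfolded:
  assumes \<Phi>[measurable]: "\<Phi> \<in> borel_measurable (history_space n \<Otimes>\<^sub>M (borel \<Otimes>\<^sub>M borel))"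
  shows "(\<integral>\<^sup>+\<omega>. \<Phi> (history n \<omega>, (T (Suc n) \<omega> - T n \<omega>, U (Suc n) \<omega>)) \<partial>M)
    = (\<integral>\<^sup>+u. (\<integral>\<^sup>+t. (\<integral>\<^sup>+z. (\<integral>\<^sup>+e. \<Phi> ((t, u), (e, z)) \<partial>Exp) \<partial>F) \<partial>arrival_law l n) \<partial>Pi\<^sub>M {..<n} (\<lambda>_. F))"
proof -
  interpret X: prob_space Exp by (rule prob_space_exponential_density[OF l_pos])
  interpret LS: prob_space "arrival_law l (Suc n)" unfolding distr_T_vec[symmetric] by (rule prob_space_distr) simp
  interpret L: prob_space "arrival_law l n" unfolding distr_T_vec[symmetric] by (rule prob_space_distr) simp
  interpret PF: product_sigma_finite "\<lambda>_::nat. F" ..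
  have lS: "{..<Suc n} = insert n {..<n}" by auto
  have Lsets: "sets (arrival_law l k) = sets (Pi\<^sub>M {..<k} (\<lambda>_. borel))" for k by (simp add: sets_PiM_lborel)
  have Fsets: "sets (Pi\<^sub>M I (\<lambda>_. F)) = sets (Pi\<^sub>M I (\<lambda>_. borel))" for I :: "nat set" by (intro sets_PiM_cong) auto
  note [measurable_cong] = Lsets Fsets
  have m1[measurable]: "(\<lambda>t. restrict t {..<n}) \<in> Pi\<^sub>M {..<Suc n} (\<lambda>_. borel) \<rightarrow>\<^sub>M Pi\<^sub>M {..<n} (\<lambda>_. borel :: real measure)"
    by (rule measurable_restrict_subset) auto
  have m2[measurable]: "(\<lambda>t. t n - prev t n) \<in> borel_measurable (Pi\<^sub>M {..<Suc n} (\<lambda>_. borel :: real measure))"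
    by (intro borel_measurable_diff measurable_coordinate measurable_prev) auto
  have m3[measurable]: "(\<lambda>t. t n) \<in> borel_measurable (Pi\<^sub>M {..<Suc n} (\<lambda>_. borel :: real measure))"
    by (intro measurable_coordinate) auto
  define g where "g u t = \<Phi> ((restrict t {..<n}, restrict u {..<n}), (t n - prev t n, u n))" for u t
  have [measurable]: "(\<lambda>(u, t). g u t) \<in> borel_measurable (Pi\<^sub>M {..<Suc n} (\<lambda>_. borel) \<Otimes>\<^sub>M Pi\<^sub>M {..<Suc n} (\<lambda>_. borel))"
    unfolding g_def by measurable
  have "(\<integral>\<^sup>+\<omega>. \<Phi> (history n \<omega>, (T (Suc n) \<omega> - T n \<omega>, U (Suc n) \<omega>)) \<partial>M) = (\<integral>\<^sup>+\<omega>. (\<lambda>(u, t). g u t) (U_vec (Suc n) \<omega>, T_vec (Suc n) \<omega>) \<partial>M)"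
  proof (rule nn_integral_cong)
    fix \<omega> assume \<omega>: "\<omega> \<in> space M"
    have r: "restrict (T_vec (Suc n) \<omega>) {..<n} = T_vec n \<omega>" "restrict (U_vec (Suc n) \<omega>) {..<n} = U_vec n \<omega>"
      by (auto simp: T_vec_def U_vec_def fun_eq_iff)
    have p: "prev (T_vec (Suc n) \<omega>) n = T n \<omega>"
      using arrival_0[OF N_path[OF \<omega>]] by (cases n) (auto simp: prev_def T_vec_def T_def)
    show "\<Phi> (history n \<omega>, (T (Suc n) \<omega> - T n \<omega>, U (Suc n) \<omega>)) = (\<lambda>(u, t). g u t) (U_vec (Suc n) \<omega>, T_vec (Suc n) \<omega>)"
      unfolding g_def by (simp add: r p history_def) (simp add: T_vec_def U_vec_def)
  qed
  also have "\<dots> = (\<integral>\<^sup>+x. (\<lambda>(u, t). g u t) x \<partial>distr M (Pi\<^sub>M {..<Suc n} (\<lambda>_. borel) \<Otimes>\<^sub>M Pi\<^sub>M {..<Suc n} (\<lambda>_. borel)) (\<lambda>\<omega>. (U_vec (Suc n) \<omega>, T_vec (Suc n) \<omega>)))"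
    by (subst nn_integral_distr) auto
  also have "\<dots> = (\<integral>\<^sup>+u. (\<integral>\<^sup>+t. g u t \<partial>arrival_law l (Suc n)) \<partial>Pi\<^sub>M {..<Suc n} (\<lambda>_. F))"
    unfolding indep_U_vec_T_vec distr_U_vec_Suc distr_T_vec
    by (subst LS.nn_integral_fst[symmetric]) auto
  also have "\<dots> = (\<integral>\<^sup>+u. (\<integral>\<^sup>+t. (\<integral>\<^sup>+e. \<Phi> ((t, restrict u {..<n}), (e, u n)) \<partial>Exp) \<partial>arrival_law l n) \<partial>Pi\<^sub>M {..<Suc n} (\<lambda>_. F))"
  proof (rule nn_integral_cong)
    fix u assume "u \<in> space (Pi\<^sub>M {..<Suc n} (\<lambda>_. F))"
    then have u: "restrict u {..<n} \<in> space (Pi\<^sub>M {..<n} (\<lambda>_. borel :: real measure))" by (auto simp: space_PiM)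
    have "(\<lambda>(t, e). \<Phi> ((t, restrict u {..<n}), (e, u n))) \<in> borel_measurable (Pi\<^sub>M {..<n} (\<lambda>_. borel) \<Otimes>\<^sub>M borel)"
      using u by measurable
    from nn_integral_arrival_law_Suc[OF l_pos this]
    show "(\<integral>\<^sup>+t. g u t \<partial>arrival_law l (Suc n)) = (\<integral>\<^sup>+t. (\<integral>\<^sup>+e. \<Phi> ((t, restrict u {..<n}), (e, u n)) \<partial>Exp) \<partial>arrival_law l n)"
      by (simp add: g_def)
  qed
  also have "\<dots> = (\<integral>\<^sup>+u. (\<integral>\<^sup>+z. (\<integral>\<^sup>+t. (\<integral>\<^sup>+e. \<Phi> ((t, u), (e, z)) \<partial>Exp) \<partial>arrival_law l n) \<partial>F) \<partial>Pi\<^sub>M {..<n} (\<lambda>_. F))"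
  proof -
    have "(\<lambda>u. (\<integral>\<^sup>+t. (\<integral>\<^sup>+e. \<Phi> ((t, restrict u {..<n}), (e, u n)) \<partial>Exp) \<partial>arrival_law l n)) \<in> borel_measurable (Pi\<^sub>M {..<Suc n} (\<lambda>_. F))"
      by measurable
    then have "(\<integral>\<^sup>+u. (\<integral>\<^sup>+t. (\<integral>\<^sup>+e. \<Phi> ((t, restrict u {..<n}), (e, u n)) \<partial>Exp) \<partial>arrival_law l n) \<partial>Pi\<^sub>M {..<Suc n} (\<lambda>_. F))
      = (\<integral>\<^sup>+u. (\<integral>\<^sup>+z. (\<integral>\<^sup>+t. (\<integral>\<^sup>+e. \<Phi> ((t, restrict (u(n:=z)) {..<n}), (e, (u(n:=z)) n)) \<partial>Exp) \<partial>arrival_law l n) \<partial>F) \<partial>Pi\<^sub>M {..<n} (\<lambda>_. F))"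
      unfolding lS by (intro PF.product_nn_integral_insert) auto
    also have "\<dots> = (\<integral>\<^sup>+u. (\<integral>\<^sup>+z. (\<integral>\<^sup>+t. (\<integral>\<^sup>+e. \<Phi> ((t, u), (e, z)) \<partial>Exp) \<partial>arrival_law l n) \<partial>F) \<partial>Pi\<^sub>M {..<n} (\<lambda>_. F))"
    proof (rule nn_integral_cong)
      fix u assume "u \<in> space (Pi\<^sub>M {..<n} (\<lambda>_. F))"
      then have "restrict (u(n:=z)) {..<n} = u" for z
        by (auto simp: space_PiM PiE_def extensional_def fun_eq_iff restrict_def)
      then show "(\<integral>\<^sup>+z. (\<integral>\<^sup>+t. (\<integral>\<^sup>+e. \<Phi> ((t, restrict (u(n:=z)) {..<n}), (e, (u(n:=z)) n)) \<partial>Exp) \<partial>arrival_law l n) \<partial>F)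
        = (\<integral>\<^sup>+z. (\<integral>\<^sup>+t. (\<integral>\<^sup>+e. \<Phi> ((t, u), (e, z)) \<partial>Exp) \<partial>arrival_law l n) \<partial>F)" by simp
    qed
    finally show ?thesis .
  qed
  also have "\<dots> = (\<integral>\<^sup>+u. (\<integral>\<^sup>+t. (\<integral>\<^sup>+z. (\<integral>\<^sup>+e. \<Phi> ((t, u), (e, z)) \<partial>Exp) \<partial>F) \<partial>arrival_law l n) \<partial>Pi\<^sub>M {..<n} (\<lambda>_. F))"
  proof (rule nn_integral_cong)
    fix u assume "u \<in> space (Pi\<^sub>M {..<n} (\<lambda>_. F))"
    then have [measurable]: "u \<in> space (Pi\<^sub>M {..<n} (\<lambda>_. borel :: real measure))" by (auto simp: space_PiM)
    interpret FL: pair_sigma_finite F "arrival_law l n" ..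
    show "(\<integral>\<^sup>+z. (\<integral>\<^sup>+t. (\<integral>\<^sup>+e. \<Phi> ((t, u), (e, z)) \<partial>Exp) \<partial>arrival_law l n) \<partial>F) = (\<integral>\<^sup>+t. (\<integral>\<^sup>+z. (\<integral>\<^sup>+e. \<Phi> ((t, u), (e, z)) \<partial>Exp) \<partial>F) \<partial>arrival_law l n)"
      by (rule FL.Fubini'[symmetric]) measurable
  qed
  finally show ?thesis .
qed

text \<open>The Markov property of the queue: the next gap and job size have law
  \<open>Exp \<Otimes> F\<close> and are independent of the history.\<close>

lemma distr_next_arrival:
  "distr M (history_space n \<Otimes>\<^sub>M (borel \<Otimes>\<^sub>M borel)) (\<lambda>\<omega>. (history n \<omega>, (T (Suc n) \<omega> - T n \<omega>, U (Suc n) \<omega>)))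
   = distr M (history_space n) (history n) \<Otimes>\<^sub>M (Exp \<Otimes>\<^sub>M F)"
proof (rule measure_eqI)
  interpret X: prob_space Exp by (rule prob_space_exponential_density[OF l_pos])
  interpret XF: pair_prob_space Exp F ..
  interpret L: prob_space "arrival_law l n" unfolding distr_T_vec[symmetric] by (rule prob_space_distr) simp
  interpret PF: product_prob_space "\<lambda>_::nat. F" "{..<n}" ..
  have [measurable]: "U (Suc n) \<in> borel_measurable M" by (intro U_measurable) auto
  show sets_eq: "sets (distr M (history_space n \<Otimes>\<^sub>M (borel \<Otimes>\<^sub>M borel)) (\<lambda>\<omega>. (history n \<omega>, (T (Suc n) \<omega> - T n \<omega>, U (Suc n) \<omega>))))
    = sets (distr M (history_space n) (history n) \<Otimes>\<^sub>M (Exp \<Otimes>\<^sub>M F))"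
  proof -
    have "sets (distr M (history_space n) (history n) \<Otimes>\<^sub>M (Exp \<Otimes>\<^sub>M F)) = sets (history_space n \<Otimes>\<^sub>M (borel \<Otimes>\<^sub>M borel))"
      by (intro sets_pair_measure_cong) auto
    then show ?thesis by simp
  qed
  fix A assume "A \<in> sets (distr M (history_space n \<Otimes>\<^sub>M (borel \<Otimes>\<^sub>M borel)) (\<lambda>\<omega>. (history n \<omega>, (T (Suc n) \<omega> - T n \<omega>, U (Suc n) \<omega>))))"
  then have A[measurable]: "A \<in> sets (history_space n \<Otimes>\<^sub>M (borel \<Otimes>\<^sub>M borel))" by simp
  define \<psi> where "\<psi> s = (\<integral>\<^sup>+z. (\<integral>\<^sup>+e. indicator A (s, (e, z)) \<partial>Exp) \<partial>F)" for s
  have \<psi>[measurable]: "\<psi> \<in> borel_measurable (history_space n)" unfolding \<psi>_def[abs_def] by measurable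
  have "emeasure (distr M (history_space n \<Otimes>\<^sub>M (borel \<Otimes>\<^sub>M borel)) (\<lambda>\<omega>. (history n \<omega>, (T (Suc n) \<omega> - T n \<omega>, U (Suc n) \<omega>)))) A
    = (\<integral>\<^sup>+x. indicator A x \<partial>distr M (history_space n \<Otimes>\<^sub>M (borel \<Otimes>\<^sub>M borel)) (\<lambda>\<omega>. (history n \<omega>, (T (Suc n) \<omega> - T n \<omega>, U (Suc n) \<omega>))))"
    by simp
  also have "\<dots> = (\<integral>\<^sup>+\<omega>. indicator A (history n \<omega>, (T (Suc n) \<omega> - T n \<omega>, U (Suc n) \<omega>)) \<partial>M)"
    by (subst nn_integral_distr) auto
  also have "\<dots> = (\<integral>\<^sup>+u. (\<integral>\<^sup>+t. \<psi> (t, u) \<partial>arrival_law l n) \<partial>Pi\<^sub>M {..<n} (\<lambda>_. F))"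
    unfolding \<psi>_def by (rule nn_integral_next_arrival_unfolded) auto
  \<comment> \<open>The same formula, now with an integrand that ignores the next arrival, folds the
    two outer integrals back into the law of the history.\<close>
  also have "\<dots> = (\<integral>\<^sup>+\<omega>. \<psi> (history n \<omega>) \<partial>M)"
  proof -
    have "(\<lambda>x. \<psi> (fst x)) \<in> borel_measurable (history_space n \<Otimes>\<^sub>M (borel \<Otimes>\<^sub>M (borel :: real measure)))" by measurable
    from nn_integral_next_arrival_unfolded[OF this]
    show ?thesis by (simp add: X.emeasure_space_1[simplified] F.emeasure_space_1)
  qed
  also have "\<dots> = (\<integral>\<^sup>+s. \<psi> s \<partial>distr M (history_space n) (history n))"
    by (subst nn_integral_distr) auto
  also have "\<dots> = (\<integral>\<^sup>+s. (\<integral>\<^sup>+p. indicator A (s, p) \<partial>(Exp \<Otimes>\<^sub>M F)) \<partial>distr M (history_space n) (history n))"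
  proof (rule nn_integral_cong)
    fix s assume "s \<in> space (distr M (history_space n) (history n))"
    then have s[measurable]: "s \<in> space (history_space n)" by simp
    interpret FX: pair_sigma_finite F Exp ..
    have "(\<lambda>p. indicator A (s, p) :: ennreal) \<in> borel_measurable (Exp \<Otimes>\<^sub>M F)" by measurable
    then show "\<psi> s = (\<integral>\<^sup>+p. indicator A (s, p) \<partial>(Exp \<Otimes>\<^sub>M F))"
      unfolding \<psi>_def by (subst XF.nn_integral_snd[symmetric]) auto
  qed
  also have "\<dots> = emeasure (distr M (history_space n) (history n) \<Otimes>\<^sub>M (Exp \<Otimes>\<^sub>M F)) A"
    using A sets_eq by (subst XF.emeasure_pair_measure) auto
  finally show "emeasure (distr M (history_space n \<Otimes>\<^sub>M (borel \<Otimes>\<^sub>M borel)) (\<lambda>\<omega>. (history n \<omega>, (T (Suc n) \<omega> - T n \<omega>, U (Suc n) \<omega>)))) A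
    = emeasure (distr M (history_space n) (history n) \<Otimes>\<^sub>M (Exp \<Otimes>\<^sub>M F)) A" .
qed

lemma expectation_next_arrival:
  fixes \<phi> :: "_ \<Rightarrow> real"
  assumes \<phi>[measurable]: "\<phi> \<in> borel_measurable (history_space n \<Otimes>\<^sub>M (borel \<Otimes>\<^sub>M borel))"
    and B: "\<And>x. \<bar>\<phi> x\<bar> \<le> B"
  shows "expectation (\<lambda>\<omega>. \<phi> (history n \<omega>, (T (Suc n) \<omega> - T n \<omega>, U (Suc n) \<omega>)))
    = expectation (\<lambda>\<omega>. \<integral>e. (\<integral>z. \<phi> (history n \<omega>, (e, z)) \<partial>F) \<partial>Exp)"
proof -
  interpret X: prob_space Exp by (rule prob_space_exponential_density[OF l_pos])
  interpret XF: pair_prob_space Exp F ..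
  interpret Hd: prob_space "distr M (history_space n) (history n)" by (rule prob_space_distr) simp
  interpret H: pair_prob_space "distr M (history_space n) (history n)" "Exp \<Otimes>\<^sub>M F" ..
  have [measurable]: "U (Suc n) \<in> borel_measurable M" by (intro U_measurable) auto
  have \<phi>i: "integrable (distr M (history_space n) (history n) \<Otimes>\<^sub>M (Exp \<Otimes>\<^sub>M F)) \<phi>"
  proof (rule H.P.integrable_const_bound[where B=B])
    show "\<phi> \<in> borel_measurable (distr M (history_space n) (history n) \<Otimes>\<^sub>M (Exp \<Otimes>\<^sub>M F))" by measurable
  qed (use B in auto)
  have "expectation (\<lambda>\<omega>. \<phi> (history n \<omega>, (T (Suc n) \<omega> - T n \<omega>, U (Suc n) \<omega>)))
    = (\<integral>x. \<phi> x \<partial>distr M (history_space n \<Otimes>\<^sub>M (borel \<Otimes>\<^sub>M borel)) (\<lambda>\<omega>. (history n \<omega>, (T (Suc n) \<omega> - T n \<omega>, U (Suc n) \<omega>))))"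
    by (subst integral_distr) auto
  also have "\<dots> = (\<integral>x. \<phi> x \<partial>(distr M (history_space n) (history n) \<Otimes>\<^sub>M (Exp \<Otimes>\<^sub>M F)))"
    unfolding distr_next_arrival ..
  also have "\<dots> = (\<integral>s. (\<integral>p. \<phi> (s, p) \<partial>(Exp \<Otimes>\<^sub>M F)) \<partial>distr M (history_space n) (history n))"
    using H.integral_fst'[OF \<phi>i] by simp
  also have "\<dots> = (\<integral>s. (\<integral>e. (\<integral>z. \<phi> (s, (e, z)) \<partial>F) \<partial>Exp) \<partial>distr M (history_space n) (history n))"
  proof (rule Bochner_Integration.integral_cong[OF refl])
    fix s assume "s \<in> space (distr M (history_space n) (history n))"
    then have s[measurable]: "s \<in> space (history_space n)" by simp
    have "integrable (Exp \<Otimes>\<^sub>M F) (\<lambda>p. \<phi> (s, p))"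
      by (rule XF.P.integrable_const_bound[where B=B]) (use B in auto)
    from XF.integral_fst'[OF this] show "(\<integral>p. \<phi> (s, p) \<partial>(Exp \<Otimes>\<^sub>M F)) = (\<integral>e. (\<integral>z. \<phi> (s, (e, z)) \<partial>F) \<partial>Exp)" by simp
  qed
  also have "\<dots> = expectation (\<lambda>\<omega>. \<integral>e. (\<integral>z. \<phi> (history n \<omega>, (e, z)) \<partial>F) \<partial>Exp)"
    by (subst integral_distr) (auto simp del: integral_density)
  finally show ?thesis .
qed

end


subsection \<open>Paths of the workload\<close>

locale workload_path =
  fixes u0 :: real and U :: "nat \<Rightarrow> 'a \<Rightarrow> real" and N :: "real \<Rightarrow> 'a \<Rightarrow> nat" and \<omega> :: 'a
  assumes N_path: "counting_path (\<lambda>t. N t \<omega>)" and u0_nonneg: "0 \<le> u0"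
begin

abbreviation "c \<equiv> \<lambda>t. N t \<omega>"
abbreviation "X \<equiv> \<lambda>t. netput u0 U N t \<omega>"
abbreviation "Y \<equiv> \<lambda>t. workload (netput u0 U N) t \<omega>"

definition inf_X :: "real \<Rightarrow> real" where "inf_X t = Inf ({X s | s. 0 \<le> s \<and> s \<le> t} \<union> {0})"

lemma Y_eq: "Y t = X t - inf_X t"
  by (simp add: workload_def inf_X_def)

lemma X_eq: "c s = c a \<Longrightarrow> X s = X a - (s - a)"
  by (simp add: netput_def)

text \<open>The sizes carry no sign condition on this path, so the bound is the least of the
  finitely many partial sums reached before \<open>t\<close>.\<close>

lemma X_bdd_below: "bdd_below {X s | s. 0 \<le> s \<and> s \<le> t}"
proof -
  let ?f = "\<lambda>k. \<Sum>n=1..k. U n \<omega>"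
  have "Min (?f ` {..c t}) + u0 - t \<le> X s" if "0 \<le> s" "s \<le> t" for s
  proof -
    have "c s \<in> {..c t}" using counting_path_mono[OF N_path that] by simp
    then have "Min (?f ` {..c t}) \<le> ?f (c s)" by (intro Min_le) auto
    then show ?thesis using that by (simp add: netput_def)
  qed
  then show ?thesis by (auto intro!: bdd_belowI[of _ "Min (?f ` {..c t}) + u0 - t"])
qed

lemma bdd_below_X0: "bdd_below ({X s | s. 0 \<le> s \<and> s \<le> t} \<union> {0})"
  using X_bdd_below by (simp add: bdd_below_insert)

lemma inf_X_le: "0 \<le> s \<Longrightarrow> s \<le> t \<Longrightarrow> inf_X t \<le> X s"
  unfolding inf_X_def by (intro cInf_lower bdd_below_X0) auto

lemma inf_X_le_0: "inf_X t \<le> 0"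
  unfolding inf_X_def by (intro cInf_lower bdd_below_X0) auto

lemma inf_X_greatest: "z \<le> 0 \<Longrightarrow> (\<And>s. 0 \<le> s \<Longrightarrow> s \<le> t \<Longrightarrow> z \<le> X s) \<Longrightarrow> z \<le> inf_X t"
  unfolding inf_X_def by (intro cInf_greatest) auto

lemma inf_X_antimono: "s \<le> t \<Longrightarrow> inf_X t \<le> inf_X s"
  by (intro inf_X_greatest inf_X_le inf_X_le_0) auto

lemma Y_0: "Y 0 = u0"
proof -
  have "X 0 = u0" using N_path by (simp add: netput_def counting_path_def)
  moreover have "inf_X 0 = 0"
    using inf_X_le_0[of 0] \<open>X 0 = u0\<close> u0_nonneg by (intro antisym inf_X_greatest) (auto dest!: antisym)
  ultimately show ?thesis by (simp add: Y_eq)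
qed

text \<open>On a stretch of slope -1 the running infimum is the smaller of its old value and the
  current \<open>X\<close>.\<close>

lemma Y_between_jumps:
  assumes a: "0 \<le> a" "a \<le> s" and const: "\<And>r. a \<le> r \<Longrightarrow> r \<le> s \<Longrightarrow> c r = c a"
  shows "Y s = max (Y a - (s - a)) 0"
proof -
  have Xr: "X r = X a - (r - a)" if "a \<le> r" "r \<le> s" for r using const[OF that] by (rule X_eq)
  have "inf_X s = min (inf_X a) (X s)"
  proof (rule antisym)
    show "inf_X s \<le> min (inf_X a) (X s)" using a inf_X_antimono[of a s] inf_X_le[of s s] by simp
    show "min (inf_X a) (X s) \<le> inf_X s"
    proof (rule inf_X_greatest)
      show "min (inf_X a) (X s) \<le> 0" using inf_X_le_0[of a] by simp
      fix r assume r: "0 \<le> r" "r \<le> s"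
      show "min (inf_X a) (X s) \<le> X r"
      proof (cases "r \<le> a")
        case True
        then show ?thesis using inf_X_le[of r a] r by simp
      next
        case False
        then show ?thesis using Xr[of r] Xr[of s] r a by simp
      qed
    qed
  qed
  then show ?thesis using Xr[of s] a by (simp add: Y_eq min_def max_def)
qed

text \<open>The left limit \<open>X a - (b - a)\<close> is approached but not attained before
  \<open>b\<close>; it enters the infimum through an epsilon argument. The jump is not downward, so
  its own value does not lower the infimum further.\<close>

lemma Y_at_jump:
  assumes a: "0 \<le> a" "a < b" and const: "\<And>r. a \<le> r \<Longrightarrow> r < b \<Longrightarrow> c r = c a"
    and jump: "X a - (b - a) \<le> X b"
  shows "Y b = max (Y a - (b - a)) 0 + (X b - (X a - (b - a)))"
proof -
  let ?z = "X a - (b - a)"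
  have Xr: "X r = X a - (r - a)" if "a \<le> r" "r < b" for r using const[OF that] by (rule X_eq)
  have "inf_X b = min (inf_X a) ?z"
  proof (rule antisym)
    have "inf_X b \<le> ?z"
    proof (rule field_le_epsilon)
      fix e :: real assume e: "0 < e"
      define r where "r = max a (b - e)"
      have r: "a \<le> r" "r < b" "b - e \<le> r" using a e by (auto simp: r_def)
      have "inf_X b \<le> X r" using a r by (intro inf_X_le) auto
      also have "\<dots> \<le> ?z + e" using Xr[of r] r by simp
      finally show "inf_X b \<le> ?z + e" .
    qed
    then show "inf_X b \<le> min (inf_X a) ?z" using a inf_X_antimono[of a b] by simp
    show "min (inf_X a) ?z \<le> inf_X b"
    proof (rule inf_X_greatest)
      show "min (inf_X a) ?z \<le> 0" using inf_X_le_0[of a] by simp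
      fix r assume r: "0 \<le> r" "r \<le> b"
      consider "r \<le> a" | "a < r" "r < b" | "r = b" using r by linarith
      then show "min (inf_X a) ?z \<le> X r"
      proof cases
        case 1 then show ?thesis using inf_X_le[of r a] r by simp
      next
        case 2 then show ?thesis using Xr[of r] by simp
      next
        case 3 then show ?thesis using jump by simp
      qed
    qed
  qed
  then show ?thesis by (simp add: Y_eq min_def max_def)
qed

text \<open>A monotone integer path is bounded on \<open>[0, b)\<close> by \<open>c b\<close>, so it
  attains its maximum there and is constant afterwards. This gives left limits on every path, not
  only on almost every one, as measurability requires.\<close>

lemma constant_before:
  assumes b: "0 < b"
  obtains a where "0 \<le> a" "a < b" "\<And>r. a \<le> r \<Longrightarrow> r < b \<Longrightarrow> c r = c a"
proof -
  have "c ` {0..<b} \<subseteq> {..c b}" using counting_path_mono[OF N_path] by auto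
  then have fin: "finite (c ` {0..<b})" by (rule finite_subset) simp
  have "Max (c ` {0..<b}) \<in> c ` {0..<b}" using b fin by (intro Max_in) auto
  then obtain a where a: "Max (c ` {0..<b}) = c a" "0 \<le> a" "a < b" by auto
  have const: "c r = c a" if "a \<le> r" "r < b" for r
  proof (rule antisym)
    show "c r \<le> c a" unfolding a(1)[symmetric] using that a fin by (intro Max_ge) auto
    show "c a \<le> c r" using that a by (intro counting_path_mono[OF N_path]) auto
  qed
  show ?thesis by (rule that[OF a(2,3) const])
qed

lemma Y_left_limit:
  assumes a: "0 \<le> a" "a < b" and const: "\<And>r. a \<le> r \<Longrightarrow> r < b \<Longrightarrow> c r = c a"
  shows "(Y \<longlongrightarrow> max (Y a - (b - a)) 0) (at_left b)"
proof (rule Lim_transform_eventually)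
  show "((\<lambda>s. max (Y a - (s - a)) 0) \<longlongrightarrow> max (Y a - (b - a)) 0) (at_left b)"
    by (intro tendsto_intros)
  show "\<forall>\<^sub>F s in at_left b. max (Y a - (s - a)) 0 = Y s"
    unfolding eventually_at_left_field
  proof (intro exI[of _ a] conjI allI impI a(2))
    fix s assume s: "a < s" "s < b"
    have "c r = c a" if "a \<le> r" "r \<le> s" for r by (rule const) (use that s in auto)
    then show "max (Y a - (s - a)) 0 = Y s" by (intro Y_between_jumps[symmetric] a less_imp_le[OF s(1)])
  qed
qed

lemma Y_right_continuous:
  assumes t: "0 \<le> t"
  shows "(Y \<longlongrightarrow> Y t) (at_right t)"
proof -
  obtain d where d: "t < d" "\<And>s. t \<le> s \<Longrightarrow> s < d \<Longrightarrow> c s = c t"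
    using counting_path_right_constant[OF N_path t] by metis
  have "0 \<le> Y t" using inf_X_le[of t t] t by (simp add: Y_eq)
  have "((\<lambda>s. max (Y t - (s - t)) 0) \<longlongrightarrow> max (Y t - (t - t)) 0) (at_right t)"
    by (intro tendsto_intros)
  then have "((\<lambda>s. max (Y t - (s - t)) 0) \<longlongrightarrow> Y t) (at_right t)" using \<open>0 \<le> Y t\<close> by simp
  then show ?thesis
  proof (rule Lim_transform_eventually)
    show "\<forall>\<^sub>F s in at_right t. max (Y t - (s - t)) 0 = Y s"
      unfolding eventually_at_right_field
    proof (intro exI[of _ d] conjI allI impI d(1))
      fix s assume s: "t < s" "s < d"
      have "c r = c t" if "t \<le> r" "r \<le> s" for r by (rule d(2)) (use that s in auto)
      then show "max (Y t - (s - t)) 0 = Y s" by (intro Y_between_jumps[symmetric] t less_imp_le[OF s(1)])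
    qed
  qed
qed

end

fun queue_after :: "real \<Rightarrow> (nat \<Rightarrow> real) \<Rightarrow> (nat \<Rightarrow> real) \<Rightarrow> nat \<Rightarrow> real" where
  "queue_after u0 t u 0 = u0"
| "queue_after u0 t u (Suc k) = max (queue_after u0 t u k - (t k - prev t k)) 0 + u k"

locale regular_workload_path = workload_path +
  assumes T_increasing: "\<And>n. arrival (\<lambda>t. N t \<omega>) n < arrival (\<lambda>t. N t \<omega>) (Suc n)"
    and U_pos: "\<And>n. 1 \<le> n \<Longrightarrow> 0 < U n \<omega>"
begin

abbreviation "T \<equiv> arrival (\<lambda>t. N t \<omega>)"

definition D :: "nat \<Rightarrow> real" where "D = queue_after u0 (\<lambda>i. T (Suc i)) (\<lambda>i. U (Suc i) \<omega>)"

lemma T_0: "T 0 = 0" by (rule arrival_0[OF N_path])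

lemma T_nonneg: "0 \<le> T n"
  using lift_Suc_mono_le[of T 0 n] T_increasing T_0 by (simp add: less_imp_le)

lemma c_eq: "T n \<le> s \<Longrightarrow> s < T (Suc n) \<Longrightarrow> c s = n"
  using arrival_le_iff[OF N_path, of s n] arrival_le_iff[OF N_path, of s "Suc n"] T_nonneg[of n] T_nonneg[of "Suc n"]
  by (auto intro!: antisym simp: not_less_eq_eq[symmetric])

lemma D_0: "D 0 = u0" by (simp add: D_def)

lemma D_Suc: "D (Suc n) = max (D n - (T (Suc n) - T n)) 0 + U (Suc n) \<omega>"
  using T_0 by (cases n) (simp_all add: D_def prev_def)

lemma Y_T: "Y (T n) = D n"
proof (induction n)
  case 0
  then show ?case by (simp add: T_0 D_0 Y_0)
next
  case (Suc n)
  have cn: "c (T n) = n" "c (T (Suc n)) = Suc n" using c_eq[of n "T n"] c_eq[of "Suc n" "T (Suc n)"] T_increasing by auto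
  then have X: "X (T (Suc n)) - (X (T n) - (T (Suc n) - T n)) = U (Suc n) \<omega>" by (simp add: netput_def)
  have "Y (T (Suc n)) = max (Y (T n) - (T (Suc n) - T n)) 0 + (X (T (Suc n)) - (X (T n) - (T (Suc n) - T n)))"
  proof (rule Y_at_jump[OF T_nonneg T_increasing])
    show "c r = c (T n)" if "T n \<le> r" "r < T (Suc n)" for r using c_eq[OF that] cn(1) by simp
    show "X (T n) - (T (Suc n) - T n) \<le> X (T (Suc n))" using X U_pos[of "Suc n"] by simp
  qed
  then show ?case unfolding X Suc.IH D_Suc .
qed

lemma Y_between: "T n \<le> s \<Longrightarrow> s < T (Suc n) \<Longrightarrow> Y s = max (D n - (s - T n)) 0"
  unfolding Y_T[symmetric]
proof (rule Y_between_jumps[OF T_nonneg])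
  assume s: "T n \<le> s" "s < T (Suc n)"
  show "c r = c (T n)" if "T n \<le> r" "r \<le> s" for r
    using that s c_eq[of n r] c_eq[of n "T n"] T_increasing[of n] by simp
qed

text \<open>Between arrivals the workload only falls, so \<open>x\<close> can be crossed only upward
  at an arrival. The left limit there is the drained level, before the new job is added.\<close>

lemma first_overflow:
  assumes x: "0 \<le> x" and le: "\<And>k. k \<le> n \<Longrightarrow> D k \<le> x" and gt: "x < D (Suc n)"
  shows "overflow_time (workload (netput u0 U N)) x \<omega> = ereal (T (Suc n))"
    and "undershoot (workload (netput u0 U N)) x \<omega> = x - max (D n - (T (Suc n) - T n)) 0"
    and "overshoot (workload (netput u0 U N)) x \<omega> = D (Suc n) - x"
proof -
  have T_mono: "m \<le> k \<Longrightarrow> T m \<le> T k" for m k using lift_Suc_mono_le[of T m k] T_increasing by (simp add: less_imp_le)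
  have before: "Y t \<le> x" if t: "0 \<le> t" "t < T (Suc n)" for t
  proof -
    define k where "k = c t"
    have "T k \<le> t" using arrival_le_iff[OF N_path t(1), of k] by (simp add: k_def)
    moreover have "t < T (Suc k)"
      using arrival_le_iff[OF N_path t(1), of "Suc k"] T_nonneg[of "Suc k"] by (auto simp: k_def)
    moreover have "k \<le> n"
    proof (rule ccontr)
      assume "\<not> k \<le> n"
      then have "T (Suc n) \<le> T k" by (intro T_mono) auto
      then show False using \<open>T k \<le> t\<close> t by simp
    qed
    ultimately show ?thesis using Y_between[of k t] le[of k] x by simp
  qed
  show o: "overflow_time (workload (netput u0 U N)) x \<omega> = ereal (T (Suc n))"
    unfolding overflow_time_def
  proof (rule antisym)
    show "Inf {ereal t |t. 0 \<le> t \<and> Y t \<in> {x<..}} \<le> ereal (T (Suc n))"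
      using T_nonneg gt by (intro Inf_lower) (auto simp: Y_T)
    show "ereal (T (Suc n)) \<le> Inf {ereal t |t. 0 \<le> t \<and> Y t \<in> {x<..}}"
    proof (rule Inf_greatest)
      fix z assume "z \<in> {ereal t |t. 0 \<le> t \<and> Y t \<in> {x<..}}"
      then obtain t where "z = ereal t" "0 \<le> t" "x < Y t" by auto
      then show "ereal (T (Suc n)) \<le> z" using before[of t] by (cases "t < T (Suc n)") auto
    qed
  qed
  show "overshoot (workload (netput u0 U N)) x \<omega> = D (Suc n) - x"
    by (simp add: overshoot_def o Y_T)
  have pos: "0 < T (Suc n)" using T_nonneg[of n] T_increasing[of n] by linarith
  have "(Y \<longlongrightarrow> max (D n - (T (Suc n) - T n)) 0) (at_left (T (Suc n)))"
    unfolding Y_T[symmetric]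
  proof (rule Y_left_limit[OF T_nonneg T_increasing])
    show "c r = c (T n)" if "T n \<le> r" "r < T (Suc n)" for r
      using c_eq[OF that] c_eq[of n "T n"] T_increasing[of n] by simp
  qed
  moreover have "at (T (Suc n)) within {0..<T (Suc n)} = at_left (T (Suc n))"
    using pos by (intro at_within_nhd[of _ "{0<..}"]) auto
  ultimately have "Lim (at (T (Suc n)) within {0..<T (Suc n)}) Y = max (D n - (T (Suc n) - T n)) 0"
    by (intro tendsto_Lim) (auto simp: trivial_limit_at_left_real)
  then show "undershoot (workload (netput u0 U N)) x \<omega> = x - max (D n - (T (Suc n) - T n)) 0"
    by (simp add: undershoot_def o)
qed

end

subsection \<open>Measurability\<close>

text \<open>By right-continuity an exceedance persists for a moment, so an overflow before
  \<open>a\<close> is seen at some rational time before \<open>a\<close>.\<close>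

lemma measurable_overflow_time:
  fixes Y :: "real \<Rightarrow> 'a \<Rightarrow> real"
  assumes Y: "\<And>t. 0 \<le> t \<Longrightarrow> Y t \<in> borel_measurable M"
    and rc: "\<And>\<omega> t. \<omega> \<in> space M \<Longrightarrow> 0 \<le> t \<Longrightarrow> ((\<lambda>s. Y s \<omega>) \<longlongrightarrow> Y t \<omega>) (at_right t)"
  shows "overflow_time Y x \<in> borel_measurable M"
proof (rule borel_measurableI_less)
  fix a :: ereal
  let ?Q = "{q \<in> \<rat>. 0 \<le> q \<and> ereal q < a}"
  have "{\<omega> \<in> space M. overflow_time Y x \<omega> < a} = (\<Union>q\<in>?Q. {\<omega> \<in> space M. x < Y q \<omega>})"
  proof (intro set_eqI iffI)
    fix \<omega> assume w: "\<omega> \<in> {\<omega> \<in> space M. overflow_time Y x \<omega> < a}"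
    then obtain t where t: "0 \<le> t" "x < Y t \<omega>" "ereal t < a" by (auto simp: overflow_time_def Inf_less_iff)
    have "((\<lambda>s. Y s \<omega>) \<longlongrightarrow> Y t \<omega>) (at_right t)" using w t by (intro rc) auto
    then have "\<forall>\<^sub>F s in at_right t. x < Y s \<omega>" using t by (intro order_tendstoD) auto
    then obtain b where b: "t < b" "\<And>s. t < s \<Longrightarrow> s < b \<Longrightarrow> x < Y s \<omega>" by (auto simp: eventually_at_right_field)
    have "\<exists>b'. t < b' \<and> ereal b' \<le> a"
      using t by (cases a) (auto intro: exI[of _ "t + 1"])
    then obtain b' where b': "t < b'" "ereal b' \<le> a" by blast
    obtain q where q: "q \<in> \<rat>" "t < q" "q < min b b'" using Rats_dense_in_real[of t "min b b'"] b b' by auto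
    have "ereal q < a" using q b' by (auto intro: order.strict_trans2[of "ereal q" "ereal b'"])
    then show "\<omega> \<in> (\<Union>q\<in>?Q. {\<omega> \<in> space M. x < Y q \<omega>})" using w q t b by auto
  next
    fix \<omega> assume "\<omega> \<in> (\<Union>q\<in>?Q. {\<omega> \<in> space M. x < Y q \<omega>})"
    then show "\<omega> \<in> {\<omega> \<in> space M. overflow_time Y x \<omega> < a}" by (auto simp: overflow_time_def Inf_less_iff)
  qed
  also have "\<dots> \<in> sets M"
  proof (rule sets.countable_UN'')
    show "countable ?Q" using countable_rat by (rule countable_subset[rotated]) auto
    show "{\<omega> \<in> space M. x < Y q \<omega>} \<in> sets M" if "q \<in> ?Q" for q
      using Y[of q] that by (auto simp: borel_measurable_iff_greater)
  qed
  finally show "{\<omega> \<in> space M. overflow_time Y x \<omega> < a} \<in> sets M" .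
qed

lemma measurable_path_at:
  fixes Y :: "real \<Rightarrow> 'a \<Rightarrow> real" and i :: "'a \<Rightarrow> int"
  assumes Y: "\<And>t. 0 \<le> t \<Longrightarrow> Y t \<in> borel_measurable M" and i: "i \<in> M \<rightarrow>\<^sub>M count_space UNIV"
  shows "(\<lambda>\<omega>. Y (max 0 (of_int (i \<omega>) / 2 ^ n)) \<omega>) \<in> borel_measurable M"
  by (rule measurable_compose_countable[where f="\<lambda>k \<omega>. Y (max 0 (of_int k / 2 ^ n)) \<omega>", OF _ i]) (auto intro: Y)

text \<open>Approximate the overflow time strictly from either side by dyadic times; each
  approximation takes countably many values, and the one-sided limits of the path make the
  evaluations converge.\<close>

lemma measurable_undershoot_overshoot:
  fixes Y :: "real \<Rightarrow> 'a \<Rightarrow> real"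
  assumes Y: "\<And>t. 0 \<le> t \<Longrightarrow> Y t \<in> borel_measurable M"
    and rc: "\<And>\<omega> t. \<omega> \<in> space M \<Longrightarrow> 0 \<le> t \<Longrightarrow> ((\<lambda>s. Y s \<omega>) \<longlongrightarrow> Y t \<omega>) (at_right t)"
    and ll: "\<And>\<omega> t. \<omega> \<in> space M \<Longrightarrow> 0 < t \<Longrightarrow> \<exists>L. ((\<lambda>s. Y s \<omega>) \<longlongrightarrow> L) (at_left t)"
  shows "undershoot Y x \<in> borel_measurable M" and "overshoot Y x \<in> borel_measurable M"
proof -
  define \<tau> where "\<tau> \<omega> = real_of_ereal (overflow_time Y x \<omega>)" for \<omega>
  have [measurable]: "\<tau> \<in> borel_measurable M"
    unfolding \<tau>_def[abs_def] using measurable_overflow_time[OF Y rc] by measurable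
  have \<tau>_nonneg: "0 \<le> \<tau> \<omega>" for \<omega>
  proof -
    have "0 \<le> overflow_time Y x \<omega>" unfolding overflow_time_def by (intro Inf_greatest) auto
    then show ?thesis unfolding \<tau>_def by (rule real_of_ereal_pos)
  qed
  have pow: "(\<lambda>n. 1 / 2 ^ n :: real) \<longlonglongrightarrow> 0"
    using LIMSEQ_realpow_zero[of "1/2::real"] by (simp add: power_one_over)
  define up where "up n \<omega> = max 0 (of_int (\<lfloor>2 ^ n * \<tau> \<omega>\<rfloor> + 1) / 2 ^ n :: real)" for n \<omega>
  define dn where "dn n \<omega> = max 0 (of_int (\<lceil>2 ^ n * \<tau> \<omega>\<rceil> - 1) / 2 ^ n :: real)" for n \<omega>
  have up: "\<tau> \<omega> < up n \<omega>" "up n \<omega> \<le> \<tau> \<omega> + 1 / 2 ^ n" for n \<omega>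
  proof -
    have "2 ^ n * \<tau> \<omega> < of_int (\<lfloor>2 ^ n * \<tau> \<omega>\<rfloor> + 1)" "of_int (\<lfloor>2 ^ n * \<tau> \<omega>\<rfloor> + 1) \<le> 2 ^ n * \<tau> \<omega> + 1"
      by linarith+
    then have "\<tau> \<omega> < of_int (\<lfloor>2 ^ n * \<tau> \<omega>\<rfloor> + 1) / 2 ^ n" "of_int (\<lfloor>2 ^ n * \<tau> \<omega>\<rfloor> + 1) / 2 ^ n \<le> \<tau> \<omega> + 1 / 2 ^ n"
      by (auto simp: field_simps)
    then show "\<tau> \<omega> < up n \<omega>" "up n \<omega> \<le> \<tau> \<omega> + 1 / 2 ^ n" using \<tau>_nonneg[of \<omega>] by (auto simp: up_def)
  qed
  have dn: "dn n \<omega> < \<tau> \<omega>" "\<tau> \<omega> - 1 / 2 ^ n \<le> dn n \<omega>" if "0 < \<tau> \<omega>" for n \<omega>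
  proof -
    have "of_int (\<lceil>2 ^ n * \<tau> \<omega>\<rceil> - 1) < 2 ^ n * \<tau> \<omega>" "2 ^ n * \<tau> \<omega> - 1 \<le> of_int (\<lceil>2 ^ n * \<tau> \<omega>\<rceil> - 1)"
      by linarith+
    then have "of_int (\<lceil>2 ^ n * \<tau> \<omega>\<rceil> - 1) / 2 ^ n < \<tau> \<omega>" "\<tau> \<omega> - 1 / 2 ^ n \<le> of_int (\<lceil>2 ^ n * \<tau> \<omega>\<rceil> - 1) / 2 ^ n"
      by (auto simp: field_simps)
    then show "dn n \<omega> < \<tau> \<omega>" "\<tau> \<omega> - 1 / 2 ^ n \<le> dn n \<omega>" using that by (auto simp: dn_def)
  qed
  have up_lim: "filterlim (\<lambda>n. up n \<omega>) (at_right (\<tau> \<omega>)) sequentially" for \<omega>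
    unfolding filterlim_at
  proof
    show "\<forall>\<^sub>F n in sequentially. up n \<omega> \<in> {\<tau> \<omega><..} \<and> up n \<omega> \<noteq> \<tau> \<omega>" using up(1)[of \<omega>] by (auto simp: less_imp_neq[symmetric])
    show "(\<lambda>n. up n \<omega>) \<longlonglongrightarrow> \<tau> \<omega>"
      by (rule tendsto_sandwich[where f="\<lambda>_. \<tau> \<omega>" and h="\<lambda>n. \<tau> \<omega> + 1 / 2 ^ n"])
         (use up[where \<omega>=\<omega>] tendsto_add[OF tendsto_const pow] in \<open>auto simp: less_imp_le\<close>)
  qed
  have dn_lim: "filterlim (\<lambda>n. dn n \<omega>) (at_left (\<tau> \<omega>)) sequentially" if "0 < \<tau> \<omega>" for \<omega>
    unfolding filterlim_at
  proof
    show "\<forall>\<^sub>F n in sequentially. dn n \<omega> \<in> {..<\<tau> \<omega>} \<and> dn n \<omega> \<noteq> \<tau> \<omega>" using dn(1)[OF that] by (auto simp: less_imp_neq)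
    show "(\<lambda>n. dn n \<omega>) \<longlonglongrightarrow> \<tau> \<omega>"
      by (rule tendsto_sandwich[where f="\<lambda>n. \<tau> \<omega> - 1 / 2 ^ n" and h="\<lambda>_. \<tau> \<omega>"])
         (use dn[OF that] tendsto_diff[OF tendsto_const pow] in \<open>auto simp: less_imp_le\<close>)
  qed
  have up_meas: "(\<lambda>\<omega>. Y (up n \<omega>) \<omega>) \<in> borel_measurable M" for n
    unfolding up_def by (rule measurable_path_at[OF Y]) measurable
  have dn_meas: "(\<lambda>\<omega>. Y (dn n \<omega>) \<omega>) \<in> borel_measurable M" for n
    unfolding dn_def by (rule measurable_path_at[OF Y]) measurable
  have "(\<lambda>\<omega>. Y (\<tau> \<omega>) \<omega>) \<in> borel_measurable M"
  proof (rule borel_measurable_LIMSEQ_real[OF _ up_meas])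
    fix \<omega> assume "\<omega> \<in> space M"
    then show "(\<lambda>n. Y (up n \<omega>) \<omega>) \<longlonglongrightarrow> Y (\<tau> \<omega>) \<omega>"
      by (intro filterlim_compose[OF rc up_lim] \<tau>_nonneg)
  qed
  then show "overshoot Y x \<in> borel_measurable M"
    unfolding overshoot_def[abs_def] \<tau>_def by measurable
  define L where "L \<omega> = Lim (at (\<tau> \<omega>) within {0..<\<tau> \<omega>}) (\<lambda>t. Y t \<omega>)" for \<omega>
  \<comment> \<open>At time 0 the filter in \<open>Lim\<close> is trivial: every number is a limit,
    and \<open>Lim\<close> is the same arbitrary constant on all such paths. That suffices for
    measurability.\<close>
  define L0 where "L0 = (THE l::real. True)"
  have L0: "L \<omega> = L0" if "\<tau> \<omega> = 0" for \<omega>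
    by (simp add: L_def that L0_def Topological_Spaces.Lim_def at_within_def)
  have L: "(\<lambda>n. Y (dn n \<omega>) \<omega>) \<longlonglongrightarrow> L \<omega>" if \<omega>: "\<omega> \<in> space M" "0 < \<tau> \<omega>" for \<omega>
  proof -
    obtain z where z: "((\<lambda>s. Y s \<omega>) \<longlongrightarrow> z) (at_left (\<tau> \<omega>))" using ll[OF \<omega>] by blast
    have "at (\<tau> \<omega>) within {0..<\<tau> \<omega>} = at_left (\<tau> \<omega>)"
      using \<omega> by (intro at_within_nhd[of _ "{0<..}"]) auto
    then have "L \<omega> = z" unfolding L_def using z by (intro tendsto_Lim) (auto simp: trivial_limit_at_left_real)
    then show ?thesis using filterlim_compose[OF z dn_lim[OF \<omega>(2)]] by simp
  qed
  have "L \<in> borel_measurable M"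
  proof (rule borel_measurable_LIMSEQ_real)
    show "(\<lambda>\<omega>. if \<tau> \<omega> = 0 then L0 else Y (dn n \<omega>) \<omega>) \<in> borel_measurable M" for n
      using dn_meas[of n] by measurable
    fix \<omega> assume \<omega>: "\<omega> \<in> space M"
    show "(\<lambda>n. if \<tau> \<omega> = 0 then L0 else Y (dn n \<omega>) \<omega>) \<longlonglongrightarrow> L \<omega>"
      using L[OF \<omega>] L0[of \<omega>] \<tau>_nonneg[of \<omega>] by (cases "\<tau> \<omega> = 0") auto
  qed
  then show "undershoot Y x \<in> borel_measurable M"
    unfolding undershoot_def[abs_def] L_def[abs_def] \<tau>_def Let_def by measurable
qed

lemma measurable_netput:
  assumes U: "\<And>n. 1 \<le> n \<Longrightarrow> U n \<in> borel_measurable M" and N: "N t \<in> M \<rightarrow>\<^sub>M count_space UNIV"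
  shows "netput u0 U N t \<in> borel_measurable M"
proof -
  have "(\<lambda>\<omega>. \<Sum>n=1..N t \<omega>. U n \<omega>) \<in> borel_measurable M"
    by (rule measurable_compose_countable[OF _ N]) (auto intro!: borel_measurable_sum U)
  then show ?thesis unfolding netput_def[abs_def] by measurable
qed

text \<open>After a time with \<open>X s < a\<close> the path first declines, so a rational time
  shortly after \<open>s\<close> serves as well. The end point \<open>t\<close> has no later time
  inside the interval and is added to the countable set.\<close>

lemma measurable_workload:
  assumes U: "\<And>n. 1 \<le> n \<Longrightarrow> U n \<in> borel_measurable M"
    and N: "\<And>t. 0 \<le> t \<Longrightarrow> N t \<in> M \<rightarrow>\<^sub>M count_space UNIV"
    and path: "\<And>\<omega>. \<omega> \<in> space M \<Longrightarrow> counting_path (\<lambda>t. N t \<omega>)" and u0: "0 \<le> u0" and t: "0 \<le> t"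
  shows "workload (netput u0 U N) t \<in> borel_measurable M"
proof -
  note Xm = measurable_netput[of U M N _ u0, OF U N]
  define I where "I \<omega> = Inf ({netput u0 U N s \<omega> | s. 0 \<le> s \<and> s \<le> t} \<union> {0})" for \<omega>
  have "I \<in> borel_measurable M"
  proof (rule borel_measurableI_less)
    fix a :: real
    let ?Q = "{q. (q \<in> \<rat> \<or> q = t) \<and> 0 \<le> q \<and> q \<le> t}"
    have iff: "I \<omega> < a \<longleftrightarrow> 0 < a \<or> (\<exists>q\<in>?Q. netput u0 U N q \<omega> < a)" if \<omega>: "\<omega> \<in> space M" for \<omega>
    proof -
      interpret workload_path u0 U N \<omega> using path[OF \<omega>] u0 by unfold_locales
      have "I \<omega> < a \<longleftrightarrow> 0 < a \<or> (\<exists>s. 0 \<le> s \<and> s \<le> t \<and> X s < a)"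
        unfolding I_def by (subst cInf_less_iff[OF _ bdd_below_X0]) auto
      also have "(\<exists>s. 0 \<le> s \<and> s \<le> t \<and> X s < a) \<longleftrightarrow> (\<exists>q\<in>?Q. X q < a)"
      proof
        assume "\<exists>s. 0 \<le> s \<and> s \<le> t \<and> X s < a"
        then obtain s where s: "0 \<le> s" "s \<le> t" "X s < a" by blast
        show "\<exists>q\<in>?Q. X q < a"
        proof (cases "s = t")
          case True then show ?thesis using s by auto
        next
          case False
          obtain d where d: "s < d" "\<And>r. s \<le> r \<Longrightarrow> r < d \<Longrightarrow> c r = c s"
            using counting_path_right_constant[OF N_path s(1)] by metis
          obtain q where q: "q \<in> \<rat>" "s < q" "q < min d t" using Rats_dense_in_real[of s "min d t"] d False s by auto
          have "c q = c s" by (rule d(2)) (use q in auto)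
          then have "X q < a" using X_eq[of q s] q s by simp
          then show ?thesis using q s by auto
        qed
      qed auto
      finally show ?thesis .
    qed
    have "{\<omega> \<in> space M. I \<omega> < a} = {\<omega> \<in> space M. 0 < a} \<union> (\<Union>q\<in>?Q. {\<omega> \<in> space M. netput u0 U N q \<omega> < a})"
      using iff by blast
    also have "\<dots> \<in> sets M"
    proof (intro sets.Un sets.countable_UN'')
      show "countable ?Q" by (rule countable_subset[of _ "insert t \<rat>"]) (auto intro: countable_rat)
      show "{\<omega> \<in> space M. netput u0 U N q \<omega> < a} \<in> sets M" if "q \<in> ?Q" for q
        using Xm[of q] that by (auto simp: borel_measurable_iff_less)
    qed auto
    finally show "{\<omega> \<in> space M. I \<omega> < a} \<in> sets M" .
  qed
  then show ?thesis unfolding workload_def[abs_def] I_def[symmetric] using Xm[OF _ t] by measurable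
qed


subsection \<open>The overflow position as a payoff\<close>

lemma queue_after_cong:
  assumes "\<And>i. i < k \<Longrightarrow> t i = t' i" "\<And>i. i < k \<Longrightarrow> u i = u' i"
  shows "queue_after u0 t u k = queue_after u0 t' u' k"
  using assms
proof (induction k)
  case (Suc k)
  have "prev t k = prev t' k" using Suc.prems(1)[of "k - 1"] by (auto simp: prev_def)
  then show ?case using Suc by simp
qed simp

context mg1_queue
begin

definition Q :: "nat \<Rightarrow> 'a \<Rightarrow> real" where
  "Q n \<omega> = queue_after u0 (\<lambda>i. T (Suc i) \<omega>) (\<lambda>i. U (Suc i) \<omega>) n"

definition Q_pre :: "nat \<Rightarrow> 'a \<Rightarrow> real" where
  "Q_pre n \<omega> = max (Q n \<omega> - (T (Suc n) \<omega> - T n \<omega>)) 0"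

text \<open>The level as a deterministic function of the history, the form in which independence of
  the next arrival can be applied.\<close>

definition Q_hist :: "nat \<Rightarrow> (nat \<Rightarrow> real) \<times> (nat \<Rightarrow> real) \<Rightarrow> real" where
  "Q_hist n h = queue_after u0 (fst h) (snd h) n"

definition below :: "real \<Rightarrow> nat \<Rightarrow> 'a \<Rightarrow> real" where
  "below x n \<omega> = (\<Prod>k\<le>n. indicator {..x} (Q k \<omega>))"

abbreviation "Y \<equiv> workload (netput u0 U N)"

lemma T_0: "\<omega> \<in> space M \<Longrightarrow> T 0 \<omega> = 0"
  unfolding T_def by (rule arrival_0[OF N_path])

lemma Q_Suc: "\<omega> \<in> space M \<Longrightarrow> Q (Suc n) \<omega> = Q_pre n \<omega> + U (Suc n) \<omega>"
  using T_0 by (cases n) (simp_all add: Q_def Q_pre_def prev_def)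

lemma Q_history: "k \<le> n \<Longrightarrow> Q k \<omega> = Q_hist k (history n \<omega>)"
  unfolding Q_def Q_hist_def history_def
  by (intro queue_after_cong) (auto simp: T_vec_def U_vec_def)

lemma measurable_Q_hist: "k \<le> n \<Longrightarrow> Q_hist k \<in> borel_measurable (history_space n)"
proof (induction k)
  case 0
  then show ?case by (simp add: Q_hist_def)
next
  case (Suc k)
  have 1: "(\<lambda>h. fst h i) \<in> borel_measurable (history_space n)" "(\<lambda>h. snd h i) \<in> borel_measurable (history_space n)" if "i < n" for i
    using measurable_compose[OF measurable_fst measurable_coordinate[OF that]]
      measurable_compose[OF measurable_snd measurable_coordinate[OF that]] by auto
  have 2: "(\<lambda>h. prev (fst h) k) \<in> borel_measurable (history_space n)"
    using measurable_compose[OF measurable_fst measurable_prev[of k n]] Suc.prems by auto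
  have 3: "Q_hist k \<in> borel_measurable (history_space n)" using Suc by simp
  have "Q_hist (Suc k) = (\<lambda>h. max (Q_hist k h - (fst h k - prev (fst h) k)) 0 + snd h k)"
    by (simp add: Q_hist_def fun_eq_iff)
  also have "\<dots> \<in> borel_measurable (history_space n)"
  proof -
    have "k < n" using Suc.prems by simp
    note [measurable] = 1[OF this] 2 3
    show ?thesis by measurable
  qed
  finally show ?case .
qed

lemma measurable_Q[measurable]: "Q n \<in> borel_measurable M"
proof -
  have "(\<lambda>\<omega>. Q_hist n (history n \<omega>)) \<in> borel_measurable M"
    by (rule measurable_compose[OF measurable_history measurable_Q_hist]) simp
  then show ?thesis by (simp add: Q_history[of n n, symmetric])
qed

lemma measurable_Q_pre[measurable]: "Q_pre n \<in> borel_measurable M"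
  unfolding Q_pre_def[abs_def] by measurable

lemma measurable_below[measurable]: "below x n \<in> borel_measurable M"
  unfolding below_def[abs_def] by measurable

lemma below_01: "below x n \<omega> = 0 \<or> below x n \<omega> = 1"
  by (induction n) (auto simp: below_def indicator_def)

lemma below_le: "0 \<le> below x n \<omega>" "below x n \<omega> \<le> 1"
  using below_01[of x n \<omega>] by auto

lemma abs_below_mult_le: "\<bar>g\<bar> \<le> K \<Longrightarrow> \<bar>below x n \<omega> * g\<bar> \<le> K"
  using below_01[of x n \<omega>] by auto

lemma below_Suc: "below x (Suc n) \<omega> = below x n \<omega> * indicator {..x} (Q (Suc n) \<omega>)"
  by (simp add: below_def)

lemma below_eq_1: "below x n \<omega> = 1 \<longleftrightarrow> (\<forall>k\<le>n. Q k \<omega> \<le> x)"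
proof -
  have "below x n \<omega> = (if \<forall>k\<le>n. Q k \<omega> \<le> x then 1 else 0)"
    by (induction n) (auto simp: below_def indicator_def le_Suc_eq)
  then show ?thesis by simp
qed

lemma AE_U_pos: "AE \<omega> in M. \<forall>n\<ge>1. 0 < U n \<omega>"
  unfolding AE_all_countable using U_pos by (auto simp: AE_all_countable)

lemma AE_Q_nonneg: "AE \<omega> in M. \<forall>n. 0 \<le> Q n \<omega>"
  using AE_U_pos AE_space
proof eventually_elim
  case (elim \<omega>)
  show ?case
  proof
    show "0 \<le> Q n \<omega>" for n
    proof (cases n)
      case 0
      then show ?thesis using u0_nonneg by (simp add: Q_def)
    next
      case (Suc k)
      have "0 < U (Suc k) \<omega>" using elim by auto
      moreover have "0 \<le> Q_pre k \<omega>" by (simp add: Q_pre_def)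
      ultimately show ?thesis using elim(2) Suc by (simp add: Q_Suc)
    qed
  qed
qed

text \<open>The Markov property on the event of no overflow so far: that event and
  \<open>Q n\<close> are functions of the history, so the next gap and job size can be integrated
  out.\<close>

lemma expectation_below_step:
  fixes G :: "real \<times> real \<Rightarrow> real"
  assumes [measurable]: "G \<in> borel_measurable (borel \<Otimes>\<^sub>M borel)" and B: "\<And>x. \<bar>G x\<bar> \<le> B"
  shows "expectation (\<lambda>\<omega>. below x n \<omega> * G (Q_pre n \<omega>, U (Suc n) \<omega>))
    = expectation (\<lambda>\<omega>. below x n \<omega> * (\<integral>e. (\<integral>z. G (max (Q n \<omega> - e) 0, z) \<partial>F) \<partial>Exp))"
proof -
  define below_hist where "below_hist h = (\<Prod>k\<le>n. indicator {..x} (Q_hist k h) :: real)" for h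
  have [measurable]: "below_hist \<in> borel_measurable (history_space n)"
    unfolding below_hist_def[abs_def]
  proof (rule borel_measurable_prod)
    fix k assume "k \<in> {..n}"
    then have [measurable]: "Q_hist k \<in> borel_measurable (history_space n)" by (intro measurable_Q_hist) simp
    show "(\<lambda>h. indicator {..x} (Q_hist k h) :: real) \<in> borel_measurable (history_space n)" by measurable
  qed
  have [measurable]: "Q_hist n \<in> borel_measurable (history_space n)" by (rule measurable_Q_hist) simp
  have bh: "below_hist (history n \<omega>) = below x n \<omega>" for \<omega>
    unfolding below_hist_def below_def by (intro prod.cong) (auto simp: Q_history[of _ n])
  define \<phi> where "\<phi> = (\<lambda>(h, e, z). below_hist h * G (max (Q_hist n h - e) 0, z))"
  have "expectation (\<lambda>\<omega>. \<phi> (history n \<omega>, (T (Suc n) \<omega> - T n \<omega>, U (Suc n) \<omega>)))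
    = expectation (\<lambda>\<omega>. \<integral>e. (\<integral>z. \<phi> (history n \<omega>, (e, z)) \<partial>F) \<partial>Exp)"
  proof (rule expectation_next_arrival)
    show "\<phi> \<in> borel_measurable (history_space n \<Otimes>\<^sub>M (borel \<Otimes>\<^sub>M borel))" unfolding \<phi>_def by measurable
    show "\<bar>\<phi> p\<bar> \<le> B" for p
    proof -
      obtain h e z where p: "p = (h, e, z)" by (cases p) auto
      have "\<bar>below_hist h\<bar> \<le> 1" unfolding below_hist_def abs_prod by (intro prod_le_1) (auto split: split_indicator)
      then have "\<bar>below_hist h\<bar> * \<bar>G (max (Q_hist n h - e) 0, z)\<bar> \<le> 1 * B" using B by (intro mult_mono) auto
      then show ?thesis by (simp add: \<phi>_def p abs_mult)
    qed
  qed
  then show ?thesis by (simp add: \<phi>_def bh Q_history[of n n, symmetric] Q_pre_def)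
qed

lemma expectation_bounded_indicator_le:
  assumes [measurable]: "g \<in> borel_measurable M" and "\<And>\<omega>. \<bar>g \<omega>\<bar> \<le> B"
  shows "\<bar>expectation (\<lambda>\<omega>. below x n \<omega> * g \<omega>)\<bar> \<le> B * expectation (below x n)"
proof -
  have i: "integrable M (below x n)" by (rule integrable_const_bound[where B=1]) (auto simp: below_le)
  have "\<bar>expectation (\<lambda>\<omega>. below x n \<omega> * g \<omega>)\<bar> \<le> expectation (\<lambda>\<omega>. \<bar>below x n \<omega> * g \<omega>\<bar>)"
    by (rule integral_abs_bound)
  also have "\<dots> \<le> expectation (\<lambda>\<omega>. B * below x n \<omega>)"
  proof (rule integral_mono)
    show le: "\<bar>below x n \<omega> * g \<omega>\<bar> \<le> B * below x n \<omega>" for \<omega>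
      using assms(2)[of \<omega>] below_le[of x n \<omega>] by (simp add: abs_mult mult.commute mult_right_mono)
    show "integrable M (\<lambda>\<omega>. \<bar>below x n \<omega> * g \<omega>\<bar>)"
      by (rule Bochner_Integration.integrable_bound[of _ "\<lambda>\<omega>. B * below x n \<omega>"])
         (use i le in \<open>auto intro: order_trans[OF _ abs_ge_self]\<close>)
  qed (use i in auto)
  finally show ?thesis by simp
qed

end

locale mg1_scale = mg1_queue M N l U F u0 + scale_function F l \<rho>
  for M :: "'a measure" and N l U F u0 \<rho>
begin

text \<open>By the one-step equation, the payoff collected at a jump is the decrease of the mean of
  \<open>payoff p x\<close> at the current level, restricted to no overflow. The remainder is left
  as a multiple of the probability of no overflow, since its vanishing is derived from this very
  estimate.\<close>

lemma payoff_telescope: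
  assumes [measurable]: "p \<in> borel_measurable borel" and p: "\<And>q. 0 \<le> p q" "\<And>q. p q \<le> K" "\<And>q. q < 0 \<Longrightarrow> p q = 0"
    and ux: "0 < ur x" and x: "u0 \<le> x"
  obtains B where "\<And>n. \<bar>(\<Sum>k<n. expectation (\<lambda>\<omega>. below x k \<omega> * p (x - Q_pre k \<omega>))) - payoff p x u0\<bar> \<le> B * expectation (below x n)"
proof -
  obtain B where B: "\<And>y. 0 \<le> y \<Longrightarrow> \<bar>payoff p x y\<bar> \<le> B" using payoff_bounded[OF assms(1) p ux] by metis
  \<comment> \<open>The payoff is bounded only for nonnegative levels, while the step lemma asks for
    a bound everywhere; the levels are almost surely nonnegative, so the clamp changes
    nothing.\<close>
  define V where "V y = payoff p x (max y 0)" for y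
  have [measurable]: "V \<in> borel_measurable borel"
    unfolding V_def using measurable_payoff[OF assms(1) p] by measurable
  have VB: "\<bar>V y\<bar> \<le> B" for y unfolding V_def by (rule B) simp
  have V_above: "V y = 0" if "x < y" for y
    unfolding V_def using that x u0_nonneg by (intro payoff_above[OF assms(1) p]) auto
  have K: "0 \<le> K" using p(1,2)[of 0] by simp
  interpret X: prob_space Exp by (rule prob_space_exponential_density[OF l_pos])
  define v where "v n = expectation (\<lambda>\<omega>. below x n \<omega> * V (Q n \<omega>))" for n
  have intF: "integrable F (\<lambda>z. V (y + z))" for y
    by (rule F.integrable_const_bound[where B=B]) (use VB in auto)
  have step: "v n = expectation (\<lambda>\<omega>. below x n \<omega> * p (x - Q_pre n \<omega>)) + v (Suc n)" for n
  proof -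
    let ?G = "\<lambda>(y, z). p (x - y) + V (y + z)"
    have UM[measurable]: "U (Suc n) \<in> borel_measurable M" by (rule U_measurable) simp
    have i1: "integrable M (\<lambda>\<omega>. below x n \<omega> * p (x - Q_pre n \<omega>))"
      by (rule integrable_const_bound[where B=K])
         (use p in \<open>auto intro!: AE_I2 simp: abs_below_mult_le simp del: abs_mult\<close>)
    have i2: "integrable M (\<lambda>\<omega>. below x n \<omega> * V (Q_pre n \<omega> + U (Suc n) \<omega>))"
      by (rule integrable_const_bound[where B=B])
         (use VB in \<open>auto intro!: AE_I2 simp: abs_below_mult_le simp del: abs_mult\<close>)
    have "v n = expectation (\<lambda>\<omega>. below x n \<omega> * (\<integral>e. (\<integral>z. ?G (max (Q n \<omega> - e) 0, z) \<partial>F) \<partial>Exp))"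
      unfolding v_def
    proof (rule integral_cong_AE)
      show "AE \<omega> in M. below x n \<omega> * V (Q n \<omega>) = below x n \<omega> * (\<integral>e. (\<integral>z. ?G (max (Q n \<omega> - e) 0, z) \<partial>F) \<partial>Exp)"
        using AE_Q_nonneg
      proof eventually_elim
        case (elim \<omega>)
        show ?case
        proof (cases "below x n \<omega> = 1")
          case True
          then have Qn: "0 \<le> Q n \<omega>" "Q n \<omega> \<le> x" using elim by (auto simp: below_eq_1)
          have "(\<integral>z. ?G (max (Q n \<omega> - e) 0, z) \<partial>F) = p (x - max (Q n \<omega> - e) 0) + (\<integral>z. payoff p x (max (Q n \<omega> - e) 0 + z) \<partial>F)" for e
          proof -
            have "(\<integral>z. ?G (max (Q n \<omega> - e) 0, z) \<partial>F) = p (x - max (Q n \<omega> - e) 0) + (\<integral>z. V (max (Q n \<omega> - e) 0 + z) \<partial>F)"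
              using intF F.prob_space by simp
            also have "(\<integral>z. V (max (Q n \<omega> - e) 0 + z) \<partial>F) = (\<integral>z. payoff p x (max (Q n \<omega> - e) 0 + z) \<partial>F)"
              using measurable_payoff[OF assms(1) p]
              by (intro integral_cong_AE) (use F_pos in \<open>auto elim!: eventually_mono simp: V_def\<close>)
            finally show ?thesis .
          qed
          then have "(\<integral>e. (\<integral>z. ?G (max (Q n \<omega> - e) 0, z) \<partial>F) \<partial>Exp) = payoff p x (Q n \<omega>)"
            using payoff_one_step[OF assms(1) p ux Qn] by simp
          then show ?thesis using Qn by (simp add: V_def)
        next
          case False
          then show ?thesis using below_01[of x n \<omega>] by simp
        qed
      qed
    qed measurable
    also have "\<dots> = expectation (\<lambda>\<omega>. below x n \<omega> * ?G (Q_pre n \<omega>, U (Suc n) \<omega>))"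
    proof (rule expectation_below_step[symmetric])
      show "\<bar>?G p'\<bar> \<le> K + B" for p'
      proof -
        obtain y z where "p' = (y, z)" by (cases p') auto
        then show ?thesis using p(1,2)[of "x - y"] VB[of "y + z"] by simp
      qed
    qed measurable
    also have "\<dots> = expectation (\<lambda>\<omega>. below x n \<omega> * p (x - Q_pre n \<omega>)) + expectation (\<lambda>\<omega>. below x n \<omega> * V (Q_pre n \<omega> + U (Suc n) \<omega>))"
      using i1 i2 by (simp add: distrib_left)
    also have "expectation (\<lambda>\<omega>. below x n \<omega> * V (Q_pre n \<omega> + U (Suc n) \<omega>)) = v (Suc n)"
      unfolding v_def
    proof (rule Bochner_Integration.integral_cong[OF refl])
      fix \<omega> assume "\<omega> \<in> space M"
      then show "below x n \<omega> * V (Q_pre n \<omega> + U (Suc n) \<omega>) = below x (Suc n) \<omega> * V (Q (Suc n) \<omega>)"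
        using V_above[of "Q (Suc n) \<omega>"] by (auto simp: below_Suc Q_Suc indicator_def)
    qed
    finally show ?thesis .
  qed
  have sum: "(\<Sum>k<n. expectation (\<lambda>\<omega>. below x k \<omega> * p (x - Q_pre k \<omega>))) + v n = v 0" for n
  proof (induction n)
    case (Suc n)
    then show ?case using step[of n] by simp
  qed simp
  have v0: "v 0 = payoff p x u0"
    using x u0_nonneg by (simp add: v_def below_def Q_def V_def prob_space)
  have bd: "\<bar>v n\<bar> \<le> B * expectation (below x n)" for n
    unfolding v_def using VB by (intro expectation_bounded_indicator_le) auto
  show ?thesis
  proof (rule that)
    show "\<bar>(\<Sum>k<n. expectation (\<lambda>\<omega>. below x k \<omega> * p (x - Q_pre k \<omega>))) - payoff p x u0\<bar> \<le> B * expectation (below x n)" for n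
      using sum[of n] bd[of n] unfolding v0 by linarith
  qed
qed

text \<open>A payoff of 1 per jump counts the jumps before overflow; as the expected payoff is finite,
  the probabilities of not having overflowed are summable.\<close>

lemma overflow_certain:
  assumes ux: "0 < ur x" and x: "u0 \<le> x"
  shows "(\<lambda>n. expectation (below x n)) \<longlonglongrightarrow> 0"
proof -
  let ?p = "indicator {0..} :: real \<Rightarrow> real"
  obtain B where B: "\<And>n. \<bar>(\<Sum>k<n. expectation (\<lambda>\<omega>. below x k \<omega> * ?p (x - Q_pre k \<omega>))) - payoff ?p x u0\<bar> \<le> B * expectation (below x n)"
  proof -
    have "?p \<in> borel_measurable borel" "\<And>q. 0 \<le> ?p q" "\<And>q. ?p q \<le> 1" "\<And>q. q < 0 \<Longrightarrow> ?p q = 0"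
      by (auto split: split_indicator)
    from payoff_telescope[OF this ux x] show ?thesis using that by blast
  qed
  have int: "integrable M (below x n)" for n by (rule integrable_const_bound[where B=1]) (auto simp: below_le)
  have E: "0 \<le> expectation (below x n)" "expectation (below x n) \<le> 1" for n
    using below_le by (auto intro!: integral_nonneg_AE integral_le_const int)
  have eq: "expectation (\<lambda>\<omega>. below x k \<omega> * ?p (x - Q_pre k \<omega>)) = expectation (below x k)" for k
  proof (rule integral_cong_AE)
    show "AE \<omega> in M. below x k \<omega> * ?p (x - Q_pre k \<omega>) = below x k \<omega>"
      using AE_T_increasing
    proof eventually_elim
      case (elim \<omega>)
      show ?case
      proof (cases "below x k \<omega> = 1")
        case True
        then have "Q k \<omega> \<le> x" by (auto simp: below_eq_1)
        then have "Q_pre k \<omega> \<le> x" using elim x u0_nonneg less_imp_le[OF spec[OF elim, of k]] by (simp add: Q_pre_def)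
        then show ?thesis by simp
      qed (use below_01[of x k \<omega>] in auto)
    qed
  qed measurable
  have "(\<Sum>k<n. expectation (below x k)) \<le> \<bar>payoff ?p x u0\<bar> + \<bar>B\<bar>" for n
  proof -
    have "B * expectation (below x n) \<le> \<bar>B\<bar> * 1"
      using E[of n] by (intro order_trans[OF mult_right_mono[of B "\<bar>B\<bar>"] mult_left_mono]) auto
    then show ?thesis using B[of n] unfolding eq by linarith
  qed
  then have "summable (\<lambda>k. expectation (below x k))" using E by (intro summableI_nonneg_bounded) auto
  then show ?thesis by (rule summable_LIMSEQ_zero)
qed

text \<open>A jump \<open>z\<close> from level \<open>x - q\<close> overflows exactly when
  \<open>z > q\<close>, with undershoot \<open>q\<close> and overshoot \<open>z - q\<close>. This is
  the mean of \<open>f\<close> at that position, counted only if the jump overflows.\<close>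

definition jump_payoff :: "(real \<times> real \<Rightarrow> real) \<Rightarrow> real \<Rightarrow> real" where
  "jump_payoff f q = (\<integral>z. f (q, z - q) * indicator {q<..} z \<partial>F) * indicator {0..} q"

lemma
  assumes [measurable]: "f \<in> borel_measurable borel" and f: "\<And>p. 0 \<le> f p" "\<And>p. f p \<le> K"
  shows measurable_jump_payoff: "jump_payoff f \<in> borel_measurable borel"
    and jump_payoff_nonneg: "0 \<le> jump_payoff f q"
    and jump_payoff_le: "jump_payoff f q \<le> K * measure F {q<..}"
    and jump_payoff_neg: "q < 0 \<Longrightarrow> jump_payoff f q = 0"
proof -
  have fm: "f \<in> borel_measurable (borel \<Otimes>\<^sub>M borel)" by (simp add: borel_prod)
  note [measurable] = this
  have K: "0 \<le> K" using f(1,2)[of "(0, 0)"] by simp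
  have "jump_payoff f = (\<lambda>q. (\<integral>z. (if q < z then f (q, z - q) else 0) \<partial>F) * indicator {0..} q)"
    unfolding jump_payoff_def by (intro ext arg_cong2[where f="(*)"] Bochner_Integration.integral_cong) (auto split: split_indicator)
  also have "\<dots> \<in> borel_measurable borel" using fm by measurable
  finally show "jump_payoff f \<in> borel_measurable borel" .
  show "0 \<le> jump_payoff f q" unfolding jump_payoff_def using f by (intro mult_nonneg_nonneg integral_nonneg_AE) auto
  have "(\<integral>z. f (q, z - q) * indicator {q<..} z \<partial>F) \<le> (\<integral>z. K * indicator {q<..} z \<partial>F)"
  proof (rule integral_mono)
    show "integrable F (\<lambda>z. f (q, z - q) * indicator {q<..} z)"
      by (rule F.integrable_const_bound[where B=K]) (use f K in \<open>auto split: split_indicator\<close>)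
    show "f (q, z - q) * indicator {q<..} z \<le> K * indicator {q<..} z" for z using f by (auto split: split_indicator)
    show "integrable F (\<lambda>z. K * indicator {q<..} z)"
      by (rule F.integrable_const_bound[where B=K]) (use K in \<open>auto split: split_indicator\<close>)
  qed
  then show "jump_payoff f q \<le> K * measure F {q<..}"
    unfolding jump_payoff_def using K by (auto split: split_indicator)
  show "q < 0 \<Longrightarrow> jump_payoff f q = 0" by (simp add: jump_payoff_def)
qed

lemma AE_overflow:
  assumes x: "u0 \<le> x"
  shows "AE \<omega> in M. \<forall>n. below x n \<omega> = 1 \<and> x < Q (Suc n) \<omega> \<longrightarrow>
    undershoot Y x \<omega> = x - Q_pre n \<omega> \<and> overshoot Y x \<omega> = Q_pre n \<omega> + U (Suc n) \<omega> - x"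
  using AE_T_increasing AE_U_pos AE_space
proof eventually_elim
  case (elim \<omega>)
  interpret P: regular_workload_path u0 U N \<omega>
    using elim N_path u0_nonneg by unfold_locales (auto simp: T_def)
  have DQ: "P.D n = Q n \<omega>" for n by (simp add: P.D_def Q_def T_def)
  show ?case
  proof (intro allI impI)
    fix n assume n: "below x n \<omega> = 1 \<and> x < Q (Suc n) \<omega>"
    have x0: "0 \<le> x" using x u0_nonneg by simp
    have le: "P.D k \<le> x" if "k \<le> n" for k using n that by (auto simp: below_eq_1 DQ)
    show "undershoot Y x \<omega> = x - Q_pre n \<omega> \<and> overshoot Y x \<omega> = Q_pre n \<omega> + U (Suc n) \<omega> - x"
      using P.first_overflow(2,3)[OF x0 le] n Q_Suc[OF elim(3), of n] by (simp add: DQ Q_pre_def T_def)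
  qed
qed

lemma measurable_overflow_position:
  "(\<lambda>\<omega>. (undershoot Y x \<omega>, overshoot Y x \<omega>)) \<in> borel_measurable M"
proof -
  have Ym: "Y t \<in> borel_measurable M" if "0 \<le> t" for t
    using that U_measurable N_measurable N_path u0_nonneg by (intro measurable_workload) auto
  have path: "workload_path u0 N \<omega>" if "\<omega> \<in> space M" for \<omega>
    using that N_path u0_nonneg by unfold_locales
  have rc: "((\<lambda>s. Y s \<omega>) \<longlongrightarrow> Y t \<omega>) (at_right t)" if "\<omega> \<in> space M" "0 \<le> t" for \<omega> t
    by (rule workload_path.Y_right_continuous[OF path]) (use that in auto)
  have ll: "\<exists>L. ((\<lambda>s. Y s \<omega>) \<longlongrightarrow> L) (at_left t)" if "\<omega> \<in> space M" "0 < t" for \<omega> t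
  proof -
    interpret W: workload_path u0 U N \<omega> using that by (intro path)
    show ?thesis using W.constant_before[OF that(2)] W.Y_left_limit by metis
  qed
  note [measurable] = measurable_undershoot_overshoot[OF Ym rc ll]
  show ?thesis by (subst borel_prod[symmetric]) measurable
qed

text \<open>The difference of \<open>below x k\<close> and \<open>below x (Suc k)\<close> singles
  out overflow at arrival \<open>k + 1\<close>, where the position is a function of
  \<open>Q_pre k\<close> and the next job; averaging over that job turns \<open>f\<close> into
  \<open>jump_payoff f\<close>. The sum over \<open>k\<close> telescopes, and comparison with
  \<open>payoff_telescope\<close> leaves remainders that vanish because overflow is certain.\<close>

theorem expectation_overflow:
  fixes f :: "real \<times> real \<Rightarrow> real"
  assumes ux: "0 < ur x" and x: "u0 \<le> x"
    and f_meas[measurable]: "f \<in> borel_measurable borel" and f: "\<And>p. 0 \<le> f p" "\<And>p. f p \<le> K"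
  shows "expectation (\<lambda>\<omega>. f (undershoot Y x \<omega>, overshoot Y x \<omega>)) = payoff (jump_payoff f) x u0"
proof -
  let ?p = "jump_payoff f"
  have K: "0 \<le> K" using f(1,2)[of "(0, 0)"] by simp
  have p_le: "?p q \<le> K" for q
    using jump_payoff_le[OF f_meas f, of q] K mult_left_mono[of "measure F {q<..}" 1 K] by (simp add: F.prob_le_1)
  obtain B where B: "\<And>n. \<bar>(\<Sum>k<n. expectation (\<lambda>\<omega>. below x k \<omega> * ?p (x - Q_pre k \<omega>))) - payoff ?p x u0\<bar> \<le> B * expectation (below x n)"
    using payoff_telescope[OF measurable_jump_payoff[OF f_meas f] jump_payoff_nonneg[OF f_meas f] p_le jump_payoff_neg[OF f_meas f] ux x] by blast
  define \<Phi> where "\<Phi> \<omega> = f (undershoot Y x \<omega>, overshoot Y x \<omega>)" for \<omega>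
  have [measurable]: "\<Phi> \<in> borel_measurable M"
    unfolding \<Phi>_def by (rule measurable_compose[OF measurable_overflow_position f_meas])
  have \<Phi>: "0 \<le> \<Phi> \<omega>" "\<Phi> \<omega> \<le> K" for \<omega> using f by (auto simp: \<Phi>_def)
  have fm[measurable]: "f \<in> borel_measurable (borel \<Otimes>\<^sub>M borel)" by (simp add: borel_prod)
  have int: "integrable M (\<lambda>\<omega>. below x n \<omega> * \<Phi> \<omega>)" for n
    by (rule integrable_const_bound[where B=K])
       (use \<Phi> in \<open>auto intro!: AE_I2 simp: abs_below_mult_le simp del: abs_mult\<close>)
  have summand: "expectation (\<lambda>\<omega>. below x k \<omega> * ?p (x - Q_pre k \<omega>))
    = expectation (\<lambda>\<omega>. below x k \<omega> * \<Phi> \<omega>) - expectation (\<lambda>\<omega>. below x (Suc k) \<omega> * \<Phi> \<omega>)" for k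
  proof -
    let ?G = "\<lambda>(y, z). if x - y < z then f (x - y, z - (x - y)) else 0"
    have [measurable]: "?G \<in> borel_measurable (borel \<Otimes>\<^sub>M borel)" by measurable
    have GB: "\<bar>?G p\<bar> \<le> K" for p using f K by (auto split: prod.split)
    have UM[measurable]: "U (Suc k) \<in> borel_measurable M" by (rule U_measurable) simp
    have Gp: "(\<integral>z. ?G (y, z) \<partial>F) = ?p (x - y)" if "y \<le> x" for y
      using that unfolding jump_payoff_def by (auto intro!: Bochner_Integration.integral_cong split: split_indicator)
    \<comment> \<open>The step lemma is applied twice: forward with \<open>?G'\<close>, where the
      job has already been averaged, and backward with \<open>?G\<close>, which reinstates the job
      actually drawn. In between, the two inner integrals agree below \<open>x\<close>.\<close>
    let ?G' = "\<lambda>(y, z :: real). ?p (x - y)"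
    have mp[measurable]: "?p \<in> borel_measurable borel" by (rule measurable_jump_payoff[OF f_meas f])
    have Gp'B: "\<bar>?G' p\<bar> \<le> K" for p using p_le jump_payoff_nonneg[OF f_meas f] by (auto split: prod.split)
    have "expectation (\<lambda>\<omega>. below x k \<omega> * ?G' (Q_pre k \<omega>, U (Suc k) \<omega>))
      = expectation (\<lambda>\<omega>. below x k \<omega> * (\<integral>e. (\<integral>z. ?G' (max (Q k \<omega> - e) 0, z) \<partial>F) \<partial>Exp))"
      by (rule expectation_below_step[OF _ Gp'B]) measurable
    also have "\<dots> = expectation (\<lambda>\<omega>. below x k \<omega> * (\<integral>e. (\<integral>z. ?G (max (Q k \<omega> - e) 0, z) \<partial>F) \<partial>Exp))"
    proof (rule Bochner_Integration.integral_cong[OF refl])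
      fix \<omega>
      show "below x k \<omega> * (\<integral>e. (\<integral>z. ?G' (max (Q k \<omega> - e) 0, z) \<partial>F) \<partial>Exp)
        = below x k \<omega> * (\<integral>e. (\<integral>z. ?G (max (Q k \<omega> - e) 0, z) \<partial>F) \<partial>Exp)"
      proof (cases "below x k \<omega> = 1")
        case True
        then have Qx: "Q k \<omega> \<le> x" by (auto simp: below_eq_1)
        have "(\<integral>e. (\<integral>z. ?G' (max (Q k \<omega> - e) 0, z) \<partial>F) \<partial>Exp) = (\<integral>e. (\<integral>z. ?G (max (Q k \<omega> - e) 0, z) \<partial>F) \<partial>Exp)"
        proof (rule integral_cong_AE)
          show "AE e in Exp. (\<integral>z. ?G' (max (Q k \<omega> - e) 0, z) \<partial>F) = (\<integral>z. ?G (max (Q k \<omega> - e) 0, z) \<partial>F)"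
          proof (subst AE_density, simp, intro AE_I2 impI)
            fix e :: real assume "0 < ennreal (exponential_density l e)"
            then have "0 \<le> e" by (auto simp: exponential_density_def split: if_splits)
            then have "max (Q k \<omega> - e) 0 \<le> x" using Qx x u0_nonneg by simp
            from Gp[OF this] show "(\<integral>z. ?G' (max (Q k \<omega> - e) 0, z) \<partial>F) = (\<integral>z. ?G (max (Q k \<omega> - e) 0, z) \<partial>F)"
              using F.prob_space by simp
          qed
        qed measurable
        then show ?thesis by simp
      qed (use below_01[of x k \<omega>] in auto)
    qed
    also have "\<dots> = expectation (\<lambda>\<omega>. below x k \<omega> * ?G (Q_pre k \<omega>, U (Suc k) \<omega>))"
      by (rule expectation_below_step[OF _ GB, symmetric]) measurable
    also have "\<dots> = expectation (\<lambda>\<omega>. below x k \<omega> * \<Phi> \<omega> - below x (Suc k) \<omega> * \<Phi> \<omega>)"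
    proof (rule integral_cong_AE)
      show "AE \<omega> in M. below x k \<omega> * ?G (Q_pre k \<omega>, U (Suc k) \<omega>) = below x k \<omega> * \<Phi> \<omega> - below x (Suc k) \<omega> * \<Phi> \<omega>"
        using AE_overflow[OF x] AE_space
      proof eventually_elim
        case (elim \<omega>)
        show ?case
        proof (cases "below x k \<omega> = 1")
          case True
          show ?thesis
          proof (cases "x < Q (Suc k) \<omega>")
            case over: True
            then have "\<Phi> \<omega> = f (x - Q_pre k \<omega>, Q_pre k \<omega> + U (Suc k) \<omega> - x)"
              using elim True by (simp add: \<Phi>_def)
            then show ?thesis using True over Q_Suc[OF elim(2), of k] by (simp add: below_Suc algebra_simps)
          next
            case False
            then show ?thesis using True Q_Suc[OF elim(2), of k] by (simp add: below_Suc)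
          qed
        qed (use below_01[of x k \<omega>] in \<open>auto simp: below_Suc\<close>)
      qed
    qed measurable
    also have "\<dots> = expectation (\<lambda>\<omega>. below x k \<omega> * \<Phi> \<omega>) - expectation (\<lambda>\<omega>. below x (Suc k) \<omega> * \<Phi> \<omega>)"
      by (intro Bochner_Integration.integral_diff int)
    finally show ?thesis by simp
  qed
  have "(\<Sum>k<n. expectation (\<lambda>\<omega>. below x k \<omega> * ?p (x - Q_pre k \<omega>))) = expectation \<Phi> - expectation (\<lambda>\<omega>. below x n \<omega> * \<Phi> \<omega>)" for n
  proof (induction n)
    case 0
    have "below x 0 \<omega> = 1" for \<omega> using x by (simp add: below_def Q_def)
    then show ?case by simp
  qed (simp add: summand)
  then have sum: "\<bar>expectation \<Phi> - expectation (\<lambda>\<omega>. below x n \<omega> * \<Phi> \<omega>) - payoff ?p x u0\<bar> \<le> B * expectation (below x n)" for n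
    using B[of n] by simp
  have bd: "\<bar>expectation \<Phi> - payoff ?p x u0\<bar> \<le> (B + K) * expectation (below x n)" for n
  proof -
    have "\<bar>expectation (\<lambda>\<omega>. below x n \<omega> * \<Phi> \<omega>)\<bar> \<le> K * expectation (below x n)"
      using \<Phi> by (intro expectation_bounded_indicator_le) auto
    then show ?thesis using sum[of n] by (simp add: distrib_right)
  qed
  have "(\<lambda>n. (B + K) * expectation (below x n)) \<longlonglongrightarrow> (B + K) * 0"
    by (intro tendsto_intros overflow_certain ux x)
  then have "\<bar>expectation \<Phi> - payoff ?p x u0\<bar> \<le> (B + K) * 0"
    by (rule LIMSEQ_le_const) (use bd in auto)
  then show ?thesis by (simp add: \<Phi>_def[abs_def])
qed

end


subsection \<open>Moments of the netput\<close>

context mg1_queue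
begin

definition jump_sum :: "nat \<Rightarrow> 'a \<Rightarrow> real" where "jump_sum k \<omega> = (\<Sum>n=1..k. U n \<omega>)"

definition pois :: "nat \<Rightarrow> real" where "pois k = l ^ k / fact k * exp (- l)"

lemma pois_nonneg: "0 \<le> pois k" using l_pos by (simp add: pois_def)

lemma measurable_jump_sum[measurable]: "jump_sum k \<in> borel_measurable M"
  unfolding jump_sum_def[abs_def] by (intro borel_measurable_sum U_measurable) auto

lemma jump_sum_U_vec: "jump_sum k \<omega> = (\<Sum>i<k. U_vec k \<omega> i)"
  unfolding jump_sum_def U_vec_def by (simp add: sum.atLeast1_atMost_eq)

text \<open>Conditioning on the number of jumps, for nonnegative functions with possibly infinite
  integral, so that finiteness for the netput can be turned into finiteness for
  \<open>F\<close>.\<close>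

lemma nn_integral_compound_poisson:
  assumes [measurable]: "\<phi> \<in> borel_measurable borel"
  shows "(\<integral>\<^sup>+\<omega>. \<phi> (jump_sum (N 1 \<omega>) \<omega>) \<partial>M) = (\<Sum>k. ennreal (pois k) * (\<integral>\<^sup>+\<omega>. \<phi> (jump_sum k \<omega>) \<partial>M))"
proof -
  have N1[measurable]: "N 1 \<in> M \<rightarrow>\<^sub>M count_space UNIV" by (intro N_measurable) simp
  have "(\<integral>\<^sup>+\<omega>. \<phi> (jump_sum (N 1 \<omega>) \<omega>) \<partial>M) = (\<integral>\<^sup>+\<omega>. (\<Sum>k. indicator {k} (N 1 \<omega>) * \<phi> (jump_sum k \<omega>)) \<partial>M)"
  proof (rule nn_integral_cong)
    fix \<omega>
    have "(\<Sum>k. indicator {k} (N 1 \<omega>) * \<phi> (jump_sum k \<omega>)) = (\<Sum>k\<in>{N 1 \<omega>}. indicator {k} (N 1 \<omega>) * \<phi> (jump_sum k \<omega>))"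
      by (intro suminf_finite) auto
    then show "\<phi> (jump_sum (N 1 \<omega>) \<omega>) = (\<Sum>k. indicator {k} (N 1 \<omega>) * \<phi> (jump_sum k \<omega>))" by simp
  qed
  also have "\<dots> = (\<Sum>k. \<integral>\<^sup>+\<omega>. indicator {k} (N 1 \<omega>) * \<phi> (jump_sum k \<omega>) \<partial>M)"
  proof (rule nn_integral_suminf)
    fix k :: nat
    have [measurable]: "(\<lambda>\<omega>. indicator {k} (N 1 \<omega>) :: ennreal) \<in> borel_measurable M"
      by (rule measurable_compose[OF N1]) simp
    show "(\<lambda>\<omega>. indicator {k} (N 1 \<omega>) * \<phi> (jump_sum k \<omega>)) \<in> borel_measurable M" by measurable
  qed
  also have "(\<lambda>k. \<integral>\<^sup>+\<omega>. indicator {k} (N 1 \<omega>) * \<phi> (jump_sum k \<omega>) \<partial>M) = (\<lambda>k. ennreal (pois k) * (\<integral>\<^sup>+\<omega>. \<phi> (jump_sum k \<omega>) \<partial>M))"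
  proof
    fix k :: nat
    let ?P = "Pi\<^sub>M {..<k} (\<lambda>_. borel :: real measure)"
    interpret DU: prob_space "distr M ?P (U_vec k)" by (rule prob_space_distr) simp
    interpret DN: prob_space "distr M (count_space UNIV) (N 1)" by (rule prob_space_distr) simp
    have sm[measurable]: "(\<lambda>u. \<Sum>i<k. u i) \<in> borel_measurable ?P" by (intro borel_measurable_sum measurable_coordinate) auto
    have [measurable]: "(\<lambda>u. \<phi> (\<Sum>i<k. u i)) \<in> borel_measurable ?P" by (rule measurable_compose[OF sm]) simp
    have ind: "(indicator {k} :: nat \<Rightarrow> ennreal) \<in> borel_measurable (count_space UNIV)" by simp
    have [measurable]: "(\<lambda>x. indicator {k} (snd x) :: ennreal) \<in> borel_measurable (?P \<Otimes>\<^sub>M count_space UNIV)"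
      by (rule measurable_compose[OF measurable_snd ind])
    have [measurable]: "(\<lambda>(u, j). indicator {k} j * \<phi> (\<Sum>i<k. u i)) \<in> borel_measurable (?P \<Otimes>\<^sub>M count_space UNIV)"
      unfolding split_beta' by measurable
    have "(\<integral>\<^sup>+\<omega>. indicator {k} (N 1 \<omega>) * \<phi> (jump_sum k \<omega>) \<partial>M)
      = (\<integral>\<^sup>+x. (\<lambda>(u, j). indicator {k} j * \<phi> (\<Sum>i<k. u i)) x \<partial>distr M (?P \<Otimes>\<^sub>M count_space UNIV) (\<lambda>\<omega>. (U_vec k \<omega>, N 1 \<omega>)))"
      by (subst nn_integral_distr) (auto simp: jump_sum_U_vec)
    also have "\<dots> = (\<integral>\<^sup>+u. (\<integral>\<^sup>+j. indicator {k} j * \<phi> (\<Sum>i<k. u i) \<partial>distr M (count_space UNIV) (N 1)) \<partial>distr M ?P (U_vec k))"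
      unfolding indep_U_vec_N[OF measurable_N_algebra[of 1, simplified] N1]
      by (subst DN.nn_integral_fst[symmetric]) auto
    also have "\<dots> = (\<integral>\<^sup>+u. ennreal (pois k) * \<phi> (\<Sum>i<k. u i) \<partial>distr M ?P (U_vec k))"
    proof (rule nn_integral_cong)
      fix u
      have "(\<integral>\<^sup>+j. indicator {k} j * \<phi> (\<Sum>i<k. u i) \<partial>distr M (count_space UNIV) (N 1)) = emeasure (distr M (count_space UNIV) (N 1)) {k} * \<phi> (\<Sum>i<k. u i)"
        by (subst nn_integral_multc) auto
      also have "emeasure (distr M (count_space UNIV) (N 1)) {k} = ennreal (prob {\<omega> \<in> space M. N 1 \<omega> - N 0 \<omega> = k})"
        using N_path by (subst emeasure_distr) (auto simp: emeasure_eq_measure counting_path_def intro!: arg_cong[where f=prob])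
      finally show "(\<integral>\<^sup>+j. indicator {k} j * \<phi> (\<Sum>i<k. u i) \<partial>distr M (count_space UNIV) (N 1)) = ennreal (pois k) * \<phi> (\<Sum>i<k. u i)"
        by (simp add: increment_prob pois_def)
    qed
    also have "\<dots> = ennreal (pois k) * (\<integral>\<^sup>+\<omega>. \<phi> (jump_sum k \<omega>) \<partial>M)"
      by (subst nn_integral_cmult, measurable, subst nn_integral_distr) (auto simp: jump_sum_U_vec)
    finally show "(\<integral>\<^sup>+\<omega>. indicator {k} (N 1 \<omega>) * \<phi> (jump_sum k \<omega>) \<partial>M) = ennreal (pois k) * (\<integral>\<^sup>+\<omega>. \<phi> (jump_sum k \<omega>) \<partial>M)" .
  qed
  finally show ?thesis .
qed

lemma nn_integral_U: "1 \<le> n \<Longrightarrow> \<phi> \<in> borel_measurable borel \<Longrightarrow> (\<integral>\<^sup>+\<omega>. \<phi> (U n \<omega>) \<partial>M) = (\<integral>\<^sup>+z. \<phi> z \<partial>F)"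
  by (subst U_distr[symmetric]) (auto intro!: nn_integral_distr[symmetric] U_measurable)

text \<open>Exactly one jump occurs with positive probability, so the single term
  \<open>k = 1\<close> carries a moment of the netput over to \<open>F\<close>.\<close>

lemma finite_of_compound_poisson:
  assumes [measurable]: "\<phi> \<in> borel_measurable borel" and fin: "(\<integral>\<^sup>+\<omega>. \<phi> (jump_sum (N 1 \<omega>) \<omega>) \<partial>M) < \<infinity>"
  shows "(\<integral>\<^sup>+z. \<phi> z \<partial>F) < \<infinity>"
proof -
  have "ennreal (pois 1) * (\<integral>\<^sup>+\<omega>. \<phi> (jump_sum 1 \<omega>) \<partial>M) \<le> (\<Sum>k. ennreal (pois k) * (\<integral>\<^sup>+\<omega>. \<phi> (jump_sum k \<omega>) \<partial>M))"
    using sum_le_suminf[of "\<lambda>k. ennreal (pois k) * (\<integral>\<^sup>+\<omega>. \<phi> (jump_sum k \<omega>) \<partial>M)" "{1}"] by simp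
  also have "\<dots> < \<infinity>" using fin unfolding nn_integral_compound_poisson[OF assms(1)] .
  finally have "ennreal (pois 1) * (\<integral>\<^sup>+\<omega>. \<phi> (jump_sum 1 \<omega>) \<partial>M) < \<infinity>" .
  moreover have "(\<integral>\<^sup>+\<omega>. \<phi> (jump_sum 1 \<omega>) \<partial>M) = (\<integral>\<^sup>+z. \<phi> z \<partial>F)"
    using nn_integral_U[of 1 \<phi>] by (simp add: jump_sum_def)
  moreover have "0 < pois 1" using l_pos by (simp add: pois_def)
  ultimately show ?thesis by (auto simp: ennreal_mult_less_top)
qed

lemma nn_integral_exp_jump_sum: "(\<integral>\<^sup>+\<omega>. ennreal (exp (\<gamma> * jump_sum k \<omega>)) \<partial>M) = (\<integral>\<^sup>+z. ennreal (exp (\<gamma> * z)) \<partial>F) ^ k"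
proof -
  have "indep_vars (\<lambda>_. borel) (\<lambda>i \<omega>. ennreal (exp (\<gamma> * U i \<omega>))) {1..k}"
    by (rule indep_vars_compose2[where Y="\<lambda>_ z. ennreal (exp (\<gamma> * z))", OF indep_vars_subset[OF U_indep]]) auto
  then have "(\<integral>\<^sup>+\<omega>. (\<Prod>i\<in>{1..k}. ennreal (exp (\<gamma> * U i \<omega>))) \<partial>M) = (\<Prod>i\<in>{1..k}. \<integral>\<^sup>+\<omega>. exp (\<gamma> * U i \<omega>) \<partial>M)"
    by (intro indep_vars_nn_integral) auto
  also have "\<dots> = (\<Prod>i\<in>{1..k}. \<integral>\<^sup>+z. exp (\<gamma> * z) \<partial>F)"
    by (intro prod.cong refl nn_integral_U) auto
  finally show ?thesis by (simp add: jump_sum_def sum_distrib_left exp_sum prod_ennreal)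
qed

text \<open>The exponential formula for a compound Poisson variable, summed as a power series in
  \<open>a\<close>. Finiteness of \<open>a\<close> is obtained beforehand from the term with one
  jump.\<close>

lemma exponential_moment:
  assumes int: "integrable M (\<lambda>\<omega>. exp (\<gamma> * (jump_sum (N 1 \<omega>) \<omega> - 1)))"
  shows "integrable F (\<lambda>z. exp (\<gamma> * z))"
    and "expectation (\<lambda>\<omega>. exp (\<gamma> * (jump_sum (N 1 \<omega>) \<omega> - 1))) = exp (l * ((\<integral>z. exp (\<gamma> * z) \<partial>F) - 1) - \<gamma>)"
proof -
  let ?\<phi> = "\<lambda>s. ennreal (exp (\<gamma> * (s - 1)))"
  define a where "a = (\<integral>z. exp (\<gamma> * z) \<partial>F)"
  have nn: "(\<integral>\<^sup>+\<omega>. ?\<phi> (jump_sum (N 1 \<omega>) \<omega>) \<partial>M) = ennreal (expectation (\<lambda>\<omega>. exp (\<gamma> * (jump_sum (N 1 \<omega>) \<omega> - 1))))"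
    by (rule nn_integral_eq_integral[OF int]) simp
  have "(\<integral>\<^sup>+z. ?\<phi> z \<partial>F) < \<infinity>" by (rule finite_of_compound_poisson) (use nn in auto)
  then have "integrable F (\<lambda>z. exp (\<gamma> * (z - 1)))" by (intro integrableI_nonneg) auto
  then have "integrable F (\<lambda>z. exp \<gamma> * exp (\<gamma> * (z - 1)))" by (intro integrable_mult_right)
  then show i: "integrable F (\<lambda>z. exp (\<gamma> * z))" by (simp add: exp_add[symmetric] algebra_simps)
  have a: "(\<integral>\<^sup>+z. ennreal (exp (\<gamma> * z)) \<partial>F) = ennreal a" "0 \<le> a"
    using nn_integral_eq_integral[OF i] by (auto simp: a_def)
  have "(\<integral>\<^sup>+\<omega>. ?\<phi> (jump_sum k \<omega>) \<partial>M) = ennreal (exp (- \<gamma>) * a ^ k)" for k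
  proof -
    have "(\<integral>\<^sup>+\<omega>. ?\<phi> (jump_sum k \<omega>) \<partial>M) = (\<integral>\<^sup>+\<omega>. ennreal (exp (- \<gamma>)) * ennreal (exp (\<gamma> * jump_sum k \<omega>)) \<partial>M)"
      by (intro nn_integral_cong) (simp add: ennreal_mult[symmetric] exp_add[symmetric] algebra_simps)
    also have "\<dots> = ennreal (exp (- \<gamma>)) * ennreal a ^ k"
      by (subst nn_integral_cmult) (auto simp: nn_integral_exp_jump_sum a)
    finally show ?thesis using a by (simp add: ennreal_mult ennreal_power)
  qed
  then have "(\<integral>\<^sup>+\<omega>. ?\<phi> (jump_sum (N 1 \<omega>) \<omega>) \<partial>M) = (\<Sum>k. ennreal (pois k * (exp (- \<gamma>) * a ^ k)))"
    by (subst nn_integral_compound_poisson) (auto simp: ennreal_mult pois_nonneg a)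
  also have "\<dots> = ennreal (exp (l * (a - 1) - \<gamma>))"
  proof -
    have "(\<lambda>k. exp (- l - \<gamma>) * ((l * a) ^ k /\<^sub>R fact k)) sums (exp (- l - \<gamma>) * exp (l * a))"
      by (intro sums_mult exp_converges)
    also have "(\<lambda>k. exp (- l - \<gamma>) * ((l * a) ^ k /\<^sub>R fact k)) = (\<lambda>k. pois k * (exp (- \<gamma>) * a ^ k))"
      by (auto simp: fun_eq_iff pois_def power_mult_distrib exp_diff exp_minus field_simps)
    also have "exp (- l - \<gamma>) * exp (l * a) = exp (l * (a - 1) - \<gamma>)"
      by (simp add: exp_add[symmetric] algebra_simps)
    finally have "(\<lambda>k. pois k * (exp (- \<gamma>) * a ^ k)) sums exp (l * (a - 1) - \<gamma>)" .
    then show ?thesis using a pois_nonneg by (intro suminf_ennreal_eq) auto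
  qed
  finally show "expectation (\<lambda>\<omega>. exp (\<gamma> * (jump_sum (N 1 \<omega>) \<omega> - 1))) = exp (l * ((\<integral>z. exp (\<gamma> * z) \<partial>F) - 1) - \<gamma>)"
    unfolding nn a_def[symmetric] by (subst (asm) ennreal_inj) auto
qed

lemma AE_jump_sum_nonneg: "AE \<omega> in M. \<forall>k. 0 \<le> jump_sum k \<omega>"
  using AE_U_pos
proof eventually_elim
  case (elim \<omega>)
  show ?case unfolding jump_sum_def by (intro allI sum_nonneg less_imp_le) (use elim in auto)
qed

lemma expectation_compound_poisson:
  assumes int: "integrable M (\<lambda>\<omega>. \<bar>jump_sum (N 1 \<omega>) \<omega> - 1\<bar>)"
  shows "integrable F (\<lambda>z. z)" and "expectation (\<lambda>\<omega>. jump_sum (N 1 \<omega>) \<omega> - 1) = l * (\<integral>z. z \<partial>F) - 1"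
proof -
  have N1[measurable]: "N 1 \<in> M \<rightarrow>\<^sub>M count_space UNIV" by (intro N_measurable) simp
  have jm[measurable]: "(\<lambda>\<omega>. jump_sum (N 1 \<omega>) \<omega>) \<in> borel_measurable M"
    by (rule measurable_compose_countable[OF _ N1]) simp
  have "(\<integral>\<^sup>+\<omega>. ennreal \<bar>jump_sum (N 1 \<omega>) \<omega> - 1\<bar> \<partial>M) < \<infinity>"
    using int nn_integral_eq_integral[OF int] by simp
  then have "(\<integral>\<^sup>+z. ennreal \<bar>z - 1\<bar> \<partial>F) < \<infinity>" by (intro finite_of_compound_poisson[where \<phi>="\<lambda>z. ennreal \<bar>z - 1\<bar>"]) auto
  then have "integrable F (\<lambda>z. \<bar>z - 1\<bar>)" by (intro integrableI_nonneg) auto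
  then have "integrable F (\<lambda>z. z - 1)" by (subst (asm) integrable_abs_iff) auto
  then have "integrable F (\<lambda>z. (z - 1) + 1)" by (intro Bochner_Integration.integrable_add) auto
  then show i: "integrable F (\<lambda>z. z)" by simp
  define m where "m = (\<integral>z. z \<partial>F)"
  have F0: "AE z in F. 0 \<le> z" using F_pos by eventually_elim simp
  have m: "(\<integral>\<^sup>+z. ennreal z \<partial>F) = ennreal m" "0 \<le> m"
    unfolding m_def using nn_integral_eq_integral[OF i F0] F0 by (auto intro: integral_nonneg_AE)
  have js: "(\<integral>\<^sup>+\<omega>. ennreal (jump_sum k \<omega>) \<partial>M) = ennreal (real k * m)" for k
  proof -
    have "(\<integral>\<^sup>+\<omega>. ennreal (jump_sum k \<omega>) \<partial>M) = (\<integral>\<^sup>+\<omega>. (\<Sum>n=1..k. ennreal (U n \<omega>)) \<partial>M)"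
    proof (rule nn_integral_cong_AE)
      show "AE \<omega> in M. ennreal (jump_sum k \<omega>) = (\<Sum>n=1..k. ennreal (U n \<omega>))"
        using AE_U_pos
      proof eventually_elim
        case (elim \<omega>)
        show ?case unfolding jump_sum_def by (intro sum_ennreal[symmetric] less_imp_le) (use elim in auto)
      qed
    qed
    also have "\<dots> = (\<Sum>n=1..k. \<integral>\<^sup>+\<omega>. ennreal (U n \<omega>) \<partial>M)" by (intro nn_integral_sum measurable_compose[OF U_measurable measurable_ennreal]) auto
    also have "\<dots> = (\<Sum>n=1..k. ennreal m)" using nn_integral_U[of _ ennreal] by (intro sum.cong) (auto simp: m)
    finally show ?thesis using m by (simp add: ennreal_mult ennreal_of_nat_eq_real_of_nat)
  qed
  have "(\<integral>\<^sup>+\<omega>. ennreal (jump_sum (N 1 \<omega>) \<omega>) \<partial>M) = (\<Sum>k. ennreal (pois k * (real k * m)))"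
    by (subst nn_integral_compound_poisson) (auto simp: js ennreal_mult pois_nonneg m)
  also have "\<dots> = ennreal (l * m)"
  proof -
    have "(\<lambda>k. exp (- l) * (l ^ k /\<^sub>R fact k)) sums (exp (- l) * exp l)" by (intro sums_mult exp_converges)
    then have "pois sums 1" by (simp add: pois_def[abs_def] exp_minus field_simps)
    then have "(\<lambda>k. (l * m) * pois k) sums ((l * m) * 1)" by (rule sums_mult)
    moreover have "(l * m) * pois k = pois (Suc k) * (real (Suc k) * m)" for k
      by (simp add: pois_def field_simps del: of_nat_Suc)
    ultimately have "(\<lambda>k. pois (Suc k) * (real (Suc k) * m)) sums (l * m)" by simp
    then have "(\<lambda>k. pois k * (real k * m)) sums (l * m)" by (subst (asm) sums_Suc_iff) simp
    then show ?thesis using m pois_nonneg by (intro suminf_ennreal_eq) auto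
  qed
  finally have nn: "(\<integral>\<^sup>+\<omega>. ennreal (jump_sum (N 1 \<omega>) \<omega>) \<partial>M) = ennreal (l * m)" .
  have "has_bochner_integral M (\<lambda>\<omega>. jump_sum (N 1 \<omega>) \<omega>) (l * m)"
    using AE_jump_sum_nonneg m l_pos by (intro has_bochner_integral_nn_integral nn) (auto elim: eventually_mono)
  then have "integrable M (\<lambda>\<omega>. jump_sum (N 1 \<omega>) \<omega>)" "expectation (\<lambda>\<omega>. jump_sum (N 1 \<omega>) \<omega>) = l * m"
    by (auto simp: has_bochner_integral_iff)
  then show "expectation (\<lambda>\<omega>. jump_sum (N 1 \<omega>) \<omega> - 1) = l * (\<integral>z. z \<partial>F) - 1"
    by (simp add: m_def prob_space)
qed

subsection \<open>Roots of the characteristic equation\<close>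

lemma char_root_iff: "char_root l F s \<longleftrightarrow> integrable F (\<lambda>y. exp (s * y)) \<and> l * ((\<integral>y. exp (s * y) \<partial>F) - 1) = s"
proof -
  have AE: "AE y in F. indicator {0<..} y *\<^sub>R exp (s * y) = exp (s * y)" using F_pos by eventually_elim simp
  have "set_integrable F {0<..} (\<lambda>y. exp (s * y)) \<longleftrightarrow> integrable F (\<lambda>y. exp (s * y))"
    unfolding set_integrable_def using AE by (intro integrable_cong_AE) auto
  moreover have "(LINT y:{0<..}|F. exp (s * y)) = (\<integral>y. exp (s * y) \<partial>F)"
    unfolding set_lebesgue_integral_def using AE by (intro integral_cong_AE) auto
  ultimately show ?thesis by (auto simp: char_root_def algebra_simps)
qed

lemma set_mean: "(LINT y:{0<..}|F. y) = (\<integral>y. y \<partial>F)"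
  unfolding set_lebesgue_integral_def
  by (intro integral_cong_AE) (use F_pos in \<open>auto elim: eventually_mono\<close>)

lemma exp_strict: "w \<noteq> 0 \<Longrightarrow> 1 + w < exp (w :: real)"
proof -
  assume w: "w \<noteq> 0"
  show ?thesis
  \<comment> \<open>Squaring the tangent bound at \<open>w / 2\<close> beats \<open>1 + w\<close> by
    \<open>w\<^sup>2 / 4\<close>, but squaring is monotone only while \<open>1 + w / 2\<close> is
    nonnegative; below -2 the left side is negative anyway.\<close>
  proof (cases "-2 \<le> w")
    case True
    have "0 < w ^ 2" using w by simp
    then have "1 + w < (1 + w / 2) ^ 2" by (simp add: power2_eq_square field_simps)
    also have "\<dots> \<le> exp (w / 2) ^ 2" using True by (intro power_mono exp_ge_add_one_self) auto
    also have "\<dots> = exp w" by (simp add: exp_double[symmetric])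
    finally show ?thesis .
  next
    case False
    then have "1 + w < 0" by simp
    then show ?thesis using exp_gt_zero[of w] by linarith
  qed
qed

text \<open>The strict tangent bound at \<open>(1 - \<theta>) * w\<close> and at
  \<open>- \<theta> * w\<close>, weighted with \<theta> and \<open>1 - \<theta>\<close> so that the
  linear terms cancel; multiplying by \<open>exp (\<theta> * w)\<close> gives the claim.\<close>

lemma exp_strictly_convex:
  assumes "0 < \<theta>" "\<theta> < 1" "w \<noteq> (0::real)"
  shows "exp (\<theta> * w) < \<theta> * exp w + (1 - \<theta>)"
proof -
  have "\<theta> * (1 + (1 - \<theta>) * w) < \<theta> * exp ((1 - \<theta>) * w)" using assms by (intro mult_strict_left_mono exp_strict) auto
  moreover have "(1 - \<theta>) * (1 + - \<theta> * w) < (1 - \<theta>) * exp (- \<theta> * w)" using assms by (intro mult_strict_left_mono exp_strict) auto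
  ultimately have "1 < \<theta> * exp ((1 - \<theta>) * w) + (1 - \<theta>) * exp (- \<theta> * w)" by (simp add: algebra_simps)
  then have "exp (\<theta> * w) * 1 < exp (\<theta> * w) * (\<theta> * exp ((1 - \<theta>) * w) + (1 - \<theta>) * exp (- \<theta> * w))"
    by (intro mult_strict_left_mono) auto
  also have "\<dots> = \<theta> * (exp (\<theta> * w) * exp ((1 - \<theta>) * w)) + (1 - \<theta>) * (exp (\<theta> * w) * exp (- \<theta> * w))"
    by (simp add: algebra_simps)
  also have "exp (\<theta> * w) * exp ((1 - \<theta>) * w) = exp w" by (simp add: exp_add[symmetric] algebra_simps)
  also have "exp (\<theta> * w) * exp (- \<theta> * w) = 1" by (simp add: exp_add[symmetric])
  finally show ?thesis by simp
qed

lemma integral_F_pos: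
  assumes i: "integrable F (h :: real \<Rightarrow> real)" and pos: "\<And>y. 0 < y \<Longrightarrow> 0 < h y"
  shows "0 < (\<integral>y. h y \<partial>F)"
proof -
  have nn: "AE y in F. 0 \<le> h y" using F_pos by eventually_elim (use pos in \<open>auto intro: less_imp_le\<close>)
  have "(\<integral>y. h y \<partial>F) \<noteq> 0"
  proof
    assume "(\<integral>y. h y \<partial>F) = 0"
    then have "AE y in F. h y = 0" using integral_nonneg_eq_0_iff_AE[OF i nn] by simp
    with F_pos have "AE y in F. False" by eventually_elim (use pos in force)
    then show False by simp
  qed
  then show ?thesis using integral_nonneg_AE[OF nn] by linarith
qed

text \<open>The characteristic function is strictly convex and vanishes at 0, so it cannot vanish
  both at \<open>t\<close> and at a point strictly between 0 and \<open>t\<close>. This identifies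
  the largest and the smallest root.\<close>

lemma char_roots_same_sign:
  assumes s: "char_root l F s" and t: "char_root l F t" and \<theta>: "s = \<theta> * t" "0 < \<theta>" "\<theta> < 1" and "t \<noteq> 0"
  shows False
proof -
  note s' = s[unfolded char_root_iff] and t' = t[unfolded char_root_iff]
  have "0 < (\<integral>y. \<theta> * exp (t * y) + (1 - \<theta>) - exp (s * y) \<partial>F)"
  proof (rule integral_F_pos)
    show "integrable F (\<lambda>y. \<theta> * exp (t * y) + (1 - \<theta>) - exp (s * y))" using s' t' by auto
    show "0 < \<theta> * exp (t * y) + (1 - \<theta>) - exp (s * y)" if "0 < y" for y
      using exp_strictly_convex[OF \<theta>(2,3), of "t * y"] that \<open>t \<noteq> 0\<close> by (simp add: \<theta>(1) mult.assoc)
  qed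
  also have "(\<integral>y. \<theta> * exp (t * y) + (1 - \<theta>) - exp (s * y) \<partial>F) = \<theta> * ((\<integral>y. exp (t * y) \<partial>F) - 1) - ((\<integral>y. exp (s * y) \<partial>F) - 1)"
    using s' t' F.prob_space by (simp add: algebra_simps)
  also have "\<dots> = \<theta> * (t / l) - s / l"
    using s' t' l_pos by (simp add: field_simps)
  also have "\<dots> = 0" using \<theta> by simp
  finally show False by simp
qed

text \<open>At \<open>-s\<close> the characteristic function is
  \<open>l * (\<Lambda> s - 1) + s\<close>. Its slope at 0 is one minus \<open>l\<close> times the
  mean, hence negative, while at \<open>s = l\<close> its value is
  \<open>l * \<Lambda> l > 0\<close>; the intermediate value theorem gives the root. The slope is
  computed along \<open>s = 1 / Suc n\<close> by dominated convergence.\<close>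

lemma negative_root_exists:
  assumes i: "integrable F (\<lambda>y. y)" and drift: "1 < l * (\<integral>y. y \<partial>F)"
  obtains \<rho> where "0 < \<rho>" "char_root l F (- \<rho>)"
proof -
  define \<Lambda> where "\<Lambda> s = (\<integral>y. exp (- s * y) \<partial>F)" for s
  have F0: "AE y in F. 0 \<le> y" using F_pos by eventually_elim simp
  have ie: "integrable F (\<lambda>y. exp (- s * y))" if "0 \<le> s" for s
    by (rule F.integrable_const_bound[where B=1]) (use F0 that in \<open>auto elim: eventually_mono\<close>)
  have lim: "(\<lambda>n. \<integral>y. real (Suc n) * (1 - exp (- (1 / real (Suc n)) * y)) \<partial>F) \<longlonglongrightarrow> (\<integral>y. y \<partial>F)"
  proof (rule integral_dominated_convergence[where w="\<lambda>y. y"])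
    show "AE y in F. (\<lambda>n. real (Suc n) * (1 - exp (- (1 / real (Suc n)) * y))) \<longlonglongrightarrow> y"
    proof (intro AE_I2)
      fix y :: real
      have "(\<lambda>n. real n * (1 - exp (- (1 / real n) * y))) \<longlonglongrightarrow> y" by real_asymp
      then show "(\<lambda>n. real (Suc n) * (1 - exp (- (1 / real (Suc n)) * y))) \<longlonglongrightarrow> y" by (rule LIMSEQ_Suc)
    qed
    show "AE y in F. norm (real (Suc n) * (1 - exp (- (1 / real (Suc n)) * y))) \<le> y" for n
      using F0
    proof eventually_elim
      case (elim y)
      have "1 + (- (1 / real (Suc n)) * y) \<le> exp (- (1 / real (Suc n)) * y)" by (rule exp_ge_add_one_self)
      then have "1 - exp (- (1 / real (Suc n)) * y) \<le> y / real (Suc n)" by simp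
      then have "real (Suc n) * (1 - exp (- (1 / real (Suc n)) * y)) \<le> y" by (simp add: field_simps)
      moreover have "0 \<le> 1 - exp (- (1 / real (Suc n)) * y)" using elim by simp
      ultimately show ?case by (simp add: abs_mult)
    qed
    show "integrable F (\<lambda>y. y)" by (rule i)
    show "(\<lambda>y. y) \<in> borel_measurable F" by measurable
    show "(\<lambda>y. real (Suc n) * (1 - exp (- (1 / real (Suc n)) * y))) \<in> borel_measurable F" for n by measurable
  qed
  have "1 / l < (\<integral>y. y \<partial>F)" using drift l_pos by (simp add: field_simps)
  then have "\<forall>\<^sub>F n in sequentially. 1 / l < (\<integral>y. real (Suc n) * (1 - exp (- (1 / real (Suc n)) * y)) \<partial>F)"
    using lim by (intro order_tendstoD) auto
  \<comment> \<open>Ensures that the left end \<open>1 / Suc n\<close> does not exceed the right end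
    \<open>l\<close>.\<close>
  moreover have "\<forall>\<^sub>F n in sequentially. 1 / l < real n" using filterlim_real_sequentially by (rule filterlim_at_top_dense[THEN iffD1, rule_format])
  ultimately have "\<forall>\<^sub>F n in sequentially. 1 / l < (\<integral>y. real (Suc n) * (1 - exp (- (1 / real (Suc n)) * y)) \<partial>F) \<and> 1 / l < real n"
    by eventually_elim simp
  then obtain n where n: "1 / l < (\<integral>y. real (Suc n) * (1 - exp (- (1 / real (Suc n)) * y)) \<partial>F)" "1 / l < real n"
    using eventually_happens by force
  define a where "a = 1 / real (Suc n)"
  have a: "0 < a" "a \<le> l" using n l_pos by (auto simp: a_def field_simps)
  have eq: "(\<integral>y. real (Suc n) * (1 - exp (- a * y)) \<partial>F) = real (Suc n) * (1 - \<Lambda> a)"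
    using ie[of a] a F.prob_space by (simp add: \<Lambda>_def)
  have "1 / l < real (Suc n) * (1 - \<Lambda> a)" using n(1) unfolding a_def[symmetric] eq .
  then have "a * (1 / l) < a * (real (Suc n) * (1 - \<Lambda> a))" using a by (intro mult_strict_left_mono)
  also have "\<dots> = 1 - \<Lambda> a" by (simp add: a_def)
  finally have na: "l * (\<Lambda> a - 1) + a < 0" using l_pos by (simp add: field_simps)
  have "0 < \<Lambda> l" unfolding \<Lambda>_def using l_pos by (intro integral_F_pos ie) auto
  then have nl: "0 < l * (\<Lambda> l - 1) + l" using l_pos by (simp add: algebra_simps)
  have cont: "continuous_on {a..l} (\<lambda>s. l * (\<Lambda> s - 1) + s)"
  proof (intro continuous_intros)
    show "continuous_on {a..l} \<Lambda>"
      unfolding continuous_on_sequentially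
    proof (intro allI ballI impI)
      fix x :: "nat \<Rightarrow> real" and s assume s: "s \<in> {a..l}" and x: "(\<forall>n. x n \<in> {a..l}) \<and> x \<longlonglongrightarrow> s"
      show "(\<Lambda> \<circ> x) \<longlonglongrightarrow> \<Lambda> s" unfolding comp_def \<Lambda>_def
      proof (rule integral_dominated_convergence[where w="\<lambda>_. 1"])
        show "AE y in F. (\<lambda>n. exp (- x n * y)) \<longlonglongrightarrow> exp (- s * y)" using x by (intro AE_I2 tendsto_intros) auto
        show "AE y in F. norm (exp (- x n * y)) \<le> 1" for n
          using F0 x a(1) less_le_trans[OF a(1), of "x n"] by (auto elim!: eventually_mono simp: less_imp_le)
      qed auto
    qed
  qed
  obtain \<rho> where \<rho>: "a \<le> \<rho>" "l * (\<Lambda> \<rho> - 1) + \<rho> = 0"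
    using IVT'[of "\<lambda>s. l * (\<Lambda> s - 1) + s" a 0 l] na nl a cont by auto
  show ?thesis
  proof (rule that)
    show "0 < \<rho>" using a \<rho> by simp
    show "char_root l F (- \<rho>)" unfolding char_root_iff
      using ie[of \<rho>] a \<rho> by (auto simp: \<Lambda>_def)
  qed
qed

end


subsection \<open>The limit law\<close>

context mg1_queue
begin

text \<open>The conclusion of the theorem with constant and exponent left open, so that both cases
  share the construction of the limit law.\<close>

definition overflow_limit :: "real \<Rightarrow> real \<Rightarrow> bool" where
  "overflow_limit C r \<longleftrightarrow> (\<exists>L :: (real \<times> real) measure.
     prob_space L \<and> sets L = sets borel \<and>
     (\<forall>A B. A \<in> sets borel \<and> B \<in> sets borel \<and> A \<subseteq> {0<..} \<and> B \<subseteq> {0<..} \<longrightarrow>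
        emeasure L (A \<times> B) =
          (\<integral>\<^sup>+u\<in>A. ennreal (C * (1 - exp (r * u))) * emeasure F ((\<lambda>v. v + u) ` B) \<partial>lborel)) \<and>
     weak_conv_at_top (\<lambda>x. distr M borel (\<lambda>\<omega>. (undershoot Y x \<omega>, overshoot Y x \<omega>))) L)"

end

context mg1_scale
begin

text \<open>The candidate is the measure \<open>c u du F(dz)\<close> on \<open>0 < u < z\<close>,
  moved by \<open>(u, z - u)\<close>; its integral of \<open>f\<close> is that of \<open>c\<close>
  times \<open>jump_payoff f\<close>, which is the assumed limit. The total mass is one because the
  expectations of the constant 1 converge to it.\<close>

lemma overflow_limitI:
  fixes C r :: real
  defines "c \<equiv> \<lambda>u. C * (1 - exp (r * u))"
  assumes c_nonneg: "\<And>u. 0 < u \<Longrightarrow> 0 \<le> c u"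
    and pos: "\<forall>\<^sub>F x in at_top. 0 < ur x"
    and lim: "\<And>p K. p \<in> borel_measurable borel \<Longrightarrow> (\<And>q. 0 \<le> p q) \<Longrightarrow> (\<And>q. p q \<le> K * measure F {q<..}) \<Longrightarrow>
      (\<And>q. q < 0 \<Longrightarrow> p q = 0) \<Longrightarrow> ((\<lambda>x. payoff p x u0) \<longlongrightarrow> (\<integral>q. c q * p q \<partial>lborel)) at_top"
  shows "overflow_limit C r"
proof -
  have [measurable]: "c \<in> borel_measurable borel" unfolding c_def by measurable
  define w where "w = (\<lambda>(u, z). if 0 < u \<and> u < z then ennreal (c u) else 0)"
  have w_meas[measurable]: "w \<in> borel_measurable (lborel \<Otimes>\<^sub>M F)" unfolding w_def by measurable
  have shift[measurable]: "(\<lambda>(y, z). (y, z - y)) \<in> lborel \<Otimes>\<^sub>M F \<rightarrow>\<^sub>M (borel :: (real \<times> real) measure)"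
    by (subst borel_prod[symmetric]) measurable
  define L where "L = distr (density (lborel \<Otimes>\<^sub>M F) w) borel (\<lambda>(y, z). (y, z - y))"
  have setsL[simp, measurable_cong]: "sets L = sets borel" by (simp add: L_def)
  have nnL: "(\<integral>\<^sup>+x. f x \<partial>L) = (\<integral>\<^sup>+u. (\<integral>\<^sup>+z. w (u, z) * f (u, z - u) \<partial>F) \<partial>lborel)"
    if f[measurable]: "f \<in> borel_measurable borel" for f
  proof -
    have fm[measurable]: "(\<lambda>x. f ((\<lambda>(y, z). (y, z - y)) x)) \<in> borel_measurable (lborel \<Otimes>\<^sub>M F)"
      by (rule measurable_compose[OF shift f])
    have "(\<integral>\<^sup>+x. f x \<partial>L) = (\<integral>\<^sup>+x. f ((\<lambda>(y, z). (y, z - y)) x) \<partial>density (lborel \<Otimes>\<^sub>M F) w)"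
      unfolding L_def using shift f by (intro nn_integral_distr) auto
    also have "\<dots> = (\<integral>\<^sup>+x. w x * f ((\<lambda>(y, z). (y, z - y)) x) \<partial>(lborel \<Otimes>\<^sub>M F))"
      by (intro nn_integral_density) auto
    also have "\<dots> = (\<integral>\<^sup>+u. (\<integral>\<^sup>+z. w (u, z) * f ((\<lambda>(y, z). (y, z - y)) (u, z)) \<partial>F) \<partial>lborel)"
      by (intro F.nn_integral_fst[symmetric]) measurable
    finally show ?thesis by simp
  qed
  have nnL_real: "(\<integral>\<^sup>+x. ennreal (f x) \<partial>L) = (\<integral>\<^sup>+u. ennreal (c u * jump_payoff f u) \<partial>lborel)"
    if f[measurable]: "f \<in> borel_measurable borel" and f_bd: "\<And>x. 0 \<le> f x" "\<And>x. f x \<le> K" for f :: "real \<times> real \<Rightarrow> real" and K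
  proof (subst nnL, measurable, intro nn_integral_cong_AE eventually_mono[OF AE_lborel_singleton[of 0]])
    \<comment> \<open>\<open>jump_payoff\<close> counts \<open>q = 0\<close> whereas the density
      \<open>w\<close> asks for \<open>u > 0\<close>; the difference is a null set.\<close>
    fix u :: real assume "u \<noteq> 0"
    have fm: "f \<in> borel_measurable (borel \<Otimes>\<^sub>M borel)" using f by (simp add: borel_prod)
    note [measurable] = this
    show "(\<integral>\<^sup>+z. w (u, z) * ennreal (f (u, z - u)) \<partial>F) = ennreal (c u * jump_payoff f u)"
    proof (cases "0 < u")
      case True
      have i: "integrable F (\<lambda>z. f (u, z - u) * indicator {u<..} z)"
        by (rule F.integrable_const_bound[where B=K])
           (use f_bd order_trans[OF f_bd] in \<open>auto split: split_indicator\<close>)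
      have "(\<integral>\<^sup>+z. w (u, z) * ennreal (f (u, z - u)) \<partial>F) = (\<integral>\<^sup>+z. ennreal (c u) * ennreal (f (u, z - u) * indicator {u<..} z) \<partial>F)"
        using True by (intro nn_integral_cong) (auto simp: w_def split: split_indicator)
      also have "\<dots> = ennreal (c u) * (\<integral>\<^sup>+z. ennreal (f (u, z - u) * indicator {u<..} z) \<partial>F)"
        by (intro nn_integral_cmult) measurable
      also have "(\<integral>\<^sup>+z. ennreal (f (u, z - u) * indicator {u<..} z) \<partial>F) = ennreal (jump_payoff f u)"
        using True f_bd by (subst nn_integral_eq_integral[OF i]) (auto simp: jump_payoff_def)
      finally show ?thesis using c_nonneg[OF True] jump_payoff_nonneg[OF f f_bd] by (simp add: ennreal_mult)
    next
      case False
      then show ?thesis using \<open>u \<noteq> 0\<close> by (simp add: w_def jump_payoff_def)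
    qed
  qed
  have weight_nonneg: "0 \<le> c u * jump_payoff f u"
    if "f \<in> borel_measurable borel" "\<And>x. 0 \<le> f x" "\<And>x. f x \<le> K" for f :: "real \<times> real \<Rightarrow> real" and K u
  proof -
    consider "u < 0" | "u = 0" | "0 < u" by linarith
    then show ?thesis
    proof cases
      case 3
      then show ?thesis by (intro mult_nonneg_nonneg c_nonneg jump_payoff_nonneg[OF that])
    qed (auto simp: jump_payoff_def c_def)
  qed
  have integral_L: "(\<integral>x. f x \<partial>L) = (\<integral>u. c u * jump_payoff f u \<partial>lborel)"
    if f[measurable]: "f \<in> borel_measurable borel" and f_bd: "\<And>x. 0 \<le> f x" "\<And>x. f x \<le> K" for f :: "real \<times> real \<Rightarrow> real" and K
  proof -
    have [measurable]: "jump_payoff f \<in> borel_measurable borel" by (rule measurable_jump_payoff[OF f f_bd])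
    show ?thesis
      using f_bd weight_nonneg[OF f f_bd] by (subst (1 2) integral_eq_nn_integral) (auto simp: nnL_real[OF f f_bd])
  qed
  have conv: "((\<lambda>x. expectation (\<lambda>\<omega>. f (undershoot Y x \<omega>, overshoot Y x \<omega>))) \<longlongrightarrow> (\<integral>x. f x \<partial>L)) at_top"
    if f[measurable]: "f \<in> borel_measurable borel" and f_bd: "\<And>x. 0 \<le> f x" "\<And>x. f x \<le> K" for f :: "real \<times> real \<Rightarrow> real" and K
  proof -
    have "((\<lambda>x. payoff (jump_payoff f) x u0) \<longlongrightarrow> (\<integral>x. f x \<partial>L)) at_top"
      unfolding integral_L[OF f f_bd]
      by (rule lim[OF measurable_jump_payoff[OF f f_bd] jump_payoff_nonneg[OF f f_bd] jump_payoff_le[OF f f_bd] jump_payoff_neg[OF f f_bd]])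
    then show ?thesis
    proof (rule Lim_transform_eventually)
      show "\<forall>\<^sub>F x in at_top. payoff (jump_payoff f) x u0 = expectation (\<lambda>\<omega>. f (undershoot Y x \<omega>, overshoot Y x \<omega>))"
        using pos eventually_ge_at_top[of u0] by eventually_elim (rule expectation_overflow[OF _ _ f f_bd, symmetric])
    qed
  qed
  have L1: "(\<integral>x. 1 \<partial>L) = (1 :: real)"
  proof (rule tendsto_unique[OF _ conv[of "\<lambda>_. 1" 1]])
    show "((\<lambda>x. expectation (\<lambda>\<omega>. 1)) \<longlongrightarrow> (1::real)) (at_top :: real filter)" by (simp add: prob_space)
  qed auto
  interpret L: prob_space L
  proof
    \<comment> \<open>If the constant were not integrable its integral would be 0 by convention, so
      \<open>L1\<close> also proves that \<open>L\<close> is finite.\<close>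
    have "integrable L (\<lambda>x. 1 :: real)" using L1 not_integrable_integral_eq by fastforce
    then have "(\<integral>\<^sup>+x. ennreal 1 \<partial>L) = ennreal (\<integral>x. 1 \<partial>L)" by (intro nn_integral_eq_integral) auto
    then show "emeasure L (space L) = 1" unfolding L1 by simp
  qed
  have rect: "emeasure L (A \<times> B) = (\<integral>\<^sup>+u\<in>A. ennreal (C * (1 - exp (r * u))) * emeasure F ((\<lambda>v. v + u) ` B) \<partial>lborel)"
    if A[measurable]: "A \<in> sets borel" and B[measurable]: "B \<in> sets borel" and sub: "A \<subseteq> {0<..}" "B \<subseteq> {0<..}" for A B :: "real set"
  proof -
    have AB[measurable]: "A \<times> B \<in> sets borel" by (simp add: borel_prod[symmetric])
    have "emeasure L (A \<times> B) = (\<integral>\<^sup>+x. indicator (A \<times> B) x \<partial>L)" by simp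
    also have "\<dots> = (\<integral>\<^sup>+u. (\<integral>\<^sup>+z. w (u, z) * indicator (A \<times> B) (u, z - u) \<partial>F) \<partial>lborel)" by (intro nnL) measurable
    also have "\<dots> = (\<integral>\<^sup>+u\<in>A. ennreal (C * (1 - exp (r * u))) * emeasure F ((\<lambda>v. v + u) ` B) \<partial>lborel)"
    proof (rule nn_integral_cong)
      fix u :: real
      have im: "(\<lambda>v. v + u) ` B = (\<lambda>z. z - u) -` B" by (auto intro: image_eqI[of _ _ "_ - u"])
      have ims: "(\<lambda>v. v + u) ` B \<in> sets F"
      proof -
        have "(\<lambda>z. z - u) \<in> borel_measurable (borel :: real measure)" by measurable
        from measurable_sets[OF this B] show ?thesis unfolding im by simp
      qed
      have "(\<integral>\<^sup>+z. w (u, z) * indicator (A \<times> B) (u, z - u) \<partial>F) = (\<integral>\<^sup>+z. (ennreal (c u) * indicator A u) * indicator ((\<lambda>v. v + u) ` B) z \<partial>F)"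
        unfolding im by (intro nn_integral_cong) (use sub in \<open>auto simp: w_def split: split_indicator\<close>)
      also have "\<dots> = ennreal (c u) * indicator A u * emeasure F ((\<lambda>v. v + u) ` B)"
        by (rule nn_integral_cmult_indicator[OF ims])
      finally show "(\<integral>\<^sup>+z. w (u, z) * indicator (A \<times> B) (u, z - u) \<partial>F)
        = ennreal (C * (1 - exp (r * u))) * emeasure F ((\<lambda>v. v + u) ` B) * indicator A u"
        by (simp add: c_def ac_simps)
    qed
    finally show ?thesis .
  qed
  have weak: "weak_conv_at_top (\<lambda>x. distr M borel (\<lambda>\<omega>. (undershoot Y x \<omega>, overshoot Y x \<omega>))) L"
    unfolding weak_conv_at_top_def
  proof (intro allI impI)
    fix f :: "real \<times> real \<Rightarrow> real" assume f: "continuous_on UNIV f \<and> bounded (range f)"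
    have fm[measurable]: "f \<in> borel_measurable borel" using f by (intro borel_measurable_continuous_onI) auto
    obtain K where K: "\<And>x. \<bar>f x\<bar> \<le> K" using f by (auto simp: bounded_iff)
    \<comment> \<open>The payoff identities are stated for nonnegative functions; adding
      \<open>K\<close> to the test function makes them applicable.\<close>
    have K': "0 \<le> f x + K" "f x + K \<le> 2 * K" for x using K[of x] by auto
    have dist: "(\<integral>p. f p \<partial>distr M borel (\<lambda>\<omega>. (undershoot Y x \<omega>, overshoot Y x \<omega>)))
      = expectation (\<lambda>\<omega>. f (undershoot Y x \<omega>, overshoot Y x \<omega>) + K) - K" for x
    proof -
      have i: "integrable M (\<lambda>\<omega>. f (undershoot Y x \<omega>, overshoot Y x \<omega>))"
        by (rule integrable_const_bound[where B=K]) (use K measurable_compose[OF measurable_overflow_position fm] in auto)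
      show ?thesis
        using measurable_overflow_position[of x] i prob_space by (subst integral_distr) auto
    qed
    have iL: "integrable L f" by (rule L.integrable_const_bound[where B=K]) (use K in auto)
    have "((\<lambda>x. expectation (\<lambda>\<omega>. f (undershoot Y x \<omega>, overshoot Y x \<omega>) + K) - K) \<longlongrightarrow> (\<integral>x. f x + K \<partial>L) - K) at_top"
      by (intro tendsto_diff tendsto_const conv[of "\<lambda>p. f p + K" "2 * K"] K') measurable
    then show "((\<lambda>x. \<integral>p. f p \<partial>distr M borel (\<lambda>\<omega>. (undershoot Y x \<omega>, overshoot Y x \<omega>))) \<longlongrightarrow> (\<integral>p. f p \<partial>L)) at_top"
      using iL L.prob_space by (simp add: dist)
  qed
  show ?thesis unfolding overflow_limit_def
    by (intro exI[of _ L] conjI allI impI weak rect setsL L.prob_space_axioms) auto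
qed

end

section \<open>The Cramer case and the positive drift case\<close>

context mg1_queue
begin

lemma xi_eq: "netput u0 U N 1 \<omega> - u0 = jump_sum (N 1 \<omega>) \<omega> - 1"
  by (simp add: netput_def jump_sum_def)

text \<open>The exponential moment formula makes \<gamma> a root, and convexity admits no larger
  one, so the given exponent is \<gamma>. The drift is negative, and the scale function is built on
  the root 0 of \<psi>.\<close>

lemma overflow_limit_cramer:
  assumes "cramer_case M (\<lambda>\<omega>. netput u0 U N 1 \<omega> - u0)" and r: "r = (GREATEST s. char_root l F s)"
  shows "overflow_limit (l / (l * (\<integral>y. y \<partial>F) - 1)) r"
proof -
  obtain \<gamma> where \<gamma>: "0 < \<gamma>" "integrable M (\<lambda>\<omega>. exp (\<gamma> * (jump_sum (N 1 \<omega>) \<omega> - 1)))"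
    "expectation (\<lambda>\<omega>. exp (\<gamma> * (jump_sum (N 1 \<omega>) \<omega> - 1))) = 1"
    "integrable M (\<lambda>\<omega>. \<bar>jump_sum (N 1 \<omega>) \<omega> - 1\<bar> * exp (\<gamma> * (jump_sum (N 1 \<omega>) \<omega> - 1)))"
    "integrable M (\<lambda>\<omega>. \<bar>jump_sum (N 1 \<omega>) \<omega> - 1\<bar>)"
    using assms(1) unfolding cramer_case_def xi_eq by blast
  have F_exp: "integrable F (\<lambda>z. exp (\<gamma> * z))" using exponential_moment(1)[OF \<gamma>(2)] .
  have root: "l * ((\<integral>z. exp (\<gamma> * z) \<partial>F) - 1) = \<gamma>"
    using exponential_moment(2)[OF \<gamma>(2)] \<gamma>(3) by simp
  have char: "char_root l F \<gamma>" using F_exp root by (simp add: char_root_iff)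
  have r\<gamma>: "r = \<gamma>" unfolding r
  proof (rule Greatest_equality[of "char_root l F", OF char])
    fix s assume s: "char_root l F s"
    show "s \<le> \<gamma>"
    proof (rule ccontr)
      assume "\<not> s \<le> \<gamma>"
      then show False using char_roots_same_sign[OF char s, of "\<gamma> / s"] \<gamma>(1) by simp
    qed
  qed
  have F_mean: "integrable F (\<lambda>z. z)" by (rule expectation_compound_poisson(1)[OF \<gamma>(5)])
  have F_exp_mean: "integrable F (\<lambda>z. z * exp (\<gamma> * z))"
  proof -
    have "(\<integral>\<^sup>+z. ennreal (\<bar>z - 1\<bar> * exp (\<gamma> * (z - 1))) \<partial>F) < \<infinity>"
      using nn_integral_eq_integral[OF \<gamma>(4)]
      by (intro finite_of_compound_poisson[where \<phi>="\<lambda>z. ennreal (\<bar>z - 1\<bar> * exp (\<gamma> * (z - 1)))"]) auto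
    then have "integrable F (\<lambda>z. \<bar>z - 1\<bar> * exp (\<gamma> * (z - 1)))" by (intro integrableI_nonneg) auto
    then have "integrable F (\<lambda>z. \<bar>(z - 1) * exp (\<gamma> * (z - 1))\<bar>)" by (simp add: abs_mult)
    then have "integrable F (\<lambda>z. (z - 1) * exp (\<gamma> * (z - 1)))" by (subst (asm) integrable_abs_iff) auto
    then have "integrable F (\<lambda>z. exp \<gamma> * ((z - 1) * exp (\<gamma> * (z - 1))) + exp (\<gamma> * z))"
      by (intro Bochner_Integration.integrable_add integrable_mult_right F_exp)
    moreover have "exp \<gamma> * ((z - 1) * exp (\<gamma> * (z - 1))) + exp (\<gamma> * z) = z * exp (\<gamma> * z)" for z
    proof -
      have "exp \<gamma> * exp (\<gamma> * (z - 1)) = exp (\<gamma> * z)" by (simp add: exp_add[symmetric] algebra_simps)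
      then have "exp \<gamma> * ((z - 1) * exp (\<gamma> * (z - 1))) = (z - 1) * exp (\<gamma> * z)" by (metis mult.left_commute)
      then show ?thesis by (simp add: algebra_simps)
    qed
    ultimately show ?thesis by simp
  qed
  \<comment> \<open>The sign of the drift is not assumed: integrate
    \<open>exp (\<gamma> * y) > 1 + \<gamma> * y\<close> and insert the root equation.\<close>
  have drift: "l * (\<integral>y. y \<partial>F) < 1"
  proof -
    have "0 < (\<integral>y. exp (\<gamma> * y) - 1 - \<gamma> * y \<partial>F)"
    proof (rule integral_F_pos)
      show "integrable F (\<lambda>y. exp (\<gamma> * y) - 1 - \<gamma> * y)" using F_exp F_mean by simp
      show "0 < exp (\<gamma> * y) - 1 - \<gamma> * y" if "0 < y" for y using exp_strict[of "\<gamma> * y"] \<gamma>(1) that by simp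
    qed
    also have "(\<integral>y. exp (\<gamma> * y) - 1 - \<gamma> * y \<partial>F) = \<gamma> / l - \<gamma> * (\<integral>y. y \<partial>F)"
      using F_exp F_mean F.prob_space root l_pos by (simp add: field_simps)
    finally have "\<gamma> * (l * (\<integral>y. y \<partial>F)) < \<gamma> * 1" using l_pos by (simp add: field_simps)
    then show ?thesis using \<gamma>(1) by simp
  qed
  have "scale_function F l 0"
    by (rule scale_function.intro[OF F.prob_space_axioms F_sets F_pos l_pos]) (simp_all add: F.emeasure_space_1)
  then interpret S: mg1_scale M N l U F u0 0
    by (rule mg1_scale.intro[OF mg1_queue_axioms])
  note limit = S.payoff_limit_cramer[OF refl \<gamma>(1) F_exp root F_exp_mean F_mean drift _ _ _ _ u0_nonneg]
  show ?thesis unfolding r\<gamma>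
  proof (rule S.overflow_limitI)
    show "0 \<le> l / (l * (\<integral>y. y \<partial>F) - 1) * (1 - exp (\<gamma> * u))" if "0 < u" for u
      using that \<gamma>(1) l_pos drift by (intro mult_nonpos_nonpos divide_nonneg_neg) auto
    \<comment> \<open>The positivity part of the limit theorem does not mention the payoff, so it is
      instantiated with the zero payoff.\<close>
    show "\<forall>\<^sub>F x in at_top. 0 < S.ur x" by (rule limit(1)[of "\<lambda>_. 0" 0]) auto
    show "((\<lambda>x. S.payoff p x u0) \<longlongrightarrow> (\<integral>q. l / (l * (\<integral>y. y \<partial>F) - 1) * (1 - exp (\<gamma> * q)) * p q \<partial>lborel)) at_top"
      if "p \<in> borel_measurable borel" "\<And>q. 0 \<le> p q" "\<And>q. p q \<le> K * measure F {q<..}" "\<And>q. q < 0 \<Longrightarrow> p q = 0" for p K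
      using limit(2)[OF that] by (simp add: mult.assoc del: times_divide_eq_left)
  qed
qed

text \<open>The characteristic function at \<open>-s\<close> is \<open>\<psi> s\<close>, so a
  negative root \<open>- \<rho>\<close> is the positive zero \<rho> of \<psi> on which the scale
  function is built. Convexity leaves no smaller root.\<close>

lemma overflow_limit_positive_drift:
  assumes "positive_drift_case M (\<lambda>\<omega>. netput u0 U N 1 \<omega> - u0)" and r: "r = (LEAST s. char_root l F s)"
  shows "overflow_limit (l / (l * (\<integral>y. y \<partial>F) - 1)) r"
proof -
  have int: "integrable M (\<lambda>\<omega>. \<bar>jump_sum (N 1 \<omega>) \<omega> - 1\<bar>)" and "0 < expectation (\<lambda>\<omega>. jump_sum (N 1 \<omega>) \<omega> - 1)"
    using assms(1) unfolding positive_drift_case_def xi_eq by auto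
  then have drift: "1 < l * (\<integral>y. y \<partial>F)" using expectation_compound_poisson(2)[OF int] by simp
  have F_mean: "integrable F (\<lambda>z. z)" by (rule expectation_compound_poisson(1)[OF int])
  obtain \<rho> where \<rho>: "0 < \<rho>" "char_root l F (- \<rho>)" using negative_root_exists[OF F_mean drift] .
  have r\<rho>: "r = - \<rho>" unfolding r
  proof (rule Least_equality[of "char_root l F", OF \<rho>(2)])
    fix s assume s: "char_root l F s"
    show "- \<rho> \<le> s"
    proof (rule ccontr)
      assume "\<not> - \<rho> \<le> s"
      then show False using char_roots_same_sign[OF \<rho>(2) s, of "- \<rho> / s"] \<rho>(1) by (simp add: divide_simps)
    qed
  qed
  have \<rho>': "integrable F (\<lambda>y. exp (- \<rho> * y))" "l * ((\<integral>y. exp (- \<rho> * y) \<partial>F) - 1) = - \<rho>"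
    using \<rho>(2) by (auto simp: char_root_iff)
  have root: "ennreal l * (\<integral>\<^sup>+y. ennreal (exp (- \<rho> * y)) \<partial>F) + ennreal \<rho> = ennreal l"
  proof -
    have n: "0 \<le> (\<integral>y. exp (- \<rho> * y) \<partial>F)" by simp
    have "ennreal l * (\<integral>\<^sup>+y. ennreal (exp (- \<rho> * y)) \<partial>F) + ennreal \<rho> = ennreal (l * (\<integral>y. exp (- \<rho> * y) \<partial>F) + \<rho>)"
      using nn_integral_eq_integral[OF \<rho>'(1)] l_pos \<rho>(1) n by (simp add: ennreal_mult)
    also have "l * (\<integral>y. exp (- \<rho> * y) \<partial>F) + \<rho> = l" using \<rho>'(2) by (simp add: algebra_simps)
    finally show ?thesis .
  qed
  have "scale_function F l \<rho>"
    by (rule scale_function.intro[OF F.prob_space_axioms F_sets F_pos l_pos less_imp_le[OF \<rho>(1)] root])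
  then interpret S: mg1_scale M N l U F u0 \<rho>
    by (rule mg1_scale.intro[OF mg1_queue_axioms])
  note limit = S.payoff_limit_positive_drift[OF \<rho>(1) F_mean drift _ _ _ _ u0_nonneg]
  show ?thesis unfolding r\<rho>
  proof (rule S.overflow_limitI)
    show "0 \<le> l / (l * (\<integral>y. y \<partial>F) - 1) * (1 - exp (- \<rho> * u))" if "0 < u" for u
      using that \<rho>(1) l_pos drift by (intro mult_nonneg_nonneg divide_nonneg_pos) auto
    show "\<forall>\<^sub>F x in at_top. 0 < S.ur x" by (rule limit(1)[of "\<lambda>_. 0" 0]) auto
    show "((\<lambda>x. S.payoff p x u0) \<longlongrightarrow> (\<integral>q. l / (l * (\<integral>y. y \<partial>F) - 1) * (1 - exp (- \<rho> * q)) * p q \<partial>lborel)) at_top"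
      if "p \<in> borel_measurable borel" "\<And>q. 0 \<le> p q" "\<And>q. p q \<le> K * measure F {q<..}" "\<And>q. q < 0 \<Longrightarrow> p q = 0" for p K
      using limit(2)[OF that] by (simp add: mult.assoc del: times_divide_eq_left)
  qed
qed

end

theorem mainTheorem3:
  fixes M :: "'a measure"
    and U :: "nat \<Rightarrow> 'a \<Rightarrow> real"
    and N :: "real \<Rightarrow> 'a \<Rightarrow> nat"
    and F :: "real measure"
    and rate u0 m r :: real
    and X Y \<xi> :: "real \<Rightarrow> 'a \<Rightarrow> real"
  defines "m \<equiv> LINT y:{0<..}|F. y"
    and "X \<equiv> netput u0 U N"
    and "Y \<equiv> workload X"
    and "\<xi> \<equiv> \<lambda>t \<omega>. X t \<omega> - u0"
  assumes "prob_space M"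
    and "prob_space.indep_vars M (\<lambda>_. borel) U {1..}"
    and "\<forall>n\<ge>1. AE \<omega> in M. 0 < U n \<omega>"
    and "\<forall>n\<ge>1. distr M borel (U n) = F"
    and "0 < rate"
    and "poisson_process M rate N"
    and "prob_space.indep_set M
           (sets (vimage_algebra (space M) (\<lambda>\<omega>. \<lambda>n\<in>{1..}. U n \<omega>)
                   (Pi\<^sub>M {1..} (\<lambda>_. borel))))
           (sets (vimage_algebra (space M) (\<lambda>\<omega>. \<lambda>t\<in>{0..}. N t \<omega>)
                   (Pi\<^sub>M {0..} (\<lambda>_. count_space UNIV))))"
    and "0 \<le> u0"
    and "non_lattice (distr M borel (\<xi> 1))"
    and "(cramer_case M (\<xi> 1) \<and> r = (GREATEST s. char_root rate F s)) \<or>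
         (positive_drift_case M (\<xi> 1) \<and> r = (LEAST s. char_root rate F s))"
  shows "\<exists>L :: (real \<times> real) measure.
           prob_space L \<and> sets L = sets borel \<and>
           (\<forall>A B. A \<in> sets borel \<and> B \<in> sets borel \<and> A \<subseteq> {0<..} \<and> B \<subseteq> {0<..} \<longrightarrow>
              emeasure L (A \<times> B) =
                (\<integral>\<^sup>+u\<in>A. ennreal (rate / (rate * m - 1) * (1 - exp (r * u))) *
                              emeasure F ((\<lambda>v. v + u) ` B) \<partial>lborel)) \<and>
           weak_conv_at_top
             (\<lambda>x. distr M borel (\<lambda>\<omega>. (undershoot Y x \<omega>, overshoot Y x \<omega>))) L"
proof -
  interpret prob_space M by fact
  interpret Q: mg1_queue M N rate U F u0
    using assms(5-12) by unfold_locales auto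
  have "Q.overflow_limit (rate / (rate * m - 1)) r"
    using assms(14)
  proof
    assume "cramer_case M (\<xi> 1) \<and> r = (GREATEST s. char_root rate F s)"
    then show ?thesis unfolding m_def Q.set_mean \<xi>_def X_def by (intro Q.overflow_limit_cramer) auto
  next
    assume "positive_drift_case M (\<xi> 1) \<and> r = (LEAST s. char_root rate F s)"
    then show ?thesis unfolding m_def Q.set_mean \<xi>_def X_def by (intro Q.overflow_limit_positive_drift) auto
  qed
  then show ?thesis unfolding Q.overflow_limit_def Y_def X_def .
qed

end
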